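(* Let $G_\bullet$, $H_{1,\bullet},\dots,H_{n,\bullet}$ be braided crossed modules and let $K_{i,j,\bullet}$ ($i=1,\dots,n$, $j=1,\dots,m_i$) be crossed modules of $\mathbf T$. Let $E$ be a braided $n$-butterfly from $H_{1,\bullet}\times\dots\times H_{n,\bullet}$ to $G_\bullet$, and for each $i=1,\dots,n$ let $F_i$ be an $m_i$-butterfly from $K_{i,1,\bullet}\times\dots\times K_{i,m_i,\bullet}$ to $H_{i,\bullet}$. Let $$P=(F_1\times\dots\times F_n)\times_{H_{1,0}\times\dots\times H_{n,0}}E ,$$ viewed as an $(H_{1,1}\times\dots\times H_{n,1})$-equivariant $(G_1,G_0)$-torsor over $F_1\times\dots\times F_n$. Then $P$ has a well-defined quotient by $H_{1,1}\times\dots\times H_{n,1}$, and this quotient carries a structure of $(m_1+\dots+m_n)$-butterfly (in particular, of a multiextension) from $K_{1,1,\bullet}\times\dots\times K_{n,m_n,\bullet}$ to $G_\bullet$.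
   Context: Fix a topos $\mathbf T=\mathrm{Sh}(\mathbf C)$ of sheaves on a site; elements are generalized points. Crossed modules and torsors. A crossed module $G_\bullet=(\partial\colon G_1\to G_0)$ is a homomorphism of groups of $\mathbf T$ with a right action $(g,x)\mapsto g^x$ of $G_0$ on $G_1$ by automorphisms such that $\partial(g^x)=x^{-1}\partial(g)x$ and $g^{\partial h}=h^{-1}gh$. A braiding is a map $\{-,-\}\colon G_0\times G_0\to G_1$ with $\partial\{x,y\}=y^{-1}x^{-1}yx$, $\{x,yz\}=\{x,y\}^z\{x,z\}$, $\{xy,z\}=\{y,z\}\{x,z\}^y$, $\{x,\partial h\}=h^{-1}h^x$, $\{\partial g,y\}=(g^{-1})^yg$. A $(G_1,G_0)$-torsor over $S$ is a pair $(P,s)$ with $P$ a right $G_1$-torsor over $S$ and $s\colon P\to G_0$ with $s(ug)=s(u)\partial g$; it has the left action $gu=ug^{s(u)}$; morphisms are torsor maps compatible with the maps to $G_0$. Product: $(P,s)\wedge(Q,t)=(P\wedge^{G_1}Q,\ u\wedge v\mapsto s(u)t(v))$; unit $(G_1,e)$; the braiding of torsors is $c(u\wedge v)=(v\wedge u)\{s(u),t(v)\}^{-1}$. Multiextensions. An $n$-extension of groups $(H_1,\dots,H_n)$ by a braided crossed module $(G_1,G_0)$ is a $(G_1,G_0)$-torsor $p\colon E\to H_1\times\dots\times H_n$, with structural map $\jmath\colon E\to G_0$, and $n$ partial composition laws $\times_1,\dots,\times_n$, where $\times_i$ is given by associative isomorphisms of $(G_1,G_0)$-torsors $E_{\dots,h_i,\dots}\wedge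 E_{\dots,h_i',\dots}\to E_{\dots,h_ih_i',\dots}$ (other coordinates fixed), such that each pair $i\neq j$ satisfies the interchange condition: with $\gamma^i,\gamma^j$ the corresponding torsor maps, $\gamma^j\circ(\gamma^i\wedge\gamma^i)=\gamma^i\circ(\gamma^j\wedge\gamma^j)\circ\hat c$, with $\hat c$ exchanging the two middle factors by the braiding. A trivialization is an isomorphism from the trivial $n$-extension (trivial torsor, $\jmath$ sending the unit section to $e$). $n$-butterflies. An $n$-butterfly from $H_{1,\bullet}\times\dots\times H_{n,\bullet}$ to $G_\bullet$ is an $n$-extension $E$ of $(H_{1,0},\dots,H_{n,0})$ by $(G_1,G_0)$ with trivializations of its $n$ pullbacks along $\mathrm{id}\times\dots\times\partial\times\dots\times\mathrm{id}$, regarded as maps $s_i\colon H_{1,0}\times\dots\times H_{i,1}\times\dots\times H_{n,0}\to E$, such that $s_i(\dots,h_i,\dots,\partial h_j,\dots)=s_j(\dots,\partial h_i,\dots,h_j,\dots)$ for $i\neq j$ and $s_i(y_1,\dots,h,\dots,y_n)\times_ie=e\times_is_i(y_1,\dots,h^{y_i},\dots,y_n)$ for $h\in H_{i,1}$, $e\in E_{y_1,\dots,y_n}$. When the $H_{i,\bullet}$ are braided, the $n$-butterfly is called braided if the corresponding $n$-additive functor of associated stacks is braided in each variable; explicitly, for each $i$ and all $e\in E_{\dots,y,\dots}$, $e'\in E_{\dots,y',\dots}$ (differing only in the $i$-th coordinate) one has $e'\times_ie=\bigl(e\times_ie'\times_is_i(\dots,\{y',y\}^{-1}_{H_i},\dots)\bigr)\{\jmath(e),\jmath(e')\}_G$.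 The equivariant torsor $P$. The fibre product uses the structural maps $\jmath_i\colon F_i\to H_{i,0}$ and $p\colon E\to H_{1,0}\times\dots\times H_{n,0}$. A point of $P$ is $(v_1,\dots,v_n,u)$ with $p(u)=(y_1,\dots,y_n)$, $y_i=\jmath_i(v_i)$. An element $h_i\in H_{i,1}$ acts on the right by $(v_1,\dots,v_n,u)\mapsto(v_1,\dots,v_ih_i,\dots,v_n,\ u\times_is_i(y_1,\dots,h_i,\dots,y_n))$, and on the left by $(v_1,\dots,h_iv_i,\dots,v_n,\ s_i(y_1,\dots,h_i,\dots,y_n)\times_iu)$. The $G_1$-actions are those on the last component $u$, and the structural map to $G_0$ is $(v_1,\dots,v_n,u)\mapsto\jmath(u)$. *)

theory Defs
  imports "HOL-Algebra.Product_Groups"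
begin

section \<open>Sites and sheaves of sets\<close>

text \<open>
  A small category with a Grothendieck topology given by covering sieves; \<open>cmp C f g\<close> is ``\<open>f\<close> after \<open>g\<close>''.
  Every set-valued sheaf below is given by its sections \<open>sec X U\<close>, and a generalized point of
  stage \<open>U\<close> is an element of \<open>sec X U\<close>.  Maps of sheaves are families of functions indexed
  by the objects \<open>U\<close>; their values outside the sections are irrelevant.
\<close>

record ('o, 'm) site_data =
  Ob  :: "'o set"
  Ar  :: "'m set"
  src :: "'m \<Rightarrow> 'o"
  tgt :: "'m \<Rightarrow> 'o"
  idt :: "'o \<Rightarrow> 'm"
  cmp :: "'m \<Rightarrow> 'm \<Rightarrow> 'm"
  cov :: "'o \<Rightarrow> 'm set set"

definition arr_to :: "('o, 'm) site_data \<Rightarrow> 'o \<Rightarrow> 'm set" where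
  "arr_to C U = {f \<in> Ar C. tgt C f = U}"

definition category :: "('o, 'm) site_data \<Rightarrow> bool" where
  "category C \<longleftrightarrow>
    (\<forall>f\<in>Ar C. src C f \<in> Ob C \<and> tgt C f \<in> Ob C) \<and>
    (\<forall>U\<in>Ob C. idt C U \<in> Ar C \<and> src C (idt C U) = U \<and> tgt C (idt C U) = U) \<and>
    (\<forall>f\<in>Ar C. \<forall>g\<in>arr_to C (src C f).
       cmp C f g \<in> Ar C \<and> src C (cmp C f g) = src C g \<and> tgt C (cmp C f g) = tgt C f) \<and>
    (\<forall>f\<in>Ar C. cmp C f (idt C (src C f)) = f \<and> cmp C (idt C (tgt C f)) f = f) \<and>
    (\<forall>f\<in>Ar C. \<forall>g\<in>arr_to C (src C f). \<forall>h\<in>arr_to C (src C g).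
       cmp C (cmp C f g) h = cmp C f (cmp C g h))"

definition sieve :: "('o, 'm) site_data \<Rightarrow> 'o \<Rightarrow> 'm set \<Rightarrow> bool" where
  "sieve C U R \<longleftrightarrow> R \<subseteq> arr_to C U \<and> (\<forall>f\<in>R. \<forall>g\<in>arr_to C (src C f). cmp C f g \<in> R)"

definition pullback_sieve :: "('o, 'm) site_data \<Rightarrow> 'm \<Rightarrow> 'm set \<Rightarrow> 'm set" where
  "pullback_sieve C f R = {g \<in> arr_to C (src C f). cmp C f g \<in> R}"

definition site :: "('o, 'm) site_data \<Rightarrow> bool" where
  "site C \<longleftrightarrow> category C \<and>
    (\<forall>U\<in>Ob C. \<forall>R\<in>cov C U. sieve C U R) \<and>
    (\<forall>U\<in>Ob C. arr_to C U \<in> cov C U) \<and>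
    (\<forall>f\<in>Ar C. \<forall>R\<in>cov C (tgt C f). pullback_sieve C f R \<in> cov C (src C f)) \<and>
    (\<forall>U\<in>Ob C. \<forall>R\<in>cov C U. \<forall>R'. sieve C U R' \<and>
       (\<forall>f\<in>R. pullback_sieve C f R' \<in> cov C (src C f)) \<longrightarrow> R' \<in> cov C U)"

record ('o, 'm, 'x) sh =
  sec :: "'o \<Rightarrow> 'x set"
  res :: "'m \<Rightarrow> 'x \<Rightarrow> 'x"

definition presheaf :: "('o, 'm) site_data \<Rightarrow> ('o, 'm, 'x) sh \<Rightarrow> bool" where
  "presheaf C X \<longleftrightarrow>
    (\<forall>f\<in>Ar C. \<forall>x\<in>sec X (tgt C f). res X f x \<in> sec X (src C f)) \<and>
    (\<forall>U\<in>Ob C. \<forall>x\<in>sec X U. res X (idt C U) x = x) \<and>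
    (\<forall>f\<in>Ar C. \<forall>g\<in>arr_to C (src C f). \<forall>x\<in>sec X (tgt C f).
       res X (cmp C f g) x = res X g (res X f x))"

definition sheaf :: "('o, 'm) site_data \<Rightarrow> ('o, 'm, 'x) sh \<Rightarrow> bool" where
  "sheaf C X \<longleftrightarrow> presheaf C X \<and>
    (\<forall>U\<in>Ob C. \<forall>R\<in>cov C U. \<forall>x.
       (\<forall>f\<in>R. x f \<in> sec X (src C f)) \<and>
       (\<forall>f\<in>R. \<forall>g\<in>arr_to C (src C f). x (cmp C f g) = res X g (x f)) \<longrightarrow>
       (\<exists>!y. y \<in> sec X U \<and> (\<forall>f\<in>R. res X f y = x f)))"

definition sheaf_hom ::
    "('o, 'm) site_data \<Rightarrow> ('o, 'm, 'x) sh \<Rightarrow> ('o, 'm, 'y) sh \<Rightarrow> ('o \<Rightarrow> 'x \<Rightarrow> 'y) \<Rightarrow> bool" where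
  "sheaf_hom C X Y \<phi> \<longleftrightarrow>
    (\<forall>U\<in>Ob C. \<forall>x\<in>sec X U. \<phi> U x \<in> sec Y U) \<and>
    (\<forall>f\<in>Ar C. \<forall>x\<in>sec X (tgt C f). \<phi> (src C f) (res X f x) = res Y f (\<phi> (tgt C f) x))"

text \<open>Epimorphisms of sheaves.\<close>

definition locally_surj ::
    "('o, 'm) site_data \<Rightarrow> ('o, 'm, 'x) sh \<Rightarrow> ('o, 'm, 'y) sh \<Rightarrow> ('o \<Rightarrow> 'x \<Rightarrow> 'y) \<Rightarrow> bool" where
  "locally_surj C X Y \<phi> \<longleftrightarrow>
    (\<forall>U\<in>Ob C. \<forall>y\<in>sec Y U.
       {f \<in> arr_to C U. \<exists>x\<in>sec X (src C f). \<phi> (src C f) x = res Y f y} \<in> cov C U)"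

definition prod_sh :: "'i set \<Rightarrow> ('i \<Rightarrow> ('o, 'm, 'x) sh) \<Rightarrow> ('o, 'm, 'i \<Rightarrow> 'x) sh" where
  "prod_sh I X = \<lparr> sec = (\<lambda>U. \<Pi>\<^sub>E i\<in>I. sec (X i) U), res = (\<lambda>f x. \<lambda>i\<in>I. res (X i) f (x i)) \<rparr>"


section \<open>Groups and crossed modules of the topos\<close>

record ('o, 'm, 'a) gsh =
  grp  :: "'o \<Rightarrow> 'a monoid"
  gres :: "'m \<Rightarrow> 'a \<Rightarrow> 'a"

definition ush :: "('o, 'm, 'a) gsh \<Rightarrow> ('o, 'm, 'a) sh" where
  "ush A = \<lparr> sec = (\<lambda>U. carrier (grp A U)), res = gres A \<rparr>"

definition group_sheaf :: "('o, 'm) site_data \<Rightarrow> ('o, 'm, 'a) gsh \<Rightarrow> bool" where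
  "group_sheaf C A \<longleftrightarrow> sheaf C (ush A) \<and> (\<forall>U\<in>Ob C. group (grp A U)) \<and>
    (\<forall>f\<in>Ar C. gres A f \<in> hom (grp A (tgt C f)) (grp A (src C f)))"

definition prod_gsh :: "'i set \<Rightarrow> ('i \<Rightarrow> ('o, 'm, 'a) gsh) \<Rightarrow> ('o, 'm, 'i \<Rightarrow> 'a) gsh" where
  "prod_gsh I A = \<lparr> grp = (\<lambda>U. product_group I (\<lambda>i. grp (A i) U)),
                    gres = (\<lambda>f x. \<lambda>i\<in>I. gres (A i) f (x i)) \<rparr>"

definition right_action ::
    "('o, 'm) site_data \<Rightarrow> ('o, 'm, 'a) gsh \<Rightarrow> ('o, 'm, 'x) sh \<Rightarrow> ('o \<Rightarrow> 'x \<Rightarrow> 'a \<Rightarrow> 'x) \<Rightarrow> bool" where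
  "right_action C A X a \<longleftrightarrow>
    (\<forall>U\<in>Ob C. \<forall>x\<in>sec X U. \<forall>g\<in>carrier (grp A U). a U x g \<in> sec X U) \<and>
    (\<forall>f\<in>Ar C. \<forall>x\<in>sec X (tgt C f). \<forall>g\<in>carrier (grp A (tgt C f)).
       res X f (a (tgt C f) x g) = a (src C f) (res X f x) (gres A f g)) \<and>
    (\<forall>U\<in>Ob C. \<forall>x\<in>sec X U. a U x \<one>\<^bsub>grp A U\<^esub> = x) \<and>
    (\<forall>U\<in>Ob C. \<forall>x\<in>sec X U. \<forall>g\<in>carrier (grp A U). \<forall>h\<in>carrier (grp A U).
       a U x (g \<otimes>\<^bsub>grp A U\<^esub> h) = a U (a U x g) h)"

text \<open>
  The two groups of a crossed module have sections in one type (a common carrier type for both can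
  always be found).  This lets \<open>H\<^sub>1\<^sub>,\<^sub>0 \<times> \<dots> \<times> H\<^sub>i\<^sub>,\<^sub>1 \<times> \<dots> \<times> H\<^sub>n\<^sub>,\<^sub>0\<close> be the product of an updated
  family of groups.
\<close>

record ('o, 'm, 'a) xmod =
  X1   :: "('o, 'm, 'a) gsh"
  X0   :: "('o, 'm, 'a) gsh"
  bd   :: "'o \<Rightarrow> 'a \<Rightarrow> 'a"
  xact :: "'o \<Rightarrow> 'a \<Rightarrow> 'a \<Rightarrow> 'a"

definition crossed_module :: "('o, 'm) site_data \<Rightarrow> ('o, 'm, 'a, 'z) xmod_scheme \<Rightarrow> bool" where
  "crossed_module C G \<longleftrightarrow>
    group_sheaf C (X1 G) \<and> group_sheaf C (X0 G) \<and>
    sheaf_hom C (ush (X1 G)) (ush (X0 G)) (bd G) \<and>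
    (\<forall>U\<in>Ob C. bd G U \<in> hom (grp (X1 G) U) (grp (X0 G) U)) \<and>
    right_action C (X0 G) (ush (X1 G)) (xact G) \<and>
    (\<forall>U\<in>Ob C. \<forall>x\<in>carrier (grp (X0 G) U).
       (\<lambda>g. xact G U g x) \<in> hom (grp (X1 G) U) (grp (X1 G) U)) \<and>
    (\<forall>U\<in>Ob C. \<forall>g\<in>carrier (grp (X1 G) U). \<forall>x\<in>carrier (grp (X0 G) U).
       bd G U (xact G U g x) =
         inv\<^bsub>grp (X0 G) U\<^esub> x \<otimes>\<^bsub>grp (X0 G) U\<^esub> bd G U g \<otimes>\<^bsub>grp (X0 G) U\<^esub> x) \<and>
    (\<forall>U\<in>Ob C. \<forall>g\<in>carrier (grp (X1 G) U). \<forall>h\<in>carrier (grp (X1 G) U).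
       xact G U g (bd G U h) =
         inv\<^bsub>grp (X1 G) U\<^esub> h \<otimes>\<^bsub>grp (X1 G) U\<^esub> g \<otimes>\<^bsub>grp (X1 G) U\<^esub> h)"

record ('o, 'm, 'a) bxmod = "('o, 'm, 'a) xmod" +
  brd :: "'o \<Rightarrow> 'a \<Rightarrow> 'a \<Rightarrow> 'a"

definition braided_crossed_module :: "('o, 'm) site_data \<Rightarrow> ('o, 'm, 'a) bxmod \<Rightarrow> bool" where
  "braided_crossed_module C G \<longleftrightarrow> crossed_module C G \<and>
    (\<forall>U\<in>Ob C. \<forall>x\<in>carrier (grp (X0 G) U). \<forall>y\<in>carrier (grp (X0 G) U).
       brd G U x y \<in> carrier (grp (X1 G) U)) \<and>
    (\<forall>f\<in>Ar C. \<forall>x\<in>carrier (grp (X0 G) (tgt C f)). \<forall>y\<in>carrier (grp (X0 G) (tgt C f)).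
       gres (X1 G) f (brd G (tgt C f) x y) =
         brd G (src C f) (gres (X0 G) f x) (gres (X0 G) f y)) \<and>
    (\<forall>U\<in>Ob C. \<forall>x\<in>carrier (grp (X0 G) U). \<forall>y\<in>carrier (grp (X0 G) U).
       bd G U (brd G U x y) =
         inv\<^bsub>grp (X0 G) U\<^esub> y \<otimes>\<^bsub>grp (X0 G) U\<^esub> inv\<^bsub>grp (X0 G) U\<^esub> x
           \<otimes>\<^bsub>grp (X0 G) U\<^esub> y \<otimes>\<^bsub>grp (X0 G) U\<^esub> x) \<and>
    (\<forall>U\<in>Ob C. \<forall>x\<in>carrier (grp (X0 G) U). \<forall>y\<in>carrier (grp (X0 G) U).
       \<forall>z\<in>carrier (grp (X0 G) U).
       brd G U x (y \<otimes>\<^bsub>grp (X0 G) U\<^esub> z) =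
         xact G U (brd G U x y) z \<otimes>\<^bsub>grp (X1 G) U\<^esub> brd G U x z \<and>
       brd G U (x \<otimes>\<^bsub>grp (X0 G) U\<^esub> y) z =
         brd G U y z \<otimes>\<^bsub>grp (X1 G) U\<^esub> xact G U (brd G U x z) y) \<and>
    (\<forall>U\<in>Ob C. \<forall>x\<in>carrier (grp (X0 G) U). \<forall>h\<in>carrier (grp (X1 G) U).
       brd G U x (bd G U h) =
         inv\<^bsub>grp (X1 G) U\<^esub> h \<otimes>\<^bsub>grp (X1 G) U\<^esub> xact G U h x) \<and>
    (\<forall>U\<in>Ob C. \<forall>g\<in>carrier (grp (X1 G) U). \<forall>y\<in>carrier (grp (X0 G) U).
       brd G U (bd G U g) y =
         xact G U (inv\<^bsub>grp (X1 G) U\<^esub> g) y \<otimes>\<^bsub>grp (X1 G) U\<^esub> g)"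


section \<open>Torsors\<close>

record ('o, 'm, 'b, 'g, 'p) tors =
  tot  :: "('o, 'm, 'p) sh"
  proj :: "'o \<Rightarrow> 'p \<Rightarrow> 'b"
  ract :: "'o \<Rightarrow> 'p \<Rightarrow> 'g \<Rightarrow> 'p"
  str  :: "'o \<Rightarrow> 'p \<Rightarrow> 'g"

text \<open>Right torsors over \<open>B\<close> under \<open>A\<close>, and \<open>(G\<^sub>1, G\<^sub>0)\<close>-torsors over \<open>B\<close>.\<close>

definition torsor ::
    "('o, 'm) site_data \<Rightarrow> ('o, 'm, 'g) gsh \<Rightarrow> ('o, 'm, 'b) sh \<Rightarrow>
     ('o, 'm, 'b, 'g, 'p, 'z) tors_scheme \<Rightarrow> bool" where
  "torsor C A B T \<longleftrightarrow>
    sheaf C B \<and> sheaf C (tot T) \<and> sheaf_hom C (tot T) B (proj T) \<and>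
    locally_surj C (tot T) B (proj T) \<and>
    right_action C A (tot T) (ract T) \<and>
    (\<forall>U\<in>Ob C. \<forall>u\<in>sec (tot T) U. \<forall>g\<in>carrier (grp A U). proj T U (ract T U u g) = proj T U u) \<and>
    (\<forall>U\<in>Ob C. \<forall>u\<in>sec (tot T) U. \<forall>v\<in>sec (tot T) U. proj T U u = proj T U v \<longrightarrow>
       (\<exists>!g. g \<in> carrier (grp A U) \<and> v = ract T U u g))"

definition gtorsor ::
    "('o, 'm) site_data \<Rightarrow> ('o, 'm, 'g, 'y) xmod_scheme \<Rightarrow> ('o, 'm, 'b) sh \<Rightarrow>
     ('o, 'm, 'b, 'g, 'p, 'z) tors_scheme \<Rightarrow> bool" where
  "gtorsor C G B T \<longleftrightarrow> torsor C (X1 G) B T \<and>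
    sheaf_hom C (tot T) (ush (X0 G)) (str T) \<and>
    (\<forall>U\<in>Ob C. \<forall>u\<in>sec (tot T) U. \<forall>g\<in>carrier (grp (X1 G) U).
       str T U (ract T U u g) = str T U u \<otimes>\<^bsub>grp (X0 G) U\<^esub> bd G U g)"

definition lact ::
    "('o, 'm, 'g, 'y) xmod_scheme \<Rightarrow> ('o, 'm, 'b, 'g, 'p, 'z) tors_scheme \<Rightarrow> 'o \<Rightarrow> 'g \<Rightarrow> 'p \<Rightarrow> 'p" where
  "lact G T U g u = ract T U u (xact G U g (str T U u))"

definition torsor_hom ::
    "('o, 'm) site_data \<Rightarrow> ('o, 'm, 'g, 'y) xmod_scheme \<Rightarrow>
     ('o, 'm, 'b, 'g, 'p, 'z) tors_scheme \<Rightarrow> ('o, 'm, 'b, 'g, 'q, 'w) tors_scheme \<Rightarrow>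
     ('o \<Rightarrow> 'p \<Rightarrow> 'q) \<Rightarrow> bool" where
  "torsor_hom C G T T' \<phi> \<longleftrightarrow> sheaf_hom C (tot T) (tot T') \<phi> \<and>
    (\<forall>U\<in>Ob C. \<forall>u\<in>sec (tot T) U.
       proj T' U (\<phi> U u) = proj T U u \<and> str T' U (\<phi> U u) = str T U u \<and>
       (\<forall>g\<in>carrier (grp (X1 G) U). \<phi> U (ract T U u g) = ract T' U (\<phi> U u) g))"

definition torsor_iso ::
    "('o, 'm) site_data \<Rightarrow> ('o, 'm, 'g, 'y) xmod_scheme \<Rightarrow>
     ('o, 'm, 'b, 'g, 'p, 'z) tors_scheme \<Rightarrow> ('o, 'm, 'b, 'g, 'q, 'w) tors_scheme \<Rightarrow>
     ('o \<Rightarrow> 'p \<Rightarrow> 'q) \<Rightarrow> bool" where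
  "torsor_iso C G T T' \<phi> \<longleftrightarrow> torsor_hom C G T T' \<phi> \<and>
    (\<forall>U\<in>Ob C. bij_betw (\<phi> U) (sec (tot T) U) (sec (tot T') U))"

definition pb_tors ::
    "('o, 'm, 'c) sh \<Rightarrow> ('o \<Rightarrow> 'c \<Rightarrow> 'b) \<Rightarrow> ('o, 'm, 'b, 'g, 'p, 'z) tors_scheme \<Rightarrow>
     ('o, 'm, 'c, 'g, 'c \<times> 'p) tors" where
  "pb_tors B' \<phi> T =
    \<lparr> tot = \<lparr> sec = (\<lambda>U. {(b, u). b \<in> sec B' U \<and> u \<in> sec (tot T) U \<and> \<phi> U b = proj T U u}),
              res = (\<lambda>f (b, u). (res B' f b, res (tot T) f u)) \<rparr>,
      proj = (\<lambda>U. fst),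
      ract = (\<lambda>U (b, u) g. (b, ract T U u g)),
      str = (\<lambda>U (b, u). str T U u) \<rparr>"


section \<open>Quotients by a group action\<close>

text \<open>
  The quotient sheaf \<open>X/A\<close> is realised as the image of \<open>X\<close> in the power object of \<open>X\<close>: a section
  over \<open>U\<close> is a subsheaf \<open>W\<close> of \<open>h\<^sub>U \<times> X\<close>, given as a set of pairs \<open>(f : V \<rightarrow> U, x)\<close> with
  \<open>x\<close> a section of \<open>X\<close> over \<open>V\<close>, which is locally an orbit.
\<close>

definition loc_orbit ::
    "('o, 'm) site_data \<Rightarrow> ('o, 'm, 'a) gsh \<Rightarrow> ('o, 'm, 'x) sh \<Rightarrow> ('o \<Rightarrow> 'x \<Rightarrow> 'a \<Rightarrow> 'x) \<Rightarrow>
     'o \<Rightarrow> 'x \<Rightarrow> 'x \<Rightarrow> bool" where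
  "loc_orbit C A X a U x y \<longleftrightarrow>
    {f \<in> arr_to C U. \<exists>g\<in>carrier (grp A (src C f)).
       res X f y = a (src C f) (res X f x) g} \<in> cov C U"

definition quot_sh ::
    "('o, 'm) site_data \<Rightarrow> ('o, 'm, 'a) gsh \<Rightarrow> ('o, 'm, 'x) sh \<Rightarrow> ('o \<Rightarrow> 'x \<Rightarrow> 'a \<Rightarrow> 'x) \<Rightarrow>
     ('o, 'm, ('m \<times> 'x) set) sh" where
  "quot_sh C A X a =
    \<lparr> sec = (\<lambda>U. {W. W \<subseteq> {(f, x). f \<in> arr_to C U \<and> x \<in> sec X (src C f)} \<and>
        (\<forall>(f, x)\<in>W. \<forall>g\<in>arr_to C (src C f). (cmp C f g, res X g x) \<in> W) \<and>
        (\<forall>f\<in>arr_to C U. \<forall>x\<in>sec X (src C f). \<forall>R\<in>cov C (src C f).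
           (\<forall>g\<in>R. (cmp C f g, res X g x) \<in> W) \<longrightarrow> (f, x) \<in> W) \<and>
        (\<forall>(f, x)\<in>W. \<forall>y\<in>sec X (src C f). (f, y) \<in> W \<longleftrightarrow> loc_orbit C A X a (src C f) x y) \<and>
        {f \<in> arr_to C U. \<exists>x. (f, x) \<in> W} \<in> cov C U}),
      res = (\<lambda>f W. {(g, x). g \<in> arr_to C (src C f) \<and> (cmp C f g, x) \<in> W}) \<rparr>"

definition quot_pt ::
    "('o, 'm) site_data \<Rightarrow> ('o, 'm, 'a) gsh \<Rightarrow> ('o, 'm, 'x) sh \<Rightarrow> ('o \<Rightarrow> 'x \<Rightarrow> 'a \<Rightarrow> 'x) \<Rightarrow>
     'o \<Rightarrow> 'x \<Rightarrow> ('m \<times> 'x) set" where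
  "quot_pt C A X a U x = {(f, y). f \<in> arr_to C U \<and> y \<in> sec X (src C f) \<and>
     loc_orbit C A X a (src C f) (res X f x) y}"

text \<open>The map \<open>X/A \<rightarrow> Y\<close> induced by an invariant map \<open>X \<rightarrow> Y\<close>.\<close>

definition descend ::
    "('o, 'm) site_data \<Rightarrow> ('o, 'm, 'y) sh \<Rightarrow> ('o \<Rightarrow> 'x \<Rightarrow> 'y) \<Rightarrow> 'o \<Rightarrow> ('m \<times> 'x) set \<Rightarrow> 'y" where
  "descend C Y \<phi> U W = (THE y. y \<in> sec Y U \<and> (\<forall>(f, x)\<in>W. res Y f y = \<phi> (src C f) x))"

text \<open>
  Quotient of (the total space of) \<open>T\<close> by an action \<open>a\<close> of \<open>A\<close>, as an object over \<open>B\<close>, where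
  \<open>\<pi>\<close> is an invariant map from the base of \<open>T\<close> to \<open>B\<close>.
\<close>

definition quot_tors ::
    "('o, 'm) site_data \<Rightarrow> ('o, 'm, 'g, 'y) xmod_scheme \<Rightarrow> ('o, 'm, 'a) gsh \<Rightarrow>
     ('o \<Rightarrow> 'p \<Rightarrow> 'a \<Rightarrow> 'p) \<Rightarrow> ('o, 'm, 'c) sh \<Rightarrow> ('o \<Rightarrow> 'b \<Rightarrow> 'c) \<Rightarrow>
     ('o, 'm, 'b, 'g, 'p, 'z) tors_scheme \<Rightarrow> ('o, 'm, 'c, 'g, ('m \<times> 'p) set) tors" where
  "quot_tors C G A a B \<pi> T =
    \<lparr> tot = quot_sh C A (tot T) a,
      proj = descend C B (\<lambda>U u. \<pi> U (proj T U u)),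
      ract = (\<lambda>U W g. {(f, ract T (src C f) u (gres (X1 G) f g)) | f u. (f, u) \<in> W}),
      str = descend C (ush (X0 G)) (str T) \<rparr>"

text \<open>
  That \<open>quot_tors\<close> is a \<open>(G\<^sub>1, G\<^sub>0)\<close>-torsor over \<open>B\<close> through which the quotient map respects all
  the structure, the fibres of the quotient map being the orbits.
\<close>

definition well_defined_quotient ::
    "('o, 'm) site_data \<Rightarrow> ('o, 'm, 'g, 'y) xmod_scheme \<Rightarrow> ('o, 'm, 'a) gsh \<Rightarrow>
     ('o \<Rightarrow> 'p \<Rightarrow> 'a \<Rightarrow> 'p) \<Rightarrow> ('o, 'm, 'c) sh \<Rightarrow> ('o \<Rightarrow> 'b \<Rightarrow> 'c) \<Rightarrow>
     ('o, 'm, 'b, 'g, 'p, 'z) tors_scheme \<Rightarrow> bool" where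
  "well_defined_quotient C G A a B \<pi> T \<longleftrightarrow>
    (let Q = quot_tors C G A a B \<pi> T; q = quot_pt C A (tot T) a in
      gtorsor C G B Q \<and>
      sheaf_hom C (tot T) (tot Q) q \<and> locally_surj C (tot T) (tot Q) q \<and>
      (\<forall>U\<in>Ob C. \<forall>u\<in>sec (tot T) U. \<forall>v\<in>sec (tot T) U.
         q U u = q U v \<longleftrightarrow> (\<exists>h\<in>carrier (grp A U). v = a U u h)) \<and>
      (\<forall>U\<in>Ob C. \<forall>u\<in>sec (tot T) U.
         proj Q U (q U u) = \<pi> U (proj T U u) \<and> str Q U (q U u) = str T U u \<and>
         (\<forall>g\<in>carrier (grp (X1 G) U). ract Q U (q U u) g = q U (ract T U u g))))"

text \<open>\<open>(G\<^sub>1, G\<^sub>0)\<close>-torsors over \<open>X\<close> equivariant for a right action \<open>b\<close> of \<open>A\<close> on \<open>X\<close>.\<close>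

definition equivariant_gtorsor ::
    "('o, 'm) site_data \<Rightarrow> ('o, 'm, 'g, 'y) xmod_scheme \<Rightarrow> ('o, 'm, 'a) gsh \<Rightarrow>
     ('o, 'm, 'x) sh \<Rightarrow> ('o \<Rightarrow> 'x \<Rightarrow> 'a \<Rightarrow> 'x) \<Rightarrow>
     ('o, 'm, 'x, 'g, 'p, 'z) tors_scheme \<Rightarrow> ('o \<Rightarrow> 'p \<Rightarrow> 'a \<Rightarrow> 'p) \<Rightarrow> bool" where
  "equivariant_gtorsor C G A X b T a \<longleftrightarrow>
    gtorsor C G X T \<and> right_action C A X b \<and> right_action C A (tot T) a \<and>
    (\<forall>U\<in>Ob C. \<forall>u\<in>sec (tot T) U. \<forall>h\<in>carrier (grp A U).
       proj T U (a U u h) = b U (proj T U u) h \<and> str T U (a U u h) = str T U u \<and>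
       (\<forall>g\<in>carrier (grp (X1 G) U). a U (ract T U u g) h = ract T U (a U u h) g))"


section \<open>Contracted products\<close>

text \<open>
  \<open>P \<and>\<^bsup>G\<^sub>1\<^esup> Q\<close> is the quotient of the fibre product by \<open>(u, v)g = (ug, g\<inverse>v)\<close>.
\<close>

definition pre_wedge ::
    "('o, 'm, 'g, 'y) xmod_scheme \<Rightarrow> ('o, 'm, 'b, 'g, 'p, 'z) tors_scheme \<Rightarrow>
     ('o, 'm, 'b, 'g, 'q, 'w) tors_scheme \<Rightarrow> ('o, 'm, 'b, 'g, 'p \<times> 'q) tors" where
  "pre_wedge G P Q =
    \<lparr> tot = \<lparr> sec = (\<lambda>U. {(u, v). u \<in> sec (tot P) U \<and> v \<in> sec (tot Q) U \<and>
                                proj P U u = proj Q U v}),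
              res = (\<lambda>f (u, v). (res (tot P) f u, res (tot Q) f v)) \<rparr>,
      proj = (\<lambda>U (u, v). proj P U u),
      ract = (\<lambda>U (u, v) g. (u, ract Q U v g)),
      str = (\<lambda>U (u, v). str P U u \<otimes>\<^bsub>grp (X0 G) U\<^esub> str Q U v) \<rparr>"

definition wedge_act ::
    "('o, 'm, 'g, 'y) xmod_scheme \<Rightarrow> ('o, 'm, 'b, 'g, 'p, 'z) tors_scheme \<Rightarrow>
     ('o, 'm, 'b, 'g, 'q, 'w) tors_scheme \<Rightarrow> 'o \<Rightarrow> 'p \<times> 'q \<Rightarrow> 'g \<Rightarrow> 'p \<times> 'q" where
  "wedge_act G P Q U = (\<lambda>(u, v) g. (ract P U u g, lact G Q U (inv\<^bsub>grp (X1 G) U\<^esub> g) v))"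

definition wedge ::
    "('o, 'm) site_data \<Rightarrow> ('o, 'm, 'g, 'y) xmod_scheme \<Rightarrow> ('o, 'm, 'b) sh \<Rightarrow>
     ('o, 'm, 'b, 'g, 'p, 'z) tors_scheme \<Rightarrow> ('o, 'm, 'b, 'g, 'q, 'w) tors_scheme \<Rightarrow>
     ('o, 'm, 'b, 'g, ('m \<times> 'p \<times> 'q) set) tors" where
  "wedge C G B P Q =
    quot_tors C G (X1 G) (wedge_act G P Q) B (\<lambda>U b. b) (pre_wedge G P Q)"

definition wedge_pt ::
    "('o, 'm) site_data \<Rightarrow> ('o, 'm, 'g, 'y) xmod_scheme \<Rightarrow>
     ('o, 'm, 'b, 'g, 'p, 'z) tors_scheme \<Rightarrow> ('o, 'm, 'b, 'g, 'q, 'w) tors_scheme \<Rightarrow>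
     'o \<Rightarrow> 'p \<Rightarrow> 'q \<Rightarrow> ('m \<times> 'p \<times> 'q) set" where
  "wedge_pt C G P Q U u v = quot_pt C (X1 G) (tot (pre_wedge G P Q)) (wedge_act G P Q) U (u, v)"


section \<open>Multiextensions\<close>

text \<open>
  Multiextensions are indexed by an arbitrary finite set \<open>I\<close> in place of \<open>{1..n}\<close>; \<open>plaw E i\<close> is the
  partial composition law \<open>\<times>\<^sub>i\<close>.
\<close>

record ('o, 'm, 'i, 'h, 'g, 'p) mext = "('o, 'm, 'i \<Rightarrow> 'h, 'g, 'p) tors" +
  plaw :: "'i \<Rightarrow> 'o \<Rightarrow> 'p \<Rightarrow> 'p \<Rightarrow> 'p"

abbreviation mbase :: "'i set \<Rightarrow> ('i \<Rightarrow> ('o, 'm, 'h) gsh) \<Rightarrow> ('o, 'm, 'i \<Rightarrow> 'h) sh" where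
  "mbase I H \<equiv> ush (prod_gsh I H)"

text \<open>Pairs of points of the base which differ at most in the \<open>i\<close>-th coordinate, and their product.\<close>

definition axis_pairs ::
    "'i set \<Rightarrow> ('i \<Rightarrow> ('o, 'm, 'h) gsh) \<Rightarrow> 'i \<Rightarrow> ('o, 'm, ('i \<Rightarrow> 'h) \<times> ('i \<Rightarrow> 'h)) sh" where
  "axis_pairs I H i =
    \<lparr> sec = (\<lambda>U. {(h, h'). h \<in> sec (mbase I H) U \<and> h' \<in> sec (mbase I H) U \<and>
                         (\<forall>l\<in>I - {i}. h l = h' l)}),
      res = (\<lambda>f (h, h'). (res (mbase I H) f h, res (mbase I H) f h')) \<rparr>"

definition axis_mult ::
    "('i \<Rightarrow> ('o, 'm, 'h) gsh) \<Rightarrow> 'i \<Rightarrow> 'o \<Rightarrow> ('i \<Rightarrow> 'h) \<times> ('i \<Rightarrow> 'h) \<Rightarrow> ('i \<Rightarrow> 'h)" where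
  "axis_mult H i U = (\<lambda>(h, h'). h(i := h i \<otimes>\<^bsub>grp (H i) U\<^esub> h' i))"

definition composable ::
    "'i set \<Rightarrow> ('o, 'm, 'i, 'h, 'g, 'p, 'z) mext_scheme \<Rightarrow> 'i \<Rightarrow> 'o \<Rightarrow> 'p \<Rightarrow> 'p \<Rightarrow> bool" where
  "composable I E i U u v \<longleftrightarrow> u \<in> sec (tot E) U \<and> v \<in> sec (tot E) U \<and>
    (\<forall>l\<in>I - {i}. proj E U u l = proj E U v l)"

text \<open>
  \<open>u \<times>\<^sub>i v = \<gamma>\<^sup>i(u \<and> v)\<close> for an isomorphism \<open>\<gamma>\<^sup>i\<close> of torsors over the sheaf of pairs, from the contracted
  product of the two pullbacks of \<open>E\<close> to its pullback along the multiplication.  Points of pullbacks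
  carry their point of the base along, whence the pairs below.
\<close>

definition composition_law ::
    "('o, 'm) site_data \<Rightarrow> 'i set \<Rightarrow> ('i \<Rightarrow> ('o, 'm, 'h) gsh) \<Rightarrow> ('o, 'm, 'g, 'y) xmod_scheme \<Rightarrow>
     ('o, 'm, 'i, 'h, 'g, 'p, 'z) mext_scheme \<Rightarrow> 'i \<Rightarrow> bool" where
  "composition_law C I H G E i \<longleftrightarrow>
    (let B = axis_pairs I H i;
         E\<^sub>1 = pb_tors B (\<lambda>U. fst) E; E\<^sub>2 = pb_tors B (\<lambda>U. snd) E;
         E\<^sub>1\<^sub>2 = pb_tors B (axis_mult H i) E
     in \<exists>\<gamma>. torsor_iso C G (wedge C G B E\<^sub>1 E\<^sub>2) E\<^sub>1\<^sub>2 \<gamma> \<and>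
          (\<forall>U\<in>Ob C. \<forall>u v. composable I E i U u v \<longrightarrow>
             (let b = (proj E U u, proj E U v)
              in \<gamma> U (wedge_pt C G E\<^sub>1 E\<^sub>2 U (b, u) (b, v)) = (b, plaw E i U u v)))) \<and>
    (\<forall>U\<in>Ob C. \<forall>u v w. composable I E i U u v \<and> composable I E i U v w \<longrightarrow>
       plaw E i U (plaw E i U u v) w = plaw E i U u (plaw E i U v w))"

text \<open>
  On points the braiding of torsors is \<open>c(u \<and> v) = (v \<and> u){\<jmath>(u), \<jmath>(v)}\<inverse>\<close>; hence
  \<open>\<hat>c((a \<and> b) \<and> (c \<and> d)) = (a \<and> c) \<and> (b{\<jmath>(b), \<jmath>(c)}\<inverse> \<and> d)\<close>.
  The law is imposed for all ordered pairs \<open>i \<noteq> j\<close>.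
\<close>

definition interchange ::
    "('o, 'm) site_data \<Rightarrow> 'i set \<Rightarrow> ('o, 'm, 'g) bxmod \<Rightarrow>
     ('o, 'm, 'i, 'h, 'g, 'p, 'z) mext_scheme \<Rightarrow> 'i \<Rightarrow> 'i \<Rightarrow> bool" where
  "interchange C I G E i j \<longleftrightarrow>
    (\<forall>U\<in>Ob C. \<forall>a b c d.
       composable I E i U a b \<and> composable I E i U c d \<and>
       composable I E j U a c \<and> composable I E j U b d \<longrightarrow>
       plaw E j U (plaw E i U a b) (plaw E i U c d) =
       plaw E i U (plaw E j U a c)
         (plaw E j U (ract E U b (inv\<^bsub>grp (X1 G) U\<^esub> (brd G U (str E U b) (str E U c)))) d))"

definition multiextension ::
    "('o, 'm) site_data \<Rightarrow> 'i set \<Rightarrow> ('i \<Rightarrow> ('o, 'm, 'h) gsh) \<Rightarrow> ('o, 'm, 'g) bxmod \<Rightarrow>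
     ('o, 'm, 'i, 'h, 'g, 'p, 'z) mext_scheme \<Rightarrow> bool" where
  "multiextension C I H G E \<longleftrightarrow> finite I \<and> gtorsor C G (mbase I H) E \<and>
    (\<forall>i\<in>I. composition_law C I H G E i) \<and>
    (\<forall>i\<in>I. \<forall>j\<in>I. i \<noteq> j \<longrightarrow> interchange C I G E i j)"

definition trivial_mext ::
    "'i set \<Rightarrow> ('i \<Rightarrow> ('o, 'm, 'h) gsh) \<Rightarrow> ('o, 'm, 'g, 'y) xmod_scheme \<Rightarrow>
     ('o, 'm, 'i, 'h, 'g, ('i \<Rightarrow> 'h) \<times> 'g) mext" where
  "trivial_mext I H G =
    \<lparr> tot = \<lparr> sec = (\<lambda>U. sec (mbase I H) U \<times> carrier (grp (X1 G) U)),
              res = (\<lambda>f (h, g). (res (mbase I H) f h, gres (X1 G) f g)) \<rparr>,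
      proj = (\<lambda>U. fst),
      ract = (\<lambda>U (h, g) g'. (h, g \<otimes>\<^bsub>grp (X1 G) U\<^esub> g')),
      str = (\<lambda>U (h, g). bd G U g),
      plaw = (\<lambda>i U (h, g) (h', g'). (axis_mult H i U (h, h'), g \<otimes>\<^bsub>grp (X1 G) U\<^esub> g')) \<rparr>"

text \<open>Pullback along a product of homomorphisms \<open>f\<^sub>l : H'\<^sub>l \<rightarrow> H\<^sub>l\<close>.\<close>

definition pb_mext ::
    "'i set \<Rightarrow> ('i \<Rightarrow> ('o, 'm, 'k) gsh) \<Rightarrow> ('i \<Rightarrow> 'o \<Rightarrow> 'k \<Rightarrow> 'h) \<Rightarrow>
     ('o, 'm, 'i, 'h, 'g, 'p, 'z) mext_scheme \<Rightarrow> ('o, 'm, 'i, 'k, 'g, ('i \<Rightarrow> 'k) \<times> 'p) mext" where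
  "pb_mext I H' f E =
    tors.extend (pb_tors (mbase I H') (\<lambda>U h. \<lambda>l\<in>I. f l U (h l)) E)
      (mext.fields (\<lambda>i U (h, u) (h', u'). (axis_mult H' i U (h, h'), plaw E i U u u')))"

definition mext_iso ::
    "('o, 'm) site_data \<Rightarrow> 'i set \<Rightarrow> ('o, 'm, 'g, 'y) xmod_scheme \<Rightarrow>
     ('o, 'm, 'i, 'h, 'g, 'p, 'z) mext_scheme \<Rightarrow> ('o, 'm, 'i, 'h, 'g, 'q, 'w) mext_scheme \<Rightarrow>
     ('o \<Rightarrow> 'p \<Rightarrow> 'q) \<Rightarrow> bool" where
  "mext_iso C I G E E' \<phi> \<longleftrightarrow> torsor_iso C G E E' \<phi> \<and>
    (\<forall>i\<in>I. \<forall>U\<in>Ob C. \<forall>u v. composable I E i U u v \<longrightarrow>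
       \<phi> U (plaw E i U u v) = plaw E' i U (\<phi> U u) (\<phi> U v))"


section \<open>Butterflies\<close>

text \<open>\<open>triv E i\<close> is the map \<open>s\<^sub>i\<close>, the image of the unit section under the \<open>i\<close>-th trivialization.\<close>

record ('o, 'm, 'i, 'h, 'g, 'p) bfly = "('o, 'm, 'i, 'h, 'g, 'p) mext" +
  triv :: "'i \<Rightarrow> 'o \<Rightarrow> ('i \<Rightarrow> 'h) \<Rightarrow> 'p"

definition trivialization ::
    "('o, 'm) site_data \<Rightarrow> 'i set \<Rightarrow> ('i \<Rightarrow> ('o, 'm, 'h, 'x) xmod_scheme) \<Rightarrow>
     ('o, 'm, 'g) bxmod \<Rightarrow> ('o, 'm, 'i, 'h, 'g, 'p, 'z) mext_scheme \<Rightarrow> 'i \<Rightarrow>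
     ('o \<Rightarrow> ('i \<Rightarrow> 'h) \<Rightarrow> 'p) \<Rightarrow> bool" where
  "trivialization C I H G E i s \<longleftrightarrow>
    (let H\<^sub>i = (\<lambda>l. X0 (H l))(i := X1 (H i));
         f = (\<lambda>l U x. x)(i := bd (H i))
     in \<exists>\<phi>. mext_iso C I G (trivial_mext I H\<^sub>i G) (pb_mext I H\<^sub>i f E) \<phi> \<and>
          (\<forall>U\<in>Ob C. \<forall>h\<in>sec (mbase I H\<^sub>i) U. \<phi> U (h, \<one>\<^bsub>grp (X1 G) U\<^esub>) = (h, s U h)))"

definition butterfly ::
    "('o, 'm) site_data \<Rightarrow> 'i set \<Rightarrow> ('i \<Rightarrow> ('o, 'm, 'h, 'x) xmod_scheme) \<Rightarrow>
     ('o, 'm, 'g) bxmod \<Rightarrow> ('o, 'm, 'i, 'h, 'g, 'p) bfly \<Rightarrow> bool" where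
  "butterfly C I H G E \<longleftrightarrow>
    multiextension C I (\<lambda>l. X0 (H l)) G E \<and>
    (\<forall>i\<in>I. trivialization C I H G E i (triv E i)) \<and>
    (\<forall>i\<in>I. \<forall>j\<in>I. i \<noteq> j \<longrightarrow>
       (\<forall>U\<in>Ob C. \<forall>h\<in>sec (mbase I ((\<lambda>l. X0 (H l))(i := X1 (H i), j := X1 (H j)))) U.
          triv E i U (h(j := bd (H j) U (h j))) = triv E j U (h(i := bd (H i) U (h i))))) \<and>
    (\<forall>i\<in>I. \<forall>U\<in>Ob C. \<forall>e\<in>sec (tot E) U. \<forall>h\<in>carrier (grp (X1 (H i)) U).
       let y = proj E U e in
         plaw E i U (triv E i U (y(i := h))) e =
         plaw E i U e (triv E i U (y(i := xact (H i) U h (y i)))))"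

definition braided_butterfly ::
    "('o, 'm) site_data \<Rightarrow> 'i set \<Rightarrow> ('i \<Rightarrow> ('o, 'm, 'h) bxmod) \<Rightarrow>
     ('o, 'm, 'g) bxmod \<Rightarrow> ('o, 'm, 'i, 'h, 'g, 'p) bfly \<Rightarrow> bool" where
  "braided_butterfly C I H G E \<longleftrightarrow> butterfly C I H G E \<and>
    (\<forall>i\<in>I. \<forall>U\<in>Ob C. \<forall>e e'. composable I E i U e e' \<longrightarrow>
       (let y = proj E U e; y' = proj E U e' in
         plaw E i U e' e =
         ract E U
           (plaw E i U (plaw E i U e e')
             (triv E i U (y(i := inv\<^bsub>grp (X1 (H i)) U\<^esub> (brd (H i) U (y' i) (y i))))))
           (brd G U (str E U e) (str E U e'))))"


section \<open>The equivariant torsor of a composite\<close>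

text \<open>
  Points of \<open>P\<close> are pairs \<open>(v, u)\<close> of a tuple \<open>v = (v\<^sub>1, \<dots>, v\<^sub>n)\<close> and a point \<open>u\<close> of \<open>E\<close>.  The
  element \<open>h\<close> of the product group acts by the successive actions of its components.
\<close>

definition comp_base ::
    "nat \<Rightarrow> (nat \<Rightarrow> ('o, 'm, 'i, 'k, 'h, 'f) bfly) \<Rightarrow> ('o, 'm, nat \<Rightarrow> 'f) sh" where
  "comp_base n F = prod_sh {1..n} (\<lambda>i. tot (F i))"

definition comp_tors ::
    "nat \<Rightarrow> (nat \<Rightarrow> ('o, 'm, 'i, 'k, 'h, 'f) bfly) \<Rightarrow> ('o, 'm, nat, 'h, 'g, 'e) bfly \<Rightarrow>
     ('o, 'm, nat \<Rightarrow> 'f, 'g, (nat \<Rightarrow> 'f) \<times> 'e) tors" where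
  "comp_tors n F E = pb_tors (comp_base n F) (\<lambda>U v. \<lambda>i\<in>{1..n}. str (F i) U (v i)) E"

definition comp_act1 ::
    "(nat \<Rightarrow> ('o, 'm, 'i, 'k, 'h, 'f) bfly) \<Rightarrow> ('o, 'm, nat, 'h, 'g, 'e) bfly \<Rightarrow>
     nat \<Rightarrow> 'o \<Rightarrow> (nat \<Rightarrow> 'f) \<times> 'e \<Rightarrow> 'h \<Rightarrow> (nat \<Rightarrow> 'f) \<times> 'e" where
  "comp_act1 F E i U = (\<lambda>(v, u) h.
     (v(i := ract (F i) U (v i) h), plaw E i U u (triv E i U ((proj E U u)(i := h)))))"

definition comp_left_act1 ::
    "(nat \<Rightarrow> ('o, 'm, 'h) bxmod) \<Rightarrow> (nat \<Rightarrow> ('o, 'm, 'i, 'k, 'h, 'f) bfly) \<Rightarrow>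
     ('o, 'm, nat, 'h, 'g, 'e) bfly \<Rightarrow>
     nat \<Rightarrow> 'o \<Rightarrow> 'h \<Rightarrow> (nat \<Rightarrow> 'f) \<times> 'e \<Rightarrow> (nat \<Rightarrow> 'f) \<times> 'e" where
  "comp_left_act1 H F E i U h = (\<lambda>(v, u).
     (v(i := lact (H i) (F i) U h (v i)), plaw E i U (triv E i U ((proj E U u)(i := h))) u))"

definition comp_act ::
    "nat \<Rightarrow> (nat \<Rightarrow> ('o, 'm, 'i, 'k, 'h, 'f) bfly) \<Rightarrow> ('o, 'm, nat, 'h, 'g, 'e) bfly \<Rightarrow>
     'o \<Rightarrow> (nat \<Rightarrow> 'f) \<times> 'e \<Rightarrow> (nat \<Rightarrow> 'h) \<Rightarrow> (nat \<Rightarrow> 'f) \<times> 'e" where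
  "comp_act n F E U p h = foldl (\<lambda>q i. comp_act1 F E i U q (h i)) p [1..<Suc n]"

definition comp_base_act ::
    "nat \<Rightarrow> (nat \<Rightarrow> ('o, 'm, 'i, 'k, 'h, 'f) bfly) \<Rightarrow>
     'o \<Rightarrow> (nat \<Rightarrow> 'f) \<Rightarrow> (nat \<Rightarrow> 'h) \<Rightarrow> (nat \<Rightarrow> 'f)" where
  "comp_base_act n F U v h = (\<lambda>i\<in>{1..n}. ract (F i) U (v i) (h i))"

text \<open>
  The group \<open>H\<^sub>1\<^sub>,\<^sub>1 \<times> \<dots> \<times> H\<^sub>n\<^sub>,\<^sub>1\<close>, the index set of the composite (of cardinality
  \<open>m\<^sub>1 + \<dots> + m\<^sub>n\<close>), and the projection from \<open>F\<^sub>1 \<times> \<dots> \<times> F\<^sub>n\<close> to the product of the \<open>K\<^sub>i\<^sub>,\<^sub>j\<^sub>,\<^sub>0\<close>.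
\<close>

definition comp_group :: "nat \<Rightarrow> (nat \<Rightarrow> ('o, 'm, 'h) bxmod) \<Rightarrow> ('o, 'm, nat \<Rightarrow> 'h) gsh" where
  "comp_group n H = prod_gsh {1..n} (\<lambda>i. X1 (H i))"

definition comp_index :: "nat \<Rightarrow> (nat \<Rightarrow> nat) \<Rightarrow> (nat \<times> nat) set" where
  "comp_index n m = (SIGMA i:{1..n}. {1..m i})"

definition comp_proj ::
    "nat \<Rightarrow> (nat \<Rightarrow> nat) \<Rightarrow> (nat \<Rightarrow> ('o, 'm, nat, 'k, 'h, 'f) bfly) \<Rightarrow>
     'o \<Rightarrow> (nat \<Rightarrow> 'f) \<Rightarrow> (nat \<times> nat \<Rightarrow> 'k)" where
  "comp_proj n m F U v = (\<lambda>(i, j)\<in>comp_index n m. proj (F i) U (v i) j)"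

end

theory Submission
  imports Defs
begin

text \<open>
  The group \<open>H\<^sub>1\<^sub>,\<^sub>1 \<times> \<dots> \<times> H\<^sub>n\<^sub>,\<^sub>1\<close> acts freely on \<open>P\<close>, because it does so already on \<open>F\<^sub>1 \<times> \<dots> \<times> F\<^sub>n\<close>. Local
  orbits are therefore orbits, and whatever is constructed on points of \<open>P\<close> up to the action descends to the
  quotient by gluing. Along the axis \<open>(i, j)\<close> two classes are multiplied by choosing representatives \<open>(v, u)\<close> and
  \<open>(v', u')\<close> with \<open>v\<^sub>l = v'\<^sub>l\<close> for \<open>l \<noteq> i\<close>: the product is the class of \<open>(v, u \<times>\<^sub>i u')\<close> with \<open>v\<^sub>i\<close> replaced
  by \<open>v\<^sub>i \<times>\<^sub>j v'\<^sub>i\<close>. For distinct \<open>i\<close> interchange is that of \<open>E\<close>. For \<open>(i, j)\<close> and \<open>(i, j')\<close>, interchange in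
  \<open>F\<^sub>i\<close> contributes a braiding of \<open>H\<^sub>i\<close>, which is turned into the one of \<open>G\<close> since \<open>E\<close> is braided. Here
  \<open>{y', y}\<^sup>-\<^sup>1\<close> appears in place of \<open>{y, y'}\<close>; on the values of the structural map of \<open>F\<^sub>i\<close> the two agree, by
  interchange for both \<open>(j, j')\<close> and \<open>(j', j)\<close>. The trivialization in direction \<open>(i, j)\<close> is the class of the
  point whose \<open>F\<^sub>i\<close>-component is the section of \<open>F\<^sub>i\<close> and whose \<open>E\<close>-component is \<open>s\<^sub>i\<close> at the unit of \<open>H\<^sub>i\<^sub>,\<^sub>1\<close>.
\<close>

section \<open>Local existence on a site\<close>

text \<open>The definitions speak of isomorphisms of sheaves, out of contracted products and out of
  trivial extensions, while all that is to be checked about the composite is calculation with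
  points. Each such isomorphism is therefore traded for equations at every stage plus naturality.
  The contracted product is itself a quotient by a free action, of \<open>G\<^sub>1\<close> on
  composable pairs, so one treatment of quotients serves for it and for the composite. The product
  of classes is independent of representatives because two matched pairs with the same classes
  differ by \<open>h\<close>, \<open>h'\<close> that agree outside \<open>i\<close>; at
  \<open>i\<close> they combine to \<open>h'\<close> times a twist of \<open>h\<close>. This twist
  is the same in \<open>F\<^sub>i\<close> and in \<open>E\<close>, since the structural map of
  \<open>F\<^sub>i\<close> gives the \<open>i\<close>-th coordinate in the base of \<open>E\<close>.
  The same coincidence settles interchange for \<open>(i, j)\<close> and \<open>(i, j')\<close>:
  exchanging the middle factors in \<open>E\<close> costs an element of
  \<open>H\<^sub>i\<^sub>,\<^sub>1\<close> and one of \<open>G\<^sub>1\<close>. The former is the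
  translation by which the two orders differ in \<open>F\<^sub>i\<close>, the latter the correction
  prescribed by the interchange law.\<close>

locale site_loc =
  fixes C :: "('o, 'm) site_data"
  assumes site: "site C"
begin

section \<open>Arrows and covering sieves\<close>

lemma cat: "category C"
  using site by (simp add: site_def)

lemma src_Ob [simp]: "f \<in> arr_to C U \<Longrightarrow> src C f \<in> Ob C"
  using cat by (auto simp: category_def arr_to_def)

lemma idt_arr [simp]: "U \<in> Ob C \<Longrightarrow> idt C U \<in> arr_to C U"
  using cat by (auto simp: category_def arr_to_def)

lemma src_idt [simp]: "U \<in> Ob C \<Longrightarrow> src C (idt C U) = U"
  using cat by (auto simp: category_def)

lemma cmp_arr [simp]: "f \<in> arr_to C U \<Longrightarrow> g \<in> arr_to C (src C f) \<Longrightarrow> cmp C f g \<in> arr_to C U"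
  using cat by (auto simp: category_def arr_to_def)

lemma src_cmp [simp]: "f \<in> arr_to C U \<Longrightarrow> g \<in> arr_to C (src C f) \<Longrightarrow> src C (cmp C f g) = src C g"
  using cat by (auto simp: category_def arr_to_def)

lemma cmp_idt_right [simp]: "f \<in> arr_to C U \<Longrightarrow> cmp C f (idt C (src C f)) = f"
  using cat by (auto simp: category_def arr_to_def)

lemma cmp_idt_left [simp]: "f \<in> arr_to C U \<Longrightarrow> cmp C (idt C U) f = f"
  using cat by (auto simp: category_def arr_to_def)

lemma cmp_assoc: "f \<in> arr_to C U \<Longrightarrow> g \<in> arr_to C (src C f) \<Longrightarrow> h \<in> arr_to C (src C g) \<Longrightarrow>
    cmp C (cmp C f g) h = cmp C f (cmp C g h)"
  using cat by (auto simp: category_def arr_to_def)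

lemma cov_sub: "U \<in> Ob C \<Longrightarrow> R \<in> cov C U \<Longrightarrow> R \<subseteq> arr_to C U"
  using site by (auto simp: site_def sieve_def)

lemma cov_cmp: "U \<in> Ob C \<Longrightarrow> R \<in> cov C U \<Longrightarrow> f \<in> R \<Longrightarrow> g \<in> arr_to C (src C f) \<Longrightarrow> cmp C f g \<in> R"
  using site by (auto simp: site_def sieve_def)

lemma cov_max: "U \<in> Ob C \<Longrightarrow> arr_to C U \<in> cov C U"
  using site by (auto simp: site_def)

lemma cov_pullback: "f \<in> arr_to C U \<Longrightarrow> R \<in> cov C U \<Longrightarrow> pullback_sieve C f R \<in> cov C (src C f)"
  using site by (auto simp: site_def arr_to_def)

lemma cov_local: "U \<in> Ob C \<Longrightarrow> R \<in> cov C U \<Longrightarrow> sieve C U R' \<Longrightarrow>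
    (\<And>f. f \<in> R \<Longrightarrow> pullback_sieve C f R' \<in> cov C (src C f)) \<Longrightarrow> R' \<in> cov C U"
  using site unfolding site_def by blast

text \<open>The larger sieve pulls back to the maximal sieve along every arrow of the smaller one,
  so the local character of the topology applies.\<close>

lemma cov_superset:
  assumes U: "U \<in> Ob C" and R: "R \<in> cov C U" and R': "sieve C U R'" and sub: "R \<subseteq> R'"
  shows "R' \<in> cov C U"
proof (rule cov_local[OF U R R'])
  fix f assume f: "f \<in> R"
  then have fa: "f \<in> arr_to C U" using cov_sub[OF U R] by auto
  have "pullback_sieve C f R' = arr_to C (src C f)"
    using f sub R' by (auto simp: pullback_sieve_def sieve_def)
  then show "pullback_sieve C f R' \<in> cov C (src C f)" using cov_max[OF src_Ob[OF fa]] by simp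
qed

text \<open>Local truth. \<open>P\<close> is a predicate on arrows that need not be stable under
  composition, so the arrows satisfying it need not form a sieve; they only have to contain a
  covering one.\<close>

definition lc :: "'o \<Rightarrow> ('m \<Rightarrow> bool) \<Rightarrow> bool" where
  "lc U P \<longleftrightarrow> (\<exists>R\<in>cov C U. \<forall>f\<in>R. P f)"

lemma lc_mono:
  assumes "lc U P" "U \<in> Ob C" "\<And>f. f \<in> arr_to C U \<Longrightarrow> P f \<Longrightarrow> Q f"
  shows "lc U Q"
  using assms cov_sub unfolding lc_def by (meson subsetD)

lemma lc_always: "U \<in> Ob C \<Longrightarrow> (\<And>f. f \<in> arr_to C U \<Longrightarrow> P f) \<Longrightarrow> lc U P"
  unfolding lc_def using cov_max by blast

lemma lc_pull:
  assumes f: "f \<in> arr_to C U" and "lc U P"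
  shows "lc (src C f) (\<lambda>g. P (cmp C f g))"
proof -
  obtain R where R: "R \<in> cov C U" "\<forall>f\<in>R. P f" using assms unfolding lc_def by auto
  have "pullback_sieve C f R \<in> cov C (src C f)" using cov_pullback[OF f R(1)] .
  moreover have "\<forall>g\<in>pullback_sieve C f R. P (cmp C f g)" using R(2) by (auto simp: pullback_sieve_def)
  ultimately show ?thesis unfolding lc_def by blast
qed

text \<open>Transitivity of the topology in the form used for successive local choices: on each
  piece of a cover the conclusion need again only hold locally. The covers chosen on the pieces
  compose to a covering sieve.\<close>

lemma lc_bind:
  assumes U: "U \<in> Ob C" and P: "lc U P"
    and Q: "\<And>f. f \<in> arr_to C U \<Longrightarrow> P f \<Longrightarrow> lc (src C f) (\<lambda>g. Q (cmp C f g))"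
  shows "lc U Q"
proof -
  obtain R where R: "R \<in> cov C U" "\<forall>f\<in>R. P f" using P unfolding lc_def by auto
  have Ra: "R \<subseteq> arr_to C U" using cov_sub[OF U R(1)] .
  have "\<forall>f\<in>R. \<exists>S\<in>cov C (src C f). \<forall>g\<in>S. Q (cmp C f g)"
    using Q R Ra unfolding lc_def by blast
  then obtain S where S: "\<And>f. f \<in> R \<Longrightarrow> S f \<in> cov C (src C f)"
      "\<And>f g. f \<in> R \<Longrightarrow> g \<in> S f \<Longrightarrow> Q (cmp C f g)"
    by metis
  define R' where "R' = {cmp C f g | f g. f \<in> R \<and> g \<in> S f}"
  have Sa: "S f \<subseteq> arr_to C (src C f)" if "f \<in> R" for f
    using cov_sub[OF src_Ob S(1)] Ra that by blast
  have sv: "sieve C U R'"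
    unfolding sieve_def
  proof (intro conjI ballI)
    show "R' \<subseteq> arr_to C U" using Ra Sa unfolding R'_def by (force intro: cmp_arr)
  next
    fix k h assume k: "k \<in> R'" and h: "h \<in> arr_to C (src C k)"
    then obtain f g where fg: "k = cmp C f g" "f \<in> R" "g \<in> S f" unfolding R'_def by auto
    have fa: "f \<in> arr_to C U" and ga: "g \<in> arr_to C (src C f)" using fg Ra Sa by auto
    have h': "h \<in> arr_to C (src C g)" using h fg fa ga by simp
    have "cmp C k h = cmp C f (cmp C g h)" using fg fa ga h' cmp_assoc by simp
    moreover have "cmp C g h \<in> S f" using cov_cmp[OF src_Ob[OF fa] S(1)] fg h' by blast
    ultimately show "cmp C k h \<in> R'" using fg unfolding R'_def by auto
  qed
  have "R' \<in> cov C U"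
  proof (rule cov_local[OF U R(1) sv])
    fix f assume f: "f \<in> R"
    then have fa: "f \<in> arr_to C U" using Ra by auto
    show "pullback_sieve C f R' \<in> cov C (src C f)"
    proof (rule cov_superset[OF src_Ob[OF fa] S(1)[OF f]])
      show "S f \<subseteq> pullback_sieve C f R'" using f Sa unfolding R'_def pullback_sieve_def by blast
      show "sieve C (src C f) (pullback_sieve C f R')"
        unfolding sieve_def
      proof (intro conjI ballI)
        show "pullback_sieve C f R' \<subseteq> arr_to C (src C f)" by (auto simp: pullback_sieve_def)
        fix g h assume g: "g \<in> pullback_sieve C f R'" and h: "h \<in> arr_to C (src C g)"
        then have ga: "g \<in> arr_to C (src C f)" "cmp C f g \<in> R'" by (auto simp: pullback_sieve_def)
        have "cmp C (cmp C f g) h \<in> R'" using sv ga fa h unfolding sieve_def by simp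
        then show "cmp C g h \<in> pullback_sieve C f R'"
          using ga fa h cmp_assoc by (simp add: pullback_sieve_def cmp_arr[OF ga(1)])
      qed
    qed
  qed
  moreover have "\<forall>k\<in>R'. Q k" using S(2) unfolding R'_def by auto
  ultimately show ?thesis unfolding lc_def by blast
qed

text \<open>Stability of \<open>P\<close> keeps it true on the finer cover where \<open>Q\<close>
  holds as well.\<close>

lemma lc_conj:
  assumes U: "U \<in> Ob C" and "lc U P" "lc U Q" and st: "\<And>f g. f \<in> arr_to C U \<Longrightarrow> g \<in> arr_to C (src C f) \<Longrightarrow> P f \<Longrightarrow> P (cmp C f g)"
  shows "lc U (\<lambda>f. P f \<and> Q f)"
  by (rule lc_bind[OF U assms(2)], rule lc_mono[OF lc_pull[OF _ assms(3)]]) (auto simp: st)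

text \<open>Covers are refined one index at a time, hence the finiteness of
  \<open>I\<close>.\<close>

lemma lc_ball:
  assumes U: "U \<in> Ob C" and "finite I" and "\<And>i. i \<in> I \<Longrightarrow> lc U (P i)"
    and st: "\<And>i f g. i \<in> I \<Longrightarrow> f \<in> arr_to C U \<Longrightarrow> g \<in> arr_to C (src C f) \<Longrightarrow> P i f \<Longrightarrow> P i (cmp C f g)"
  shows "lc U (\<lambda>f. \<forall>i\<in>I. P i f)"
  using assms(2,3) st
proof (induction I rule: finite_induct)
  case empty
  then show ?case using lc_always[OF U] by simp
next
  case (insert x F)
  have "lc U (\<lambda>f. P x f \<and> (\<forall>i\<in>F. P i f))"
    by (rule lc_conj[OF U]) (use insert in auto)
  then show ?case by simp
qed

lemma cov_lc: "{f \<in> arr_to C U. P f} \<in> cov C U \<Longrightarrow> lc U P"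
  unfolding lc_def by (rule bexI[rotated]) auto

text \<open>For a stable predicate the arrows satisfying it do form a sieve, and it contains a
  covering one.\<close>

lemma lc_cov:
  assumes U: "U \<in> Ob C" and "lc U P"
    and st: "\<And>f g. f \<in> arr_to C U \<Longrightarrow> g \<in> arr_to C (src C f) \<Longrightarrow> P f \<Longrightarrow> P (cmp C f g)"
  shows "{f \<in> arr_to C U. P f} \<in> cov C U"
proof -
  obtain R where R: "R \<in> cov C U" "\<forall>f\<in>R. P f" using assms unfolding lc_def by auto
  show ?thesis
    by (rule cov_superset[OF U R(1)]) (use R cov_sub[OF U R(1)] st in \<open>auto simp: sieve_def\<close>)
qed

section \<open>Presheaves, maps of sheaves and gluing\<close>

lemma res_in: "presheaf C X \<Longrightarrow> f \<in> arr_to C U \<Longrightarrow> x \<in> sec X U \<Longrightarrow> res X f x \<in> sec X (src C f)"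
  by (auto simp: presheaf_def arr_to_def)

lemma res_idt: "presheaf C X \<Longrightarrow> U \<in> Ob C \<Longrightarrow> x \<in> sec X U \<Longrightarrow> res X (idt C U) x = x"
  by (auto simp: presheaf_def)

lemma res_cmp: "presheaf C X \<Longrightarrow> f \<in> arr_to C U \<Longrightarrow> g \<in> arr_to C (src C f) \<Longrightarrow> x \<in> sec X U \<Longrightarrow>
    res X (cmp C f g) x = res X g (res X f x)"
  by (auto simp: presheaf_def arr_to_def)

lemma sheaf_presheaf: "sheaf C X \<Longrightarrow> presheaf C X"
  by (simp add: sheaf_def)

lemma hom_in: "sheaf_hom C X Y \<phi> \<Longrightarrow> U \<in> Ob C \<Longrightarrow> x \<in> sec X U \<Longrightarrow> \<phi> U x \<in> sec Y U"
  by (simp add: sheaf_hom_def)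

lemma hom_res: "sheaf_hom C X Y \<phi> \<Longrightarrow> f \<in> arr_to C U \<Longrightarrow> x \<in> sec X U \<Longrightarrow>
    \<phi> (src C f) (res X f x) = res Y f (\<phi> U x)"
  by (auto simp: sheaf_hom_def arr_to_def)

lemma sheaf_homI:
  assumes "\<And>U x. U \<in> Ob C \<Longrightarrow> x \<in> sec X U \<Longrightarrow> \<phi> U x \<in> sec Y U"
    and "\<And>U f x. U \<in> Ob C \<Longrightarrow> f \<in> arr_to C U \<Longrightarrow> x \<in> sec X U \<Longrightarrow> \<phi> (src C f) (res X f x) = res Y f (\<phi> U x)"
  shows "sheaf_hom C X Y \<phi>"
  using assms cat by (auto simp: sheaf_hom_def arr_to_def category_def)

lemma sheaf_hom_comp:
  assumes "sheaf_hom C X Y \<phi>" "sheaf_hom C Y Z \<psi>"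
  shows "sheaf_hom C X Z (\<lambda>U x. \<psi> U (\<phi> U x))"
  using assms by (intro sheaf_homI) (auto simp: hom_in hom_res)

lemma presheafI:
  assumes "\<And>U f x. U \<in> Ob C \<Longrightarrow> f \<in> arr_to C U \<Longrightarrow> x \<in> sec X U \<Longrightarrow> res X f x \<in> sec X (src C f)"
    and "\<And>U x. U \<in> Ob C \<Longrightarrow> x \<in> sec X U \<Longrightarrow> res X (idt C U) x = x"
    and "\<And>U f g x. U \<in> Ob C \<Longrightarrow> f \<in> arr_to C U \<Longrightarrow> g \<in> arr_to C (src C f) \<Longrightarrow> x \<in> sec X U \<Longrightarrow>
      res X (cmp C f g) x = res X g (res X f x)"
  shows "presheaf C X"
  using assms cat by (auto simp: presheaf_def arr_to_def category_def)

lemma locally_surjI: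
  assumes X: "presheaf C X" and Y: "presheaf C Y" and \<phi>: "sheaf_hom C X Y \<phi>"
    and "\<And>U y. U \<in> Ob C \<Longrightarrow> y \<in> sec Y U \<Longrightarrow>
      lc U (\<lambda>f. \<exists>x\<in>sec X (src C f). \<phi> (src C f) x = res Y f y)"
  shows "locally_surj C X Y \<phi>"
  unfolding locally_surj_def
proof (intro ballI)
  fix U y assume U: "U \<in> Ob C" and y: "y \<in> sec Y U"
  show "{f \<in> arr_to C U. \<exists>x\<in>sec X (src C f). \<phi> (src C f) x = res Y f y} \<in> cov C U"
  proof (rule lc_cov[OF U assms(4)[OF U y]])
    fix f g assume f: "f \<in> arr_to C U" and g: "g \<in> arr_to C (src C f)"
    assume "\<exists>x\<in>sec X (src C f). \<phi> (src C f) x = res Y f y"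
    then obtain x where x: "x \<in> sec X (src C f)" "\<phi> (src C f) x = res Y f y" by auto
    show "\<exists>x\<in>sec X (src C (cmp C f g)). \<phi> (src C (cmp C f g)) x = res Y (cmp C f g) y"
      by (rule bexI[of _ "res X g x"])
        (use x f g in \<open>simp_all add: res_in[OF X] hom_res[OF \<phi>] res_cmp[OF Y f g y]\<close>)
  qed
qed

lemma locally_surjD: "locally_surj C X Y \<phi> \<Longrightarrow> U \<in> Ob C \<Longrightarrow> y \<in> sec Y U \<Longrightarrow>
    lc U (\<lambda>f. \<exists>x\<in>sec X (src C f). \<phi> (src C f) x = res Y f y)"
  by (rule cov_lc) (simp add: locally_surj_def)

lemma sheaf_eqI:
  assumes X: "sheaf C X" and U: "U \<in> Ob C" and x: "x \<in> sec X U" and y: "y \<in> sec X U"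
    and l: "lc U (\<lambda>f. res X f x = res X f y)"
  shows "x = y"
proof -
  have p: "presheaf C X" using X by (simp add: sheaf_def)
  obtain R where R: "R \<in> cov C U" "\<forall>f\<in>R. res X f x = res X f y" using l unfolding lc_def by auto
  have Ra: "R \<subseteq> arr_to C U" using cov_sub[OF U R(1)] .
  have "\<exists>!z. z \<in> sec X U \<and> (\<forall>f\<in>R. res X f z = res X f x)"
    using X U R(1) Ra unfolding sheaf_def
    by (elim conjE ballE[where x=U] ballE[where x=R] allE[where x="\<lambda>f. res X f x"])
      (auto simp: res_in[OF p _ x] res_cmp[OF p _ _ x] subset_iff)
  then show ?thesis using x y R(2) by metis
qed

text \<open>The local data are a relation rather than a function because later they come from
  arbitrary choices of representatives; \<open>uniq\<close> says that the value does not depend on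
  the choice. The glued section is characterized by its restriction along every arrow at which
  \<open>\<Phi>\<close> has a value, so that it can be named by a definite description.\<close>

lemma glue:
  assumes X: "sheaf C X" and U: "U \<in> Ob C"
    and "in": "\<And>f x. f \<in> arr_to C U \<Longrightarrow> \<Phi> f x \<Longrightarrow> x \<in> sec X (src C f)"
    and st: "\<And>f g x. f \<in> arr_to C U \<Longrightarrow> g \<in> arr_to C (src C f) \<Longrightarrow> \<Phi> f x \<Longrightarrow> \<Phi> (cmp C f g) (res X g x)"
    and uniq: "\<And>f x y. f \<in> arr_to C U \<Longrightarrow> \<Phi> f x \<Longrightarrow> \<Phi> f y \<Longrightarrow> x = y"
    and ex: "lc U (\<lambda>f. \<exists>x. \<Phi> f x)"
  shows "\<exists>!y. y \<in> sec X U \<and> (\<forall>f\<in>arr_to C U. \<forall>x. \<Phi> f x \<longrightarrow> res X f y = x)"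
proof -
  \<comment> \<open>Stability of \<open>\<Phi>\<close> makes its whole domain a covering sieve, on
    which \<open>\<Phi>\<close> is the graph of a compatible family.\<close>
  define R where "R = {f \<in> arr_to C U. \<exists>x. \<Phi> f x}"
  have R: "R \<in> cov C U" unfolding R_def by (rule lc_cov[OF U ex]) (use st in blast)
  define \<xi> where "\<xi> f = (THE x. \<Phi> f x)" for f
  have \<xi>: "\<Phi> f x \<longleftrightarrow> x = \<xi> f" if f: "f \<in> R" for f x
  proof -
    obtain z where z: "f \<in> arr_to C U" "\<Phi> f z" using f unfolding R_def by blast
    have "\<xi> f = z" unfolding \<xi>_def by (rule the_equality, rule z(2)) (rule uniq[OF z(1) _ z(2)])
    then show ?thesis using z uniq[OF z(1) z(2)] by blast
  qed
  have "(\<forall>f\<in>R. \<xi> f \<in> sec X (src C f)) \<and>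
      (\<forall>f\<in>R. \<forall>g\<in>arr_to C (src C f). \<xi> (cmp C f g) = res X g (\<xi> f))"
  proof (intro conjI ballI)
    fix f assume f: "f \<in> R"
    then show "\<xi> f \<in> sec X (src C f)" using "in" \<xi>[OF f] R_def by blast
    fix g assume g: "g \<in> arr_to C (src C f)"
    have "\<Phi> (cmp C f g) (res X g (\<xi> f))" using st[OF _ g] \<xi>[OF f] f R_def by blast
    moreover have "cmp C f g \<in> R" using cov_cmp[OF U R f g] .
    ultimately show "\<xi> (cmp C f g) = res X g (\<xi> f)" using \<xi> by metis
  qed
  then have e: "\<exists>!y. y \<in> sec X U \<and> (\<forall>f\<in>R. res X f y = \<xi> f)"
    using X U R unfolding sheaf_def
    by (elim conjE ballE[where x=U] ballE[where x=R] allE[where x=\<xi>]) simp_all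
  have "(\<forall>f\<in>R. res X f y = \<xi> f) \<longleftrightarrow> (\<forall>f\<in>arr_to C U. \<forall>x. \<Phi> f x \<longrightarrow> res X f y = x)" for y
  proof (intro iffI ballI allI impI)
    fix f x assume "\<forall>f\<in>R. res X f y = \<xi> f" "f \<in> arr_to C U" "\<Phi> f x"
    moreover from this have "f \<in> R" unfolding R_def by blast
    ultimately show "res X f y = x" using \<xi>[of f x] by simp
  next
    fix f assume h: "\<forall>f\<in>arr_to C U. \<forall>x. \<Phi> f x \<longrightarrow> res X f y = x" and f: "f \<in> R"
    then have "f \<in> arr_to C U" unfolding R_def by blast
    then show "res X f y = \<xi> f" using h \<xi>[OF f, of "\<xi> f"] by simp
  qed
  then show ?thesis using e by simp
qed

lemma sheafI:
  assumes p: "presheaf C X"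
    and sep: "\<And>U x y. U \<in> Ob C \<Longrightarrow> x \<in> sec X U \<Longrightarrow> y \<in> sec X U \<Longrightarrow>
      lc U (\<lambda>f. res X f x = res X f y) \<Longrightarrow> x = y"
    and ex: "\<And>U R \<xi>. U \<in> Ob C \<Longrightarrow> R \<in> cov C U \<Longrightarrow> (\<And>f. f \<in> R \<Longrightarrow> \<xi> f \<in> sec X (src C f)) \<Longrightarrow>
      (\<And>f g. f \<in> R \<Longrightarrow> g \<in> arr_to C (src C f) \<Longrightarrow> \<xi> (cmp C f g) = res X g (\<xi> f)) \<Longrightarrow>
      \<exists>y\<in>sec X U. \<forall>f\<in>R. res X f y = \<xi> f"
  shows "sheaf C X"
  unfolding sheaf_def
proof (intro conjI p ballI allI impI)
  fix U R \<xi> assume U: "U \<in> Ob C" and R: "R \<in> cov C U"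
    and h: "(\<forall>f\<in>R. \<xi> f \<in> sec X (src C f)) \<and>
       (\<forall>f\<in>R. \<forall>g\<in>arr_to C (src C f). \<xi> (cmp C f g) = res X g (\<xi> f))"
  obtain y where y: "y \<in> sec X U" "\<forall>f\<in>R. res X f y = \<xi> f" using ex[OF U R, of \<xi>] h by blast
  show "\<exists>!y. y \<in> sec X U \<and> (\<forall>f\<in>R. res X f y = \<xi> f)"
  proof (rule ex1I[of _ y])
    fix z assume "z \<in> sec X U \<and> (\<forall>f\<in>R. res X f z = \<xi> f)"
    moreover from this have "\<forall>f\<in>R. res X f z = res X f y" using y by simp
    ultimately show "z = y" using y R by (intro sep[OF U]) (simp_all only: lc_def, blast)
  qed (use y in blast)
qed

lemma sheaf_glue:
  assumes "sheaf C X" "U \<in> Ob C" "R \<in> cov C U" "\<And>f. f \<in> R \<Longrightarrow> \<xi> f \<in> sec X (src C f)"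
    "\<And>f g. f \<in> R \<Longrightarrow> g \<in> arr_to C (src C f) \<Longrightarrow> \<xi> (cmp C f g) = res X g (\<xi> f)"
  obtains y where "y \<in> sec X U" "\<And>f. f \<in> R \<Longrightarrow> res X f y = \<xi> f"
proof -
  have "\<exists>!y. y \<in> sec X U \<and> (\<forall>f\<in>R. res X f y = \<xi> f)"
    using assms(1,2,3) unfolding sheaf_def
    by (elim conjE ballE[where x=U] ballE[where x=R] allE[where x=\<xi>]) (simp_all add: assms(4,5))
  then show ?thesis using that by blast
qed

section \<open>Fibre products and products of sheaves\<close>

lemma fibre_sheaf:
  assumes X: "sheaf C X" and Y: "sheaf C Y" and B: "sheaf C B"
    and p: "sheaf_hom C X B p" and q: "sheaf_hom C Y B q"
  shows "sheaf C \<lparr> sec = (\<lambda>U. {(x, y). x \<in> sec X U \<and> y \<in> sec Y U \<and> p U x = q U y}),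
                   res = (\<lambda>f (x, y). (res X f x, res Y f y)) \<rparr>" (is "sheaf C ?Z")
proof (rule sheafI)
  note pX = sheaf_presheaf[OF X] and pY = sheaf_presheaf[OF Y] and pB = sheaf_presheaf[OF B]
  show "presheaf C ?Z"
    by (rule presheafI)
      (auto simp: res_in[OF pX] res_in[OF pY] hom_res[OF p] hom_res[OF q] res_idt[OF pX] res_idt[OF pY]
        res_cmp[OF pX] res_cmp[OF pY])
next
  fix U x y assume U: "U \<in> Ob C" and x: "x \<in> sec ?Z U" and y: "y \<in> sec ?Z U"
    and l: "lc U (\<lambda>f. res ?Z f x = res ?Z f y)"
  obtain x1 x2 y1 y2 where e: "x = (x1, x2)" "y = (y1, y2)" by fastforce
  have "x1 = y1"
    by (rule sheaf_eqI[OF X U _ _ lc_mono[OF l U]]) (use x y e in auto)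
  moreover have "x2 = y2"
    by (rule sheaf_eqI[OF Y U _ _ lc_mono[OF l U]]) (use x y e in auto)
  ultimately show "x = y" using e by simp
next
  fix U R \<xi> assume U: "U \<in> Ob C" and R: "R \<in> cov C U" and i: "\<And>f. f \<in> R \<Longrightarrow> \<xi> f \<in> sec ?Z (src C f)"
    and c: "\<And>f g. f \<in> R \<Longrightarrow> g \<in> arr_to C (src C f) \<Longrightarrow> \<xi> (cmp C f g) = res ?Z g (\<xi> f)"
  obtain x where x: "x \<in> sec X U" "\<And>f. f \<in> R \<Longrightarrow> res X f x = fst (\<xi> f)"
    by (rule sheaf_glue[OF X U R, of "\<lambda>f. fst (\<xi> f)"]) (use i c in \<open>auto simp: split_beta\<close>)
  obtain y where y: "y \<in> sec Y U" "\<And>f. f \<in> R \<Longrightarrow> res Y f y = snd (\<xi> f)"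
    by (rule sheaf_glue[OF Y U R, of "\<lambda>f. snd (\<xi> f)"]) (use i c in \<open>auto simp: split_beta\<close>)
  have Ra: "R \<subseteq> arr_to C U" using cov_sub[OF U R] .
  \<comment> \<open>The two components were glued separately; they lie over the same point of
    \<open>B\<close> because \<open>B\<close> is separated.\<close>
  have "p U x = q U y"
  proof (rule sheaf_eqI[OF B U hom_in[OF p U x(1)] hom_in[OF q U y(1)]])
    have "\<forall>f\<in>R. res B f (p U x) = res B f (q U y)"
      using Ra x y i by (auto simp: hom_res[OF p, symmetric] hom_res[OF q, symmetric] subset_iff split_beta)
    then show "lc U (\<lambda>f. res B f (p U x) = res B f (q U y))" using R unfolding lc_def by blast
  qed
  then show "\<exists>y\<in>sec ?Z U. \<forall>f\<in>R. res ?Z f y = \<xi> f"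
    by (intro bexI[of _ "(x, y)"]) (use x y in auto)
qed

lemma prod_sheaf:
  assumes X: "\<And>i. i \<in> I \<Longrightarrow> sheaf C (X i)"
  shows "sheaf C (prod_sh I X)"
proof (rule sheafI)
  have p: "presheaf C (X i)" if "i \<in> I" for i using X that by (simp add: sheaf_def)
  show "presheaf C (prod_sh I X)"
    by (rule presheafI) (auto simp: prod_sh_def PiE_iff res_in[OF p] res_idt[OF p] res_cmp[OF p]
          restrict_def extensional_def intro!: ext)
next
  fix U x y assume U: "U \<in> Ob C" and x: "x \<in> sec (prod_sh I X) U" and y: "y \<in> sec (prod_sh I X) U"
    and l: "lc U (\<lambda>f. res (prod_sh I X) f x = res (prod_sh I X) f y)"
  have "x i = y i" if i: "i \<in> I" for i
  proof (rule sheaf_eqI[OF X[OF i] U _ _ lc_mono[OF l U]])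
    show "x i \<in> sec (X i) U" "y i \<in> sec (X i) U" using x y i by (auto simp: prod_sh_def)
    fix f assume "res (prod_sh I X) f x = res (prod_sh I X) f y"
    from fun_cong[OF this, of i] show "res (X i) f (x i) = res (X i) f (y i)"
      using i by (simp add: prod_sh_def)
  qed
  then show "x = y" using x y by (intro PiE_ext[of x I _ y]) (auto simp: prod_sh_def)
next
  fix U R \<xi> assume U: "U \<in> Ob C" and R: "R \<in> cov C U"
    and i: "\<And>f. f \<in> R \<Longrightarrow> \<xi> f \<in> sec (prod_sh I X) (src C f)"
    and c: "\<And>f g. f \<in> R \<Longrightarrow> g \<in> arr_to C (src C f) \<Longrightarrow> \<xi> (cmp C f g) = res (prod_sh I X) g (\<xi> f)"
  have "\<exists>y\<in>sec (X k) U. \<forall>f\<in>R. res (X k) f y = \<xi> f k" if k: "k \<in> I" for k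
    by (rule sheaf_glue[OF X[OF k] U R, of "\<lambda>f. \<xi> f k"]) (use i c k in \<open>auto simp: prod_sh_def PiE_iff\<close>)
  then obtain y where y: "\<And>k. k \<in> I \<Longrightarrow> y k \<in> sec (X k) U \<and> (\<forall>f\<in>R. res (X k) f (y k) = \<xi> f k)"
    by metis
  show "\<exists>y\<in>sec (prod_sh I X) U. \<forall>f\<in>R. res (prod_sh I X) f y = \<xi> f"
  proof (intro bexI[of _ "restrict y I"] ballI)
    show "restrict y I \<in> sec (prod_sh I X) U" using y by (auto simp: prod_sh_def)
    fix f assume "f \<in> R"
    then show "res (prod_sh I X) f (restrict y I) = \<xi> f" using y i[of f]
      by (auto simp: prod_sh_def PiE_iff fun_eq_iff extensional_def restrict_def)
  qed
qed

lemma mbase_prod_sh: "mbase I H = prod_sh I (\<lambda>i. ush (H i))"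
  by (simp add: ush_def prod_gsh_def prod_sh_def)

lemma mbase_sheaf: "(\<And>i. i \<in> I \<Longrightarrow> group_sheaf C (H i)) \<Longrightarrow> sheaf C (mbase I H)"
  unfolding mbase_prod_sh by (rule prod_sheaf) (simp add: group_sheaf_def)

lemma group_sheaf_prod:
  assumes "\<And>i. i \<in> I \<Longrightarrow> group_sheaf C (H i)"
  shows "group_sheaf C (prod_gsh I H)"
  unfolding group_sheaf_def
proof (intro conjI ballI)
  show "sheaf C (mbase I H)" by (rule mbase_sheaf[OF assms])
  show "group (grp (prod_gsh I H) U)" if "U \<in> Ob C" for U
    using assms that by (auto simp: prod_gsh_def group_sheaf_def)
  show "gres (prod_gsh I H) f \<in> hom (grp (prod_gsh I H) (tgt C f)) (grp (prod_gsh I H) (src C f))"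
    if f: "f \<in> Ar C" for f
  proof -
    have h: "gres (H i) f \<in> hom (grp (H i) (tgt C f)) (grp (H i) (src C f))" if "i \<in> I" for i
      using assms[OF that] f by (simp add: group_sheaf_def)
    show ?thesis
      by (rule homI) (auto simp: prod_gsh_def PiE_iff fun_eq_iff hom_in_carrier[OF h] hom_mult[OF h])
  qed
qed

text \<open>The sheaf of pairs is the fibre product of the base with itself over the product of the
  factors other than \<open>i\<close>.\<close>

lemma axis_pairs_sheaf:
  assumes "\<And>i. i \<in> I \<Longrightarrow> group_sheaf C (H i)"
  shows "sheaf C (axis_pairs I H i)"
proof -
  have s: "sheaf C (mbase I H)" by (rule mbase_sheaf[OF assms])
  have t: "sheaf C (mbase (I - {i}) H)" by (rule mbase_sheaf) (use assms in auto)
  have h: "sheaf_hom C (mbase I H) (mbase (I - {i}) H) (\<lambda>U x. restrict x (I - {i}))"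
    by (rule sheaf_homI) (auto simp: ush_def prod_gsh_def PiE_iff fun_eq_iff)
  have e: "axis_pairs I H i = \<lparr> sec = (\<lambda>U. {(x, y). x \<in> sec (mbase I H) U \<and> y \<in> sec (mbase I H) U \<and>
      restrict x (I - {i}) = restrict y (I - {i})}),
                   res = (\<lambda>f (x, y). (res (mbase I H) f x, res (mbase I H) f y)) \<rparr>"
    by (auto simp: axis_pairs_def fun_eq_iff restrict_def)
  show ?thesis unfolding e by (rule fibre_sheaf[OF s s t h h])
qed

end

section \<open>Quotients by free actions\<close>

text \<open>Freeness at every stage is what turns the fibres of the quotient map into orbits, as
  opposed to local orbits.\<close>

locale free_action = site_loc C for C :: "('o, 'm) site_data" +
  fixes A :: "('o, 'm, 'a) gsh" and X :: "('o, 'm, 'x) sh" and a :: "'o \<Rightarrow> 'x \<Rightarrow> 'a \<Rightarrow> 'x"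
  assumes gA: "group_sheaf C A" and shX: "sheaf C X" and act: "right_action C A X a"
    and free: "\<And>U x g h. U \<in> Ob C \<Longrightarrow> x \<in> sec X U \<Longrightarrow> g \<in> carrier (grp A U) \<Longrightarrow> h \<in> carrier (grp A U) \<Longrightarrow>
      a U x g = a U x h \<Longrightarrow> g = h"
begin

abbreviation "q \<equiv> quot_pt C A X a"
abbreviation "Q \<equiv> quot_sh C A X a"

definition orb :: "'o \<Rightarrow> 'x \<Rightarrow> 'x \<Rightarrow> bool" where
  "orb U x y \<longleftrightarrow> (\<exists>g\<in>carrier (grp A U). y = a U x g)"

lemma pX: "presheaf C X" using shX by (simp add: sheaf_def)

lemma grpA: "U \<in> Ob C \<Longrightarrow> group (grp A U)" using gA by (simp add: group_sheaf_def)

lemma gres_in: "f \<in> arr_to C U \<Longrightarrow> g \<in> carrier (grp A U) \<Longrightarrow> gres A f g \<in> carrier (grp A (src C f))"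
  using gA by (auto simp: group_sheaf_def arr_to_def hom_def)

lemma a_in: "U \<in> Ob C \<Longrightarrow> x \<in> sec X U \<Longrightarrow> g \<in> carrier (grp A U) \<Longrightarrow> a U x g \<in> sec X U"
  using act by (simp add: right_action_def)

lemma a_res: "f \<in> arr_to C U \<Longrightarrow> x \<in> sec X U \<Longrightarrow> g \<in> carrier (grp A U) \<Longrightarrow>
    res X f (a U x g) = a (src C f) (res X f x) (gres A f g)"
  using act by (auto simp: right_action_def arr_to_def)

lemma a_one: "U \<in> Ob C \<Longrightarrow> x \<in> sec X U \<Longrightarrow> a U x \<one>\<^bsub>grp A U\<^esub> = x"
  using act by (simp add: right_action_def)

lemma a_mult: "U \<in> Ob C \<Longrightarrow> x \<in> sec X U \<Longrightarrow> g \<in> carrier (grp A U) \<Longrightarrow> h \<in> carrier (grp A U) \<Longrightarrow>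
    a U x (g \<otimes>\<^bsub>grp A U\<^esub> h) = a U (a U x g) h"
  using act by (simp add: right_action_def)

lemma orb_refl: "U \<in> Ob C \<Longrightarrow> x \<in> sec X U \<Longrightarrow> orb U x x"
  unfolding orb_def using a_one grpA group.is_monoid monoid.one_closed by metis

lemma orb_act: "g \<in> carrier (grp A U) \<Longrightarrow> orb U x (a U x g)"
  unfolding orb_def by auto

lemma orb_sym: assumes "U \<in> Ob C" "x \<in> sec X U" "orb U x y" shows "orb U y x"
proof -
  interpret group "grp A U" using grpA assms by auto
  obtain g where g: "g \<in> carrier (grp A U)" "y = a U x g" using assms by (auto simp: orb_def)
  have "x = a U y (inv\<^bsub>grp A U\<^esub> g)"
    using g assms a_mult[of U x g "inv\<^bsub>grp A U\<^esub> g"] a_one by simp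
  then show ?thesis using g unfolding orb_def by auto
qed

lemma orb_trans: assumes "U \<in> Ob C" "x \<in> sec X U" "orb U x y" "orb U y z" shows "orb U x z"
proof -
  interpret group "grp A U" using grpA assms by auto
  show ?thesis using assms a_mult unfolding orb_def by (metis m_closed)
qed

lemma orb_res: "f \<in> arr_to C U \<Longrightarrow> x \<in> sec X U \<Longrightarrow> orb U x y \<Longrightarrow> orb (src C f) (res X f x) (res X f y)"
  unfolding orb_def using a_res gres_in by metis

text \<open>Freeness makes the local translations agree on overlaps, so that they glue.\<close>

lemma orb_local:
  assumes U: "U \<in> Ob C" and x: "x \<in> sec X U" and y: "y \<in> sec X U"
    and l: "lc U (\<lambda>f. orb (src C f) (res X f x) (res X f y))"
  shows "orb U x y"
proof -
  define \<Phi> where "\<Phi> f g \<longleftrightarrow> g \<in> carrier (grp A (src C f)) \<and> res X f y = a (src C f) (res X f x) g" for f g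
  have sA: "sheaf C (ush A)" using gA by (simp add: group_sheaf_def)
  have "\<exists>!g. g \<in> sec (ush A) U \<and> (\<forall>f\<in>arr_to C U. \<forall>h. \<Phi> f h \<longrightarrow> res (ush A) f g = h)"
  proof (rule glue[OF sA U])
    fix f g h assume f: "f \<in> arr_to C U" and g: "g \<in> arr_to C (src C f)" and h: "\<Phi> f h"
    then show "\<Phi> (cmp C f g) (res (ush A) g h)"
      unfolding \<Phi>_def using x y
      by (simp add: ush_def gres_in res_cmp[OF pX] a_res res_in[OF pX])
  next
    fix f g h assume "f \<in> arr_to C U" "\<Phi> f g" "\<Phi> f h"
    then show "g = h" unfolding \<Phi>_def using free[of "src C f" "res X f x" g h] x
      by (simp add: res_in[OF pX])
  next
    show "lc U (\<lambda>f. \<exists>h. \<Phi> f h)"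
      by (rule lc_mono[OF l U]) (auto simp: orb_def \<Phi>_def)
  qed (simp add: \<Phi>_def ush_def)
  then obtain g where g: "g \<in> carrier (grp A U)" "\<And>f h. f \<in> arr_to C U \<Longrightarrow> \<Phi> f h \<Longrightarrow> gres A f g = h"
    by (auto simp: ush_def)
  have "y = a U x g"
  proof (rule sheaf_eqI[OF shX U y a_in[OF U x g(1)]], rule lc_mono[OF l U])
    fix f assume f: "f \<in> arr_to C U" and "orb (src C f) (res X f x) (res X f y)"
    then obtain h where h: "\<Phi> f h" unfolding orb_def \<Phi>_def by auto
    then have e: "gres A f g = h" using g f by auto
    have "res X f y = a (src C f) (res X f x) (gres A f g)" using h e by (simp add: \<Phi>_def)
    then show "res X f y = res X f (a U x g)" using a_res[OF f x g(1)] by simp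
  qed
  then show ?thesis using g orb_def by auto
qed

text \<open>\<open>quot_sh\<close> is defined with local orbits, which make sense for any action;
  here they are identified with orbits, and the quotient can be handled stage by stage.\<close>

lemma loc_orbit_iff:
  assumes U: "U \<in> Ob C" and x: "x \<in> sec X U" and y: "y \<in> sec X U"
  shows "loc_orbit C A X a U x y \<longleftrightarrow> orb U x y"
proof
  assume "loc_orbit C A X a U x y"
  then have "lc U (\<lambda>f. orb (src C f) (res X f x) (res X f y))"
    unfolding loc_orbit_def orb_def by (rule cov_lc)
  then show "orb U x y" by (rule orb_local[OF U x y])
next
  assume o: "orb U x y"
  have "{f \<in> arr_to C U. \<exists>g\<in>carrier (grp A (src C f)). res X f y = a (src C f) (res X f x) g} = arr_to C U"
    using orb_res[OF _ x o] unfolding orb_def by auto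
  then show "loc_orbit C A X a U x y" unfolding loc_orbit_def using cov_max[OF U] by simp
qed

lemma q_mem: "U \<in> Ob C \<Longrightarrow> x \<in> sec X U \<Longrightarrow>
    (f, y) \<in> q U x \<longleftrightarrow> f \<in> arr_to C U \<and> y \<in> sec X (src C f) \<and> orb (src C f) (res X f x) y"
  unfolding quot_pt_def by (auto simp: loc_orbit_iff res_in[OF pX])

text \<open>The defining conditions of \<open>quot_sh\<close>, rephrased with \<open>lc\<close> and
  \<open>orb\<close>. Freeness enters through \<open>loc_orbit_iff\<close>.\<close>

lemma sec_Q_iff: "U \<in> Ob C \<Longrightarrow> W \<in> sec Q U \<longleftrightarrow>
    (\<forall>f x. (f, x) \<in> W \<longrightarrow> f \<in> arr_to C U \<and> x \<in> sec X (src C f)) \<and>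
    (\<forall>f x g. (f, x) \<in> W \<longrightarrow> g \<in> arr_to C (src C f) \<longrightarrow> (cmp C f g, res X g x) \<in> W) \<and>
    (\<forall>f x. f \<in> arr_to C U \<longrightarrow> x \<in> sec X (src C f) \<longrightarrow> lc (src C f) (\<lambda>g. (cmp C f g, res X g x) \<in> W) \<longrightarrow> (f, x) \<in> W) \<and>
    (\<forall>f x y. (f, x) \<in> W \<longrightarrow> y \<in> sec X (src C f) \<longrightarrow> (f, y) \<in> W \<longleftrightarrow> orb (src C f) x y) \<and>
    lc U (\<lambda>f. \<exists>x. (f, x) \<in> W)" (is "_ \<Longrightarrow> _ \<longleftrightarrow> ?s \<and> ?r \<and> ?l \<and> ?o \<and> ?c")
proof -
  assume U: "U \<in> Ob C"
  have c: "{f \<in> arr_to C U. \<exists>x. (f, x) \<in> W} \<in> cov C U \<longleftrightarrow> ?c" if ?r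
    using lc_cov[OF U, of "\<lambda>f. \<exists>x. (f, x) \<in> W"] cov_lc[of U "\<lambda>f. \<exists>x. (f, x) \<in> W"] that by blast
  have l: "(\<forall>f\<in>arr_to C U. \<forall>x\<in>sec X (src C f). \<forall>R\<in>cov C (src C f).
           (\<forall>g\<in>R. (cmp C f g, res X g x) \<in> W) \<longrightarrow> (f, x) \<in> W) \<longleftrightarrow> ?l"
    unfolding lc_def by blast
  have o: "(\<forall>(f, x)\<in>W. \<forall>y\<in>sec X (src C f). (f, y) \<in> W \<longleftrightarrow> loc_orbit C A X a (src C f) x y) \<longleftrightarrow> ?o" if s: ?s
  proof -
    have "loc_orbit C A X a (src C f) x y \<longleftrightarrow> orb (src C f) x y" if "(f, x) \<in> W" "y \<in> sec X (src C f)" for f x y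
    proof -
      have "f \<in> arr_to C U" "x \<in> sec X (src C f)" using s that by auto
      then show ?thesis using that by (intro loc_orbit_iff) simp_all
    qed
    then show ?thesis by (simp add: Ball_def split_paired_All)
  qed
  have s: "W \<subseteq> {(f, x). f \<in> arr_to C U \<and> x \<in> sec X (src C f)} \<longleftrightarrow> ?s" by auto
  have r: "(\<forall>(f, x)\<in>W. \<forall>g\<in>arr_to C (src C f). (cmp C f g, res X g x) \<in> W) \<longleftrightarrow> ?r" by auto
  show ?thesis unfolding quot_sh_def by (simp only: sh.simps mem_Collect_eq l s r) (use o c in blast)
qed

lemma Q_props:
  assumes "W \<in> sec Q U" "U \<in> Ob C"
  shows "(\<forall>f x. (f, x) \<in> W \<longrightarrow> f \<in> arr_to C U \<and> x \<in> sec X (src C f)) \<and>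
    (\<forall>f x g. (f, x) \<in> W \<longrightarrow> g \<in> arr_to C (src C f) \<longrightarrow> (cmp C f g, res X g x) \<in> W) \<and>
    (\<forall>f x. f \<in> arr_to C U \<longrightarrow> x \<in> sec X (src C f) \<longrightarrow> lc (src C f) (\<lambda>g. (cmp C f g, res X g x) \<in> W) \<longrightarrow> (f, x) \<in> W) \<and>
    (\<forall>f x y. (f, x) \<in> W \<longrightarrow> y \<in> sec X (src C f) \<longrightarrow> (f, y) \<in> W \<longleftrightarrow> orb (src C f) x y) \<and>
    lc U (\<lambda>f. \<exists>x. (f, x) \<in> W)"
  by (rule iffD1[OF sec_Q_iff[OF assms(2)] assms(1)])

lemmas Q_mem = Q_props[THEN conjunct1, rule_format]
  and Q_stable = Q_props[THEN conjunct2, THEN conjunct1, rule_format]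
  and Q_local = Q_props[THEN conjunct2, THEN conjunct2, THEN conjunct1, rule_format]
  and Q_orb = Q_props[THEN conjunct2, THEN conjunct2, THEN conjunct2, THEN conjunct1, rule_format]
  and Q_cover = Q_props[THEN conjunct2, THEN conjunct2, THEN conjunct2, THEN conjunct2]

lemma res_Q_mem: "(g, x) \<in> res Q f W \<longleftrightarrow> g \<in> arr_to C (src C f) \<and> (cmp C f g, x) \<in> W"
  by (simp add: quot_sh_def)

lemma q_in:
  assumes U: "U \<in> Ob C" and x: "x \<in> sec X U"
  shows "q U x \<in> sec Q U"
proof (subst sec_Q_iff[OF U], intro conjI allI impI)
  fix f y assume m: "(f, y) \<in> q U x"
  then show fa: "f \<in> arr_to C U" and y: "y \<in> sec X (src C f)" using q_mem[OF U x] by auto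
  have o: "orb (src C f) (res X f x) y" using m q_mem[OF U x] by auto
  note xf = res_in[OF pX fa x]
  { fix g assume g: "g \<in> arr_to C (src C f)"
    then show "(cmp C f g, res X g y) \<in> q U x"
      using fa y x orb_res[OF g xf o] by (simp add: q_mem[OF U] res_in[OF pX] res_cmp[OF pX]) }
  fix z assume z: "z \<in> sec X (src C f)"
  show "((f, z) \<in> q U x) \<longleftrightarrow> orb (src C f) y z"
    using fa z x q_mem[OF U x] o orb_trans[OF src_Ob[OF fa]] orb_sym[OF src_Ob[OF fa]] xf y by blast
next
  fix f y assume f: "f \<in> arr_to C U" and y: "y \<in> sec X (src C f)"
    and l: "lc (src C f) (\<lambda>g. (cmp C f g, res X g y) \<in> q U x)"
  have "orb (src C f) (res X f x) y"
    by (rule orb_local[OF src_Ob[OF f] res_in[OF pX f x] y], rule lc_mono[OF l src_Ob[OF f]])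
      (use f x in \<open>simp add: q_mem[OF U x] res_cmp[OF pX]\<close>)
  then show "(f, y) \<in> q U x" using f y x U by (simp add: q_mem)
next
  have "(f, res X f x) \<in> q U x" if "f \<in> arr_to C U" for f
    using that x U by (simp add: q_mem res_in[OF pX] orb_refl)
  then show "lc U (\<lambda>f. \<exists>y. (f, y) \<in> q U x)" by (intro lc_always[OF U]) auto
qed

lemma Q_res_in:
  assumes U: "U \<in> Ob C" and f: "f \<in> arr_to C U" and W: "W \<in> sec Q U"
  shows "res Q f W \<in> sec Q (src C f)"
proof (subst sec_Q_iff[OF src_Ob[OF f]], intro conjI allI impI)
  fix g x assume m: "(g, x) \<in> res Q f W"
  then show g: "g \<in> arr_to C (src C f)" by (simp add: res_Q_mem)
  have m': "(cmp C f g, x) \<in> W" using m by (simp add: res_Q_mem)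
  show x: "x \<in> sec X (src C g)" using Q_mem[OF W U m'] f g by simp
  { fix h assume h: "h \<in> arr_to C (src C g)"
    then show "(cmp C g h, res X h x) \<in> res Q f W"
      using Q_stable[OF W U m', of h] f g by (simp add: res_Q_mem cmp_assoc) }
  fix y assume y: "y \<in> sec X (src C g)"
  then show "(g, y) \<in> res Q f W \<longleftrightarrow> orb (src C g) x y"
    using Q_orb[OF W U m', of y] f g by (simp add: res_Q_mem)
next
  fix g x assume g: "g \<in> arr_to C (src C f)" and x: "x \<in> sec X (src C g)"
    and l: "lc (src C g) (\<lambda>h. (cmp C g h, res X h x) \<in> res Q f W)"
  have "(cmp C f g, x) \<in> W"
    by (rule Q_local[OF W U]) (use f g x in \<open>auto intro!: lc_mono[OF l] simp: res_Q_mem cmp_assoc\<close>)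
  then show "(g, x) \<in> res Q f W" using g by (simp add: res_Q_mem)
next
  show "lc (src C f) (\<lambda>g. \<exists>x. (g, x) \<in> res Q f W)"
    by (rule lc_mono[OF lc_pull[OF f Q_cover[OF W U]] src_Ob[OF f]]) (simp add: res_Q_mem)
qed

lemma Q_presheaf: "presheaf C Q"
proof (rule presheafI)
  fix U W assume U: "U \<in> Ob C" and W: "W \<in> sec Q U"
  show "res Q (idt C U) W = W"
    using Q_mem[OF W U] U by (auto simp: res_Q_mem)
  fix f g assume f: "f \<in> arr_to C U" and g: "g \<in> arr_to C (src C f)"
  show "res Q (cmp C f g) W = res Q g (res Q f W)"
    using f g by (auto simp: res_Q_mem cmp_assoc)
qed (rule Q_res_in)

text \<open>A section \<open>W\<close> of the quotient is the set of its local lifts: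
  \<open>(f, x)\<close> belongs to it exactly when \<open>x\<close> represents its restriction along
  \<open>f\<close>. This is one direction, \<open>res_q_mem\<close> is the other.\<close>

lemma mem_res_q:
  assumes U: "U \<in> Ob C" and W: "W \<in> sec Q U" and m: "(f, x) \<in> W"
  shows "res Q f W = q (src C f) x"
proof -
  have f: "f \<in> arr_to C U" and x: "x \<in> sec X (src C f)" using Q_mem[OF W U m] by auto
  have "(g, y) \<in> res Q f W \<longleftrightarrow> (g, y) \<in> q (src C f) x" for g y
  proof (cases "g \<in> arr_to C (src C f) \<and> y \<in> sec X (src C g)")
    case True
    then show ?thesis using Q_orb[OF W U Q_stable[OF W U m], of g y] f x
      by (simp add: res_Q_mem q_mem)
  next
    case False
    then show ?thesis using q_mem[OF src_Ob[OF f] x] Q_mem[OF W U, of "cmp C f g" y] f res_Q_mem src_cmp by metis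
  qed
  then show ?thesis by auto
qed

lemma res_q_mem:
  assumes U: "U \<in> Ob C" and W: "W \<in> sec Q U" and f: "f \<in> arr_to C U" and x: "x \<in> sec X (src C f)"
    and e: "res Q f W = q (src C f) x"
  shows "(f, x) \<in> W"
proof -
  have "(idt C (src C f), x) \<in> res Q f W" unfolding e
    using f x by (simp add: q_mem res_idt[OF pX] orb_refl)
  then show ?thesis using f by (simp add: res_Q_mem)
qed

lemma q_eq_iff:
  assumes U: "U \<in> Ob C" and x: "x \<in> sec X U" and y: "y \<in> sec X U"
  shows "q U x = q U y \<longleftrightarrow> orb U x y"
proof
  assume "q U x = q U y"
  moreover have "(idt C U, y) \<in> q U y" using U y by (simp add: q_mem res_idt[OF pX] orb_refl)
  ultimately have "(idt C U, y) \<in> q U x" by simp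
  then show "orb U x y" using U x by (simp add: q_mem res_idt[OF pX])
next
  assume o: "orb U x y"
  have "(f, z) \<in> q U x \<longleftrightarrow> (f, z) \<in> q U y" for f z
    using orb_res[OF _ x o, of f] orb_trans[of "src C f"] orb_sym[of "src C f"] res_in[OF pX] x y
    unfolding q_mem[OF U x] q_mem[OF U y] by (meson src_Ob)
  then show "q U x = q U y" by auto
qed

lemma q_res:
  assumes f: "f \<in> arr_to C U" and U: "U \<in> Ob C" and x: "x \<in> sec X U"
  shows "q (src C f) (res X f x) = res Q f (q U x)"
  by (rule mem_res_q[OF U q_in[OF U x], symmetric])
    (use assms in \<open>simp add: q_mem res_in[OF pX] orb_refl\<close>)

lemma q_hom: "sheaf_hom C X Q q"
  by (rule sheaf_homI) (simp_all add: q_in q_res)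

lemma Q_lift:
  assumes U: "U \<in> Ob C" and W: "W \<in> sec Q U"
  shows "lc U (\<lambda>f. \<exists>x\<in>sec X (src C f). q (src C f) x = res Q f W)"
  by (rule lc_mono[OF Q_cover[OF W U] U]) (use mem_res_q[OF U W] Q_mem[OF W U] in force)

lemma q_surj: "locally_surj C X Q q"
  by (rule locally_surjI[OF pX Q_presheaf q_hom]) (rule Q_lift)

text \<open>A section contains every pair that belongs to it locally. Membership may therefore be
  tested on a cover, where it is read off from the restrictions.\<close>

lemma Q_sep:
  assumes U: "U \<in> Ob C" and W: "W \<in> sec Q U" and W': "W' \<in> sec Q U"
    and l: "lc U (\<lambda>f. res Q f W = res Q f W')"
  shows "W = W'"
proof -
  have *: "(f, x) \<in> V'" if V: "V \<in> sec Q U" "V' \<in> sec Q U" "lc U (\<lambda>f. res Q f V = res Q f V')" "(f, x) \<in> V"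
    for V V' f x
  proof -
    have f: "f \<in> arr_to C U" and x: "x \<in> sec X (src C f)" using Q_mem[OF V(1) U V(4)] by auto
    show ?thesis
    proof (rule Q_local[OF V(2) U f x], rule lc_mono[OF lc_pull[OF f V(3)] src_Ob[OF f]])
      fix g assume g: "g \<in> arr_to C (src C f)" and e: "res Q (cmp C f g) V = res Q (cmp C f g) V'"
      have "res Q (cmp C f g) V = q (src C (cmp C f g)) (res X g x)"
        by (rule mem_res_q[OF U V(1) Q_stable[OF V(1) U V(4) g]])
      then show "(cmp C f g, res X g x) \<in> V'" using e f g x
        by (intro res_q_mem[OF U V(2)]) (simp_all add: res_in[OF pX])
    qed
  qed
  have "lc U (\<lambda>f. res Q f W' = res Q f W)" using l by (simp add: eq_commute)
  then show ?thesis using *[OF W W' l] *[OF W' W] by auto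
qed

lemma Q_sheaf: "sheaf C Q"
proof (rule sheafI[OF Q_presheaf Q_sep])
  fix U R \<xi> assume U: "U \<in> Ob C" and R: "R \<in> cov C U"
    and i: "\<And>f. f \<in> R \<Longrightarrow> \<xi> f \<in> sec Q (src C f)"
    and c: "\<And>f g. f \<in> R \<Longrightarrow> g \<in> arr_to C (src C f) \<Longrightarrow> \<xi> (cmp C f g) = res Q g (\<xi> f)"
  \<comment> \<open>The glued section consists of the points whose class agrees with the given
    family wherever that family is defined.\<close>
  define W where "W = {(f, x). f \<in> arr_to C U \<and> x \<in> sec X (src C f) \<and>
      (\<forall>g\<in>arr_to C (src C f). cmp C f g \<in> R \<longrightarrow> \<xi> (cmp C f g) = q (src C g) (res X g x))}"
  have Ra: "\<And>f. f \<in> R \<Longrightarrow> f \<in> arr_to C U" using cov_sub[OF U R] by auto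
  have pb: "lc (src C f) (\<lambda>g. cmp C f g \<in> R)" if "f \<in> arr_to C U" for f
    by (rule lc_pull[OF that]) (use R in \<open>auto simp: lc_def\<close>)
  \<comment> \<open>Over an arrow of \<open>R\<close> the condition may be tested at the identity,
    and there it says that \<open>x\<close> represents \<open>\<xi> f\<close>.\<close>
  have Rx: "(f, x) \<in> W \<longleftrightarrow> x \<in> sec X (src C f) \<and> \<xi> f = q (src C f) x" if f: "f \<in> R" for f x
  proof
    assume m: "(f, x) \<in> W"
    then have x: "x \<in> sec X (src C f)" unfolding W_def by auto
    have e: "\<xi> (cmp C f g) = q (src C g) (res X g x)" if "g \<in> arr_to C (src C f)" "cmp C f g \<in> R" for g
      using m that unfolding W_def by simp
    have "idt C (src C f) \<in> arr_to C (src C f)" "cmp C f (idt C (src C f)) = f" using Ra[OF f] by simp_all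
    from e[OF this(1)] this f have "\<xi> f = q (src C (idt C (src C f))) (res X (idt C (src C f)) x)"
      by simp
    then show "x \<in> sec X (src C f) \<and> \<xi> f = q (src C f) x"
      using x Ra[OF f] by (simp add: res_idt[OF pX])
  next
    assume h: "x \<in> sec X (src C f) \<and> \<xi> f = q (src C f) x"
    then show "(f, x) \<in> W"
      unfolding W_def using Ra[OF f] c[OF f] by (auto simp: q_res)
  qed
  have WQ: "W \<in> sec Q U"
  proof (subst sec_Q_iff[OF U], intro conjI allI impI)
    fix f x assume m: "(f, x) \<in> W"
    then show f: "f \<in> arr_to C U" and x: "x \<in> sec X (src C f)" by (auto simp: W_def)
    have e: "\<xi> (cmp C f g) = q (src C g) (res X g x)" if "g \<in> arr_to C (src C f)" "cmp C f g \<in> R" for g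
      using m that unfolding W_def by simp
    { fix k assume k: "k \<in> arr_to C (src C f)"
      then show "(cmp C f k, res X k x) \<in> W" unfolding W_def
        using f x e by (auto simp: cmp_assoc res_in[OF pX] res_cmp[OF pX, symmetric]) }
    fix y assume y: "y \<in> sec X (src C f)"
    show "(f, y) \<in> W \<longleftrightarrow> orb (src C f) x y"
    proof
      assume m': "(f, y) \<in> W"
      have e': "\<xi> (cmp C f g) = q (src C g) (res X g y)" if "g \<in> arr_to C (src C f)" "cmp C f g \<in> R" for g
        using m' that unfolding W_def by simp
      show "orb (src C f) x y"
        by (rule orb_local[OF src_Ob[OF f] x y], rule lc_mono[OF pb[OF f] src_Ob[OF f]])
          (metis e e' q_eq_iff res_in[OF pX _ x] res_in[OF pX _ y] src_Ob)
    next
      assume o: "orb (src C f) x y"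
      have "q (src C g) (res X g x) = q (src C g) (res X g y)" if "g \<in> arr_to C (src C f)" for g
        using orb_res[OF that x o] that x y by (simp add: q_eq_iff res_in[OF pX])
      then show "(f, y) \<in> W" unfolding W_def using f y e by auto
    qed
  next
    fix f x assume f: "f \<in> arr_to C U" and x: "x \<in> sec X (src C f)"
      and l: "lc (src C f) (\<lambda>k. (cmp C f k, res X k x) \<in> W)"
    have "\<xi> (cmp C f g) = q (src C g) (res X g x)" if g: "g \<in> arr_to C (src C f)" and r: "cmp C f g \<in> R" for g
    proof (rule Q_sep[OF src_Ob[OF g]])
      show "\<xi> (cmp C f g) \<in> sec Q (src C g)" using i[OF r] f g by simp
      show "q (src C g) (res X g x) \<in> sec Q (src C g)" using g x by (simp add: q_in res_in[OF pX])
      show "lc (src C g) (\<lambda>k. res Q k (\<xi> (cmp C f g)) = res Q k (q (src C g) (res X g x)))"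
      proof (rule lc_mono[OF lc_pull[OF g l] src_Ob[OF g]])
        fix k assume k: "k \<in> arr_to C (src C g)" and m: "(cmp C f (cmp C g k), res X (cmp C g k) x) \<in> W"
        have r': "cmp C f (cmp C g k) \<in> R" using cov_cmp[OF U R r, of k] f g k by (simp add: cmp_assoc)
        have "\<xi> (cmp C (cmp C f g) k) = q (src C k) (res X (cmp C g k) x)"
          using Rx[OF r'] m f g k by (simp add: cmp_assoc)
        then show "res Q k (\<xi> (cmp C f g)) = res Q k (q (src C g) (res X g x))"
          using c[OF r, of k] f g k x by (simp add: q_res[symmetric] res_in[OF pX] res_cmp[OF pX])
      qed
    qed
    then show "(f, x) \<in> W" unfolding W_def using f x by auto
  next
    have "lc U (\<lambda>f. f \<in> R)" using R by (auto simp: lc_def)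
    then show "lc U (\<lambda>f. \<exists>x. (f, x) \<in> W)"
    proof (rule lc_bind[OF U])
      fix f assume f: "f \<in> arr_to C U" and r: "f \<in> R"
      show "lc (src C f) (\<lambda>g. \<exists>x. (cmp C f g, x) \<in> W)"
      proof (rule lc_mono[OF Q_lift[OF src_Ob[OF f] i[OF r]] src_Ob[OF f]])
        fix g assume g: "g \<in> arr_to C (src C f)"
          and "\<exists>x\<in>sec X (src C g). q (src C g) x = res Q g (\<xi> f)"
        then obtain x where "x \<in> sec X (src C g)" "q (src C g) x = res Q g (\<xi> f)" by auto
        then have "(cmp C f g, x) \<in> W" using Rx[OF cov_cmp[OF U R r g]] c[OF r g] f g by simp
        then show "\<exists>x. (cmp C f g, x) \<in> W" by auto
      qed
    qed
  qed
  show "\<exists>W\<in>sec Q U. \<forall>f\<in>R. res Q f W = \<xi> f"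
  proof (intro bexI[OF _ WQ] ballI)
    fix f assume f: "f \<in> R"
    show "res Q f W = \<xi> f"
    proof (rule Q_sep[OF src_Ob[OF Ra[OF f]] Q_res_in[OF U Ra[OF f] WQ] i[OF f]])
      show "lc (src C f) (\<lambda>g. res Q g (res Q f W) = res Q g (\<xi> f))"
      proof (rule lc_mono[OF Q_lift[OF src_Ob[OF Ra[OF f]] i[OF f]] src_Ob[OF Ra[OF f]]])
        fix g assume g: "g \<in> arr_to C (src C f)"
          and "\<exists>x\<in>sec X (src C g). q (src C g) x = res Q g (\<xi> f)"
        then obtain x where x: "x \<in> sec X (src C g)" "q (src C g) x = res Q g (\<xi> f)" by auto
        then have "(cmp C f g, x) \<in> W" using Rx[OF cov_cmp[OF U R f g]] c[OF f g] Ra[OF f] g by simp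
        from mem_res_q[OF U WQ this] show "res Q g (res Q f W) = res Q g (\<xi> f)"
          using x Ra[OF f] g by (simp add: res_cmp[OF Q_presheaf Ra[OF f] g WQ])
      qed
    qed
  qed
qed

end

section \<open>Maps out of the quotient\<close>

context free_action
begin

context
  fixes Y :: "('o, 'm, 'y) sh" and \<phi> :: "'o \<Rightarrow> 'x \<Rightarrow> 'y"
  assumes Y: "sheaf C Y" and \<phi>: "sheaf_hom C X Y \<phi>"
    and inv: "\<And>U x g. U \<in> Ob C \<Longrightarrow> x \<in> sec X U \<Longrightarrow> g \<in> carrier (grp A U) \<Longrightarrow> \<phi> U (a U x g) = \<phi> U x"
begin

lemma \<phi>_orb: "U \<in> Ob C \<Longrightarrow> x \<in> sec X U \<Longrightarrow> orb U x y \<Longrightarrow> \<phi> U y = \<phi> U x"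
  using inv unfolding orb_def by auto

text \<open>The values of \<open>\<phi>\<close> at representatives are compatible local data:
  representatives over one arrow lie in one orbit, on which \<open>\<phi>\<close> is
  constant.\<close>

lemma descend_ex1:
  assumes U: "U \<in> Ob C" and W: "W \<in> sec Q U"
  shows "\<exists>!y. y \<in> sec Y U \<and> (\<forall>(f, x)\<in>W. res Y f y = \<phi> (src C f) x)"
proof -
  define \<Phi> where "\<Phi> f y \<longleftrightarrow> (\<exists>x. (f, x) \<in> W \<and> y = \<phi> (src C f) x)" for f y
  note m = Q_mem[OF W U]
  have "\<exists>!y. y \<in> sec Y U \<and> (\<forall>f\<in>arr_to C U. \<forall>z. \<Phi> f z \<longrightarrow> res Y f y = z)"
  proof (rule glue[OF Y U])
    show "y \<in> sec Y (src C f)" if "f \<in> arr_to C U" "\<Phi> f y" for f y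
      using that m hom_in[OF \<phi>] unfolding \<Phi>_def by fastforce
    show "\<Phi> (cmp C f g) (res Y g y)" if f: "f \<in> arr_to C U" and g: "g \<in> arr_to C (src C f)" and y: "\<Phi> f y" for f g y
    proof -
      obtain x where x: "(f, x) \<in> W" "y = \<phi> (src C f) x" using y \<Phi>_def by auto
      have "(cmp C f g, res X g x) \<in> W" by (rule Q_stable[OF W U x(1) g])
      moreover have "res Y g y = \<phi> (src C (cmp C f g)) (res X g x)"
        using x m[OF x(1)] f g by (simp add: hom_res[OF \<phi>])
      ultimately show ?thesis unfolding \<Phi>_def by blast
    qed
    show "y = z" if f: "f \<in> arr_to C U" and yz: "\<Phi> f y" "\<Phi> f z" for f y z
    proof -
      obtain x x' where x: "(f, x) \<in> W" "y = \<phi> (src C f) x" "(f, x') \<in> W" "z = \<phi> (src C f) x'"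
        using yz \<Phi>_def by auto
      have "orb (src C f) x x'" using Q_orb[OF W U x(1)] m[OF x(3)] x(3) by simp
      then show ?thesis using x m[OF x(1)] f by (simp add: \<phi>_orb)
    qed
    show "lc U (\<lambda>f. \<exists>y. \<Phi> f y)"
      by (rule lc_mono[OF Q_cover[OF W U] U]) (auto simp: \<Phi>_def)
  qed
  moreover have "(\<forall>f\<in>arr_to C U. \<forall>z. \<Phi> f z \<longrightarrow> res Y f y = z) \<longleftrightarrow> (\<forall>(f, x)\<in>W. res Y f y = \<phi> (src C f) x)" for y
    unfolding \<Phi>_def using m by fastforce
  ultimately show ?thesis by simp
qed

lemma descend_in: "U \<in> Ob C \<Longrightarrow> W \<in> sec Q U \<Longrightarrow> descend C Y \<phi> U W \<in> sec Y U"
  and descend_mem: "U \<in> Ob C \<Longrightarrow> W \<in> sec Q U \<Longrightarrow> (f, x) \<in> W \<Longrightarrow> res Y f (descend C Y \<phi> U W) = \<phi> (src C f) x"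
  using theI'[OF descend_ex1[of U W]] unfolding descend_def by auto

lemma descend_eqI:
  assumes "U \<in> Ob C" "W \<in> sec Q U" "y \<in> sec Y U" "\<And>f x. (f, x) \<in> W \<Longrightarrow> res Y f y = \<phi> (src C f) x"
  shows "descend C Y \<phi> U W = y"
  unfolding descend_def by (rule the1_equality[OF descend_ex1]) (use assms in auto)

lemma descend_q: "U \<in> Ob C \<Longrightarrow> x \<in> sec X U \<Longrightarrow> descend C Y \<phi> U (q U x) = \<phi> U x"
  by (rule descend_eqI)
    (auto simp: q_in hom_in[OF \<phi>] q_mem hom_res[OF \<phi>, symmetric] res_in[OF pX] intro!: \<phi>_orb[symmetric])

lemma descend_res:
  assumes U: "U \<in> Ob C" and f: "f \<in> arr_to C U" and W: "W \<in> sec Q U"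
  shows "descend C Y \<phi> (src C f) (res Q f W) = res Y f (descend C Y \<phi> U W)"
proof (rule descend_eqI)
  note pY = sheaf_presheaf[OF Y]
  show "res Y f (descend C Y \<phi> U W) \<in> sec Y (src C f)" using f W U by (simp add: descend_in res_in[OF pY])
  fix g x assume m: "(g, x) \<in> res Q f W"
  then have "g \<in> arr_to C (src C f)" by (simp add: res_Q_mem)
  then show "res Y g (res Y f (descend C Y \<phi> U W)) = \<phi> (src C g) x"
    using m descend_mem[OF U W, of "cmp C f g" x] f descend_in[OF U W]
    by (simp add: res_Q_mem res_cmp[OF pY])
qed (use f U W in \<open>simp_all add: Q_res_in\<close>)

lemma descend_hom: "sheaf_hom C Q Y (descend C Y \<phi>)"
  by (rule sheaf_homI) (simp_all add: descend_in descend_res)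

text \<open>A recognition criterion for the quotient. If points with equal image lie in one orbit,
  the induced map is injective; since preimages of a section exist locally, injectivity makes them
  unique and lets them glue.\<close>

lemma descend_bij:
  assumes surj: "locally_surj C X Y \<phi>"
    and inj: "\<And>U x y. U \<in> Ob C \<Longrightarrow> x \<in> sec X U \<Longrightarrow> y \<in> sec X U \<Longrightarrow> \<phi> U x = \<phi> U y \<Longrightarrow> orb U x y"
    and U: "U \<in> Ob C"
  shows "bij_betw (descend C Y \<phi> U) (sec Q U) (sec Y U)"
proof -
  \<comment> \<open>Stated for all stages, since the gluing below applies it over the sources of
    arrows.\<close>
  have i: "W = W'" if U: "U \<in> Ob C" and W: "W \<in> sec Q U" "W' \<in> sec Q U" and e: "descend C Y \<phi> U W = descend C Y \<phi> U W'"
    for U W W'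
  proof (rule Q_sep[OF U W], rule lc_bind[OF U Q_lift[OF U W(1)]])
    fix f assume f: "f \<in> arr_to C U" and "\<exists>x\<in>sec X (src C f). q (src C f) x = res Q f W"
    then obtain x where x: "x \<in> sec X (src C f)" "q (src C f) x = res Q f W" by auto
    show "lc (src C f) (\<lambda>g. res Q (cmp C f g) W = res Q (cmp C f g) W')"
    proof (rule lc_mono[OF lc_pull[OF f Q_lift[OF U W(2)]] src_Ob[OF f]])
      fix g assume g: "g \<in> arr_to C (src C f)"
        and "\<exists>x\<in>sec X (src C (cmp C f g)). q (src C (cmp C f g)) x = res Q (cmp C f g) W'"
      then obtain y where y: "y \<in> sec X (src C g)" "q (src C g) y = res Q (cmp C f g) W'" using f by auto
      have x': "res X g x \<in> sec X (src C g)" "q (src C g) (res X g x) = res Q (cmp C f g) W"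
        using x f g W by (auto simp: res_in[OF pX] q_res res_cmp[OF Q_presheaf])
      have fg: "cmp C f g \<in> arr_to C U" using f g by simp
      have "\<phi> (src C g) (res X g x) = res Y (cmp C f g) (descend C Y \<phi> U W)"
        using descend_q[OF src_Ob[OF g] x'(1)] descend_res[OF U fg W(1)] f g x' by simp
      also have "\<dots> = res Y (cmp C f g) (descend C Y \<phi> U W')" using e by simp
      also have "\<dots> = \<phi> (src C g) y"
        using descend_q[OF src_Ob[OF g] y(1)] descend_res[OF U fg W(2)] f g y by simp
      finally have "orb (src C g) (res X g x) y" using inj x' y g by simp
      then have "q (src C g) (res X g x) = q (src C g) y" using q_eq_iff[OF src_Ob[OF g] x'(1) y(1)] by simp
      then show "res Q (cmp C f g) W = res Q (cmp C f g) W'" using x' y by simp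
    qed
  qed
  moreover have "\<exists>W\<in>sec Q U. descend C Y \<phi> U W = y" if y: "y \<in> sec Y U" for y
  proof -
    define \<Phi> where "\<Phi> f W \<longleftrightarrow> W \<in> sec Q (src C f) \<and> descend C Y \<phi> (src C f) W = res Y f y" for f W
    have "\<exists>!W. W \<in> sec Q U \<and> (\<forall>f\<in>arr_to C U. \<forall>V. \<Phi> f V \<longrightarrow> res Q f W = V)"
    proof (rule glue[OF Q_sheaf U])
      show "\<Phi> (cmp C f g) (res Q g V)" if "f \<in> arr_to C U" "g \<in> arr_to C (src C f)" "\<Phi> f V" for f g V
        using that y Q_res_in[OF src_Ob[OF that(1)] that(2), of V] descend_res[OF src_Ob[OF that(1)] that(2), of V]
        unfolding \<Phi>_def by (simp add: res_cmp[OF sheaf_presheaf[OF Y]])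
      show "V = V'" if "f \<in> arr_to C U" "\<Phi> f V" "\<Phi> f V'" for f V V'
        using that unfolding \<Phi>_def by (intro i[of "src C f"]) auto
      show "lc U (\<lambda>f. \<exists>V. \<Phi> f V)"
      proof (rule lc_mono[OF locally_surjD[OF surj U y] U])
        fix f assume f: "f \<in> arr_to C U" and "\<exists>x\<in>sec X (src C f). \<phi> (src C f) x = res Y f y"
        then obtain x where "x \<in> sec X (src C f)" "\<phi> (src C f) x = res Y f y" by auto
        then have "\<Phi> f (q (src C f) x)" unfolding \<Phi>_def using f by (simp add: q_in descend_q)
        then show "\<exists>V. \<Phi> f V" by blast
      qed
    qed (simp add: \<Phi>_def)
    then obtain W where W': "W \<in> sec Q U \<and> (\<forall>f\<in>arr_to C U. \<forall>V. \<Phi> f V \<longrightarrow> res Q f W = V)" by (elim ex1E)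
    then have W: "W \<in> sec Q U" "\<And>f V. f \<in> arr_to C U \<Longrightarrow> \<Phi> f V \<Longrightarrow> res Q f W = V" by simp_all
    have "descend C Y \<phi> U W = y"
    proof (rule sheaf_eqI[OF Y U descend_in[OF U W(1)] y], rule lc_mono[OF locally_surjD[OF surj U y] U])
      fix f assume f: "f \<in> arr_to C U" and "\<exists>x\<in>sec X (src C f). \<phi> (src C f) x = res Y f y"
      then obtain x where x: "x \<in> sec X (src C f)" "\<phi> (src C f) x = res Y f y" by auto
      have "\<Phi> f (q (src C f) x)" unfolding \<Phi>_def using f x by (simp add: q_in descend_q)
      then have "res Q f W = q (src C f) x" using W f by auto
      then show "res Y f (descend C Y \<phi> U W) = res Y f y"
        using descend_res[OF U f W(1)] f x by (simp add: descend_q)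
    qed
    then show ?thesis using W by auto
  qed
  ultimately show ?thesis using U
    unfolding bij_betw_def by (intro conjI inj_onI subset_antisym subsetI) (auto simp: descend_in, metis imageI)
qed

end

end

locale quotient_torsor = free_action C A "tot T" a
  for C :: "('o, 'm) site_data" and A :: "('o, 'm, 'a) gsh"
    and T :: "('o, 'm, 'b, 'g, 'p, 'z) tors_scheme" and a +
  fixes G :: "('o, 'm, 'g, 'y) xmod_scheme" and B :: "('o, 'm, 'c) sh" and \<pi> :: "'o \<Rightarrow> 'b \<Rightarrow> 'c"
  assumes cG: "crossed_module C G" and shB: "sheaf C B"
    and prj: "sheaf_hom C (tot T) B (\<lambda>U u. \<pi> U (proj T U u))"
    and prj_inv: "\<And>U x g. U \<in> Ob C \<Longrightarrow> x \<in> sec (tot T) U \<Longrightarrow> g \<in> carrier (grp A U) \<Longrightarrow>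
      \<pi> U (proj T U (a U x g)) = \<pi> U (proj T U x)"
    and strh: "sheaf_hom C (tot T) (ush (X0 G)) (str T)"
    and str_inv: "\<And>U x g. U \<in> Ob C \<Longrightarrow> x \<in> sec (tot T) U \<Longrightarrow> g \<in> carrier (grp A U) \<Longrightarrow>
      str T U (a U x g) = str T U x"
    and ra: "right_action C (X1 G) (tot T) (ract T)"
    and ra_comm: "\<And>U x g h. U \<in> Ob C \<Longrightarrow> x \<in> sec (tot T) U \<Longrightarrow> g \<in> carrier (grp (X1 G) U) \<Longrightarrow>
      h \<in> carrier (grp A U) \<Longrightarrow> a U (ract T U x g) h = ract T U (a U x h) g"
    and ra_prj: "\<And>U x g. U \<in> Ob C \<Longrightarrow> x \<in> sec (tot T) U \<Longrightarrow> g \<in> carrier (grp (X1 G) U) \<Longrightarrow>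
      \<pi> U (proj T U (ract T U x g)) = \<pi> U (proj T U x)"
    and ra_str: "\<And>U x g. U \<in> Ob C \<Longrightarrow> x \<in> sec (tot T) U \<Longrightarrow> g \<in> carrier (grp (X1 G) U) \<Longrightarrow>
      str T U (ract T U x g) = str T U x \<otimes>\<^bsub>grp (X0 G) U\<^esub> bd G U g"
begin

abbreviation "QT \<equiv> quot_tors C G A a B \<pi> T"

lemma tot_QT: "tot QT = Q" by (simp add: quot_tors_def)

lemma shG0: "sheaf C (ush (X0 G))" using cG by (simp add: crossed_module_def group_sheaf_def)

lemma shG1: "sheaf C (ush (X1 G))" using cG by (simp add: crossed_module_def group_sheaf_def)

lemma grpG: "U \<in> Ob C \<Longrightarrow> group (grp (X1 G) U)"
  using cG by (simp add: crossed_module_def group_sheaf_def)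

lemma gresG_in: "f \<in> arr_to C U \<Longrightarrow> g \<in> carrier (grp (X1 G) U) \<Longrightarrow> gres (X1 G) f g \<in> carrier (grp (X1 G) (src C f))"
  using cG by (auto simp: crossed_module_def group_sheaf_def arr_to_def hom_def)

lemma gresG_mult: "f \<in> arr_to C U \<Longrightarrow> g \<in> carrier (grp (X1 G) U) \<Longrightarrow> h \<in> carrier (grp (X1 G) U) \<Longrightarrow>
    gres (X1 G) f (g \<otimes>\<^bsub>grp (X1 G) U\<^esub> h) = gres (X1 G) f g \<otimes>\<^bsub>grp (X1 G) (src C f)\<^esub> gres (X1 G) f h"
  using cG by (auto simp: crossed_module_def group_sheaf_def arr_to_def hom_def)

lemma gresG_cmp: "U \<in> Ob C \<Longrightarrow> f \<in> arr_to C U \<Longrightarrow> k \<in> arr_to C (src C f) \<Longrightarrow> g \<in> carrier (grp (X1 G) U) \<Longrightarrow>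
    gres (X1 G) (cmp C f k) g = gres (X1 G) k (gres (X1 G) f g)"
  using res_cmp[OF sheaf_presheaf[OF shG1]] by (simp add: ush_def)

lemma T_in: "U \<in> Ob C \<Longrightarrow> x \<in> sec (tot T) U \<Longrightarrow> g \<in> carrier (grp (X1 G) U) \<Longrightarrow> ract T U x g \<in> sec (tot T) U"
  using ra by (simp add: right_action_def)

lemma T_res: "f \<in> arr_to C U \<Longrightarrow> x \<in> sec (tot T) U \<Longrightarrow> g \<in> carrier (grp (X1 G) U) \<Longrightarrow>
    res (tot T) f (ract T U x g) = ract T (src C f) (res (tot T) f x) (gres (X1 G) f g)"
  using ra by (auto simp: right_action_def arr_to_def)

lemma T_one: "U \<in> Ob C \<Longrightarrow> x \<in> sec (tot T) U \<Longrightarrow> ract T U x \<one>\<^bsub>grp (X1 G) U\<^esub> = x"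
  using ra by (simp add: right_action_def)

lemma T_mult: "U \<in> Ob C \<Longrightarrow> x \<in> sec (tot T) U \<Longrightarrow> g \<in> carrier (grp (X1 G) U) \<Longrightarrow> h \<in> carrier (grp (X1 G) U) \<Longrightarrow>
    ract T U x (g \<otimes>\<^bsub>grp (X1 G) U\<^esub> h) = ract T U (ract T U x g) h"
  using ra by (simp add: right_action_def)

lemma proj_hom: "sheaf_hom C Q B (proj QT)"
  unfolding quot_tors_def by (simp add: descend_hom[OF shB prj prj_inv])

lemma proj_q: "U \<in> Ob C \<Longrightarrow> x \<in> sec (tot T) U \<Longrightarrow> proj QT U (q U x) = \<pi> U (proj T U x)"
  unfolding quot_tors_def by (simp add: descend_q[OF shB prj prj_inv])

lemma str_hom: "sheaf_hom C Q (ush (X0 G)) (str QT)"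
  unfolding quot_tors_def by (simp add: descend_hom[OF shG0 strh str_inv])

lemma str_q: "U \<in> Ob C \<Longrightarrow> x \<in> sec (tot T) U \<Longrightarrow> str QT U (q U x) = str T U x"
  unfolding quot_tors_def by (simp add: descend_q[OF shG0 strh str_inv])

lemma ract_QT: "ract QT U W g = {(f, ract T (src C f) u (gres (X1 G) f g)) | f u. (f, u) \<in> W}"
  by (simp add: quot_tors_def)

lemma orb_ract:
  assumes U: "U \<in> Ob C" and x: "x \<in> sec (tot T) U" and g: "g \<in> carrier (grp (X1 G) U)" and o: "orb U x y"
  shows "orb U (ract T U x g) (ract T U y g)"
proof -
  obtain h where h: "h \<in> carrier (grp A U)" "y = a U x h" using o by (auto simp: orb_def)
  show ?thesis unfolding orb_def using h ra_comm[OF U x g h(1)] by (intro bexI[of _ h]) simp_all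
qed

lemma ract_inv_cancel:
  assumes U: "U \<in> Ob C" and x: "x \<in> sec (tot T) U" and g: "g \<in> carrier (grp (X1 G) U)"
  shows "ract T U (ract T U x g) (inv\<^bsub>grp (X1 G) U\<^esub> g) = x"
    and "ract T U (ract T U x (inv\<^bsub>grp (X1 G) U\<^esub> g)) g = x"
proof -
  interpret group "grp (X1 G) U" using grpG[OF U] .
  show "ract T U (ract T U x g) (inv\<^bsub>grp (X1 G) U\<^esub> g) = x"
    and "ract T U (ract T U x (inv\<^bsub>grp (X1 G) U\<^esub> g)) g = x"
    using T_mult[OF U x, symmetric] T_one[OF U x] g by simp_all
qed

lemma orb_ract_iff:
  assumes U: "U \<in> Ob C" and x: "x \<in> sec (tot T) U" and y: "y \<in> sec (tot T) U" and g: "g \<in> carrier (grp (X1 G) U)"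
  shows "orb U (ract T U x g) y \<longleftrightarrow> orb U x (ract T U y (inv\<^bsub>grp (X1 G) U\<^esub> g))"
proof -
  interpret group "grp (X1 G) U" using grpG[OF U] .
  have gi: "inv\<^bsub>grp (X1 G) U\<^esub> g \<in> carrier (grp (X1 G) U)" using g by simp
  show ?thesis
    using orb_ract[OF U T_in[OF U x g] gi, of y] orb_ract[OF U x g, of "ract T U y (inv\<^bsub>grp (X1 G) U\<^esub> g)"]
      ract_inv_cancel[OF U x g] ract_inv_cancel[OF U y g] by auto
qed

text \<open>Solves for the representative: the image in the definition of the action on the quotient
  becomes a preimage, which combines directly with stability and locality of
  \<open>W\<close>.\<close>

lemma mem_ract_iff:
  assumes U: "U \<in> Ob C" and W: "W \<in> sec Q U" and g: "g \<in> carrier (grp (X1 G) U)"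
  shows "(f, y) \<in> ract QT U W g \<longleftrightarrow> f \<in> arr_to C U \<and> y \<in> sec (tot T) (src C f) \<and>
      (f, ract T (src C f) y (inv\<^bsub>grp (X1 G) (src C f)\<^esub> (gres (X1 G) f g))) \<in> W"
proof
  assume "(f, y) \<in> ract QT U W g"
  then obtain u where u: "(f, u) \<in> W" "y = ract T (src C f) u (gres (X1 G) f g)" by (auto simp: ract_QT)
  have f: "f \<in> arr_to C U" and us: "u \<in> sec (tot T) (src C f)" using Q_mem[OF W U u(1)] by auto
  then show "f \<in> arr_to C U \<and> y \<in> sec (tot T) (src C f) \<and>
      (f, ract T (src C f) y (inv\<^bsub>grp (X1 G) (src C f)\<^esub> (gres (X1 G) f g))) \<in> W"
    using u gresG_in[OF f g] by (simp add: T_in ract_inv_cancel)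
next
  assume h: "f \<in> arr_to C U \<and> y \<in> sec (tot T) (src C f) \<and>
      (f, ract T (src C f) y (inv\<^bsub>grp (X1 G) (src C f)\<^esub> (gres (X1 G) f g))) \<in> W"
  then have f: "src C f \<in> Ob C" by auto
  from h have "ract T (src C f) (ract T (src C f) y (inv\<^bsub>grp (X1 G) (src C f)\<^esub> (gres (X1 G) f g))) (gres (X1 G) f g) = y"
    using ract_inv_cancel(2)[of "src C f" y "gres (X1 G) f g"] gresG_in[OF _ g] f by simp
  then show "(f, y) \<in> ract QT U W g" unfolding ract_QT using h by (intro CollectI exI[of _ f] exI[of _ "ract T (src C f) y (inv\<^bsub>grp (X1 G) (src C f)\<^esub> (gres (X1 G) f g))"]) simp
qed

lemma ract_q:
  assumes U: "U \<in> Ob C" and x: "x \<in> sec (tot T) U" and g: "g \<in> carrier (grp (X1 G) U)"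
  shows "ract QT U (q U x) g = q U (ract T U x g)"
proof -
  have "(f, y) \<in> ract QT U (q U x) g \<longleftrightarrow> (f, y) \<in> q U (ract T U x g)" for f y
  proof (cases "f \<in> arr_to C U \<and> y \<in> sec (tot T) (src C f)")
    case True
    then have f: "f \<in> arr_to C U" and y: "y \<in> sec (tot T) (src C f)" by auto
    have V: "src C f \<in> Ob C" using f by simp
    interpret group "grp (X1 G) (src C f)" using grpG[OF V] .
    show ?thesis
      using f y x g U V gresG_in[OF f g]
      by (simp add: mem_ract_iff q_in q_mem T_in T_res orb_ract_iff res_in[OF pX])
  next
    case False
    then show ?thesis using U x g by (auto simp: mem_ract_iff q_in q_mem T_in)
  qed
  then show ?thesis by auto
qed

lemma res_ract_QT:
  assumes U: "U \<in> Ob C" and W: "W \<in> sec Q U" and g: "g \<in> carrier (grp (X1 G) U)" and f: "f \<in> arr_to C U"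
  shows "res Q f (ract QT U W g) = ract QT (src C f) (res Q f W) (gres (X1 G) f g)"
proof -
  have "(k, y) \<in> res Q f (ract QT U W g) \<longleftrightarrow> (k, y) \<in> ract QT (src C f) (res Q f W) (gres (X1 G) f g)" for k y
    using U W g f gresG_in[OF f g] Q_res_in[OF U f W]
    by (auto simp: res_Q_mem mem_ract_iff gresG_cmp)
  then show ?thesis by auto
qed

lemma ract_QT_in:
  assumes U: "U \<in> Ob C" and W: "W \<in> sec Q U" and g: "g \<in> carrier (grp (X1 G) U)"
  shows "ract QT U W g \<in> sec Q U"
proof (subst sec_Q_iff[OF U], intro conjI allI impI)
  fix f x assume m: "(f, x) \<in> ract QT U W g"
  then show f: "f \<in> arr_to C U" and x: "x \<in> sec (tot T) (src C f)" using mem_ract_iff[OF assms] by auto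
  have V: "src C f \<in> Ob C" using f by simp
  interpret group "grp (X1 G) (src C f)" using grpG[OF V] .
  have gf: "gres (X1 G) f g \<in> carrier (grp (X1 G) (src C f))" using gresG_in[OF f g] .
  have m': "(f, ract T (src C f) x (inv\<^bsub>grp (X1 G) (src C f)\<^esub> (gres (X1 G) f g))) \<in> W"
    using m mem_ract_iff[OF assms] by auto
  { fix k assume k: "k \<in> arr_to C (src C f)"
    obtain u where u: "(f, u) \<in> W" "x = ract T (src C f) u (gres (X1 G) f g)" using m by (auto simp: ract_QT)
    have us: "u \<in> sec (tot T) (src C f)" using Q_mem[OF W U u(1)] by auto
    show "(cmp C f k, res (tot T) k x) \<in> ract QT U W g"
      unfolding ract_QT using Q_stable[OF W U u(1) k] u us f k gf g U by (fastforce simp: T_res gresG_cmp) }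
  fix y assume y: "y \<in> sec (tot T) (src C f)"
  show "(f, y) \<in> ract QT U W g \<longleftrightarrow> orb (src C f) x y"
    using mem_ract_iff[OF assms] f y x V gf Q_orb[OF W U m', of "ract T (src C f) y (inv\<^bsub>grp (X1 G) (src C f)\<^esub> (gres (X1 G) f g))"]
      orb_ract_iff[OF V T_in[OF V x inv_closed[OF gf]] y gf] ract_inv_cancel[OF V x gf]
    by (simp add: T_in)
next
  fix f x assume f: "f \<in> arr_to C U" and x: "x \<in> sec (tot T) (src C f)"
    and l: "lc (src C f) (\<lambda>k. (cmp C f k, res (tot T) k x) \<in> ract QT U W g)"
  have V: "src C f \<in> Ob C" using f by simp
  interpret group "grp (X1 G) (src C f)" using grpG[OF V] .
  have gf: "gres (X1 G) f g \<in> carrier (grp (X1 G) (src C f))" using gresG_in[OF f g] .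
  have "(f, ract T (src C f) x (inv\<^bsub>grp (X1 G) (src C f)\<^esub> (gres (X1 G) f g))) \<in> W"
  proof (rule Q_local[OF W U f T_in[OF V x inv_closed[OF gf]]], rule lc_mono[OF l V])
    fix k assume k: "k \<in> arr_to C (src C f)" and m: "(cmp C f k, res (tot T) k x) \<in> ract QT U W g"
    interpret k: group "grp (X1 G) (src C k)" using grpG[OF src_Ob[OF k]] .
    have "group_hom (grp (X1 G) (src C f)) (grp (X1 G) (src C k)) (gres (X1 G) k)"
      using gresG_in[OF k] gresG_mult[OF k] by unfold_locales (auto simp: hom_def)
    then have "gres (X1 G) k (inv\<^bsub>grp (X1 G) (src C f)\<^esub> (gres (X1 G) f g)) =
        inv\<^bsub>grp (X1 G) (src C k)\<^esub> (gres (X1 G) (cmp C f k) g)"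
      using group_hom.hom_inv gf gresG_cmp[OF U f k g] by metis
    then show "(cmp C f k, res (tot T) k (ract T (src C f) x (inv\<^bsub>grp (X1 G) (src C f)\<^esub> (gres (X1 G) f g)))) \<in> W"
      using m mem_ract_iff[OF assms] f k x gf by (simp add: T_res)
  qed
  then show "(f, x) \<in> ract QT U W g" using mem_ract_iff[OF assms] f x by auto
next
  have "(f, ract T (src C f) u (gres (X1 G) f g)) \<in> ract QT U W g" if "(f, u) \<in> W" for f u
    using that unfolding ract_QT by blast
  then show "lc U (\<lambda>f. \<exists>x. (f, x) \<in> ract QT U W g)"
    by (intro lc_mono[OF Q_cover[OF W U] U]) blast
qed

text \<open>An equality of sections is local, so \<open>W\<close> may be taken to be the class of a
  point.\<close>

lemma Q_eq_lift:
  assumes U: "U \<in> Ob C" and W: "W \<in> sec Q U" and V: "V \<in> sec Q U" "V' \<in> sec Q U"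
    and e: "\<And>f x. f \<in> arr_to C U \<Longrightarrow> x \<in> sec (tot T) (src C f) \<Longrightarrow> res Q f W = q (src C f) x \<Longrightarrow>
      res Q f V = res Q f V'"
  shows "V = V'"
  by (rule Q_sep[OF U V], rule lc_mono[OF Q_lift[OF U W] U]) (use e in force)

lemma QT_ract: "right_action C (X1 G) Q (ract QT)"
  unfolding right_action_def
proof (intro conjI ballI)
  fix U W g assume U: "U \<in> Ob C" and W: "W \<in> sec Q U" and g: "g \<in> carrier (grp (X1 G) U)"
  interpret group "grp (X1 G) U" using grpG[OF U] .
  show "ract QT U W g \<in> sec Q U" by (rule ract_QT_in[OF U W g])
  fix h assume h: "h \<in> carrier (grp (X1 G) U)"
  show "ract QT U W (g \<otimes>\<^bsub>grp (X1 G) U\<^esub> h) = ract QT U (ract QT U W g) h"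
  proof (rule Q_eq_lift[OF U W])
    fix f x assume f: "f \<in> arr_to C U" and x: "x \<in> sec (tot T) (src C f)" "res Q f W = q (src C f) x"
    interpret f: group "grp (X1 G) (src C f)" using grpG[OF src_Ob[OF f]] .
    show "res Q f (ract QT U W (g \<otimes>\<^bsub>grp (X1 G) U\<^esub> h)) = res Q f (ract QT U (ract QT U W g) h)"
      using U W g h f x by (simp add: res_ract_QT ract_QT_in gresG_mult ract_q T_in gresG_in T_mult)
  qed (use U W g h in \<open>simp_all add: ract_QT_in\<close>)
next
  fix f W g assume f: "f \<in> Ar C" "W \<in> sec Q (tgt C f)" "g \<in> carrier (grp (X1 G) (tgt C f))"
  then have "f \<in> arr_to C (tgt C f)" "tgt C f \<in> Ob C" using cat by (auto simp: arr_to_def category_def)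
  then show "res Q f (ract QT (tgt C f) W g) = ract QT (src C f) (res Q f W) (gres (X1 G) f g)"
    using res_ract_QT f by simp
next
  fix U W assume U: "U \<in> Ob C" and W: "W \<in> sec Q U"
  have [simp]: "\<one>\<^bsub>grp (X1 G) V\<^esub> \<in> carrier (grp (X1 G) V)" if "V \<in> Ob C" for V
    using grpG[OF that] by (simp add: group.is_monoid)
  have [simp]: "gres (X1 G) f \<one>\<^bsub>grp (X1 G) U\<^esub> = \<one>\<^bsub>grp (X1 G) (src C f)\<^esub>" if "f \<in> arr_to C U" for f
    using gresG_in[OF that] gresG_mult[OF that] grpG[OF U] grpG[OF src_Ob[OF that]]
    by (intro hom_one[of _ "grp (X1 G) U"]) (auto simp: hom_def)
  show "ract QT U W \<one>\<^bsub>grp (X1 G) U\<^esub> = W"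
    by (rule Q_eq_lift[OF U W _ W]) (use U W in \<open>simp_all add: ract_QT_in res_ract_QT ract_q T_one\<close>)
qed

text \<open>The torsor axioms become statements about points of \<open>T\<close> modulo the action
  of \<open>A\<close>. An element carrying one class to another over the same point of
  \<open>B\<close> is found locally, and these elements glue because they are unique.\<close>

lemma gtorsor_QT:
  assumes surj: "locally_surj C (tot T) B (\<lambda>U u. \<pi> U (proj T U u))"
    and trans: "\<And>U x y. U \<in> Ob C \<Longrightarrow> x \<in> sec (tot T) U \<Longrightarrow> y \<in> sec (tot T) U \<Longrightarrow>
      \<pi> U (proj T U x) = \<pi> U (proj T U y) \<Longrightarrow> \<exists>g\<in>carrier (grp (X1 G) U). orb U (ract T U x g) y"
    and ffree: "\<And>U x g h. U \<in> Ob C \<Longrightarrow> x \<in> sec (tot T) U \<Longrightarrow> g \<in> carrier (grp (X1 G) U) \<Longrightarrow>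
      h \<in> carrier (grp (X1 G) U) \<Longrightarrow> orb U (ract T U x g) (ract T U x h) \<Longrightarrow> g = h"
  shows "gtorsor C G B QT"
proof -
  note pG1 = sheaf_presheaf[OF shG1] and pB = sheaf_presheaf[OF shB]
  \<comment> \<open>Freeness for arbitrary classes, needed both for uniqueness of the translating
    element and to glue its local values.\<close>
  have Qfree: "g = h" if U: "U \<in> Ob C" and W: "W \<in> sec Q U" and gh: "g \<in> carrier (grp (X1 G) U)" "h \<in> carrier (grp (X1 G) U)"
    and e: "ract QT U W g = ract QT U W h" for U W g h
  proof (rule sheaf_eqI[OF shG1 U])
    show "lc U (\<lambda>f. res (ush (X1 G)) f g = res (ush (X1 G)) f h)"
    proof (rule lc_mono[OF Q_lift[OF U W] U])
      fix f assume f: "f \<in> arr_to C U" and "\<exists>x\<in>sec (tot T) (src C f). q (src C f) x = res Q f W"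
      then obtain x where x: "x \<in> sec (tot T) (src C f)" "res Q f W = q (src C f) x" by auto
      have "ract QT (src C f) (res Q f W) (gres (X1 G) f g) = ract QT (src C f) (res Q f W) (gres (X1 G) f h)"
        using res_ract_QT[OF U W gh(1) f] res_ract_QT[OF U W gh(2) f] e by simp
      then have "orb (src C f) (ract T (src C f) x (gres (X1 G) f g)) (ract T (src C f) x (gres (X1 G) f h))"
        using x f gh by (simp add: ract_q gresG_in q_eq_iff T_in)
      then show "res (ush (X1 G)) f g = res (ush (X1 G)) f h"
        using ffree[OF src_Ob[OF f] x(1)] gresG_in[OF f] gh by (simp add: ush_def)
    qed
  qed (use gh in \<open>simp_all add: ush_def\<close>)
  have pr: "proj QT U (ract QT U W g) = proj QT U W"
    if U: "U \<in> Ob C" and W: "W \<in> sec Q U" and g: "g \<in> carrier (grp (X1 G) U)" for U W g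
  proof (rule sheaf_eqI[OF shB U hom_in[OF proj_hom U ract_QT_in[OF U W g]] hom_in[OF proj_hom U W]], rule lc_mono[OF Q_lift[OF U W] U])
    fix f assume f: "f \<in> arr_to C U" and "\<exists>x\<in>sec (tot T) (src C f). q (src C f) x = res Q f W"
    then obtain x where x: "x \<in> sec (tot T) (src C f)" "res Q f W = q (src C f) x" by auto
    show "res B f (proj QT U (ract QT U W g)) = res B f (proj QT U W)"
      using f x W U g by (simp add: hom_res[OF proj_hom, symmetric] ract_QT_in res_ract_QT ract_q gresG_in proj_q T_in ra_prj)
  qed
  have st: "str QT U (ract QT U W g) = str QT U W \<otimes>\<^bsub>grp (X0 G) U\<^esub> bd G U g"
    if U: "U \<in> Ob C" and W: "W \<in> sec Q U" and g: "g \<in> carrier (grp (X1 G) U)" for U W g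
  proof -
    have bd: "bd G V g \<in> carrier (grp (X0 G) V)" if "V \<in> Ob C" "g \<in> carrier (grp (X1 G) V)" for V g
      using cG that by (auto simp: crossed_module_def hom_def)
    have bdr: "gres (X0 G) f (bd G U g) = bd G (src C f) (gres (X1 G) f g)" if "f \<in> arr_to C U" for f
      using cG that g hom_res[of "ush (X1 G)" "ush (X0 G)" "bd G" f U g] by (simp add: crossed_module_def ush_def)
    have G0: "group (grp (X0 G) V)" if "V \<in> Ob C" for V using cG that by (simp add: crossed_module_def group_sheaf_def)
    have G0r: "gres (X0 G) f \<in> hom (grp (X0 G) U) (grp (X0 G) (src C f))" if "f \<in> arr_to C U" for f
      using cG that by (auto simp: crossed_module_def group_sheaf_def arr_to_def)
    have stc: "str QT V W \<in> carrier (grp (X0 G) V)" if "V \<in> Ob C" "W \<in> sec Q V" for V W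
      using hom_in[OF str_hom that] by (simp add: ush_def)
    interpret g0: group "grp (X0 G) U" using G0[OF U] .
    show ?thesis
    proof (rule sheaf_eqI[OF shG0 U hom_in[OF str_hom U ract_QT_in[OF U W g]]], goal_cases)
      case 1 show ?case using stc[OF U W] bd[OF U g] by (simp add: ush_def)
    next
      case 2 show ?case
      proof (rule lc_mono[OF Q_lift[OF U W] U])
        fix f assume f: "f \<in> arr_to C U" and "\<exists>x\<in>sec (tot T) (src C f). q (src C f) x = res Q f W"
        then obtain x where x: "x \<in> sec (tot T) (src C f)" "res Q f W = q (src C f) x" by auto
        have 1: "res (ush (X0 G)) f (str QT U (ract QT U W g)) = str T (src C f) x \<otimes>\<^bsub>grp (X0 G) (src C f)\<^esub> bd G (src C f) (gres (X1 G) f g)"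
          using f x W U g by (simp add: hom_res[OF str_hom, symmetric] ract_QT_in res_ract_QT ract_q gresG_in str_q T_in ra_str)
        have "res (ush (X0 G)) f (str QT U W) = str T (src C f) x"
          using f x W by (simp add: hom_res[OF str_hom, symmetric] str_q)
        then have 2: "gres (X0 G) f (str QT U W) = str T (src C f) x" by (simp add: ush_def)
        show "res (ush (X0 G)) f (str QT U (ract QT U W g)) = res (ush (X0 G)) f (str QT U W \<otimes>\<^bsub>grp (X0 G) U\<^esub> bd G U g)"
          unfolding 1 using hom_mult[OF G0r[OF f] stc[OF U W] bd[OF U g]] 2 bdr[OF f] by (simp add: ush_def)
      qed
    qed
  qed
  have sj: "locally_surj C Q B (proj QT)"
  proof (rule locally_surjI[OF Q_presheaf pB proj_hom])
    fix U y assume U: "U \<in> Ob C" and y: "y \<in> sec B U"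
    show "lc U (\<lambda>f. \<exists>W\<in>sec Q (src C f). proj QT (src C f) W = res B f y)"
    proof (rule lc_mono[OF locally_surjD[OF surj U y] U])
      fix f assume f: "f \<in> arr_to C U" and "\<exists>x\<in>sec (tot T) (src C f). \<pi> (src C f) (proj T (src C f) x) = res B f y"
      then obtain x where "x \<in> sec (tot T) (src C f)" "\<pi> (src C f) (proj T (src C f) x) = res B f y" by auto
      then show "\<exists>W\<in>sec Q (src C f). proj QT (src C f) W = res B f y"
        using f by (intro bexI[of _ "q (src C f) x"]) (simp_all add: proj_q q_in)
    qed
  qed
  have tr: "\<exists>!g. g \<in> carrier (grp (X1 G) U) \<and> V = ract QT U W g"
    if U: "U \<in> Ob C" and W: "W \<in> sec Q U" and V: "V \<in> sec Q U" and e: "proj QT U W = proj QT U V" for U V W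
  proof -
    define \<Phi> where "\<Phi> f g \<longleftrightarrow> g \<in> carrier (grp (X1 G) (src C f)) \<and> res Q f V = ract QT (src C f) (res Q f W) g" for f g
    have l\<Phi>: "lc U (\<lambda>f. \<exists>g. \<Phi> f g)"
    proof (rule lc_bind[OF U Q_lift[OF U W]])
      fix f assume f: "f \<in> arr_to C U" and "\<exists>x\<in>sec (tot T) (src C f). q (src C f) x = res Q f W"
      then obtain x where x: "x \<in> sec (tot T) (src C f)" "q (src C f) x = res Q f W" by auto
      show "lc (src C f) (\<lambda>k. \<exists>g. \<Phi> (cmp C f k) g)"
      proof (rule lc_mono[OF lc_pull[OF f Q_lift[OF U V]] src_Ob[OF f]])
        fix k assume k: "k \<in> arr_to C (src C f)"
          and "\<exists>x\<in>sec (tot T) (src C (cmp C f k)). q (src C (cmp C f k)) x = res Q (cmp C f k) V"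
        then obtain y where y: "y \<in> sec (tot T) (src C k)" "q (src C k) y = res Q (cmp C f k) V" using f by auto
        define x' where "x' = res (tot T) k x"
        have x': "x' \<in> sec (tot T) (src C k)" "q (src C k) x' = res Q (cmp C f k) W"
          unfolding x'_def using x f k W by (auto simp: res_in[OF pX] q_res res_cmp[OF Q_presheaf])
        have fk: "cmp C f k \<in> arr_to C U" using f k by simp
        have "proj QT (src C k) (q (src C k) x') = proj QT (src C k) (q (src C k) y)"
          using hom_res[OF proj_hom fk W] hom_res[OF proj_hom fk V] e x' y f k by simp
        then have "\<pi> (src C k) (proj T (src C k) x') = \<pi> (src C k) (proj T (src C k) y)"
          using proj_q[OF src_Ob[OF k] x'(1)] proj_q[OF src_Ob[OF k] y(1)] by simp
        then obtain g where g: "g \<in> carrier (grp (X1 G) (src C k))" "orb (src C k) (ract T (src C k) x' g) y"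
          using trans[OF src_Ob[OF k] x'(1) y(1)] by auto
        have "q (src C k) (ract T (src C k) x' g) = q (src C k) y"
          using q_eq_iff[OF src_Ob[OF k] T_in[OF src_Ob[OF k] x'(1) g(1)] y(1)] g by blast
        then have "ract QT (src C k) (q (src C k) x') g = q (src C k) y"
          using ract_q[OF src_Ob[OF k] x'(1) g(1)] by simp
        then have "\<Phi> (cmp C f k) g" unfolding \<Phi>_def using x' y g f k by simp
        then show "\<exists>g. \<Phi> (cmp C f k) g" by blast
      qed
    qed
    have "\<exists>!g. g \<in> sec (ush (X1 G)) U \<and> (\<forall>f\<in>arr_to C U. \<forall>h. \<Phi> f h \<longrightarrow> res (ush (X1 G)) f g = h)"
    proof (rule glue[OF shG1 U])
      show "h \<in> sec (ush (X1 G)) (src C f)" if "\<Phi> f h" for f h using that by (simp add: \<Phi>_def ush_def)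
      show "g = h" if "f \<in> arr_to C U" "\<Phi> f g" "\<Phi> f h" for f g h
        by (rule Qfree[of "src C f" "res Q f W"]) (use that U W in \<open>simp_all add: \<Phi>_def Q_res_in\<close>)
      show "\<Phi> (cmp C f k) (res (ush (X1 G)) k h)" if "f \<in> arr_to C U" "k \<in> arr_to C (src C f)" "\<Phi> f h" for f k h
        using that U W V unfolding \<Phi>_def
        by (simp add: ush_def gresG_in res_cmp[OF Q_presheaf] res_ract_QT Q_res_in)
    qed (rule l\<Phi>)
    then obtain g where g: "g \<in> carrier (grp (X1 G) U)" "\<And>f h. f \<in> arr_to C U \<Longrightarrow> \<Phi> f h \<Longrightarrow> gres (X1 G) f g = h"
      unfolding ush_def by auto
    have "V = ract QT U W g"
    proof (rule Q_sep[OF U V ract_QT_in[OF U W g(1)]], rule lc_mono[OF l\<Phi> U])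
      fix f assume f: "f \<in> arr_to C U" and "\<exists>h. \<Phi> f h"
      then obtain h where h: "\<Phi> f h" by auto
      then have "gres (X1 G) f g = h" using g(2) f by blast
      then show "res Q f V = res Q f (ract QT U W g)" using h res_ract_QT[OF U W g(1) f] by (simp add: \<Phi>_def)
    qed
    then show ?thesis using g(1) Qfree[OF U W] by metis
  qed
  show ?thesis
    unfolding gtorsor_def torsor_def tot_QT
    using shB Q_sheaf proj_hom sj QT_ract pr tr str_hom st by blast
qed

end

section \<open>Torsors and multiextensions on points\<close>

text \<open>The crossed module seen by points over a single stage \<open>U\<close>, so that
  calculations need no reference to the site.\<close>

locale xmod_stage =
  fixes G :: "('o, 'm, 'g, 'y) xmod_scheme" and U :: 'o
  assumes grp1: "group (grp (X1 G) U)" and grp0: "group (grp (X0 G) U)"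
    and bd_hom: "bd G U \<in> hom (grp (X1 G) U) (grp (X0 G) U)"
    and act_in: "g \<in> carrier (grp (X1 G) U) \<Longrightarrow> x \<in> carrier (grp (X0 G) U) \<Longrightarrow> xact G U g x \<in> carrier (grp (X1 G) U)"
    and act_one: "g \<in> carrier (grp (X1 G) U) \<Longrightarrow> xact G U g \<one>\<^bsub>grp (X0 G) U\<^esub> = g"
    and act_act: "g \<in> carrier (grp (X1 G) U) \<Longrightarrow> x \<in> carrier (grp (X0 G) U) \<Longrightarrow> y \<in> carrier (grp (X0 G) U) \<Longrightarrow>
      xact G U g (x \<otimes>\<^bsub>grp (X0 G) U\<^esub> y) = xact G U (xact G U g x) y"
    and act_hom: "x \<in> carrier (grp (X0 G) U) \<Longrightarrow> (\<lambda>g. xact G U g x) \<in> hom (grp (X1 G) U) (grp (X1 G) U)"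
    and bd_act: "g \<in> carrier (grp (X1 G) U) \<Longrightarrow> x \<in> carrier (grp (X0 G) U) \<Longrightarrow> bd G U (xact G U g x) =
         inv\<^bsub>grp (X0 G) U\<^esub> x \<otimes>\<^bsub>grp (X0 G) U\<^esub> bd G U g \<otimes>\<^bsub>grp (X0 G) U\<^esub> x"
    and peiffer: "g \<in> carrier (grp (X1 G) U) \<Longrightarrow> h \<in> carrier (grp (X1 G) U) \<Longrightarrow> xact G U g (bd G U h) =
         inv\<^bsub>grp (X1 G) U\<^esub> h \<otimes>\<^bsub>grp (X1 G) U\<^esub> g \<otimes>\<^bsub>grp (X1 G) U\<^esub> h"
begin

sublocale G1: group "grp (X1 G) U" by (rule grp1)
sublocale G0: group "grp (X0 G) U" by (rule grp0)

lemma bd_in: "g \<in> carrier (grp (X1 G) U) \<Longrightarrow> bd G U g \<in> carrier (grp (X0 G) U)"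
  using bd_hom by (auto simp: hom_def)

lemma bd_one: "bd G U \<one>\<^bsub>grp (X1 G) U\<^esub> = \<one>\<^bsub>grp (X0 G) U\<^esub>"
  using hom_one[OF bd_hom] grp1 grp0 by simp

lemma act_mult: "g \<in> carrier (grp (X1 G) U) \<Longrightarrow> h \<in> carrier (grp (X1 G) U) \<Longrightarrow> x \<in> carrier (grp (X0 G) U) \<Longrightarrow>
    xact G U (g \<otimes>\<^bsub>grp (X1 G) U\<^esub> h) x = xact G U g x \<otimes>\<^bsub>grp (X1 G) U\<^esub> xact G U h x"
  using act_hom by (auto simp: hom_def)

lemma act_1: "x \<in> carrier (grp (X0 G) U) \<Longrightarrow> xact G U \<one>\<^bsub>grp (X1 G) U\<^esub> x = \<one>\<^bsub>grp (X1 G) U\<^esub>"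
  using hom_one[OF act_hom] grp1 by simp

lemma act_inv: "g \<in> carrier (grp (X1 G) U) \<Longrightarrow> x \<in> carrier (grp (X0 G) U) \<Longrightarrow>
    xact G U (inv\<^bsub>grp (X1 G) U\<^esub> g) x = inv\<^bsub>grp (X1 G) U\<^esub> (xact G U g x)"
  by (rule group_hom.hom_inv[of "grp (X1 G) U" "grp (X1 G) U" "\<lambda>g. xact G U g x"])
    (simp_all add: group_hom_def group_hom_axioms_def grp1 act_hom)

lemma act_cancel:
  assumes "g \<in> carrier (grp (X1 G) U)" "h \<in> carrier (grp (X1 G) U)" "x \<in> carrier (grp (X0 G) U)"
    and e: "xact G U g x = xact G U h x"
  shows "g = h"
proof -
  have "xact G U (xact G U k x) (inv\<^bsub>grp (X0 G) U\<^esub> x) = k" if "k \<in> carrier (grp (X1 G) U)" for k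
    using that assms by (simp add: act_act[symmetric] act_one)
  then show ?thesis using e assms by metis
qed

end

lemma xmod_stageI:
  assumes "crossed_module C G" "U \<in> Ob C"
  shows "xmod_stage G U"
  using assms unfolding crossed_module_def right_action_def group_sheaf_def
  by (intro xmod_stage.intro) (simp_all add: ush_def)

text \<open>The content of a \<open>(G\<^sub>1, G\<^sub>0)\<close>-torsor at one stage. Local
  surjectivity onto the base has no counterpart here and is used only where sections are
  glued.\<close>

locale tors_stage = xmod_stage G U for G :: "('o, 'm, 'g, 'y) xmod_scheme" and U +
  fixes T :: "('o, 'm, 'b, 'g, 'p, 'z) tors_scheme" and B :: "'b set"
  assumes proj_in: "u \<in> sec (tot T) U \<Longrightarrow> proj T U u \<in> B"
    and ra_in: "u \<in> sec (tot T) U \<Longrightarrow> g \<in> carrier (grp (X1 G) U) \<Longrightarrow> ract T U u g \<in> sec (tot T) U"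
    and ra_one: "u \<in> sec (tot T) U \<Longrightarrow> ract T U u \<one>\<^bsub>grp (X1 G) U\<^esub> = u"
    and ra_mult: "u \<in> sec (tot T) U \<Longrightarrow> g \<in> carrier (grp (X1 G) U) \<Longrightarrow> h \<in> carrier (grp (X1 G) U) \<Longrightarrow>
      ract T U u (g \<otimes>\<^bsub>grp (X1 G) U\<^esub> h) = ract T U (ract T U u g) h"
    and ra_proj: "u \<in> sec (tot T) U \<Longrightarrow> g \<in> carrier (grp (X1 G) U) \<Longrightarrow> proj T U (ract T U u g) = proj T U u"
    and ra_ex1: "u \<in> sec (tot T) U \<Longrightarrow> v \<in> sec (tot T) U \<Longrightarrow> proj T U u = proj T U v \<Longrightarrow>
      \<exists>!g. g \<in> carrier (grp (X1 G) U) \<and> v = ract T U u g"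
    and str_in: "u \<in> sec (tot T) U \<Longrightarrow> str T U u \<in> carrier (grp (X0 G) U)"
    and str_ra: "u \<in> sec (tot T) U \<Longrightarrow> g \<in> carrier (grp (X1 G) U) \<Longrightarrow>
      str T U (ract T U u g) = str T U u \<otimes>\<^bsub>grp (X0 G) U\<^esub> bd G U g"
begin

lemma ra_ex:
  assumes "u \<in> sec (tot T) U" "v \<in> sec (tot T) U" "proj T U u = proj T U v"
  obtains g where "g \<in> carrier (grp (X1 G) U)" "v = ract T U u g"
  using ra_ex1[OF assms] by auto

lemma ra_free:
  assumes "u \<in> sec (tot T) U" "g \<in> carrier (grp (X1 G) U)" "h \<in> carrier (grp (X1 G) U)" "ract T U u g = ract T U u h"
  shows "g = h"
  using ra_ex1[of u "ract T U u g"] assms ra_in ra_proj by metis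

lemma ra_free_one: "u \<in> sec (tot T) U \<Longrightarrow> g \<in> carrier (grp (X1 G) U) \<Longrightarrow> ract T U u g = u \<Longrightarrow> g = \<one>\<^bsub>grp (X1 G) U\<^esub>"
  using ra_free[of u g "\<one>\<^bsub>grp (X1 G) U\<^esub>"] by (simp add: ra_one)

lemma lact_in: "u \<in> sec (tot T) U \<Longrightarrow> g \<in> carrier (grp (X1 G) U) \<Longrightarrow> lact G T U g u \<in> sec (tot T) U"
  unfolding lact_def by (simp add: ra_in act_in str_in)

lemma lact_proj: "u \<in> sec (tot T) U \<Longrightarrow> g \<in> carrier (grp (X1 G) U) \<Longrightarrow> proj T U (lact G T U g u) = proj T U u"
  unfolding lact_def by (simp add: ra_proj act_in str_in)

lemma str_lact: "u \<in> sec (tot T) U \<Longrightarrow> g \<in> carrier (grp (X1 G) U) \<Longrightarrow>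
    str T U (lact G T U g u) = bd G U g \<otimes>\<^bsub>grp (X0 G) U\<^esub> str T U u"
  unfolding lact_def by (simp add: str_ra act_in str_in bd_act bd_in G0.m_assoc[symmetric])

lemma lact_one: "u \<in> sec (tot T) U \<Longrightarrow> lact G T U \<one>\<^bsub>grp (X1 G) U\<^esub> u = u"
  unfolding lact_def by (simp add: act_1 str_in ra_one)

text \<open>By the Peiffer identity the boundary of \<open>h\<close>, which enters the structural
  value of \<open>ract T U u h\<close>, acts by conjugation with \<open>h\<close>; this conjugation
  is just what commuting the two actions requires.\<close>

lemma lact_ract: 
  assumes u: "u \<in> sec (tot T) U" and g: "g \<in> carrier (grp (X1 G) U)" and h: "h \<in> carrier (grp (X1 G) U)"
  shows "lact G T U g (ract T U u h) = ract T U (lact G T U g u) h"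
proof -
  have s: "str T U u \<in> carrier (grp (X0 G) U)" using str_in[OF u] .
  have a: "xact G U g (str T U u) \<in> carrier (grp (X1 G) U)" using act_in[OF g s] .
  have "lact G T U g (ract T U u h) = ract T U (ract T U u h) (xact G U (xact G U g (str T U u)) (bd G U h))"
    using u g h s by (simp add: lact_def str_ra act_act bd_in)
  also have "\<dots> = ract T U (ract T U u h) (inv\<^bsub>grp (X1 G) U\<^esub> h \<otimes>\<^bsub>grp (X1 G) U\<^esub> (xact G U g (str T U u) \<otimes>\<^bsub>grp (X1 G) U\<^esub> h))"
    using a h by (simp add: peiffer G1.m_assoc)
  also have "\<dots> = ract T U u (h \<otimes>\<^bsub>grp (X1 G) U\<^esub> (inv\<^bsub>grp (X1 G) U\<^esub> h \<otimes>\<^bsub>grp (X1 G) U\<^esub> (xact G U g (str T U u) \<otimes>\<^bsub>grp (X1 G) U\<^esub> h)))"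
    using u h a by (intro ra_mult[symmetric]) simp_all
  also have "h \<otimes>\<^bsub>grp (X1 G) U\<^esub> (inv\<^bsub>grp (X1 G) U\<^esub> h \<otimes>\<^bsub>grp (X1 G) U\<^esub> (xact G U g (str T U u) \<otimes>\<^bsub>grp (X1 G) U\<^esub> h))
      = xact G U g (str T U u) \<otimes>\<^bsub>grp (X1 G) U\<^esub> h"
    using a h by (simp add: G1.m_assoc[symmetric])
  also have "ract T U u \<dots> = ract T U (lact G T U g u) h" using u a h by (simp add: lact_def ra_mult)
  finally show ?thesis .
qed

lemma lact_mult:
  assumes u: "u \<in> sec (tot T) U" and g: "g \<in> carrier (grp (X1 G) U)" and h: "h \<in> carrier (grp (X1 G) U)"
  shows "lact G T U (g \<otimes>\<^bsub>grp (X1 G) U\<^esub> h) u = lact G T U g (lact G T U h u)"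
proof -
  have a: "xact G U k (str T U u) \<in> carrier (grp (X1 G) U)" if "k \<in> carrier (grp (X1 G) U)" for k
    using act_in[OF that str_in[OF u]] .
  have "lact G T U g (lact G T U h u) = ract T U (lact G T U g u) (xact G U h (str T U u))"
    using lact_ract[OF u g a[OF h]] by (simp add: lact_def)
  then show ?thesis using u g h a by (simp add: lact_def act_mult ra_mult str_in)
qed

end

lemma tors_stageI:
  assumes "crossed_module C G" "gtorsor C G Bs T" "U \<in> Ob C"
  shows "tors_stage G U T (sec Bs U)"
proof -
  interpret xmod_stage G U by (rule xmod_stageI[OF assms(1,3)])
  show ?thesis
    by unfold_locales
      (use assms in \<open>simp_all add: gtorsor_def torsor_def right_action_def sheaf_hom_def ush_def\<close>)
qed

lemma pb_simps:
  "sec (tot (pb_tors B \<phi> T)) U = {(b, u). b \<in> sec B U \<and> u \<in> sec (tot T) U \<and> \<phi> U b = proj T U u}"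
  "res (tot (pb_tors B \<phi> T)) f (b, u) = (res B f b, res (tot T) f u)"
  "proj (pb_tors B \<phi> T) U (b, u) = b"
  "ract (pb_tors B \<phi> T) U (b, u) g = (b, ract T U u g)"
  "str (pb_tors B \<phi> T) U (b, u) = str T U u"
  by (simp_all add: pb_tors_def)

section \<open>Compatibility of the structure with restriction\<close>

context site_loc
begin

lemma gtorsor_ract_res:
  "gtorsor C G Bs T \<Longrightarrow> f \<in> arr_to C U \<Longrightarrow> u \<in> sec (tot T) U \<Longrightarrow> g \<in> carrier (grp (X1 G) U) \<Longrightarrow>
    res (tot T) f (ract T U u g) = ract T (src C f) (res (tot T) f u) (gres (X1 G) f g)"
  by (auto simp: gtorsor_def torsor_def right_action_def arr_to_def)

lemma gtorsorD:
  assumes "gtorsor C G Bs T"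
  shows "sheaf C (tot T)" "sheaf C Bs" "sheaf_hom C (tot T) Bs (proj T)" "locally_surj C (tot T) Bs (proj T)"
    "sheaf_hom C (tot T) (ush (X0 G)) (str T)" "right_action C (X1 G) (tot T) (ract T)"
  using assms by (auto simp: gtorsor_def torsor_def)

lemma xmod_sheaves:
  assumes "crossed_module C G"
  shows "group_sheaf C (X1 G)" "group_sheaf C (X0 G)"
  using assms by (auto simp: crossed_module_def)

lemma gsh_res_in: "group_sheaf C A \<Longrightarrow> f \<in> arr_to C U \<Longrightarrow> g \<in> carrier (grp A U) \<Longrightarrow> gres A f g \<in> carrier (grp A (src C f))"
  by (auto simp: group_sheaf_def arr_to_def hom_def)

lemma gsh_res_mult: "group_sheaf C A \<Longrightarrow> f \<in> arr_to C U \<Longrightarrow> g \<in> carrier (grp A U) \<Longrightarrow> h \<in> carrier (grp A U) \<Longrightarrow>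
    gres A f (g \<otimes>\<^bsub>grp A U\<^esub> h) = gres A f g \<otimes>\<^bsub>grp A (src C f)\<^esub> gres A f h"
  by (auto simp: group_sheaf_def arr_to_def hom_def)

lemma gsh_group: "group_sheaf C A \<Longrightarrow> U \<in> Ob C \<Longrightarrow> group (grp A U)"
  by (simp add: group_sheaf_def)

lemma gsh_res_group_hom:
  assumes "group_sheaf C A" "f \<in> arr_to C U" "U \<in> Ob C"
  shows "group_hom (grp A U) (grp A (src C f)) (gres A f)"
  using assms gsh_res_in gsh_res_mult
  by (auto simp: group_hom_def group_hom_axioms_def gsh_group intro!: homI)

lemma gsh_res_one: "group_sheaf C A \<Longrightarrow> f \<in> arr_to C U \<Longrightarrow> U \<in> Ob C \<Longrightarrow> gres A f \<one>\<^bsub>grp A U\<^esub> = \<one>\<^bsub>grp A (src C f)\<^esub>"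
  using group_hom.hom_one[OF gsh_res_group_hom] by metis

lemma gsh_res_inv: "group_sheaf C A \<Longrightarrow> f \<in> arr_to C U \<Longrightarrow> U \<in> Ob C \<Longrightarrow> g \<in> carrier (grp A U) \<Longrightarrow>
    gres A f (inv\<^bsub>grp A U\<^esub> g) = inv\<^bsub>grp A (src C f)\<^esub> (gres A f g)"
  using group_hom.hom_inv[OF gsh_res_group_hom] by metis

lemma xact_res: "crossed_module C G \<Longrightarrow> f \<in> arr_to C U \<Longrightarrow> g \<in> carrier (grp (X1 G) U) \<Longrightarrow> x \<in> carrier (grp (X0 G) U) \<Longrightarrow>
    gres (X1 G) f (xact G U g x) = xact G (src C f) (gres (X1 G) f g) (gres (X0 G) f x)"
  by (auto simp: crossed_module_def right_action_def ush_def arr_to_def)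

lemma bd_res: "crossed_module C G \<Longrightarrow> f \<in> arr_to C U \<Longrightarrow> g \<in> carrier (grp (X1 G) U) \<Longrightarrow>
    gres (X0 G) f (bd G U g) = bd G (src C f) (gres (X1 G) f g)"
  by (auto simp: crossed_module_def sheaf_hom_def ush_def arr_to_def)

lemma lact_res:
  assumes "crossed_module C G" "gtorsor C G Bs T" "U \<in> Ob C" "f \<in> arr_to C U" "u \<in> sec (tot T) U" "g \<in> carrier (grp (X1 G) U)"
  shows "res (tot T) f (lact G T U g u) = lact G T (src C f) (gres (X1 G) f g) (res (tot T) f u)"
proof -
  interpret tors_stage G U T "sec Bs U" by (rule tors_stageI) fact+
  show ?thesis
    using assms hom_res[OF gtorsorD(5)[OF assms(2)], of f U u]
    by (simp add: lact_def gtorsor_ract_res act_in str_in xact_res ush_def)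
qed

lemma pb_sheaf:
  assumes "sheaf C B'" "sheaf_hom C B' B \<phi>" "gtorsor C G B T"
  shows "sheaf C (tot (pb_tors B' \<phi> T))"
  using fibre_sheaf[OF assms(1) gtorsorD(1)[OF assms(3)] gtorsorD(2)[OF assms(3)] assms(2) gtorsorD(3)[OF assms(3)]]
  by (simp add: pb_tors_def)

end

text \<open>In pointwise form \<open>\<gamma>\<^sup>i\<close> is a balanced \<open>G\<^sub>1\<close>-equivariant map on composable pairs.\<close>

definition law_stage ::
    "'i set \<Rightarrow> ('i \<Rightarrow> ('o, 'm, 'h) gsh) \<Rightarrow> ('o, 'm, 'g, 'y) xmod_scheme \<Rightarrow>
     ('o, 'm, 'i, 'h, 'g, 'p, 'z) mext_scheme \<Rightarrow> 'i \<Rightarrow> 'o \<Rightarrow> bool" where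
  "law_stage I H G E i U \<longleftrightarrow>
    (\<forall>u v. composable I E i U u v \<longrightarrow>
       plaw E i U u v \<in> sec (tot E) U \<and>
       proj E U (plaw E i U u v) = axis_mult H i U (proj E U u, proj E U v) \<and>
       str E U (plaw E i U u v) = str E U u \<otimes>\<^bsub>grp (X0 G) U\<^esub> str E U v \<and>
       (\<forall>g\<in>carrier (grp (X1 G) U).
          plaw E i U u (ract E U v g) = ract E U (plaw E i U u v) g \<and>
          plaw E i U (ract E U u g) v = plaw E i U u (lact G E U g v))) \<and>
    (\<forall>u v w. composable I E i U u v \<and> composable I E i U v w \<longrightarrow>
       plaw E i U (plaw E i U u v) w = plaw E i U u (plaw E i U v w))"

text \<open>Naturality of the law, the part of being a map of sheaves that is not visible at a
  single stage.\<close>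

definition law_res ::
    "('o, 'm) site_data \<Rightarrow> 'i set \<Rightarrow> ('o, 'm, 'i, 'h, 'g, 'p, 'z) mext_scheme \<Rightarrow> 'i \<Rightarrow> bool" where
  "law_res C I E i \<longleftrightarrow> (\<forall>U\<in>Ob C. \<forall>f\<in>arr_to C U. \<forall>u v. composable I E i U u v \<longrightarrow>
     res (tot E) f (plaw E i U u v) = plaw E i (src C f) (res (tot E) f u) (res (tot E) f v))"

context free_action
begin

text \<open>The quotient map is an epimorphism of sheaves.\<close>

lemma Q_hom_ext:
  assumes Y: "sheaf C Y" and \<psi>: "sheaf_hom C Q Y \<psi>" and \<psi>': "sheaf_hom C Q Y \<psi>'"
    and e: "\<And>U x. U \<in> Ob C \<Longrightarrow> x \<in> sec X U \<Longrightarrow> \<psi> U (q U x) = \<psi>' U (q U x)"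
    and U: "U \<in> Ob C" and W: "W \<in> sec Q U"
  shows "\<psi> U W = \<psi>' U W"
proof (rule sheaf_eqI[OF Y U hom_in[OF \<psi> U W] hom_in[OF \<psi>' U W]], rule lc_mono[OF Q_lift[OF U W] U])
  fix f assume f: "f \<in> arr_to C U" and "\<exists>x\<in>sec X (src C f). q (src C f) x = res Q f W"
  then obtain x where x: "x \<in> sec X (src C f)" "q (src C f) x = res Q f W" by auto
  show "res Y f (\<psi> U W) = res Y f (\<psi>' U W)"
    using e[OF src_Ob[OF f] x(1)] x(2) by (simp add: hom_res[OF \<psi> f W, symmetric] hom_res[OF \<psi>' f W, symmetric])
qed

end

section \<open>Contracted products along one axis and the composition laws they carry\<close>

locale mext_axis = site_loc C for C :: "('o, 'm) site_data" +
  fixes I :: "'i set" and H :: "'i \<Rightarrow> ('o, 'm, 'h) gsh" and G :: "('o, 'm, 'g, 'y) xmod_scheme"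
    and E :: "('o, 'm, 'i, 'h, 'g, 'p, 'z) mext_scheme" and i :: 'i
  assumes cG: "crossed_module C G" and gH: "\<And>l. l \<in> I \<Longrightarrow> group_sheaf C (H l)"
    and gE: "gtorsor C G (mbase I H) E" and iI: "i \<in> I"
begin

abbreviation "B \<equiv> axis_pairs I H i"
abbreviation "E1 \<equiv> pb_tors B (\<lambda>U. fst) E"
abbreviation "E2 \<equiv> pb_tors B (\<lambda>U. snd) E"
abbreviation "E12 \<equiv> pb_tors B (axis_mult H i) E"
abbreviation "T \<equiv> pre_wedge G E1 E2"
abbreviation "w \<equiv> wedge_act G E1 E2"

text \<open>The point of \<open>pre_wedge\<close> given by a composable pair. The pair of
  projections occurs twice because each factor is a point of a pullback and carries its base point
  along.\<close>

definition pt where "pt U u v = (((proj E U u, proj E U v), u), ((proj E U u, proj E U v), v))"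

lemma stage: "U \<in> Ob C \<Longrightarrow> tors_stage G U E (sec (mbase I H) U)"
  by (rule tors_stageI[OF cG gE])

lemma base_mem: "h \<in> sec (mbase I H) U \<longleftrightarrow> h \<in> (\<Pi>\<^sub>E l\<in>I. carrier (grp (H l) U))"
  by (simp add: ush_def prod_gsh_def)

lemma base_res: "res (mbase I H) f h = (\<lambda>l\<in>I. gres (H l) f (h l))"
  by (simp add: ush_def prod_gsh_def)

lemma B_mem: "b \<in> sec B U \<longleftrightarrow> fst b \<in> sec (mbase I H) U \<and> snd b \<in> sec (mbase I H) U \<and> (\<forall>l\<in>I - {i}. fst b l = snd b l)"
  by (auto simp: axis_pairs_def)

lemma res_B: "res B f (h, h') = (res (mbase I H) f h, res (mbase I H) f h')"
  by (simp add: axis_pairs_def)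

lemma proj_in: "U \<in> Ob C \<Longrightarrow> u \<in> sec (tot E) U \<Longrightarrow> proj E U u \<in> sec (mbase I H) U"
  by (rule hom_in[OF gtorsorD(3)[OF gE]])

lemma proj_res: "f \<in> arr_to C U \<Longrightarrow> u \<in> sec (tot E) U \<Longrightarrow> proj E (src C f) (res (tot E) f u) = res (mbase I H) f (proj E U u)"
  by (rule hom_res[OF gtorsorD(3)[OF gE]])

lemma composable_iff: "U \<in> Ob C \<Longrightarrow> composable I E i U u v \<longleftrightarrow> u \<in> sec (tot E) U \<and> v \<in> sec (tot E) U \<and> (proj E U u, proj E U v) \<in> sec B U"
  by (auto simp: composable_def B_mem proj_in)

lemma T_mem: "U \<in> Ob C \<Longrightarrow> x \<in> sec (tot T) U \<longleftrightarrow> (\<exists>u v. composable I E i U u v \<and> x = pt U u v)"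
  unfolding composable_iff by (auto simp: pre_wedge_def pb_tors_def pt_def)

lemma composable_res: "U \<in> Ob C \<Longrightarrow> f \<in> arr_to C U \<Longrightarrow> composable I E i U u v \<Longrightarrow> composable I E i (src C f) (res (tot E) f u) (res (tot E) f v)"
  by (auto simp: composable_def proj_res base_res res_in[OF sheaf_presheaf[OF gtorsorD(1)[OF gE]]])

lemma res_pt: "U \<in> Ob C \<Longrightarrow> f \<in> arr_to C U \<Longrightarrow> composable I E i U u v \<Longrightarrow> res (tot T) f (pt U u v) = pt (src C f) (res (tot E) f u) (res (tot E) f v)"
  by (auto simp: pre_wedge_def pb_tors_def pt_def axis_pairs_def composable_def proj_res)

lemma w_pt: 
  assumes U: "U \<in> Ob C" and c: "composable I E i U u v" and g: "g \<in> carrier (grp (X1 G) U)"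
  shows "w U (pt U u v) g = pt U (ract E U u g) (lact G E U (inv\<^bsub>grp (X1 G) U\<^esub> g) v)"
proof -
  interpret tors_stage G U E "sec (mbase I H) U" by (rule stage[OF U])
  have "proj E U (lact G E U (inv\<^bsub>grp (X1 G) U\<^esub> g) v) = proj E U v" using c g by (simp add: lact_proj composable_def)
  then show ?thesis using c g
    by (simp add: wedge_act_def pt_def pb_tors_def lact_def composable_def ra_proj)
qed

lemma ract_pt:
  assumes U: "U \<in> Ob C" and c: "composable I E i U u v" and g: "g \<in> carrier (grp (X1 G) U)"
  shows "ract T U (pt U u v) g = pt U u (ract E U v g)"
proof -
  interpret tors_stage G U E "sec (mbase I H) U" by (rule stage[OF U])
  show ?thesis using c g by (simp add: pt_def pre_wedge_def pb_tors_def composable_def ra_proj)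
qed

lemma str_pt: "str T U (pt U u v) = str E U u \<otimes>\<^bsub>grp (X0 G) U\<^esub> str E U v"
  by (simp add: pt_def pre_wedge_def pb_tors_def)

lemma proj_pt: "proj T U (pt U u v) = (proj E U u, proj E U v)"
  by (simp add: pt_def pre_wedge_def pb_tors_def)

lemma pt_inj: "pt U u v = pt U u' v' \<longleftrightarrow> u = u' \<and> v = v'"
  by (auto simp: pt_def)

lemma composable_w:
  assumes U: "U \<in> Ob C" and c: "composable I E i U u v" and g: "g \<in> carrier (grp (X1 G) U)"
  shows "composable I E i U (ract E U u g) v" "composable I E i U u (ract E U v g)"
    "composable I E i U u (lact G E U g v)"
proof -
  interpret tors_stage G U E "sec (mbase I H) U" by (rule stage[OF U])
  show "composable I E i U (ract E U u g) v" "composable I E i U u (ract E U v g)"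
    "composable I E i U u (lact G E U g v)"
    using c g by (simp_all add: composable_def ra_in ra_proj lact_in lact_proj)
qed

lemma shB: "sheaf C B" by (rule axis_pairs_sheaf[OF gH])

lemma B_in:
  assumes "b \<in> sec B U" "f \<in> arr_to C U" "U \<in> Ob C"
  shows "res B f b \<in> sec B (src C f)"
  by (rule res_in[OF sheaf_presheaf[OF shB] assms(2,1)])

lemma mult_hom: "sheaf_hom C B (mbase I H) (axis_mult H i)"
proof (rule sheaf_homI)
  fix U b assume U: "U \<in> Ob C" and b: "b \<in> sec B U"
  interpret group "grp (H i) U" by (rule gsh_group[OF gH[OF iI] U])
  show "axis_mult H i U b \<in> sec (mbase I H) U"
    using b iI by (cases b) (auto simp: B_mem base_mem axis_mult_def PiE_iff extensional_def)
  fix f assume f: "f \<in> arr_to C U"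
  show "axis_mult H i (src C f) (res B f b) = res (mbase I H) f (axis_mult H i U b)"
    using b iI f gsh_res_mult[OF gH[OF iI] f]
    by (cases b) (auto simp: B_mem base_mem axis_mult_def PiE_iff fun_eq_iff axis_pairs_def base_res)
qed

lemma fst_hom: "sheaf_hom C B (mbase I H) (\<lambda>U. fst)" and snd_hom: "sheaf_hom C B (mbase I H) (\<lambda>U. snd)"
  by (rule sheaf_homI; auto simp: axis_pairs_def)+

lemma shE1: "sheaf C (tot E1)" and shE2: "sheaf C (tot E2)" and shE12: "sheaf C (tot E12)"
  by (rule pb_sheaf[OF shB fst_hom gE] pb_sheaf[OF shB snd_hom gE] pb_sheaf[OF shB mult_hom gE])+

lemma pb_proj_hom: "sheaf_hom C (tot (pb_tors B \<phi> E)) B (proj (pb_tors B \<phi> E))"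
  by (rule sheaf_homI) (auto simp: pb_tors_def)

lemma shT: "sheaf C (tot T)"
  using fibre_sheaf[OF shE1 shE2 shB pb_proj_hom pb_proj_hom] by (simp add: pre_wedge_def)

text \<open>The contracted product as a quotient by a free action. Freeness is that of
  \<open>G\<^sub>1\<close> on the first factor; the structural map is invariant because the
  boundaries of \<open>g\<close> and of its inverse meet in the middle and cancel.\<close>

sublocale quotient_torsor C "X1 G" T w G B "\<lambda>U b. b"
proof unfold_locales
  show "group_sheaf C (X1 G)" "crossed_module C G" "sheaf C (tot T)" "sheaf C B"
    using cG xmod_sheaves shT shB by auto
  have l: "lact G E (src C f) (inv\<^bsub>grp (X1 G) (src C f)\<^esub> (gres (X1 G) f g)) (res (tot E) f v) =
      res (tot E) f (lact G E U (inv\<^bsub>grp (X1 G) U\<^esub> g) v)"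
    if "U \<in> Ob C" "f \<in> arr_to C U" "v \<in> sec (tot E) U" "g \<in> carrier (grp (X1 G) U)" for U f v g
  proof -
    interpret xmod_stage G U by (rule xmod_stageI[OF cG that(1)])
    show ?thesis
      using that lact_res[OF cG gE that(1,2,3), of "inv\<^bsub>grp (X1 G) U\<^esub> g"] gsh_res_inv[OF xmod_sheaves(1)[OF cG] that(2,1,4)] by simp
  qed
  show "right_action C (X1 G) (tot T) w"
    unfolding right_action_def
  proof (intro conjI ballI)
    fix U x g assume U: "U \<in> Ob C" and x: "x \<in> sec (tot T) U" and g: "g \<in> carrier (grp (X1 G) U)"
    interpret tors_stage G U E "sec (mbase I H) U" by (rule stage[OF U])
    obtain u v where c: "composable I E i U u v" and e: "x = pt U u v" using x T_mem[OF U] by auto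
    have c': "composable I E i U (ract E U u g) (lact G E U (inv\<^bsub>grp (X1 G) U\<^esub> g) v)"
      using composable_w[OF U composable_w(1)[OF U c g]] g by simp
    show "w U x g \<in> sec (tot T) U" using T_mem[OF U] c' w_pt[OF U c g] e by auto
    have uv: "u \<in> sec (tot E) U" "v \<in> sec (tot E) U" using c by (auto simp: composable_def)
    fix h assume h: "h \<in> carrier (grp (X1 G) U)"
    show "w U x (g \<otimes>\<^bsub>grp (X1 G) U\<^esub> h) = w U (w U x g) h"
      using U c c' g h uv by (simp add: e w_pt pt_inj ra_mult lact_mult[symmetric] G1.inv_mult_group)
  next
    fix f x g assume f: "f \<in> Ar C" and x: "x \<in> sec (tot T) (tgt C f)" and g: "g \<in> carrier (grp (X1 G) (tgt C f))"
    define U where "U = tgt C f"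
    have fa: "f \<in> arr_to C U" and U: "U \<in> Ob C" using f cat unfolding U_def by (auto simp: arr_to_def category_def)
    note x = x[folded U_def] and g = g[folded U_def]
    interpret tors_stage G U E "sec (mbase I H) U" by (rule stage[OF U])
    obtain u v where c: "composable I E i U u v" and e: "x = pt U u v" using x T_mem[OF U] by auto
    have uv: "u \<in> sec (tot E) U" "v \<in> sec (tot E) U" using c by (auto simp: composable_def)
    have c': "composable I E i U (ract E U u g) (lact G E U (inv\<^bsub>grp (X1 G) U\<^esub> g) v)"
      using composable_w[OF U composable_w(1)[OF U c g]] g by simp
    have "res (tot T) f (w U x g) = w (src C f) (res (tot T) f x) (gres (X1 G) f g)"
      using w_pt[OF U c g] w_pt[OF src_Ob[OF fa] composable_res[OF U fa c] gsh_res_in[OF xmod_sheaves(1)[OF cG] fa g]]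
        res_pt[OF U fa c] res_pt[OF U fa c'] l[OF U fa uv(2) g] gtorsor_ract_res[OF gE fa uv(1) g]
      by (simp add: e)
    then show "res (tot T) f (w (tgt C f) x g) = w (src C f) (res (tot T) f x) (gres (X1 G) f g)"
      by (simp add: U_def)
  next
    fix U x assume U: "U \<in> Ob C" and x: "x \<in> sec (tot T) U"
    interpret tors_stage G U E "sec (mbase I H) U" by (rule stage[OF U])
    obtain u v where c: "composable I E i U u v" and e: "x = pt U u v" using x T_mem[OF U] by auto
    then show "w U x \<one>\<^bsub>grp (X1 G) U\<^esub> = x"
      using U by (simp add: w_pt composable_def lact_one ra_one)
  qed
  have hp: "sheaf_hom C (tot T) B (proj T)"
  proof (rule sheaf_homI)
    fix U x assume U: "U \<in> Ob C" and x: "x \<in> sec (tot T) U"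
    obtain u v where c: "composable I E i U u v" and e: "x = pt U u v" using x T_mem[OF U] by auto
    then show "proj T U x \<in> sec B U" using composable_iff[OF U] by (simp add: proj_pt)
    fix f assume f: "f \<in> arr_to C U"
    show "proj T (src C f) (res (tot T) f x) = res B f (proj T U x)"
      using c f U unfolding e by (simp add: res_pt proj_pt composable_def proj_res res_B)
  qed
  then show "sheaf_hom C (tot T) B (\<lambda>U u. proj T U u)" by simp
  show "sheaf_hom C (tot T) (ush (X0 G)) (str T)"
  proof (rule sheaf_homI)
    fix U x assume U: "U \<in> Ob C" and x: "x \<in> sec (tot T) U"
    interpret tors_stage G U E "sec (mbase I H) U" by (rule stage[OF U])
    obtain u v where c: "composable I E i U u v" and e: "x = pt U u v" using x T_mem[OF U] by auto
    have uv: "u \<in> sec (tot E) U" "v \<in> sec (tot E) U" using c by (auto simp: composable_def)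
    then show "str T U x \<in> sec (ush (X0 G)) U" unfolding e by (simp add: str_pt str_in ush_def)
    fix f assume f: "f \<in> arr_to C U"
    show "str T (src C f) (res (tot T) f x) = res (ush (X0 G)) f (str T U x)"
      using f U c uv hom_res[OF gtorsorD(5)[OF gE] f uv(1)] hom_res[OF gtorsorD(5)[OF gE] f uv(2)]
      unfolding e by (simp add: str_pt res_pt ush_def gsh_res_mult[OF xmod_sheaves(2)[OF cG] f] str_in)
  qed
  show "right_action C (X1 G) (tot T) (ract T)"
    unfolding right_action_def
  proof (intro conjI ballI)
    fix U x g assume U: "U \<in> Ob C" and x: "x \<in> sec (tot T) U" and g: "g \<in> carrier (grp (X1 G) U)"
    interpret tors_stage G U E "sec (mbase I H) U" by (rule stage[OF U])
    obtain u v where c: "composable I E i U u v" and e: "x = pt U u v" using x T_mem[OF U] by auto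
    have c': "composable I E i U u (ract E U v g)" by (rule composable_w(2)[OF U c g])
    show "ract T U x g \<in> sec (tot T) U" using T_mem[OF U] c' ract_pt[OF U c g] e by auto
    have uv: "u \<in> sec (tot E) U" "v \<in> sec (tot E) U" using c by (auto simp: composable_def)
    fix h assume h: "h \<in> carrier (grp (X1 G) U)"
    show "ract T U x (g \<otimes>\<^bsub>grp (X1 G) U\<^esub> h) = ract T U (ract T U x g) h"
      using U c c' g h uv by (simp add: e ract_pt pt_inj ra_mult)
  next
    fix f x g assume f: "f \<in> Ar C" and x: "x \<in> sec (tot T) (tgt C f)" and g: "g \<in> carrier (grp (X1 G) (tgt C f))"
    define U where "U = tgt C f"
    have fa: "f \<in> arr_to C U" and U: "U \<in> Ob C" using f cat unfolding U_def by (auto simp: arr_to_def category_def)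
    note x = x[folded U_def] and g = g[folded U_def]
    interpret tors_stage G U E "sec (mbase I H) U" by (rule stage[OF U])
    obtain u v where c: "composable I E i U u v" and e: "x = pt U u v" using x T_mem[OF U] by auto
    have uv: "u \<in> sec (tot E) U" "v \<in> sec (tot E) U" using c by (auto simp: composable_def)
    have c': "composable I E i U u (ract E U v g)" by (rule composable_w(2)[OF U c g])
    have "res (tot T) f (ract T U x g) = ract T (src C f) (res (tot T) f x) (gres (X1 G) f g)"
      using ract_pt[OF U c g] ract_pt[OF src_Ob[OF fa] composable_res[OF U fa c] gsh_res_in[OF xmod_sheaves(1)[OF cG] fa g]]
        res_pt[OF U fa c] res_pt[OF U fa c'] gtorsor_ract_res[OF gE fa uv(2) g]
      by (simp add: e)
    then show "res (tot T) f (ract T (tgt C f) x g) = ract T (src C f) (res (tot T) f x) (gres (X1 G) f g)"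
      by (simp add: U_def)
  next
    fix U x assume U: "U \<in> Ob C" and x: "x \<in> sec (tot T) U"
    interpret tors_stage G U E "sec (mbase I H) U" by (rule stage[OF U])
    obtain u v where c: "composable I E i U u v" and e: "x = pt U u v" using x T_mem[OF U] by auto
    then show "ract T U x \<one>\<^bsub>grp (X1 G) U\<^esub> = x"
      using U by (simp add: ract_pt composable_def ra_one)
  qed
next
  fix U x g assume U: "U \<in> Ob C" and x: "x \<in> sec (tot T) U" and g: "g \<in> carrier (grp (X1 G) U)"
  interpret tors_stage G U E "sec (mbase I H) U" by (rule stage[OF U])
  obtain u v where c: "composable I E i U u v" and e: "x = pt U u v" using x T_mem[OF U] by auto
  have uv: "u \<in> sec (tot E) U" "v \<in> sec (tot E) U" using c by (auto simp: composable_def)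
  show "proj T U (w U x g) = proj T U x" "proj T U (ract T U x g) = proj T U x"
    using c g U uv by (simp_all add: e w_pt ract_pt proj_pt ra_proj lact_proj)
  show "str T U (w U x g) = str T U x"
    using c g U uv group_hom.hom_inv[of "grp (X1 G) U" "grp (X0 G) U" "bd G U" g]
    by (simp add: e w_pt str_pt str_ra str_lact str_in bd_in G0.m_assoc group_hom_def group_hom_axioms_def grp1 grp0 bd_hom)
      (simp add: G0.m_assoc[symmetric] str_in bd_in)
  show "str T U (ract T U x g) = str T U x \<otimes>\<^bsub>grp (X0 G) U\<^esub> bd G U g"
    using c g U uv by (simp add: e ract_pt str_pt str_ra str_in bd_in G0.m_assoc)
  fix h assume h: "h \<in> carrier (grp (X1 G) U)"
  { assume "w U x g = w U x h"
    then have "ract E U u g = ract E U u h" using c g h U by (simp add: e w_pt pt_inj)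
    then show "g = h" using ra_free uv g h by blast }
  show "w U (ract T U x g) h = ract T U (w U x h) g"
    using c g h U uv composable_w[OF U c g] composable_w(3)[OF U composable_w(1)[OF U c h], of "inv\<^bsub>grp (X1 G) U\<^esub> h"]
    by (simp add: e ract_pt w_pt pt_inj lact_ract)
qed

lemma wedge_QT: "wedge C G B E1 E2 = QT"
  by (simp add: wedge_def)

lemma wedge_pt_q: "wedge_pt C G E1 E2 U ((proj E U u, proj E U v), u) ((proj E U u, proj E U v), v) = q U (pt U u v)"
  by (simp add: wedge_pt_def pt_def)

lemma E12_ract_res:
  assumes "f \<in> arr_to C U" "y \<in> sec (tot E12) U" "g \<in> carrier (grp (X1 G) U)"
  shows "res (tot E12) f (ract E12 U y g) = ract E12 (src C f) (res (tot E12) f y) (gres (X1 G) f g)"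
  using assms gtorsor_ract_res[OF gE assms(1) _ assms(3)] by (auto simp: pb_simps)

text \<open>The map \<open>\<gamma>\<close> is determined by its values at classes of composable
  pairs. That these depend on the class only is the balancing identity, and the torsor structure
  accounts for the other equations. Conversely a balanced law descends to the contracted product,
  bijectively by \<open>descend_bij\<close>.\<close>

lemma composition_law_iff:
  "composition_law C I H G E i \<longleftrightarrow> (\<forall>U\<in>Ob C. law_stage I H G E i U) \<and> law_res C I E i"
proof
  assume L: "composition_law C I H G E i"
  then obtain \<gamma> where \<gamma>: "torsor_iso C G QT E12 \<gamma>"
    and \<gamma>e: "\<forall>U\<in>Ob C. \<forall>u v. composable I E i U u v \<longrightarrow> \<gamma> U (q U (pt U u v)) = ((proj E U u, proj E U v), plaw E i U u v)"
    unfolding composition_law_def Let_def wedge_QT wedge_pt_q by auto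
  have as: "\<forall>U\<in>Ob C. \<forall>u v w. composable I E i U u v \<and> composable I E i U v w \<longrightarrow>
       plaw E i U (plaw E i U u v) w = plaw E i U u (plaw E i U v w)"
    using L unfolding composition_law_def by blast
  have h: "sheaf_hom C Q (tot E12) \<gamma>" using \<gamma> by (simp add: torsor_iso_def torsor_hom_def tot_QT)
  have \<gamma>s: "str E12 U (\<gamma> U W) = str QT U W"
    and \<gamma>r: "g \<in> carrier (grp (X1 G) U) \<Longrightarrow> \<gamma> U (ract QT U W g) = ract E12 U (\<gamma> U W) g"
    if "U \<in> Ob C" "W \<in> sec Q U" for U W g
    using \<gamma> that by (auto simp: torsor_iso_def torsor_hom_def tot_QT)
  have xT: "pt U u v \<in> sec (tot T) U" if "U \<in> Ob C" "composable I E i U u v" for U u v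
    using that T_mem by blast
  show "(\<forall>U\<in>Ob C. law_stage I H G E i U) \<and> law_res C I E i"
    unfolding law_stage_def law_res_def
  proof (intro conjI ballI allI impI)
    fix U u v assume U: "U \<in> Ob C" and c: "composable I E i U u v"
    interpret tors_stage G U E "sec (mbase I H) U" by (rule stage[OF U])
    note x = xT[OF U c]
    note g = \<gamma>e[rule_format, OF U c]
    have m: "\<gamma> U (q U (pt U u v)) \<in> sec (tot E12) U" using hom_in[OF h U] q_in[OF U x] by simp
    then show "plaw E i U u v \<in> sec (tot E) U" "proj E U (plaw E i U u v) = axis_mult H i U (proj E U u, proj E U v)"
      unfolding g by (simp_all add: pb_simps)
    show "str E U (plaw E i U u v) = str E U u \<otimes>\<^bsub>grp (X0 G) U\<^esub> str E U v"
      using \<gamma>s[OF U q_in[OF U x]] str_q[OF U x] g by (simp add: str_pt pb_simps)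
    fix k assume k: "k \<in> carrier (grp (X1 G) U)"
    have "\<gamma> U (q U (pt U u (ract E U v k))) = ract E12 U (\<gamma> U (q U (pt U u v))) k"
      using \<gamma>r[OF U q_in[OF U x] k] ract_q[OF U x k] ract_pt[OF U c k] by simp
    then show "plaw E i U u (ract E U v k) = ract E U (plaw E i U u v) k"
      using g \<gamma>e[rule_format, OF U composable_w(2)[OF U c k]] by (simp add: pb_simps)
    have c': "composable I E i U (ract E U u k) v" by (rule composable_w(1)[OF U c k])
    \<comment> \<open>The pairs \<open>(uk, v)\<close> and \<open>(u, kv)\<close> are in one orbit,
      the inverse of \<open>k\<close> carrying the former to the latter.\<close>
    have "q U (pt U (ract E U u k) v) = q U (pt U u (lact G E U k v))"
    proof -
      have ki: "inv\<^bsub>grp (X1 G) U\<^esub> k \<in> carrier (grp (X1 G) U)" using k by simp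
      have "w U (pt U (ract E U u k) v) (inv\<^bsub>grp (X1 G) U\<^esub> k) = pt U u (lact G E U k v)"
        using c k by (simp add: w_pt[OF U c' ki] pt_inj composable_def ra_mult[symmetric] ra_one)
      then have "orb U (pt U (ract E U u k) v) (pt U u (lact G E U k v))"
        using orb_act[OF ki, of "pt U (ract E U u k) v"] by simp
      then show ?thesis using q_eq_iff[OF U xT[OF U c'] xT[OF U composable_w(3)[OF U c k]]] by simp
    qed
    then show "plaw E i U (ract E U u k) v = plaw E i U u (lact G E U k v)"
      using \<gamma>e[rule_format, OF U c'] \<gamma>e[rule_format, OF U composable_w(3)[OF U c k]] by simp
  next
    fix U f u v assume U: "U \<in> Ob C" and f: "f \<in> arr_to C U" and c: "composable I E i U u v"
    have "\<gamma> (src C f) (q (src C f) (pt (src C f) (res (tot E) f u) (res (tot E) f v))) = res (tot E12) f (\<gamma> U (q U (pt U u v)))"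
      using hom_res[OF h f q_in[OF U xT[OF U c]]] q_res[OF f U xT[OF U c]] res_pt[OF U f c] by simp
    then show "res (tot E) f (plaw E i U u v) = plaw E i (src C f) (res (tot E) f u) (res (tot E) f v)"
      using \<gamma>e[rule_format, OF U c] \<gamma>e[rule_format, OF src_Ob[OF f] composable_res[OF U f c]]
      by (simp add: pb_simps)
  qed (use as in blast)
next
  assume "(\<forall>U\<in>Ob C. law_stage I H G E i U) \<and> law_res C I E i"
  then have S: "\<And>U. U \<in> Ob C \<Longrightarrow> law_stage I H G E i U" and R: "law_res C I E i" by auto
  define \<phi> :: "'o \<Rightarrow> ((('i \<Rightarrow> 'h) \<times> ('i \<Rightarrow> 'h)) \<times> 'p) \<times> (('i \<Rightarrow> 'h) \<times> ('i \<Rightarrow> 'h)) \<times> 'p \<Rightarrow> (('i \<Rightarrow> 'h) \<times> ('i \<Rightarrow> 'h)) \<times> 'p"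
    where "\<phi> U = (\<lambda>((b, u), (b', v)). (b, plaw E i U u v))" for U
  have \<phi>_pt: "\<phi> U (pt U u v) = ((proj E U u, proj E U v), plaw E i U u v)" for U u v
    by (simp add: \<phi>_def pt_def)
  have L: "plaw E i U u v \<in> sec (tot E) U"
      "proj E U (plaw E i U u v) = axis_mult H i U (proj E U u, proj E U v)"
      "str E U (plaw E i U u v) = str E U u \<otimes>\<^bsub>grp (X0 G) U\<^esub> str E U v"
    and Lr: "\<And>g. g\<in>carrier (grp (X1 G) U) \<Longrightarrow> plaw E i U u (ract E U v g) = ract E U (plaw E i U u v) g"
      "\<And>g. g\<in>carrier (grp (X1 G) U) \<Longrightarrow> plaw E i U (ract E U u g) v = plaw E i U u (lact G E U g v)"
    if "U \<in> Ob C" "composable I E i U u v" for U u v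
    using S[OF that(1)] that(2) unfolding law_stage_def by auto
  have as: "\<forall>U\<in>Ob C. \<forall>u v w. composable I E i U u v \<and> composable I E i U v w \<longrightarrow>
       plaw E i U (plaw E i U u v) w = plaw E i U u (plaw E i U v w)"
    using S unfolding law_stage_def by blast
  have \<phi>h: "sheaf_hom C (tot T) (tot E12) \<phi>"
  proof (rule sheaf_homI)
    fix U x assume U: "U \<in> Ob C" and x: "x \<in> sec (tot T) U"
    obtain u v where c: "composable I E i U u v" and e: "x = pt U u v" using x T_mem[OF U] by auto
    then show "\<phi> U x \<in> sec (tot E12) U" using L[OF U c] composable_iff[OF U] by (simp add: \<phi>_pt pb_simps)
    fix f assume f: "f \<in> arr_to C U"
    show "\<phi> (src C f) (res (tot T) f x) = res (tot E12) f (\<phi> U x)"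
      using R c U f composable_def[of I E i U u v]
      by (simp add: e res_pt \<phi>_pt pb_simps law_res_def res_B proj_res)
  qed
  have inv: "\<phi> U (w U x g) = \<phi> U x" if U: "U \<in> Ob C" and x: "x \<in> sec (tot T) U" and g: "g \<in> carrier (grp (X1 G) U)" for U x g
  proof -
    interpret tors_stage G U E "sec (mbase I H) U" by (rule stage[OF U])
    obtain u v where c: "composable I E i U u v" and e: "x = pt U u v" using x T_mem[OF U] by auto
    have uv: "u \<in> sec (tot E) U" "v \<in> sec (tot E) U" using c by (auto simp: composable_def)
    have c': "composable I E i U u (lact G E U (inv\<^bsub>grp (X1 G) U\<^esub> g) v)" by (rule composable_w(3)[OF U c]) (use g in simp)
    show ?thesis
      using Lr(2)[OF U c' g] g uv by (simp add: e w_pt[OF U c g] \<phi>_pt ra_proj lact_proj lact_mult[symmetric] lact_one)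
  qed
  define \<gamma> where "\<gamma> = descend C (tot E12) \<phi>"
  have \<gamma>h: "sheaf_hom C Q (tot E12) \<gamma>" unfolding \<gamma>_def by (rule descend_hom[OF shE12 \<phi>h inv])
  have \<gamma>q: "\<gamma> U (q U x) = \<phi> U x" if "U \<in> Ob C" "x \<in> sec (tot T) U" for U x
    unfolding \<gamma>_def by (rule descend_q[OF shE12 \<phi>h inv that])
  have bij: "bij_betw (\<gamma> U) (sec Q U) (sec (tot E12) U)" if U: "U \<in> Ob C" for U
    unfolding \<gamma>_def
  proof (rule descend_bij[OF shE12 \<phi>h inv _ _ U])
    \<comment> \<open>Points over the two entries of \<open>b\<close> are chosen on successive
      refinements. Their product lies over the same point as \<open>z\<close>, and the remaining
      element of \<open>G\<^sub>1\<close> is put into the second factor.\<close>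
    show "locally_surj C (tot T) (tot E12) \<phi>"
    proof (rule locally_surjI[OF pX sheaf_presheaf[OF shE12] \<phi>h])
      fix U y assume U: "U \<in> Ob C" and y: "y \<in> sec (tot E12) U"
      obtain b z where bz: "y = (b, z)" "b \<in> sec B U" "z \<in> sec (tot E) U" "axis_mult H i U b = proj E U z"
        using y by (auto simp: pb_simps)
      obtain h h' where b: "b = (h, h')" by (cases b)
      have hh: "h \<in> sec (mbase I H) U" "h' \<in> sec (mbase I H) U" using bz(2) b by (auto simp: B_mem)
      note sj = locally_surjD[OF gtorsorD(4)[OF gE] U]
      show "lc U (\<lambda>f. \<exists>x\<in>sec (tot T) (src C f). \<phi> (src C f) x = res (tot E12) f y)"
      proof (rule lc_bind[OF U sj[OF hh(1)]])
        fix f assume f: "f \<in> arr_to C U" and "\<exists>x\<in>sec (tot E) (src C f). proj E (src C f) x = res (mbase I H) f h"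
        then obtain u where u: "u \<in> sec (tot E) (src C f)" "proj E (src C f) u = res (mbase I H) f h" by auto
        show "lc (src C f) (\<lambda>g. \<exists>x\<in>sec (tot T) (src C (cmp C f g)). \<phi> (src C (cmp C f g)) x = res (tot E12) (cmp C f g) y)"
        proof (rule lc_mono[OF lc_pull[OF f sj[OF hh(2)]] src_Ob[OF f]])
          fix k assume k: "k \<in> arr_to C (src C f)"
            and "\<exists>x\<in>sec (tot E) (src C (cmp C f k)). proj E (src C (cmp C f k)) x = res (mbase I H) (cmp C f k) h'"
          then obtain v where v: "v \<in> sec (tot E) (src C k)" "proj E (src C k) v = res (mbase I H) (cmp C f k) h'"
            using f by auto
          define V where "V = src C k"
          have V: "V \<in> Ob C" using k by (simp add: V_def)
          have fk: "cmp C f k \<in> arr_to C U" "src C (cmp C f k) = V" using f k by (simp_all add: V_def)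
          interpret tors_stage G V E "sec (mbase I H) V" by (rule stage[OF V])
          define u' where "u' = res (tot E) k u"
          have u': "u' \<in> sec (tot E) V" "proj E V u' = res (mbase I H) (cmp C f k) h"
            using u k f hh res_cmp[OF sheaf_presheaf[OF gtorsorD(2)[OF gE]] f k hh(1)]
            by (simp_all add: u'_def V_def proj_res res_in[OF sheaf_presheaf[OF gtorsorD(1)[OF gE]]])
          note v = v[folded V_def]
          have rb: "res B (cmp C f k) b = (proj E V u', proj E V v)" using u' v b by (simp add: res_B)
          have c: "composable I E i V u' v"
            unfolding composable_iff[OF V] using B_in[OF bz(2) fk(1) U] rb fk(2) u' v by simp
          define z' where "z' = res (tot E) (cmp C f k) z"
          have z': "z' \<in> sec (tot E) V" using bz(3) fk res_in[OF sheaf_presheaf[OF gtorsorD(1)[OF gE]], of "cmp C f k" U z] by (simp add: z'_def)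
          have "proj E V z' = axis_mult H i V (res B (cmp C f k) b)"
            using proj_res[OF fk(1) bz(3)] bz(4) hom_res[OF mult_hom fk(1) bz(2)] fk(2) by (simp add: z'_def)
          then have "proj E V (plaw E i V u' v) = proj E V z'" using L(2)[OF V c] rb by simp
          then obtain g where g: "g \<in> carrier (grp (X1 G) V)" "z' = ract E V (plaw E i V u' v) g"
            using ra_ex[OF L(1)[OF V c] z'] by blast
          have c': "composable I E i V u' (ract E V v g)" by (rule composable_w(2)[OF V c g(1)])
          have "\<phi> V (pt V u' (ract E V v g)) = res (tot E12) (cmp C f k) y"
            using Lr(1)[OF V c g(1)] g rb bz(1) v by (simp add: \<phi>_pt pb_simps z'_def ra_proj)
          moreover have "pt V u' (ract E V v g) \<in> sec (tot T) V" using T_mem[OF V] c' by blast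
          ultimately show "\<exists>x\<in>sec (tot T) (src C (cmp C f k)). \<phi> (src C (cmp C f k)) x = res (tot E12) (cmp C f k) y"
            using fk(2) by auto
        qed
      qed
    qed
  next
    fix U x y assume U: "U \<in> Ob C" and x: "x \<in> sec (tot T) U" and y: "y \<in> sec (tot T) U" and e: "\<phi> U x = \<phi> U y"
    interpret tors_stage G U E "sec (mbase I H) U" by (rule stage[OF U])
    obtain u v where c: "composable I E i U u v" and ex: "x = pt U u v" using x T_mem[OF U] by auto
    obtain u' v' where c': "composable I E i U u' v'" and ey: "y = pt U u' v'" using y T_mem[OF U] by auto
    have uv: "u \<in> sec (tot E) U" "v \<in> sec (tot E) U" "u' \<in> sec (tot E) U" "v' \<in> sec (tot E) U"
      using c c' by (auto simp: composable_def)
    have pe: "proj E U u = proj E U u'" "proj E U v = proj E U v'" "plaw E i U u v = plaw E i U u' v'"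
      using e by (auto simp: ex ey \<phi>_pt)
    \<comment> \<open>Moving along the orbit by \<open>g\<close> makes the first factors equal. The
      second factors then differ by some \<open>k\<close>, which is trivial since the products are
      equal and the law is equivariant.\<close>
    obtain g where g: "g \<in> carrier (grp (X1 G) U)" "u' = ract E U u g" using ra_ex[OF uv(1,3) pe(1)] by auto
    define v1 where "v1 = lact G E U (inv\<^bsub>grp (X1 G) U\<^esub> g) v"
    have v1: "v1 \<in> sec (tot E) U" "proj E U v1 = proj E U v'"
      using uv g pe by (simp_all add: v1_def lact_in lact_proj)
    obtain k where k: "k \<in> carrier (grp (X1 G) U)" "v' = ract E U v1 k" using ra_ex[OF v1(1) uv(4) v1(2)] by auto
    have x': "w U x g = pt U u' v1" using w_pt[OF U c g(1)] g ex v1_def by simp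
    have c1: "composable I E i U u' v1" using c' v1 by (simp add: composable_def)
    have "plaw E i U u' v1 = plaw E i U u v"
      using inv[OF U x g(1)] x' ex by (simp add: \<phi>_pt)
    then have "ract E U (plaw E i U u' v1) k = plaw E i U u' v1"
      using Lr(1)[OF U c1 k(1)] k(2) pe(3) by simp
    then have "k = \<one>\<^bsub>grp (X1 G) U\<^esub>" using ra_free_one[OF L(1)[OF U c1] k(1)] by simp
    then have "y = w U x g" using x' k v1 ey by (simp add: ra_one)
    then show "orb U x y" unfolding orb_def using g by auto
  qed
  have "torsor_hom C G QT E12 \<gamma>"
    unfolding torsor_hom_def tot_QT
  proof (intro conjI ballI \<gamma>h)
    fix U W assume U: "U \<in> Ob C" and W: "W \<in> sec Q U"
    show "proj E12 U (\<gamma> U W) = proj QT U W"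
    proof (rule Q_hom_ext[OF shB sheaf_hom_comp[OF \<gamma>h pb_proj_hom] proj_hom _ U W])
      fix U x assume U: "U \<in> Ob C" and x: "x \<in> sec (tot T) U"
      obtain u v where c: "composable I E i U u v" and e: "x = pt U u v" using x T_mem[OF U] by auto
      show "proj E12 U (\<gamma> U (q U x)) = proj QT U (q U x)"
        using U x by (simp add: \<gamma>q proj_q) (simp add: e \<phi>_pt proj_pt pb_simps)
    qed
    have sh: "sheaf_hom C (tot E12) (ush (X0 G)) (str E12)"
      by (rule sheaf_homI) (auto simp: pb_simps hom_in[OF gtorsorD(5)[OF gE]] hom_res[OF gtorsorD(5)[OF gE]])
    show "str E12 U (\<gamma> U W) = str QT U W"
    proof (rule Q_hom_ext[OF shG0 sheaf_hom_comp[OF \<gamma>h sh] str_hom _ U W])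
      fix U x assume U: "U \<in> Ob C" and x: "x \<in> sec (tot T) U"
      obtain u v where c: "composable I E i U u v" and e: "x = pt U u v" using x T_mem[OF U] by auto
      show "str E12 U (\<gamma> U (q U x)) = str QT U (q U x)"
        using U x L(3)[OF U c] by (simp add: \<gamma>q str_q) (simp add: e \<phi>_pt str_pt pb_simps)
    qed
    fix g assume g: "g \<in> carrier (grp (X1 G) U)"
    have rc: "ract E12 U z g \<in> sec (tot E12) U" if "z \<in> sec (tot E12) U" for z
    proof -
      interpret tors_stage G U E "sec (mbase I H) U" by (rule stage[OF U])
      show ?thesis using that g by (auto simp: pb_simps ra_in ra_proj)
    qed
    note \<gamma>W = hom_in[OF \<gamma>h U W]
    \<comment> \<open>As \<open>g\<close> lives over \<open>U\<close> only, this is not an identity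
      of maps of sheaves to which \<open>Q_hom_ext\<close> would apply; it is checked on local
      representatives of \<open>W\<close>.\<close>
    show "\<gamma> U (ract QT U W g) = ract E12 U (\<gamma> U W) g"
    proof (rule sheaf_eqI[OF shE12 U hom_in[OF \<gamma>h U ract_QT_in[OF U W g]] rc[OF \<gamma>W]], rule lc_mono[OF Q_lift[OF U W] U])
      fix f assume f: "f \<in> arr_to C U" and "\<exists>x\<in>sec (tot T) (src C f). q (src C f) x = res Q f W"
      then obtain x where x: "x \<in> sec (tot T) (src C f)" "q (src C f) x = res Q f W" by auto
      note V = src_Ob[OF f]
      note gf = gresG_in[OF f g]
      obtain u v where c: "composable I E i (src C f) u v" and e: "x = pt (src C f) u v" using x T_mem[OF V] by auto
      interpret tors_stage G "src C f" E "sec (mbase I H) (src C f)" by (rule stage[OF V])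
      have "res (tot E12) f (\<gamma> U (ract QT U W g)) = \<gamma> (src C f) (ract QT (src C f) (q (src C f) x) (gres (X1 G) f g))"
        using hom_res[OF \<gamma>h f ract_QT_in[OF U W g]] res_ract_QT[OF U W g f] x by simp
      also have "\<dots> = \<phi> (src C f) (ract T (src C f) x (gres (X1 G) f g))"
        using ract_q[OF V x(1) gf] \<gamma>q[OF V T_in[OF V x(1) gf]] by simp
      also have "\<dots> = ract E12 (src C f) (\<phi> (src C f) x) (gres (X1 G) f g)"
        using Lr(1)[OF V c gf] c gf by (simp add: e ract_pt[OF V c gf] \<phi>_pt pb_simps composable_def ra_proj)
      also have "\<dots> = res (tot E12) f (ract E12 U (\<gamma> U W) g)"
        using E12_ract_res[OF f \<gamma>W g] hom_res[OF \<gamma>h f W] x \<gamma>q[OF V x(1)] by simp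
      finally show "res (tot E12) f (\<gamma> U (ract QT U W g)) = res (tot E12) f (ract E12 U (\<gamma> U W) g)" .
    qed
  qed
  then have iso: "torsor_iso C G QT E12 \<gamma>" using bij by (simp add: torsor_iso_def tot_QT)
  moreover have "\<gamma> U (q U (pt U u v)) = ((proj E U u, proj E U v), plaw E i U u v)" if "U \<in> Ob C" "composable I E i U u v" for U u v
    using \<gamma>q[OF that(1)] \<phi>_pt T_mem[OF that(1)] that by metis
  ultimately show "composition_law C I H G E i"
    unfolding composition_law_def Let_def wedge_QT wedge_pt_q using as by blast
qed

end

section \<open>Butterflies on points\<close>

abbreviation xfam :: "('i \<Rightarrow> ('o, 'm, 'h, 'x) xmod_scheme) \<Rightarrow> 'i \<Rightarrow> 'i \<Rightarrow> ('o, 'm, 'h) gsh" where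
  "xfam H i \<equiv> (\<lambda>l. X0 (H l))(i := X1 (H i))"

lemma mbase_sec: "sec (mbase I H) U = (\<Pi>\<^sub>E l\<in>I. carrier (grp (H l) U))"
  by (simp add: ush_def prod_gsh_def)

lemma mbase_res: "res (mbase I H) f h = (\<lambda>l\<in>I. gres (H l) f (h l))"
  by (simp add: ush_def prod_gsh_def)

lemma PiE_upd: "h \<in> PiE I B \<Longrightarrow> l \<in> I \<Longrightarrow> x \<in> B l \<Longrightarrow> h(l := x) \<in> PiE I B"
  by (auto simp: PiE_iff extensional_def)

text \<open>A trivialization expressed through the image of the unit section. Compatibility with the
  laws of the trivial extension becomes multiplicativity along every axis \<open>l\<close>, the axis
  \<open>i\<close> of the boundary included.\<close>

definition triv_stage ::
    "'i set \<Rightarrow> ('i \<Rightarrow> ('o, 'm, 'h, 'x) xmod_scheme) \<Rightarrow> ('o, 'm, 'g, 'y) xmod_scheme \<Rightarrow>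
     ('o, 'm, 'i, 'h, 'g, 'p, 'z) mext_scheme \<Rightarrow> 'i \<Rightarrow> ('o \<Rightarrow> ('i \<Rightarrow> 'h) \<Rightarrow> 'p) \<Rightarrow> 'o \<Rightarrow> bool" where
  "triv_stage I H G E i s U \<longleftrightarrow>
    (\<forall>h\<in>\<Pi>\<^sub>E l\<in>I. carrier (grp (xfam H i l) U).
       s U h \<in> sec (tot E) U \<and>
       proj E U (s U h) = h(i := bd (H i) U (h i)) \<and>
       str E U (s U h) = \<one>\<^bsub>grp (X0 G) U\<^esub> \<and>
       (\<forall>l\<in>I. \<forall>h'\<in>\<Pi>\<^sub>E l\<in>I. carrier (grp (xfam H i l) U). (\<forall>k\<in>I - {l}. h k = h' k) \<longrightarrow>
          plaw E l U (s U h) (s U h') = s U (axis_mult (xfam H i) l U (h, h'))))"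

definition triv_res ::
    "('o, 'm) site_data \<Rightarrow> 'i set \<Rightarrow> ('i \<Rightarrow> ('o, 'm, 'h, 'x) xmod_scheme) \<Rightarrow>
     ('o, 'm, 'i, 'h, 'g, 'p, 'z) mext_scheme \<Rightarrow> 'i \<Rightarrow> ('o \<Rightarrow> ('i \<Rightarrow> 'h) \<Rightarrow> 'p) \<Rightarrow> bool" where
  "triv_res C I H E i s \<longleftrightarrow> (\<forall>U\<in>Ob C. \<forall>f\<in>arr_to C U. \<forall>h\<in>\<Pi>\<^sub>E l\<in>I. carrier (grp (xfam H i l) U).
     res (tot E) f (s U h) = s (src C f) (\<lambda>l\<in>I. gres (xfam H i l) f (h l)))"

context site_loc
begin

text \<open>A map out of the trivial torsor is determined by its value on the unit section, so
  \<open>\<phi>\<close> must send \<open>(h, g)\<close> to \<open>(h, s(h)g)\<close>.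
  Multiplicativity on these translates follows from that of the section, because left and right
  translation agree at points with trivial structural value.\<close>

lemma trivialization_iff:
  fixes G :: "('o, 'm, 'g) bxmod"
  assumes cG: "crossed_module C G" and cH: "\<And>l. l \<in> I \<Longrightarrow> crossed_module C (H l)"
    and gE: "gtorsor C G (mbase I (\<lambda>l. X0 (H l))) E"
    and law: "\<And>l U. l \<in> I \<Longrightarrow> U \<in> Ob C \<Longrightarrow> law_stage I (\<lambda>l. X0 (H l)) G E l U"
    and i: "i \<in> I"
  shows "trivialization C I H G E i s \<longleftrightarrow> (\<forall>U\<in>Ob C. triv_stage I H G E i s U) \<and> triv_res C I H E i s"
proof -
  define f where "f = (\<lambda>l U x. x)(i := bd (H i))"
  define M where "M = trivial_mext I (xfam H i) G"
  define P where "P = pb_mext I (xfam H i) f E"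
  have gx: "group_sheaf C (xfam H i l)" if "l \<in> I" for l
    using xmod_sheaves[OF cH[OF that]] by (cases "l = i") simp_all
  have ff: "(\<lambda>l\<in>I. f l U (h l)) = h(i := bd (H i) U (h i))" if "h \<in> (\<Pi>\<^sub>E l\<in>I. carrier (grp (xfam H i l) U))" for U h
    using that i by (auto simp: f_def fun_eq_iff PiE_iff extensional_def)
  have M_simps: "(h, g) \<in> sec (tot M) U \<longleftrightarrow> h \<in> (\<Pi>\<^sub>E l\<in>I. carrier (grp (xfam H i l) U)) \<and> g \<in> carrier (grp (X1 G) U)"
      "res (tot M) k (h, g) = (\<lambda>l\<in>I. gres (xfam H i l) k (h l), gres (X1 G) k g)"
      "proj M U (h, g) = h" "ract M U (h, g) g' = (h, g \<otimes>\<^bsub>grp (X1 G) U\<^esub> g')" "str M U (h, g) = bd G U g"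
      "plaw M l U (h, g) (h', g') = (axis_mult (xfam H i) l U (h, h'), g \<otimes>\<^bsub>grp (X1 G) U\<^esub> g')"
    for h g h' g' U k l
    by (simp_all add: M_def trivial_mext_def mbase_sec mbase_res del: fun_upd_apply)
  have P_mem: "(h, u) \<in> sec (tot P) U \<longleftrightarrow> h \<in> (\<Pi>\<^sub>E l\<in>I. carrier (grp (xfam H i l) U)) \<and> u \<in> sec (tot E) U \<and>
       proj E U u = h(i := bd (H i) U (h i))" for h u U
    using ff[of h U] by (auto simp: P_def pb_mext_def pb_tors_def tors.defs mext.defs mbase_sec simp del: fun_upd_apply)
  have P_simps: 
      "res (tot P) k (h, u) = (\<lambda>l\<in>I. gres (xfam H i l) k (h l), res (tot E) k u)"
      "proj P U (h, u) = h" "ract P U (h, u) g' = (h, ract E U u g')" "str P U (h, u) = str E U u"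
      "plaw P l U (h, u) (h', u') = (axis_mult (xfam H i) l U (h, h'), plaw E l U u u')"
    for h u h' u' g' U k l
    by (simp_all add: P_def pb_mext_def pb_tors_def tors.defs mext.defs mbase_res del: fun_upd_apply)
  have am: "axis_mult (xfam H i) l U (h, h') \<in> (\<Pi>\<^sub>E l\<in>I. carrier (grp (xfam H i l) U))"
    if "U \<in> Ob C" "l \<in> I" "h \<in> (\<Pi>\<^sub>E l\<in>I. carrier (grp (xfam H i l) U))" "h' \<in> (\<Pi>\<^sub>E l\<in>I. carrier (grp (xfam H i l) U))" for U l h h'
  proof -
    interpret group "grp (xfam H i l) U" by (rule gsh_group[OF gx[OF that(2)] that(1)])
    have "h l \<in> carrier (grp (xfam H i l) U)" "h' l \<in> carrier (grp (xfam H i l) U)"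
      by (rule PiE_mem[OF that(3,2)] PiE_mem[OF that(4,2)])+
    then have "h l \<otimes>\<^bsub>grp (xfam H i l) U\<^esub> h' l \<in> carrier (grp (xfam H i l) U)" by (rule m_closed)
    from PiE_upd[OF that(3,2) this] show ?thesis by (simp only: axis_mult_def prod.case)
  qed
  have hr: "(\<lambda>l\<in>I. gres (xfam H i l) k (h l)) \<in> (\<Pi>\<^sub>E l\<in>I. carrier (grp (xfam H i l) (src C k)))"
    if "k \<in> arr_to C U" "h \<in> (\<Pi>\<^sub>E l\<in>I. carrier (grp (xfam H i l) U))" for U k h
    using that gsh_res_in[OF gx that(1)] by (auto simp: PiE_iff)
  have unf: "trivialization C I H G E i s \<longleftrightarrow> (\<exists>\<phi>. mext_iso C I G M P \<phi> \<and>
          (\<forall>U\<in>Ob C. \<forall>h\<in>\<Pi>\<^sub>E l\<in>I. carrier (grp (xfam H i l) U). \<phi> U (h, \<one>\<^bsub>grp (X1 G) U\<^esub>) = (h, s U h)))"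
    by (simp only: trivialization_def Let_def M_def P_def f_def mbase_sec)
  show ?thesis
  proof
    assume "trivialization C I H G E i s"
    then obtain \<phi> where \<phi>: "mext_iso C I G M P \<phi>" and
      \<phi>s: "\<And>U h. U\<in>Ob C \<Longrightarrow> h\<in>(\<Pi>\<^sub>E l\<in>I. carrier (grp (xfam H i l) U)) \<Longrightarrow> \<phi> U (h, \<one>\<^bsub>grp (X1 G) U\<^esub>) = (h, s U h)"
      unfolding unf by blast
    have h: "sheaf_hom C (tot M) (tot P) \<phi>" using \<phi> by (simp add: mext_iso_def torsor_iso_def torsor_hom_def)
    have hs: "str P U (\<phi> U x) = str M U x" if "U \<in> Ob C" "x \<in> sec (tot M) U" for U x
      using \<phi> that by (simp add: mext_iso_def torsor_iso_def torsor_hom_def)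
    have hl: "\<phi> U (plaw M l U x x') = plaw P l U (\<phi> U x) (\<phi> U x')" if "U \<in> Ob C" "l \<in> I" "composable I M l U x x'" for U l x x'
      using \<phi> that unfolding mext_iso_def by blast
    have x: "(h, \<one>\<^bsub>grp (X1 G) U\<^esub>) \<in> sec (tot M) U" if "U \<in> Ob C" "h\<in>(\<Pi>\<^sub>E l\<in>I. carrier (grp (xfam H i l) U))" for U h
    proof -
      interpret xmod_stage G U by (rule xmod_stageI[OF cG that(1)])
      show ?thesis using that by (simp add: M_simps del: fun_upd_apply)
    qed
    show "(\<forall>U\<in>Ob C. triv_stage I H G E i s U) \<and> triv_res C I H E i s"
      unfolding triv_stage_def triv_res_def
    proof (intro conjI ballI impI)
      fix U h assume U: "U \<in> Ob C" and hh: "h\<in>(\<Pi>\<^sub>E l\<in>I. carrier (grp (xfam H i l) U))"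
      interpret xmod_stage G U by (rule xmod_stageI[OF cG U])
      have m: "(h, s U h) \<in> sec (tot P) U" using hom_in[OF h U x[OF U hh]] \<phi>s[OF U hh] by simp
      then show "s U h \<in> sec (tot E) U" "proj E U (s U h) = h(i := bd (H i) U (h i))" by (auto simp only: P_mem)
      show "str E U (s U h) = \<one>\<^bsub>grp (X0 G) U\<^esub>" using hs[OF U x[OF U hh]] \<phi>s[OF U hh] by (simp only: P_simps M_simps bd_one)
      fix l h' assume l: "l \<in> I" and hh': "h'\<in>(\<Pi>\<^sub>E l\<in>I. carrier (grp (xfam H i l) U))" and e: "\<forall>k\<in>I - {l}. h k = h' k"
      have c: "composable I M l U (h, \<one>\<^bsub>grp (X1 G) U\<^esub>) (h', \<one>\<^bsub>grp (X1 G) U\<^esub>)"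
        using x[OF U hh] x[OF U hh'] e by (simp only: composable_def M_simps simp_thms)
      show "plaw E l U (s U h) (s U h') = s U (axis_mult (xfam H i) l U (h, h'))"
        using hl[OF U l c] by (simp only: M_simps G1.l_one[OF G1.one_closed] \<phi>s[OF U hh] \<phi>s[OF U hh'] \<phi>s[OF U am[OF U l hh hh']] P_simps prod.inject simp_thms)
    next
      fix U k h assume U: "U \<in> Ob C" and k: "k \<in> arr_to C U" and hh: "h\<in>(\<Pi>\<^sub>E l\<in>I. carrier (grp (xfam H i l) U))"
      show "res (tot E) k (s U h) = s (src C k) (\<lambda>l\<in>I. gres (xfam H i l) k (h l))"
        using hom_res[OF h k x[OF U hh]]
        by (simp only: M_simps \<phi>s[OF U hh] \<phi>s[OF src_Ob[OF k] hr[OF k hh]] gsh_res_one[OF xmod_sheaves(1)[OF cG] k U] P_simps prod.inject simp_thms)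
    qed
  next
    assume "(\<forall>U\<in>Ob C. triv_stage I H G E i s U) \<and> triv_res C I H E i s"
    then have S: "\<And>U. U \<in> Ob C \<Longrightarrow> triv_stage I H G E i s U" and R: "triv_res C I H E i s" by auto
    have s: "s U h \<in> sec (tot E) U" "proj E U (s U h) = h(i := bd (H i) U (h i))" "str E U (s U h) = \<one>\<^bsub>grp (X0 G) U\<^esub>"
      "\<And>l h'. l\<in>I \<Longrightarrow> h'\<in>(\<Pi>\<^sub>E l\<in>I. carrier (grp (xfam H i l) U)) \<Longrightarrow> (\<forall>k\<in>I - {l}. h k = h' k) \<Longrightarrow>
          plaw E l U (s U h) (s U h') = s U (axis_mult (xfam H i) l U (h, h'))"
      if "U \<in> Ob C" "h\<in>(\<Pi>\<^sub>E l\<in>I. carrier (grp (xfam H i l) U))" for U h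
      using S[OF that(1)] that(2) unfolding triv_stage_def by blast+
    define \<phi> where "\<phi> U = (\<lambda>(h, g). (h, ract E U (s U h) g))" for U
    have \<phi>_simp: "\<phi> U (h, g) = (h, ract E U (s U h) g)" for U h g by (simp add: \<phi>_def)
    have ts: "tors_stage G U E (sec (mbase I (\<lambda>l. X0 (H l))) U)" if "U \<in> Ob C" for U by (rule tors_stageI[OF cG gE that])
    have "mext_iso C I G M P \<phi>"
      unfolding mext_iso_def torsor_iso_def torsor_hom_def
    proof (intro conjI ballI allI impI)
      show "sheaf_hom C (tot M) (tot P) \<phi>"
      proof (rule sheaf_homI)
        fix U x assume U: "U \<in> Ob C" and x: "x \<in> sec (tot M) U"
        interpret tors_stage G U E "sec (mbase I (\<lambda>l. X0 (H l))) U" by (rule ts[OF U])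
        obtain h g where e: "x = (h, g)" by (cases x)
        have m: "h \<in> (\<Pi>\<^sub>E l\<in>I. carrier (grp (xfam H i l) U))" "g \<in> carrier (grp (X1 G) U)" using x by (simp_all only: e M_simps)
        show "\<phi> U x \<in> sec (tot P) U" unfolding e \<phi>_simp P_mem using s[OF U m(1)] m by (simp add: ra_in ra_proj)
        fix k assume k: "k \<in> arr_to C U"
        show "\<phi> (src C k) (res (tot M) k x) = res (tot P) k (\<phi> U x)"
          using R[unfolded triv_res_def] m k U gtorsor_ract_res[OF gE k s(1)[OF U m(1)] m(2)]
          by (simp only: e M_simps \<phi>_simp P_simps)
      qed
    next
      fix U x assume U: "U \<in> Ob C" and x: "x \<in> sec (tot M) U"
      interpret tors_stage G U E "sec (mbase I (\<lambda>l. X0 (H l))) U" by (rule ts[OF U])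
      obtain h g where e: "x = (h, g)" by (cases x)
      have m: "h \<in> (\<Pi>\<^sub>E l\<in>I. carrier (grp (xfam H i l) U))" "g \<in> carrier (grp (X1 G) U)" using x by (simp_all only: e M_simps)
      show "proj P U (\<phi> U x) = proj M U x" by (simp only: e M_simps \<phi>_simp P_simps)
      show "str P U (\<phi> U x) = str M U x" using s[OF U m(1)] m(2) by (simp add: e M_simps \<phi>_simp P_simps str_ra bd_in)
      fix k assume k: "k \<in> carrier (grp (X1 G) U)"
      show "\<phi> U (ract M U x k) = ract P U (\<phi> U x) k"
        using s[OF U m(1)] m(2) k by (simp add: e M_simps \<phi>_simp P_simps ra_mult)
    next
      fix U assume U: "U \<in> Ob C"
      interpret tors_stage G U E "sec (mbase I (\<lambda>l. X0 (H l))) U" by (rule ts[OF U])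
      show "bij_betw (\<phi> U) (sec (tot M) U) (sec (tot P) U)"
        unfolding bij_betw_def
      proof (intro conjI inj_onI subset_antisym subsetI)
        fix x y assume x: "x \<in> sec (tot M) U" and y: "y \<in> sec (tot M) U" and eq: "\<phi> U x = \<phi> U y"
        obtain h g h' g' where e: "x = (h, g)" "y = (h', g')" by (cases x, cases y)
        have m: "h \<in> (\<Pi>\<^sub>E l\<in>I. carrier (grp (xfam H i l) U))" "g \<in> carrier (grp (X1 G) U)" "g' \<in> carrier (grp (X1 G) U)" using x y by (simp_all only: e M_simps)
        have hh: "h = h'" "ract E U (s U h) g = ract E U (s U h') g'" using eq unfolding e \<phi>_simp by blast+
        then have "g = g'" using ra_free[OF s(1)[OF U m(1)] m(2,3)] by simp
        then show "x = y" using hh(1) e by simp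
      next
        fix y assume "y \<in> \<phi> U ` sec (tot M) U"
        then obtain x where x: "x \<in> sec (tot M) U" "y = \<phi> U x" by auto
        obtain h g where e: "x = (h, g)" by (cases x)
        have m: "h \<in> (\<Pi>\<^sub>E l\<in>I. carrier (grp (xfam H i l) U))" "g \<in> carrier (grp (X1 G) U)" using x by (simp_all only: e M_simps)
        show "y \<in> sec (tot P) U" unfolding x(2) e \<phi>_simp P_mem using s[OF U m(1)] m by (simp add: ra_in ra_proj)
      next
        fix y assume y: "y \<in> sec (tot P) U"
        obtain h u where e: "y = (h, u)" by (cases y)
        have m: "h \<in> (\<Pi>\<^sub>E l\<in>I. carrier (grp (xfam H i l) U))" "u \<in> sec (tot E) U" "proj E U u = h(i := bd (H i) U (h i))"
          using y by (simp_all only: e P_mem)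
        obtain g where g: "g \<in> carrier (grp (X1 G) U)" "u = ract E U (s U h) g"
          using ra_ex[OF s(1)[OF U m(1)] m(2)] s(2)[OF U m(1)] m(3) by metis
        have "(h, g) \<in> sec (tot M) U" using m g by (simp only: M_simps)
        moreover have "y = \<phi> U (h, g)" by (simp add: e \<phi>_simp g)
        ultimately show "y \<in> \<phi> U ` sec (tot M) U" by blast
      qed
    next
      fix l U x y assume l: "l \<in> I" and U: "U \<in> Ob C" and c: "composable I M l U x y"
      interpret tors_stage G U E "sec (mbase I (\<lambda>l. X0 (H l))) U" by (rule ts[OF U])
      obtain h g h' g' where e: "x = (h, g)" "y = (h', g')" by (cases x, cases y)
      have m: "h \<in> (\<Pi>\<^sub>E l\<in>I. carrier (grp (xfam H i l) U))" "g \<in> carrier (grp (X1 G) U)"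
        "h' \<in> (\<Pi>\<^sub>E l\<in>I. carrier (grp (xfam H i l) U))" "g' \<in> carrier (grp (X1 G) U)"
        "\<forall>k\<in>I - {l}. h k = h' k" using c unfolding e M_simps composable_def by blast+
      note sh = s[OF U m(1)] and sh' = s[OF U m(3)]
      have cE: "composable I E l U (s U h) (s U h')"
        using m(5) sh sh' by (auto simp: composable_def)
      have cg: "composable I E l U (ract E U (s U h) g) (s U h')"
        using cE m by (simp add: composable_def ra_in ra_proj)
      have L: "plaw E l U u (ract E U v k) = ract E U (plaw E l U u v) k"
          "plaw E l U (ract E U u k) v = plaw E l U u (lact G E U k v)" 
        if "composable I E l U u v" "k \<in> carrier (grp (X1 G) U)" for u v k
        using law[OF l U] that unfolding law_stage_def by blast+
      have "plaw E l U (s U h) (s U h') \<in> sec (tot E) U"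
        using law[OF l U] cE unfolding law_stage_def by blast
      \<comment> \<open>The element \<open>g\<close> passes over \<open>s U h'\<close> without a
        twist, the structural value there being the unit.\<close>
      then have "plaw E l U (ract E U (s U h) g) (ract E U (s U h') g') = ract E U (plaw E l U (s U h) (s U h')) (g \<otimes>\<^bsub>grp (X1 G) U\<^esub> g')"
        using L(1)[OF cg m(4)] L(2)[OF cE m(2)] L(1)[OF cE m(2)] sh' m(2,4) by (simp add: lact_def act_one ra_mult)
      then show "\<phi> U (plaw M l U x y) = plaw P l U (\<phi> U x) (\<phi> U y)"
        using sh(4)[OF l m(3,5)] by (simp add: e M_simps \<phi>_simp P_simps del: fun_upd_apply)
    qed
    moreover have "\<phi> U (h, \<one>\<^bsub>grp (X1 G) U\<^esub>) = (h, s U h)" if "U \<in> Ob C" "h\<in>(\<Pi>\<^sub>E l\<in>I. carrier (grp (xfam H i l) U))" for U h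
    proof -
      interpret tors_stage G U E "sec (mbase I (\<lambda>l. X0 (H l))) U" by (rule ts[OF that(1)])
      show ?thesis by (simp add: \<phi>_simp ra_one s[OF that])
    qed
    ultimately show "trivialization C I H G E i s" unfolding unf by blast
  qed
qed

end

section \<open>Braided crossed modules and butterflies at one stage\<close>

locale bxmod_stage = xmod_stage G U for G :: "('o, 'm, 'g) bxmod" and U +
  assumes brd_in: "x \<in> carrier (grp (X0 G) U) \<Longrightarrow> y \<in> carrier (grp (X0 G) U) \<Longrightarrow> brd G U x y \<in> carrier (grp (X1 G) U)"
    and brd_one_left: "x \<in> carrier (grp (X0 G) U) \<Longrightarrow> brd G U \<one>\<^bsub>grp (X0 G) U\<^esub> x = \<one>\<^bsub>grp (X1 G) U\<^esub>"
    and brd_one_right: "x \<in> carrier (grp (X0 G) U) \<Longrightarrow> brd G U x \<one>\<^bsub>grp (X0 G) U\<^esub> = \<one>\<^bsub>grp (X1 G) U\<^esub>"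
    and bd_brd: "x \<in> carrier (grp (X0 G) U) \<Longrightarrow> y \<in> carrier (grp (X0 G) U) \<Longrightarrow> bd G U (brd G U x y) =
         inv\<^bsub>grp (X0 G) U\<^esub> y \<otimes>\<^bsub>grp (X0 G) U\<^esub> inv\<^bsub>grp (X0 G) U\<^esub> x
           \<otimes>\<^bsub>grp (X0 G) U\<^esub> y \<otimes>\<^bsub>grp (X0 G) U\<^esub> x"

text \<open>The normalization of the braiding comes from biadditivity: evaluated at units it says
  that \<open>{1, x}\<close> and \<open>{x, 1}\<close> equal their own squares.\<close>

lemma bxmod_stageI:
  assumes "braided_crossed_module C G" "U \<in> Ob C"
  shows "bxmod_stage G U"
proof -
  have c: "crossed_module C G" using assms by (simp add: braided_crossed_module_def)
  interpret xmod_stage G U by (rule xmod_stageI[OF c assms(2)])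
  have b: "brd G U x y \<in> carrier (grp (X1 G) U)"
    and d: "bd G U (brd G U x y) = inv\<^bsub>grp (X0 G) U\<^esub> y \<otimes>\<^bsub>grp (X0 G) U\<^esub> inv\<^bsub>grp (X0 G) U\<^esub> x
           \<otimes>\<^bsub>grp (X0 G) U\<^esub> y \<otimes>\<^bsub>grp (X0 G) U\<^esub> x"
    if "x \<in> carrier (grp (X0 G) U)" "y \<in> carrier (grp (X0 G) U)" for x y
    using assms that by (simp_all add: braided_crossed_module_def)
  have m: "brd G U x (y \<otimes>\<^bsub>grp (X0 G) U\<^esub> z) =
         xact G U (brd G U x y) z \<otimes>\<^bsub>grp (X1 G) U\<^esub> brd G U x z"
       "brd G U (x \<otimes>\<^bsub>grp (X0 G) U\<^esub> y) z =
         brd G U y z \<otimes>\<^bsub>grp (X1 G) U\<^esub> xact G U (brd G U x z) y"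
    if "x \<in> carrier (grp (X0 G) U)" "y \<in> carrier (grp (X0 G) U)" "z \<in> carrier (grp (X0 G) U)" for x y z
    using assms that unfolding braided_crossed_module_def by blast+
  show ?thesis
  proof unfold_locales
    fix x assume x: "x \<in> carrier (grp (X0 G) U)"
    show "brd G U \<one>\<^bsub>grp (X0 G) U\<^esub> x = \<one>\<^bsub>grp (X1 G) U\<^esub>"
      using m(2)[of "\<one>\<^bsub>grp (X0 G) U\<^esub>" "\<one>\<^bsub>grp (X0 G) U\<^esub>" x] x b by (simp add: act_one)
    show "brd G U x \<one>\<^bsub>grp (X0 G) U\<^esub> = \<one>\<^bsub>grp (X1 G) U\<^esub>"
      using m(1)[of x "\<one>\<^bsub>grp (X0 G) U\<^esub>" "\<one>\<^bsub>grp (X0 G) U\<^esub>"] x b by (simp add: act_one)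
  qed (use b d in auto)
qed

text \<open>What a butterfly says about sections over \<open>U\<close>. Together with the torsor
  condition, finiteness of the index set and naturality this amounts to being a butterfly, by
  \<open>butterflyD\<close> and \<open>butterflyI\<close>.\<close>

locale bfly_stage = tors_stage G U E "\<Pi>\<^sub>E l\<in>I. carrier (grp (X0 (H l)) U)" + bxmod_stage G U
  for G :: "('o, 'm, 'g) bxmod" and U
    and E :: "('o, 'm, 'i, 'h, 'g, 'p) bfly" and I and H :: "'i \<Rightarrow> ('o, 'm, 'h, 'x) xmod_scheme" +
  assumes xH: "l \<in> I \<Longrightarrow> xmod_stage (H l) U"
    and law: "l \<in> I \<Longrightarrow> law_stage I (\<lambda>l. X0 (H l)) G E l U"
    and inter: "i \<in> I \<Longrightarrow> j \<in> I \<Longrightarrow> i \<noteq> j \<Longrightarrow> composable I E i U a b \<Longrightarrow> composable I E i U c d \<Longrightarrow>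
       composable I E j U a c \<Longrightarrow> composable I E j U b d \<Longrightarrow>
       plaw E j U (plaw E i U a b) (plaw E i U c d) =
       plaw E i U (plaw E j U a c)
         (plaw E j U (ract E U b (inv\<^bsub>grp (X1 G) U\<^esub> (brd G U (str E U b) (str E U c)))) d)"
    and trv: "l \<in> I \<Longrightarrow> triv_stage I H G E l (triv E l) U"
    and trv_compat: "i \<in> I \<Longrightarrow> j \<in> I \<Longrightarrow> i \<noteq> j \<Longrightarrow>
       h \<in> (\<Pi>\<^sub>E l\<in>I. carrier (grp (((\<lambda>l. X0 (H l))(i := X1 (H i), j := X1 (H j))) l) U)) \<Longrightarrow>
          triv E i U (h(j := bd (H j) U (h j))) = triv E j U (h(i := bd (H i) U (h i)))"
    and trv_comm: "i \<in> I \<Longrightarrow> e \<in> sec (tot E) U \<Longrightarrow> k \<in> carrier (grp (X1 (H i)) U) \<Longrightarrow>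
         plaw E i U (triv E i U ((proj E U e)(i := k))) e =
         plaw E i U e (triv E i U ((proj E U e)(i := xact (H i) U k (proj E U e i))))"

context site_loc
begin

lemma butterflyD:
  fixes G :: "('o, 'm, 'g) bxmod"
  assumes bG: "braided_crossed_module C G" and cH: "\<And>l. l \<in> I \<Longrightarrow> crossed_module C (H l)"
    and b: "butterfly C I H G E"
  shows "gtorsor C G (mbase I (\<lambda>l. X0 (H l))) E" "finite I"
    "U \<in> Ob C \<Longrightarrow> bfly_stage G U E I H"
    "i \<in> I \<Longrightarrow> law_res C I E i" "i \<in> I \<Longrightarrow> triv_res C I H E i (triv E i)"
proof -
  have cG: "crossed_module C G" using bG by (simp add: braided_crossed_module_def)
  have m: "multiextension C I (\<lambda>l. X0 (H l)) G E"
    and t: "\<And>i. i\<in>I \<Longrightarrow> trivialization C I H G E i (triv E i)"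
    and c: "\<And>i j U h. i\<in>I \<Longrightarrow> j\<in>I \<Longrightarrow> i \<noteq> j \<Longrightarrow> U\<in>Ob C \<Longrightarrow>
       h\<in>sec (mbase I ((\<lambda>l. X0 (H l))(i := X1 (H i), j := X1 (H j)))) U \<Longrightarrow>
          triv E i U (h(j := bd (H j) U (h j))) = triv E j U (h(i := bd (H i) U (h i)))"
    and e: "\<And>i U e h. i\<in>I \<Longrightarrow> U\<in>Ob C \<Longrightarrow> e\<in>sec (tot E) U \<Longrightarrow> h\<in>carrier (grp (X1 (H i)) U) \<Longrightarrow>
         plaw E i U (triv E i U ((proj E U e)(i := h))) e =
         plaw E i U e (triv E i U ((proj E U e)(i := xact (H i) U h (proj E U e i))))"
    using b unfolding butterfly_def Let_def by blast+
  show g: "gtorsor C G (mbase I (\<lambda>l. X0 (H l))) E" and "finite I" using m by (auto simp: multiextension_def)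
  have ax: "mext_axis C I (\<lambda>l. X0 (H l)) G E i" if "i \<in> I" for i
    by unfold_locales (use that g cG xmod_sheaves[OF cH] in auto)
  have l: "law_stage I (\<lambda>l. X0 (H l)) G E i U" and lr: "law_res C I E i" if "i \<in> I" "U \<in> Ob C" for i U
    using mext_axis.composition_law_iff[OF ax[OF that(1)]] m that by (auto simp: multiextension_def)
  show "law_res C I E i" if "i \<in> I" for i 
    using mext_axis.composition_law_iff[OF ax[OF that]] m that by (auto simp: multiextension_def)
  have ti: "(\<forall>U\<in>Ob C. triv_stage I H G E i (triv E i) U) \<and> triv_res C I H E i (triv E i)" if "i \<in> I" for i
    using trivialization_iff[OF cG cH g l that] t[OF that] by blast
  then show "i \<in> I \<Longrightarrow> triv_res C I H E i (triv E i)" for i by auto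
  assume U: "U \<in> Ob C"
  have 1: "tors_stage G U E (\<Pi>\<^sub>E l\<in>I. carrier (grp (X0 (H l)) U))"
    using tors_stageI[OF cG g U] by (simp add: mbase_sec)
  show "bfly_stage G U E I H"
  proof (intro bfly_stage.intro bfly_stage_axioms.intro 1 bxmod_stageI[OF bG U])
    show "xmod_stage (H l) U" if "l \<in> I" for l by (rule xmod_stageI[OF cH[OF that] U])
    fix i j a b c d assume *: "i \<in> I" "j \<in> I" "i \<noteq> j" "composable I E i U a b" "composable I E i U c d"
      "composable I E j U a c" "composable I E j U b d"
    then have "interchange C I G E i j" using m by (simp add: multiextension_def)
    then show "plaw E j U (plaw E i U a b) (plaw E i U c d) =
       plaw E i U (plaw E j U a c)
         (plaw E j U (ract E U b (inv\<^bsub>grp (X1 G) U\<^esub> (brd G U (str E U b) (str E U c)))) d)"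
      unfolding interchange_def using * U by blast
  next
    show "triv E i U (h(j := bd (H j) U (h j))) = triv E j U (h(i := bd (H i) U (h i)))"
      if "i \<in> I" "j \<in> I" "i \<noteq> j" "h \<in> (\<Pi>\<^sub>E l\<in>I. carrier (grp (((\<lambda>l. X0 (H l))(i := X1 (H i), j := X1 (H j))) l) U))" for i j h
      using c[OF that(1,2,3) U] that(4) by (simp only: mbase_sec)
  qed (use U l ti e in auto)
qed

lemma butterflyI:
  fixes G :: "('o, 'm, 'g) bxmod"
  assumes bG: "braided_crossed_module C G" and cH: "\<And>l. l \<in> I \<Longrightarrow> crossed_module C (H l)"
    and g: "gtorsor C G (mbase I (\<lambda>l. X0 (H l))) E" and fin: "finite I"
    and st: "\<And>U. U \<in> Ob C \<Longrightarrow> bfly_stage G U E I H"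
    and lr: "\<And>i. i \<in> I \<Longrightarrow> law_res C I E i" and tr: "\<And>i. i \<in> I \<Longrightarrow> triv_res C I H E i (triv E i)"
  shows "butterfly C I H G E"
proof -
  have cG: "crossed_module C G" using bG by (simp add: braided_crossed_module_def)
  have ax: "mext_axis C I (\<lambda>l. X0 (H l)) G E i" if "i \<in> I" for i
    by unfold_locales (use that g cG xmod_sheaves[OF cH] in auto)
  note l = bfly_stage.law[OF st]
  have "multiextension C I (\<lambda>l. X0 (H l)) G E"
    unfolding multiextension_def
  proof (intro conjI ballI impI fin g)
    show "composition_law C I (\<lambda>l. X0 (H l)) G E i" if "i \<in> I" for i
      using mext_axis.composition_law_iff[OF ax[OF that]] l lr that by auto
    show "interchange C I G E i j" if "i \<in> I" "j \<in> I" "i \<noteq> j" for i j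
      unfolding interchange_def using bfly_stage.inter[OF st that] by blast
  qed
  moreover have "trivialization C I H G E i (triv E i)" if "i \<in> I" for i
    using trivialization_iff[OF cG cH g l that] bfly_stage.trv[OF st that] tr[OF that] by blast
  ultimately show ?thesis
    unfolding butterfly_def Let_def mbase_sec
    using bfly_stage.trv_compat[OF st] bfly_stage.trv_comm[OF st] by blast
qed

end

section \<open>Calculus with the laws, the sections and the actions they define\<close>

context bfly_stage
begin

abbreviation "base \<equiv> \<Pi>\<^sub>E l\<in>I. carrier (grp (X0 (H l)) U)"
abbreviation "cmps i \<equiv> composable I E i U"

lemma cmps_iff: "cmps i u v \<longleftrightarrow> u \<in> sec (tot E) U \<and> v \<in> sec (tot E) U \<and> (\<forall>l\<in>I - {i}. proj E U u l = proj E U v l)"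
  by (simp add: composable_def)

lemma proj_mem: "u \<in> sec (tot E) U \<Longrightarrow> l \<in> I \<Longrightarrow> proj E U u l \<in> carrier (grp (X0 (H l)) U)"
  using proj_in by blast

lemma pl_in: "i \<in> I \<Longrightarrow> cmps i u v \<Longrightarrow> plaw E i U u v \<in> sec (tot E) U"
  and pl_proj: "i \<in> I \<Longrightarrow> cmps i u v \<Longrightarrow> proj E U (plaw E i U u v) =
      (proj E U u)(i := proj E U u i \<otimes>\<^bsub>grp (X0 (H i)) U\<^esub> proj E U v i)"
  and pl_str: "i \<in> I \<Longrightarrow> cmps i u v \<Longrightarrow> str E U (plaw E i U u v) = str E U u \<otimes>\<^bsub>grp (X0 G) U\<^esub> str E U v"
  and pl_ra: "i \<in> I \<Longrightarrow> cmps i u v \<Longrightarrow> g \<in> carrier (grp (X1 G) U) \<Longrightarrow>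
      plaw E i U u (ract E U v g) = ract E U (plaw E i U u v) g"
  and pl_bal: "i \<in> I \<Longrightarrow> cmps i u v \<Longrightarrow> g \<in> carrier (grp (X1 G) U) \<Longrightarrow>
      plaw E i U (ract E U u g) v = plaw E i U u (lact G E U g v)"
  and pl_assoc: "i \<in> I \<Longrightarrow> cmps i u v \<Longrightarrow> cmps i v w \<Longrightarrow>
      plaw E i U (plaw E i U u v) w = plaw E i U u (plaw E i U v w)"
  using law[of i] unfolding law_stage_def axis_mult_def prod.case by blast+

lemma cmps_upd: "cmps i u v \<Longrightarrow> (proj E U u)(i := k) = (proj E U v)(i := k)"
proof (rule ext)
  fix x assume c: "cmps i u v"
  then have "u \<in> sec (tot E) U" "v \<in> sec (tot E) U" by (auto simp: cmps_iff)
  then have "x \<notin> I \<Longrightarrow> proj E U u x = proj E U v x"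
    using PiE_arb[OF proj_in[of u], of x] PiE_arb[OF proj_in[of v], of x] by simp
  then show "((proj E U u)(i := k)) x = ((proj E U v)(i := k)) x" using c by (cases "x \<in> I") (auto simp: cmps_iff)
qed

lemma cmps_pl:
  assumes "i \<in> I" "cmps i u v"
  shows "cmps i (plaw E i U u v) w \<longleftrightarrow> cmps i u w" "cmps i w (plaw E i U u v) \<longleftrightarrow> cmps i w u"
    "cmps i w u \<longleftrightarrow> cmps i w v" "cmps i u w \<longleftrightarrow> cmps i v w" "cmps i v u"
  using assms pl_in[OF assms] pl_proj[OF assms] by (auto simp: cmps_iff)

text \<open>Balancing combined with the definition of the left action. Every twist by a structural
  value in the calculations below arises in this way.\<close>

lemma pl_ra_left:
  assumes i: "i \<in> I" "cmps i u v" and g: "g \<in> carrier (grp (X1 G) U)"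
  shows "plaw E i U (ract E U u g) v = ract E U (plaw E i U u v) (xact G U g (str E U v))"
proof -
  have "v \<in> sec (tot E) U" using i by (simp add: cmps_iff)
  then show ?thesis using pl_bal[OF i g] pl_ra[OF i act_in[OF g str_in]] by (simp add: lact_def)
qed

text \<open>\<open>tr i y k\<close> is \<open>s\<^sub>i(y\<^sub>1, \<dots>, k, \<dots>, y\<^sub>n)\<close>, and \<open>ac i u k\<close> is the right action of \<open>k\<close> on \<open>u\<close>.\<close>

definition tr where "tr i y k = triv E i U (y(i := k))"
definition ac where "ac i u k = plaw E i U u (triv E i U ((proj E U u)(i := k)))"

lemma ac_tr: "ac i u k = plaw E i U u (tr i (proj E U u) k)"
  by (simp add: ac_def tr_def)

lemma tr_cong: "y(i := k) = y'(i := k) \<Longrightarrow> tr i y k = tr i y' k"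
  by (simp add: tr_def)

lemma tr_upd: "tr i (y(i := z)) k = tr i y k"
  by (simp add: tr_def)

lemma base_upd: "y \<in> base \<Longrightarrow> i \<in> I \<Longrightarrow> k \<in> carrier (grp (X0 (H i)) U) \<Longrightarrow> y(i := k) \<in> base"
  by (rule PiE_upd)

lemma bdH: "i \<in> I \<Longrightarrow> k \<in> carrier (grp (X1 (H i)) U) \<Longrightarrow> bd (H i) U k \<in> carrier (grp (X0 (H i)) U)"
  by (rule xmod_stage.bd_in[OF xH])

lemma xfam_upd: "y \<in> base \<Longrightarrow> i \<in> I \<Longrightarrow> k \<in> carrier (grp (X1 (H i)) U) \<Longrightarrow>
    y(i := k) \<in> (\<Pi>\<^sub>E l\<in>I. carrier (grp (xfam H i l) U))"
  by (auto simp: PiE_iff extensional_def)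

lemma
  assumes "i \<in> I" "y \<in> base" "k \<in> carrier (grp (X1 (H i)) U)"
  shows tr_in: "tr i y k \<in> sec (tot E) U"
    and tr_proj: "proj E U (tr i y k) = y(i := bd (H i) U k)"
    and tr_str: "str E U (tr i y k) = \<one>\<^bsub>grp (X0 G) U\<^esub>"
  using trv[OF assms(1)] xfam_upd[OF assms(2,1,3)] unfolding triv_stage_def tr_def by auto

lemma tr_mult:
  assumes "l \<in> I" "i \<in> I" "y \<in> base" "k \<in> carrier (grp (X1 (H i)) U)" "y' \<in> base" "k' \<in> carrier (grp (X1 (H i)) U)"
    and "\<forall>t\<in>I - {l}. (y(i := k)) t = (y'(i := k')) t"
  shows "plaw E l U (tr i y k) (tr i y' k') = triv E i U (axis_mult (xfam H i) l U (y(i := k), y'(i := k')))"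
  using trv[OF assms(2)] xfam_upd[OF assms(3,2,4)] xfam_upd[OF assms(5,2,6)] assms(1,7)
  unfolding triv_stage_def tr_def by blast

lemma tr_same:
  assumes "i \<in> I" "y \<in> base" "k \<in> carrier (grp (X1 (H i)) U)" "k' \<in> carrier (grp (X1 (H i)) U)"
  shows "plaw E i U (tr i y k) (tr i y k') = tr i y (k \<otimes>\<^bsub>grp (X1 (H i)) U\<^esub> k')"
  using tr_mult[OF assms(1,1,2,3,2,4)] by (simp add: axis_mult_def tr_def)

lemma tr_other:
  assumes "i \<in> I" "l \<in> I" "l \<noteq> i" "y \<in> base" "y' \<in> base" "k \<in> carrier (grp (X1 (H i)) U)"
    and e: "\<forall>t\<in>I - {l, i}. y t = y' t"
  shows "plaw E l U (tr i y k) (tr i y' k) = tr i (y(l := y l \<otimes>\<^bsub>grp (X0 (H l)) U\<^esub> y' l)) k"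
proof -
  have "\<forall>t\<in>I - {l}. (y(i := k)) t = (y'(i := k)) t" using e by auto
  from tr_mult[OF assms(2,1,4,6,5,6) this] show ?thesis
    using assms(3) by (simp add: axis_mult_def tr_def fun_upd_twist)
qed

lemma tr_compat:
  assumes "i \<in> I" "j \<in> I" "i \<noteq> j" "y \<in> base" "k \<in> carrier (grp (X1 (H i)) U)" "k' \<in> carrier (grp (X1 (H j)) U)"
  shows "tr i (y(j := bd (H j) U k')) k = tr j (y(i := bd (H i) U k)) k'"
proof -
  have "y(i := k, j := k') \<in> (\<Pi>\<^sub>E l\<in>I. carrier (grp (((\<lambda>l. X0 (H l))(i := X1 (H i), j := X1 (H j))) l) U))"
    using assms by (auto simp: PiE_iff extensional_def)
  from trv_compat[OF assms(1-3) this] show ?thesis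
    using assms(3) by (simp add: tr_def fun_upd_twist)
qed

context
  fixes i u k
  assumes i: "i \<in> I" and u: "u \<in> sec (tot E) U" and k: "k \<in> carrier (grp (X1 (H i)) U)"
begin

lemma ac_cmps: "cmps i u (tr i (proj E U u) k)"
  using i u k proj_in[OF u] by (simp add: cmps_iff tr_in tr_proj)

lemma ac_in: "ac i u k \<in> sec (tot E) U"
  unfolding ac_tr by (rule pl_in[OF i ac_cmps])

lemma ac_proj: "proj E U (ac i u k) = (proj E U u)(i := proj E U u i \<otimes>\<^bsub>grp (X0 (H i)) U\<^esub> bd (H i) U k)"
  using i u k proj_in[OF u] by (simp add: ac_tr pl_proj[OF i ac_cmps] tr_proj)

lemma ac_str: "str E U (ac i u k) = str E U u"
  using i u k proj_in[OF u] by (simp add: ac_tr pl_str[OF i ac_cmps] tr_str str_in)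

lemma ac_ra:
  assumes g: "g \<in> carrier (grp (X1 G) U)"
  shows "ac i (ract E U u g) k = ract E U (ac i u k) g"
  using pl_ra_left[OF i ac_cmps g] g i u k proj_in[OF u] by (simp add: ac_tr ra_proj tr_str act_one)

end

lemma ac_mult:
  assumes i: "i \<in> I" and u: "u \<in> sec (tot E) U" and k: "k \<in> carrier (grp (X1 (H i)) U)" "k' \<in> carrier (grp (X1 (H i)) U)"
  shows "ac i (ac i u k) k' = ac i u (k \<otimes>\<^bsub>grp (X1 (H i)) U\<^esub> k')"
proof -
  note y = proj_in[OF u]
  have "ac i (ac i u k) k' = plaw E i U (plaw E i U u (tr i (proj E U u) k)) (tr i (proj E U u) k')"
    using ac_proj[OF i u k(1)] by (simp add: ac_tr[of i "ac i u k"] tr_upd) (simp add: ac_tr)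
  also have "\<dots> = plaw E i U u (plaw E i U (tr i (proj E U u) k) (tr i (proj E U u) k'))"
    using i u k y by (intro pl_assoc ac_cmps) (simp_all add: cmps_iff tr_in tr_proj)
  finally show ?thesis using i u k y by (simp add: tr_same ac_tr)
qed

text \<open>The unit acts by an idempotent which commutes with translations and preserves fibres; on
  a torsor such a map is the identity.\<close>

lemma ac_one:
  assumes i: "i \<in> I" and u: "u \<in> sec (tot E) U"
  shows "ac i u \<one>\<^bsub>grp (X1 (H i)) U\<^esub> = u"
proof -
  interpret Hi: xmod_stage "H i" U by (rule xH[OF i])
  have yi: "proj E U u i \<in> carrier (grp (X0 (H i)) U)" by (rule proj_mem[OF u i])
  note o = Hi.G1.one_closed
  have "proj E U (ac i u \<one>\<^bsub>grp (X1 (H i)) U\<^esub>) = proj E U u"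
    using ac_proj[OF i u o] yi by (simp add: Hi.bd_one)
  then obtain g where g: "g \<in> carrier (grp (X1 G) U)" "ac i u \<one>\<^bsub>grp (X1 (H i)) U\<^esub> = ract E U u g"
    using ra_ex[OF u ac_in[OF i u o]] by metis
  have "ract E U u g = ac i (ac i u \<one>\<^bsub>grp (X1 (H i)) U\<^esub>) \<one>\<^bsub>grp (X1 (H i)) U\<^esub>"
    using ac_mult[OF i u o o] g by simp
  also have "\<dots> = ract E U (ract E U u g) g" using ac_ra[OF i u o g(1)] g by simp
  finally have "g = \<one>\<^bsub>grp (X1 G) U\<^esub>" using ra_free_one[OF ra_in[OF u g(1)] g(1)] by simp
  then show ?thesis using g u by (simp add: ra_one)
qed

text \<open>Interchange for the square with corners \<open>u\<close>, a value of
  \<open>s\<^sub>i\<close>, a value of \<open>s\<^sub>j\<close>, and a point \<open>d\<close> that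
  is a value of both sections by \<open>tr_compat\<close>. The braiding disappears because sections
  have trivial structural value.\<close>

lemma ac_ac:
  assumes ij: "i \<in> I" "j \<in> I" "i \<noteq> j" and u: "u \<in> sec (tot E) U"
    and k: "k \<in> carrier (grp (X1 (H i)) U)" "k' \<in> carrier (grp (X1 (H j)) U)"
  shows "ac j (ac i u k) k' = ac i (ac j u k') k"
proof -
  define y where "y = proj E U u"
  note y = proj_in[OF u, folded y_def]
  note bi = bdH[OF ij(1) k(1)] and bj = bdH[OF ij(2) k(2)]
  note yi = base_upd[OF y ij(1) bi] and yj = base_upd[OF y ij(2) bj]
  define b where "b = tr i y k"
  define c where "c = tr j y k'"
  define d where "d = tr j (y(i := bd (H i) U k)) k'"
  have d': "d = tr i (y(j := bd (H j) U k')) k" unfolding d_def using tr_compat[OF ij y k] by simp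
  have cd: "plaw E i U c d = tr j (y(i := y i \<otimes>\<^bsub>grp (X0 (H i)) U\<^esub> bd (H i) U k)) k'"
    unfolding c_def d_def using tr_other[OF ij(2,1,3) y yi k(2)] by simp
  have bd: "plaw E j U b d = tr i (y(j := y j \<otimes>\<^bsub>grp (X0 (H j)) U\<^esub> bd (H j) U k')) k"
    unfolding b_def d' using tr_other[OF ij(1,2) ij(3)[symmetric] y yj k(1)] by simp
  have b: "b \<in> sec (tot E) U" "proj E U b = y(i := bd (H i) U k)" "str E U b = \<one>\<^bsub>grp (X0 G) U\<^esub>"
    using ij y k by (simp_all add: b_def tr_in tr_proj tr_str)
  have c: "c \<in> sec (tot E) U" "proj E U c = y(j := bd (H j) U k')" "str E U c = \<one>\<^bsub>grp (X0 G) U\<^esub>"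
    using ij y k by (simp_all add: c_def tr_in tr_proj tr_str)
  have d: "d \<in> sec (tot E) U" "proj E U d = y(i := bd (H i) U k, j := bd (H j) U k')"
    using ij yi k by (simp_all add: d_def tr_in tr_proj)
  have "plaw E j U (plaw E i U u b) (plaw E i U c d) = plaw E i U (plaw E j U u c)
         (plaw E j U (ract E U b (inv\<^bsub>grp (X1 G) U\<^esub> (brd G U (str E U b) (str E U c)))) d)"
    by (rule inter[OF ij]) (use u b(1,2) c(1,2) d y_def in \<open>auto simp: cmps_iff\<close>)
  also have "ract E U b (inv\<^bsub>grp (X1 G) U\<^esub> (brd G U (str E U b) (str E U c))) = b"
    using b c by (simp add: brd_one_left ra_one)
  finally have *: "plaw E j U (plaw E i U u b) (plaw E i U c d) = plaw E i U (plaw E j U u c) (plaw E j U b d)" .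
  have "ac j (ac i u k) k' = plaw E j U (ac i u k) (tr j (y(i := y i \<otimes>\<^bsub>grp (X0 (H i)) U\<^esub> bd (H i) U k)) k')"
    using ac_proj[OF ij(1) u k(1)] by (simp add: ac_tr[of j "ac i u k"] y_def)
  also have "\<dots> = plaw E i U (ac j u k') (tr i (y(j := y j \<otimes>\<^bsub>grp (X0 (H j)) U\<^esub> bd (H j) U k')) k)"
    using *[unfolded cd bd] by (simp add: ac_tr y_def[symmetric] b_def c_def)
  also have "\<dots> = ac i (ac j u k') k"
    using ac_proj[OF ij(2) u k(2)] by (simp add: ac_tr[of i "ac j u k'"] y_def)
  finally show ?thesis .
qed

lemma ac_pl_right:
  assumes i: "i \<in> I" and c: "cmps i u v" and k: "k \<in> carrier (grp (X1 (H i)) U)"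
  shows "plaw E i U u (ac i v k) = ac i (plaw E i U u v) k"
proof -
  have v: "v \<in> sec (tot E) U" using c by (simp add: cmps_iff)
  have "tr i (proj E U (plaw E i U u v)) k = tr i (proj E U v) k"
    using pl_proj[OF i c] cmps_upd[OF c, of k] by (intro tr_cong) simp
  then show ?thesis
    using pl_assoc[OF i c ac_cmps[OF i v k]] by (simp add: ac_tr)
qed

text \<open>The commutation rule moves the section past \<open>v\<close>, twisting its argument by
  the coordinate of \<open>v\<close>. This is the counterpart for \<open>ac\<close> of
  \<open>pl_ra_left\<close>, with the coordinate in the base in place of the structural
  value.\<close>

lemma ac_pl_left:
  assumes i: "i \<in> I" and c: "cmps i u v" and k: "k \<in> carrier (grp (X1 (H i)) U)"
  shows "plaw E i U (ac i u k) v = ac i (plaw E i U u v) (xact (H i) U k (proj E U v i))"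
proof -
  have uv: "u \<in> sec (tot E) U" "v \<in> sec (tot E) U" using c by (auto simp: cmps_iff)
  have kv: "xact (H i) U k (proj E U v i) \<in> carrier (grp (X1 (H i)) U)"
    using xmod_stage.act_in[OF xH[OF i] k proj_mem[OF uv(2) i]] .
  have t: "tr i (proj E U u) k = tr i (proj E U v) k" by (rule tr_cong[OF cmps_upd[OF c]])
  have c1: "cmps i u (tr i (proj E U v) k)" using ac_cmps[OF i uv(1) k] t by simp
  have c2: "cmps i (tr i (proj E U v) k) v"
    using c1 cmps_pl(4)[OF i c1, of v] c by simp
  have "plaw E i U (ac i u k) v = plaw E i U u (plaw E i U (tr i (proj E U v) k) v)"
    using pl_assoc[OF i c1 c2] t by (simp add: ac_tr)
  also have "plaw E i U (tr i (proj E U v) k) v = ac i v (xact (H i) U k (proj E U v i))"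
    using trv_comm[OF i uv(2) k] by (simp add: ac_def tr_def)
  finally show ?thesis using ac_pl_right[OF i c kv] by simp
qed

text \<open>Interchange with values of the section as second factors in direction \<open>l\<close>;
  one entry of the braiding is the unit.\<close>

lemma ac_pl_other:
  assumes il: "i \<in> I" "l \<in> I" "l \<noteq> i" and c: "cmps i u v" and k: "k \<in> carrier (grp (X1 (H l)) U)"
  shows "plaw E i U (ac l u k) (ac l v k) = ac l (plaw E i U u v) k"
proof -
  have uv: "u \<in> sec (tot E) U" "v \<in> sec (tot E) U" "\<forall>t\<in>I - {i}. proj E U u t = proj E U v t"
    using c by (auto simp: cmps_iff)
  note y = proj_in[OF uv(1)] and y' = proj_in[OF uv(2)]
  define b where "b = tr l (proj E U u) k"
  define d where "d = tr l (proj E U v) k"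
  have b: "b \<in> sec (tot E) U" "proj E U b = (proj E U u)(l := bd (H l) U k)" "str E U b = \<one>\<^bsub>grp (X0 G) U\<^esub>"
    using il y k by (simp_all add: b_def tr_in tr_proj tr_str)
  have d: "d \<in> sec (tot E) U" "proj E U d = (proj E U v)(l := bd (H l) U k)"
    using il y' k by (simp_all add: d_def tr_in tr_proj)
  have "plaw E i U (plaw E l U u b) (plaw E l U v d) = plaw E l U (plaw E i U u v)
         (plaw E i U (ract E U b (inv\<^bsub>grp (X1 G) U\<^esub> (brd G U (str E U b) (str E U v)))) d)"
    by (rule inter[OF il(2,1,3)]) (use uv b(1,2) d in \<open>auto simp: cmps_iff\<close>)
  also have "ract E U b (inv\<^bsub>grp (X1 G) U\<^esub> (brd G U (str E U b) (str E U v))) = b"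
    using b uv by (simp add: brd_one_left ra_one str_in)
  also have "plaw E i U b d = tr l ((proj E U u)(i := proj E U u i \<otimes>\<^bsub>grp (X0 (H i)) U\<^esub> proj E U v i)) k"
    unfolding b_def d_def using il uv(3) by (intro tr_other y y' k) auto
  finally show ?thesis unfolding ac_tr b_def d_def by (simp only: pl_proj[OF il(1) c])
qed

text \<open>The commutation rule reduces this to the action of the unit. With \<open>ac_one\<close>
  the unit section is neutral on both sides.\<close>

lemma tr_one_left:
  assumes i: "i \<in> I" and u: "u \<in> sec (tot E) U"
  shows "plaw E i U (tr i (proj E U u) \<one>\<^bsub>grp (X1 (H i)) U\<^esub>) u = u"
proof -
  interpret Hi: xmod_stage "H i" U by (rule xH[OF i])
  show ?thesis
    using trv_comm[OF i u Hi.G1.one_closed] ac_one[OF i u] proj_mem[OF u i]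
    by (simp add: ac_def tr_def Hi.act_1)
qed

text \<open>At the unit, \<open>s\<^sub>i\<close> agrees with the section in direction
  \<open>l\<close> by \<open>tr_compat\<close>. The factor by which \<open>k\<close> acts is thus
  again a unit section, and multiplicativity in the coordinate \<open>l\<close> applies.\<close>

lemma ac_tr_one:
  assumes il: "i \<in> I" "l \<in> I" "l \<noteq> i" and y: "y \<in> base" and k: "k \<in> carrier (grp (X1 (H l)) U)"
  shows "ac l (tr i y \<one>\<^bsub>grp (X1 (H i)) U\<^esub>) k = tr i (y(l := y l \<otimes>\<^bsub>grp (X0 (H l)) U\<^esub> bd (H l) U k)) \<one>\<^bsub>grp (X1 (H i)) U\<^esub>"
proof -
  interpret Hi: xmod_stage "H i" U by (rule xH[OF il(1)])
  have "tr l (proj E U (tr i y \<one>\<^bsub>grp (X1 (H i)) U\<^esub>)) k = tr i (y(l := bd (H l) U k)) \<one>\<^bsub>grp (X1 (H i)) U\<^esub>"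
    using tr_compat[OF il(1,2) il(3)[symmetric] y Hi.G1.one_closed k] il y by (simp add: tr_proj)
  then show ?thesis
    using tr_other[OF il y base_upd[OF y il(2) bdH[OF il(2) k]] Hi.G1.one_closed] by (simp add: ac_tr)
qed

context
  fixes i j a b c d
  assumes ij: "i \<in> I" "j \<in> I" "i \<noteq> j"
    and ab: "cmps i a b" and cd: "cmps i c d" and ac: "cmps j a c" and bd: "cmps j b d"
begin

lemma inter_cmps: "cmps j (plaw E i U a b) (plaw E i U c d)" "cmps i (plaw E j U a c) (plaw E j U b d)"
  using pl_in[OF ij(1) ab] pl_in[OF ij(1) cd] pl_in[OF ij(2) ac] pl_in[OF ij(2) bd]
    pl_proj[OF ij(1) ab] pl_proj[OF ij(1) cd] pl_proj[OF ij(2) ac] pl_proj[OF ij(2) bd] ab cd ac bd ij(3)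
  by (auto simp: cmps_iff)

text \<open>Brings the braiding of the interchange law out as one translation; passing over
  \<open>d\<close> twists it by the structural value of \<open>d\<close>.\<close>

lemma inter_ra:
  "plaw E j U (plaw E i U a b) (plaw E i U c d) =
    ract E U (plaw E i U (plaw E j U a c) (plaw E j U b d))
      (xact G U (inv\<^bsub>grp (X1 G) U\<^esub> (brd G U (str E U b) (str E U c))) (str E U d))"
proof -
  have m: "b \<in> sec (tot E) U" "c \<in> sec (tot E) U" "d \<in> sec (tot E) U" using ab cd by (auto simp: cmps_iff)
  then have k: "inv\<^bsub>grp (X1 G) U\<^esub> (brd G U (str E U b) (str E U c)) \<in> carrier (grp (X1 G) U)"
    by (simp add: brd_in str_in)
  show ?thesis
    unfolding inter[OF ij ab cd ac bd] pl_ra_left[OF ij(2) bd k]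
    by (rule pl_ra[OF ij(1) inter_cmps(2) act_in[OF k str_in[OF m(3)]]])
qed

end

text \<open>The interchange laws for \<open>(i, j)\<close> and for \<open>(j, i)\<close> together force the braiding to be symmetric.\<close>

lemma brd_sym:
  assumes ij: "i \<in> I" "j \<in> I" "i \<noteq> j"
    and ab: "cmps i a b" and cd: "cmps i c d" and ac: "cmps j a c" and bd: "cmps j b d"
  shows "brd G U (str E U b) (str E U c) = inv\<^bsub>grp (X1 G) U\<^esub> (brd G U (str E U c) (str E U b))"
proof -
  define x where "x = plaw E j U (plaw E i U a b) (plaw E i U c d)"
  define s where "s = brd G U (str E U b) (str E U c)"
  define t where "t = brd G U (str E U c) (str E U b)"
  have m: "b \<in> sec (tot E) U" "c \<in> sec (tot E) U" "d \<in> sec (tot E) U" using ab cd by (auto simp: cmps_iff)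
  have st: "s \<in> carrier (grp (X1 G) U)" "t \<in> carrier (grp (X1 G) U)" unfolding s_def t_def using m by (simp_all add: brd_in str_in)
  have sd: "str E U d \<in> carrier (grp (X0 G) U)" using m by (simp add: str_in)
  have x: "x \<in> sec (tot E) U" unfolding x_def by (rule pl_in[OF ij(2) inter_cmps(1)[OF ij ab cd ac bd]])
  \<comment> \<open>Both interchange laws in succession lead from \<open>x\<close> back to
    \<open>x\<close>, so the product of the two translations is trivial by freeness.\<close>
  have "x = ract E U (ract E U x (xact G U (inv\<^bsub>grp (X1 G) U\<^esub> t) (str E U d))) (xact G U (inv\<^bsub>grp (X1 G) U\<^esub> s) (str E U d))"
    using inter_ra[OF ij ab cd ac bd] inter_ra[OF ij(2,1) ij(3)[symmetric] ac bd ab cd]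
    unfolding x_def s_def t_def by simp
  also have "\<dots> = ract E U x (xact G U (inv\<^bsub>grp (X1 G) U\<^esub> t \<otimes>\<^bsub>grp (X1 G) U\<^esub> inv\<^bsub>grp (X1 G) U\<^esub> s) (str E U d))"
    using x st sd by (simp add: act_mult ra_mult act_in)
  finally have "xact G U (inv\<^bsub>grp (X1 G) U\<^esub> t \<otimes>\<^bsub>grp (X1 G) U\<^esub> inv\<^bsub>grp (X1 G) U\<^esub> s) (str E U d) = xact G U \<one>\<^bsub>grp (X1 G) U\<^esub> (str E U d)"
    using ra_free_one[OF x] st sd by (simp add: act_1 act_in)
  then have "inv\<^bsub>grp (X1 G) U\<^esub> t \<otimes>\<^bsub>grp (X1 G) U\<^esub> inv\<^bsub>grp (X1 G) U\<^esub> s = \<one>\<^bsub>grp (X1 G) U\<^esub>"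
    by (rule act_cancel[rotated 3]) (use st sd in auto)
  then have "inv\<^bsub>grp (X1 G) U\<^esub> (s \<otimes>\<^bsub>grp (X1 G) U\<^esub> t) = \<one>\<^bsub>grp (X1 G) U\<^esub>"
    using st by (simp add: G1.inv_mult_group)
  then have "s \<otimes>\<^bsub>grp (X1 G) U\<^esub> t = \<one>\<^bsub>grp (X1 G) U\<^esub>"
    using st by (metis G1.inv_inv G1.inv_one G1.m_closed)
  then show ?thesis using st unfolding s_def t_def by (metis G1.inv_equality)
qed

end

section \<open>The composite on points\<close>

locale comp_stage = E: bfly_stage G U E "{1..n}" H
  for G :: "('o, 'm, 'g) bxmod" and U and n :: nat and E :: "('o, 'm, nat, 'h, 'g, 'e) bfly"
    and H :: "nat \<Rightarrow> ('o, 'm, 'h) bxmod" +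
  fixes m :: "nat \<Rightarrow> nat" and F :: "nat \<Rightarrow> ('o, 'm, nat, 'k, 'h, 'f) bfly" and K :: "nat \<Rightarrow> nat \<Rightarrow> ('o, 'm, 'k) xmod"
  assumes bE: "i \<in> {1..n} \<Longrightarrow> composable {1..n} E i U e e' \<Longrightarrow>
         plaw E i U e' e =
         ract E U
           (plaw E i U (plaw E i U e e')
             (triv E i U ((proj E U e)(i := inv\<^bsub>grp (X1 (H i)) U\<^esub> (brd (H i) U (proj E U e' i) (proj E U e i))))))
           (brd G U (str E U e) (str E U e'))"
    and Fs: "i \<in> {1..n} \<Longrightarrow> bfly_stage (H i) U (F i) {1..m i} (K i)"
begin

abbreviation "idx \<equiv> [1..<Suc n]"

lemma idx: "set idx = {1..n}" "distinct idx"
  by auto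

declare One_nat_def [simp del] atLeastAtMost_iff [simp del] upt_Suc [simp del] set_upt [simp del] idx [simp]

section \<open>Points of the equivariant torsor and the action of the product group\<close>

abbreviation "P \<equiv> comp_tors n F E"
abbreviation "V \<equiv> \<Pi>\<^sub>E i\<in>{1..n}. sec (tot (F i)) U"
abbreviation "act1 \<equiv> \<lambda>i. comp_act1 F E i U"
abbreviation "H1 i \<equiv> carrier (grp (X1 (H i)) U)"
text \<open>The base point of \<open>E\<close> over which the last component of a point with
  components \<open>v\<close> has to lie.\<close>

definition "ys v = (\<lambda>i\<in>{1..n}. str (F i) U (v i))"

lemma P_mem: "(v, u) \<in> sec (tot P) U \<longleftrightarrow> v \<in> V \<and> u \<in> sec (tot E) U \<and> proj E U u = ys v"
  by (auto simp: comp_tors_def pb_simps comp_base_def prod_sh_def ys_def)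

lemma P_simps: "ract P U (v, u) g = (v, ract E U u g)" "str P U (v, u) = str E U u" "proj P U (v, u) = v"
  by (simp_all add: comp_tors_def pb_simps)

lemma P_E:
  assumes "x \<in> sec (tot P) U"
  obtains v u where "x = (v, u)" "v \<in> V" "u \<in> sec (tot E) U" "proj E U u = ys v"
  using assms P_mem by (cases x) auto

lemma ys_in: "v \<in> V \<Longrightarrow> ys v \<in> E.base"
proof -
  assume v: "v \<in> V"
  have "str (F i) U (v i) \<in> carrier (grp (X0 (H i)) U)" if "i \<in> {1..n}" for i
  proof -
    interpret Fi: bfly_stage "H i" U "F i" "{1..m i}" "K i" by (rule Fs[OF that])
    show ?thesis using v that by (intro Fi.str_in) auto
  qed
  then show ?thesis by (simp add: ys_def)
qed

lemma ys_upd: "i \<in> {1..n} \<Longrightarrow> ys (v(i := w)) = (ys v)(i := str (F i) U w)"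
  by (auto simp: ys_def fun_eq_iff)

lemma ys_at: "i \<in> {1..n} \<Longrightarrow> ys v i = str (F i) U (v i)"
  by (simp add: ys_def)

lemma V_upd: "v \<in> V \<Longrightarrow> i \<in> {1..n} \<Longrightarrow> w \<in> sec (tot (F i)) U \<Longrightarrow> v(i := w) \<in> V"
  by (rule PiE_upd)

lemma V_at: "v \<in> V \<Longrightarrow> i \<in> {1..n} \<Longrightarrow> v i \<in> sec (tot (F i)) U"
  by (rule PiE_mem)

lemma act1_simp: "act1 i (v, u) h = (v(i := ract (F i) U (v i) h), E.ac i u h)"
  by (simp add: comp_act1_def E.ac_def)

lemma act1_in:
  assumes i: "i \<in> {1..n}" and x: "x \<in> sec (tot P) U" and h: "h \<in> H1 i"
  shows "act1 i x h \<in> sec (tot P) U"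
proof -
  interpret Fi: bfly_stage "H i" U "F i" "{1..m i}" "K i" by (rule Fs[OF i])
  obtain v u where e: "x = (v, u)" "v \<in> V" "u \<in> sec (tot E) U" "proj E U u = ys v" by (rule P_E[OF x])
  show ?thesis
    using e i h V_at[OF e(2) i]
    by (simp add: act1_simp P_mem V_upd Fi.ra_in E.ac_in E.ac_proj ys_upd Fi.str_ra ys_at)
qed

lemma act1_mult:
  assumes i: "i \<in> {1..n}" and x: "x \<in> sec (tot P) U" and h: "h \<in> H1 i" "h' \<in> H1 i"
  shows "act1 i (act1 i x h) h' = act1 i x (h \<otimes>\<^bsub>grp (X1 (H i)) U\<^esub> h')"
proof -
  interpret Fi: bfly_stage "H i" U "F i" "{1..m i}" "K i" by (rule Fs[OF i])
  obtain v u where e: "x = (v, u)" "v \<in> V" "u \<in> sec (tot E) U" "proj E U u = ys v" by (rule P_E[OF x])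
  show ?thesis
    using e i h V_at[OF e(2) i] by (simp add: act1_simp Fi.ra_mult E.ac_mult)
qed

lemma act1_one:
  assumes i: "i \<in> {1..n}" and x: "x \<in> sec (tot P) U"
  shows "act1 i x \<one>\<^bsub>grp (X1 (H i)) U\<^esub> = x"
proof -
  interpret Fi: bfly_stage "H i" U "F i" "{1..m i}" "K i" by (rule Fs[OF i])
  obtain v u where e: "x = (v, u)" "v \<in> V" "u \<in> sec (tot E) U" "proj E U u = ys v" by (rule P_E[OF x])
  show ?thesis
    using e i V_at[OF e(2) i] by (simp add: act1_simp Fi.ra_one E.ac_one)
qed

lemma act1_comm:
  assumes i: "i \<in> {1..n}" "j \<in> {1..n}" "i \<noteq> j" and x: "x \<in> sec (tot P) U" and h: "h \<in> H1 i" "k \<in> H1 j"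
  shows "act1 j (act1 i x h) k = act1 i (act1 j x k) h"
proof -
  obtain v u where e: "x = (v, u)" "v \<in> V" "u \<in> sec (tot E) U" "proj E U u = ys v" by (rule P_E[OF x])
  show ?thesis
    using e i(3) E.ac_ac[OF i e(3) h] by (simp add: act1_simp fun_upd_twist)
qed

lemma act1_str: "i \<in> {1..n} \<Longrightarrow> x \<in> sec (tot P) U \<Longrightarrow> h \<in> H1 i \<Longrightarrow> str P U (act1 i x h) = str P U x"
  by (erule P_E) (simp add: act1_simp P_simps E.ac_str)

lemma act1_ract: "i \<in> {1..n} \<Longrightarrow> x \<in> sec (tot P) U \<Longrightarrow> h \<in> H1 i \<Longrightarrow> g \<in> carrier (grp (X1 G) U) \<Longrightarrow>
    act1 i (ract P U x g) h = ract P U (act1 i x h) g"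
  by (erule P_E) (simp add: act1_simp P_simps E.ac_ra)

lemma P_ract_in: "x \<in> sec (tot P) U \<Longrightarrow> g \<in> carrier (grp (X1 G) U) \<Longrightarrow> ract P U x g \<in> sec (tot P) U"
  by (erule P_E) (simp add: P_simps P_mem E.ra_in E.ra_proj)

definition fa where "fa xs x h = foldl (\<lambda>q i. act1 i q (h i)) x xs"

lemma fa_Nil [simp]: "fa [] x h = x" and fa_snoc [simp]: "fa (xs @ [i]) x h = act1 i (fa xs x h) (h i)"
  by (simp_all add: fa_def)

context
  fixes h assumes h: "\<forall>i\<in>{1..n}. h i \<in> H1 i"
begin

lemma fa_in: "set xs \<subseteq> {1..n} \<Longrightarrow> x \<in> sec (tot P) U \<Longrightarrow> fa xs x h \<in> sec (tot P) U"
  using h by (induction xs rule: rev_induct) (auto intro!: act1_in)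

lemma fa_act1:
  "set xs \<subseteq> {1..n} \<Longrightarrow> x \<in> sec (tot P) U \<Longrightarrow> i \<in> {1..n} \<Longrightarrow> i \<notin> set xs \<Longrightarrow> k \<in> H1 i \<Longrightarrow>
    fa xs (act1 i x k) h = act1 i (fa xs x h) k"
proof (induction xs rule: rev_induct)
  case (snoc j xs)
  then show ?case using act1_comm[of i j "fa xs x h" k "h j"] fa_in[of xs x] h by auto
qed simp

text \<open>Actions in distinct directions commute, so any one of them may be performed last.
  Applied to the full list this separates the axis \<open>i\<close> from all others.\<close>

lemma fa_remove:
  "set xs \<subseteq> {1..n} \<Longrightarrow> x \<in> sec (tot P) U \<Longrightarrow> i \<in> set xs \<Longrightarrow> distinct xs \<Longrightarrow>
    fa xs x h = act1 i (fa (remove1 i xs) x h) (h i)"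
proof (induction xs rule: rev_induct)
  case (snoc j xs)
  show ?case
  proof (cases "i = j")
    case True
    then show ?thesis using snoc.prems by (simp add: remove1_append)
  next
    case False
    have s: "set (remove1 i xs) \<subseteq> {1..n}" using snoc.prems(1) set_remove1_subset[of i xs] by auto
    have "fa (xs @ [j]) x h = act1 j (act1 i (fa (remove1 i xs) x h) (h i)) (h j)"
      using snoc False by simp
    also have "\<dots> = act1 i (act1 j (fa (remove1 i xs) x h) (h j)) (h i)"
      using snoc.prems False h fa_in[OF s snoc.prems(2)] by (intro act1_comm) auto
    finally show ?thesis using snoc.prems False by (simp add: remove1_append)
  qed
qed simp

lemma fa_fst: "distinct xs \<Longrightarrow> fst (fa xs x h) = (\<lambda>l. if l \<in> set xs then ract (F l) U (fst x l) (h l) else fst x l)"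
proof (induction xs rule: rev_induct)
  case (snoc j xs)
  obtain v u where "fa xs x h = (v, u)" by fastforce
  then show ?case using snoc by (auto simp: act1_simp fun_eq_iff)
qed simp

lemma fa_str: "set xs \<subseteq> {1..n} \<Longrightarrow> x \<in> sec (tot P) U \<Longrightarrow> str P U (fa xs x h) = str P U x"
  using h by (induction xs rule: rev_induct) (auto simp: act1_str fa_in)

lemma fa_ract: "set xs \<subseteq> {1..n} \<Longrightarrow> x \<in> sec (tot P) U \<Longrightarrow> g \<in> carrier (grp (X1 G) U) \<Longrightarrow>
    fa xs (ract P U x g) h = ract P U (fa xs x h) g"
  using h by (induction xs rule: rev_induct) (auto simp: act1_ract fa_in)

end

lemma fa_mult:
  assumes h: "\<forall>i\<in>{1..n}. h i \<in> H1 i" and h': "\<forall>i\<in>{1..n}. h' i \<in> H1 i"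
  shows "set xs \<subseteq> {1..n} \<Longrightarrow> x \<in> sec (tot P) U \<Longrightarrow> distinct xs \<Longrightarrow>
    fa xs (fa xs x h) h' = fa xs x (\<lambda>i. h i \<otimes>\<^bsub>grp (X1 (H i)) U\<^esub> h' i)"
proof (induction xs rule: rev_induct)
  case (snoc j xs)
  have j: "j \<in> {1..n}" "set xs \<subseteq> {1..n}" using snoc.prems by auto
  have "fa xs (act1 j (fa xs x h) (h j)) h' = act1 j (fa xs (fa xs x h) h') (h j)"
    using snoc.prems j h fa_in[OF h j(2) snoc.prems(2)] by (intro fa_act1[OF h']) auto
  then show ?case
    using snoc j h h' act1_mult[OF j(1) fa_in[OF h' j(2) fa_in[OF h j(2) snoc.prems(2)]], of "h j" "h' j"] by simp
qed simp

lemma fa_one: "set xs \<subseteq> {1..n} \<Longrightarrow> x \<in> sec (tot P) U \<Longrightarrow> (\<forall>i\<in>set xs. h i = \<one>\<^bsub>grp (X1 (H i)) U\<^esub>) \<Longrightarrow> fa xs x h = x"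
  by (induction xs rule: rev_induct) (auto simp: act1_one)

lemma fa_cong: "(\<And>i. i \<in> set xs \<Longrightarrow> h i = h' i) \<Longrightarrow> fa xs x h = fa xs x h'"
  by (induction xs rule: rev_induct) auto

abbreviation "HH \<equiv> carrier (grp (comp_group n H) U)"

lemma HH_eq: "HH = (\<Pi>\<^sub>E i\<in>{1..n}. H1 i)"
  by (simp add: comp_group_def prod_gsh_def)

lemma HH_at: "h \<in> HH \<Longrightarrow> \<forall>i\<in>{1..n}. h i \<in> H1 i"
  by (auto simp: HH_eq)

lemma comp_act_fa: "comp_act n F E U x h = fa idx x h"
  by (simp add: comp_act_def fa_def)

lemma ca_in: "x \<in> sec (tot P) U \<Longrightarrow> h \<in> HH \<Longrightarrow> comp_act n F E U x h \<in> sec (tot P) U"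
  unfolding comp_act_fa by (rule fa_in[OF HH_at]) (auto simp: idx)

lemma ca_one: "x \<in> sec (tot P) U \<Longrightarrow> comp_act n F E U x \<one>\<^bsub>grp (comp_group n H) U\<^esub> = x"
  unfolding comp_act_fa by (rule fa_one) (auto simp: idx comp_group_def prod_gsh_def)

lemma ca_mult: "x \<in> sec (tot P) U \<Longrightarrow> h \<in> HH \<Longrightarrow> h' \<in> HH \<Longrightarrow>
    comp_act n F E U x (h \<otimes>\<^bsub>grp (comp_group n H) U\<^esub> h') = comp_act n F E U (comp_act n F E U x h) h'"
  unfolding comp_act_fa using fa_mult[OF HH_at HH_at, of h h' idx x] idx
  by (auto simp: idx comp_group_def prod_gsh_def intro!: fa_cong)

lemma ca_str: "x \<in> sec (tot P) U \<Longrightarrow> h \<in> HH \<Longrightarrow> str P U (comp_act n F E U x h) = str P U x"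
  unfolding comp_act_fa by (rule fa_str[OF HH_at]) (auto simp: idx)

lemma ca_ract: "x \<in> sec (tot P) U \<Longrightarrow> h \<in> HH \<Longrightarrow> g \<in> carrier (grp (X1 G) U) \<Longrightarrow>
    comp_act n F E U (ract P U x g) h = ract P U (comp_act n F E U x h) g"
  unfolding comp_act_fa by (rule fa_ract[OF HH_at]) (auto simp: idx)

lemma ca_fst: "x \<in> sec (tot P) U \<Longrightarrow> h \<in> HH \<Longrightarrow> fst (comp_act n F E U x h) = comp_base_act n F U (fst x) h"
proof -
  assume x: "x \<in> sec (tot P) U" and h: "h \<in> HH"
  have "fst (fa idx x h) = (\<lambda>l. if l \<in> set idx then ract (F l) U (fst x l) (h l) else fst x l)"
    by (rule fa_fst[OF HH_at[OF h] idx(2)])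
  \<comment> \<open>Tuples are extensional: outside the index range both sides have the default
    value.\<close>
  moreover have "fst x l = undefined" if "l \<notin> {1..n}" for l
    using P_E[OF x] that by (metis PiE_arb fst_conv)
  ultimately show ?thesis unfolding comp_act_fa comp_base_act_def idx(1) by (auto simp: fun_eq_iff restrict_def)
qed

lemma act1_ca:
  assumes i: "i \<in> {1..n}" and x: "x \<in> sec (tot P) U" and k: "k \<in> H1 i"
  obtains h where "h \<in> HH" "act1 i x k = comp_act n F E U x h"
proof -
  define h where "h = (\<lambda>l\<in>{1..n}. if l = i then k else \<one>\<^bsub>grp (X1 (H l)) U\<^esub>)"
  have h: "h \<in> HH" unfolding HH_eq h_def using k xmod_stage.grp1[OF E.xH] by (auto simp: group.is_monoid monoid.one_closed)
  have s: "set (remove1 i idx) \<subseteq> {1..n}" using set_remove1_subset[of i idx] idx by auto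
  have "comp_act n F E U x h = act1 i (fa (remove1 i idx) x h) (h i)"
    unfolding comp_act_fa by (rule fa_remove[OF HH_at[OF h]]) (use x i idx in auto)
  also have "fa (remove1 i idx) x h = x" using idx(2) s by (intro fa_one x) (auto simp: h_def)
  also have "h i = k" using i by (simp add: h_def)
  finally show ?thesis using that[OF h] by simp
qed

text \<open>On \<open>F\<^sub>i\<close> this is the definition of the left action, on
  \<open>E\<close> it is the commutation rule for \<open>s\<^sub>i\<close>. The twists agree since
  the structural value of \<open>v i\<close> is the \<open>i\<close>-th coordinate of
  \<open>u\<close>.\<close>

lemma left_act1:
  assumes i: "i \<in> {1..n}" and x: "(v, u) \<in> sec (tot P) U" and h: "h \<in> H1 i"
  shows "comp_left_act1 H F E i U h (v, u) = act1 i (v, u) (xact (H i) U h (proj E U u i))"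
  using x i E.trv_comm[OF i _ h, of u] by (simp add: comp_left_act1_def act1_simp E.ac_def P_mem lact_def ys_at)

lemma V_ract_free:
  assumes i: "i \<in> {1..n}" and v: "v \<in> V" and h: "h \<in> H1 i" "h' \<in> H1 i" and e: "ract (F i) U (v i) h = ract (F i) U (v i) h'"
  shows "h = h'"
proof -
  interpret Fi: bfly_stage "H i" U "F i" "{1..m i}" "K i" by (rule Fs[OF i])
  show ?thesis using Fi.ra_free V_at[OF v i] h e by blast
qed

text \<open>Freeness can be seen on the components in \<open>F\<close> alone. This stronger form
  also serves to show that the quotient is a torsor, where points are compared up to translation of
  the last component.\<close>

lemma ca_free_fst:
  assumes x: "x \<in> sec (tot P) U" and h: "h \<in> HH" "h' \<in> HH"
    and e: "fst (comp_act n F E U x h) = fst (comp_act n F E U x h')"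
  shows "h = h'"
proof (rule PiE_ext)
  obtain v u where x': "x = (v, u)" "v \<in> V" by (rule P_E[OF x])
  show "h \<in> PiE {1..n} H1" "h' \<in> PiE {1..n} H1" using h by (simp_all add: HH_eq)
  fix i assume i: "i \<in> {1..n}"
  have "ract (F i) U (v i) (h i) = ract (F i) U (v i) (h' i)"
    using fun_cong[OF e, of i] ca_fst[OF x h(1)] ca_fst[OF x h(2)] i x' by (simp add: comp_base_act_def)
  then show "h i = h' i" using V_ract_free[OF i x'(2)] HH_at h i by blast
qed

text \<open>Each \<open>F\<^sub>i\<close> is a torsor under
  \<open>H\<^sub>i\<^sub>,\<^sub>1\<close>, so its component can be moved to any other point of its
  fibre, independently for each \<open>i\<close>.\<close>

lemma ca_move:
  assumes x: "x \<in> sec (tot P) U" and v': "v' \<in> V"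
    and e: "\<And>i. i \<in> {1..n} \<Longrightarrow> proj (F i) U (fst x i) = proj (F i) U (v' i)"
  obtains h where "h \<in> HH" "fst (comp_act n F E U x h) = v'"
proof -
  obtain v u where x': "x = (v, u)" "v \<in> V" by (rule P_E[OF x])
  have "\<exists>g. g \<in> H1 i \<and> v' i = ract (F i) U (v i) g" if i: "i \<in> {1..n}" for i
  proof -
    interpret Fi: bfly_stage "H i" U "F i" "{1..m i}" "K i" by (rule Fs[OF i])
    show ?thesis using Fi.ra_ex[OF V_at[OF x'(2) i] V_at[OF v' i]] e[OF i] x' by (metis fst_conv)
  qed
  then obtain g where g: "\<And>i. i \<in> {1..n} \<Longrightarrow> g i \<in> H1 i \<and> v' i = ract (F i) U (v i) (g i)" by metis
  define h where "h = restrict g {1..n}"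
  have h: "h \<in> HH" unfolding HH_eq h_def using g by auto
  have "fst (comp_act n F E U x h) = v'"
    unfolding ca_fst[OF x h] comp_base_act_def
  proof (rule ext)
    fix i show "(\<lambda>i\<in>{1..n}. ract (F i) U (fst x i) (h i)) i = v' i"
      using g[of i] PiE_arb[OF v', of i] x' by (cases "i \<in> {1..n}") (simp_all add: h_def)
  qed
  then show ?thesis using that h by blast
qed

text \<open>The pairs for which a product along \<open>(i, j)\<close> can be written down: at the
  other outer indices the components themselves coincide, not merely their projections.\<close>

definition matched where
  "matched i j x x' \<longleftrightarrow> i \<in> {1..n} \<and> j \<in> {1..m i} \<and> x \<in> sec (tot P) U \<and> x' \<in> sec (tot P) U \<and>
    (\<forall>l\<in>{1..n} - {i}. fst x l = fst x' l) \<and>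
    (\<forall>l\<in>{1..m i} - {j}. proj (F i) U (fst x i) l = proj (F i) U (fst x' i) l)"

definition md where
  "md i j x x' = ((fst x)(i := plaw (F i) j U (fst x i) (fst x' i)), plaw E i U (snd x) (snd x'))"

lemma md_simp: "md i j (v, u) (v', u') = (v(i := plaw (F i) j U (v i) (v' i)), plaw E i U u u')"
  by (simp add: md_def)

text \<open>The normal form of matched pairs for calculation. Composability of the last components
  along \<open>i\<close> is automatic, as their base points are read off from the components in
  \<open>F\<close>.\<close>

lemma matchedE:
  assumes "matched i j x x'"
  obtains v u w u' where "x = (v, u)" "x' = (v(i := w), u')" "i \<in> {1..n}" "j \<in> {1..m i}"
    "v \<in> V" "w \<in> sec (tot (F i)) U" "u \<in> sec (tot E) U" "u' \<in> sec (tot E) U"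
    "proj E U u = ys v" "proj E U u' = (ys v)(i := str (F i) U w)"
    "composable {1..m i} (F i) j U (v i) w" "composable {1..n} E i U u u'"
proof -
  have i: "i \<in> {1..n}" and j: "j \<in> {1..m i}" and x: "x \<in> sec (tot P) U" "x' \<in> sec (tot P) U"
    and e: "\<forall>l\<in>{1..n} - {i}. fst x l = fst x' l" and p: "\<forall>l\<in>{1..m i} - {j}. proj (F i) U (fst x i) l = proj (F i) U (fst x' i) l"
    using assms by (auto simp: matched_def)
  obtain v u where v: "x = (v, u)" "v \<in> V" "u \<in> sec (tot E) U" "proj E U u = ys v" by (rule P_E[OF x(1)])
  obtain v' u' where v': "x' = (v', u')" "v' \<in> V" "u' \<in> sec (tot E) U" "proj E U u' = ys v'" by (rule P_E[OF x(2)])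
  have eq: "v' = v(i := v' i)"
  proof (rule ext)
    fix l show "v' l = (v(i := v' i)) l"
      using e v v' PiE_arb[OF v(2), of l] PiE_arb[OF v'(2), of l] by (cases "l \<in> {1..n}") auto
  qed
  have "composable {1..m i} (F i) j U (v i) (v' i)" using V_at[OF v(2) i] V_at[OF v'(2) i] p v v' by (simp add: composable_def)
  moreover have "proj E U u' = (ys v)(i := str (F i) U (v' i))" using v'(4) ys_upd[OF i, of v "v' i"] eq by simp
  moreover from this have "composable {1..n} E i U u u'" using v v' by (simp add: composable_def)
  ultimately show ?thesis using that[of v u "v' i" u'] v v' i j eq V_at[OF v'(2) i] by metis
qed

lemma matchedI:
  assumes "i \<in> {1..n}" "composable {1..m i} (F i) j U (v i) w" "j \<in> {1..m i}" "(v, u) \<in> sec (tot P) U" "(v(i := w), u') \<in> sec (tot P) U"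
  shows "matched i j (v, u) (v(i := w), u')"
  using assms by (auto simp: matched_def composable_def)

lemma md_in:
  assumes "matched i j x x'"
  shows "md i j x x' \<in> sec (tot P) U"
  using assms
proof (rule matchedE)
  fix v u w u' assume h: "x = (v, u)" "x' = (v(i := w), u')" "i \<in> {1..n}" "j \<in> {1..m i}"
    "v \<in> V" "w \<in> sec (tot (F i)) U" "u \<in> sec (tot E) U" "u' \<in> sec (tot E) U"
    "proj E U u = ys v" "proj E U u' = (ys v)(i := str (F i) U w)"
    "composable {1..m i} (F i) j U (v i) w" "composable {1..n} E i U u u'"
  interpret Fi: bfly_stage "H i" U "F i" "{1..m i}" "K i" by (rule Fs[OF h(3)])
  show ?thesis using h by (simp add: md_simp P_mem V_upd Fi.pl_in E.pl_in E.pl_proj Fi.pl_str ys_upd ys_at)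
qed

lemma md_str:
  assumes "matched i j x x'"
  shows "str P U (md i j x x') = str P U x \<otimes>\<^bsub>grp (X0 G) U\<^esub> str P U x'"
  using assms by (rule matchedE) (simp add: md_simp P_simps E.pl_str)

lemma md_ract:
  assumes "matched i j x x'" and "g \<in> carrier (grp (X1 G) U)"
  shows "md i j x (ract P U x' g) = ract P U (md i j x x') g"
    and "md i j (ract P U x g) x' = md i j x (lact G P U g x')"
  using assms by (auto elim!: matchedE simp: md_simp P_simps E.pl_ra E.pl_bal[unfolded lact_def] lact_def)

lemma md_proj:
  assumes "matched i j x x'"
  shows "proj (F i) U (fst (md i j x x') i) =
      (proj (F i) U (fst x i))(j := proj (F i) U (fst x i) j \<otimes>\<^bsub>grp (X0 (K i j)) U\<^esub> proj (F i) U (fst x' i) j)"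
    and "l \<noteq> i \<Longrightarrow> fst (md i j x x') l = fst x l"
proof -
  show "proj (F i) U (fst (md i j x x') i) =
      (proj (F i) U (fst x i))(j := proj (F i) U (fst x i) j \<otimes>\<^bsub>grp (X0 (K i j)) U\<^esub> proj (F i) U (fst x' i) j)"
    using assms
  proof (rule matchedE)
    fix v u w u' assume h: "x = (v, u)" "x' = (v(i := w), u')" "i \<in> {1..n}" "j \<in> {1..m i}"
      "composable {1..m i} (F i) j U (v i) w"
    interpret Fi: bfly_stage "H i" U "F i" "{1..m i}" "K i" by (rule Fs[OF h(3)])
    show ?thesis using h by (simp add: md_simp Fi.pl_proj)
  qed
  show "l \<noteq> i \<Longrightarrow> fst (md i j x x') l = fst x l" by (simp add: md_def)
qed

lemma md_assoc:
  assumes "matched i j x x'" "matched i j x' x''"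
  shows "md i j (md i j x x') x'' = md i j x (md i j x' x'')"
  using assms(1)
proof (rule matchedE)
  fix v u w u' assume h: "x = (v, u)" "x' = (v(i := w), u')" "i \<in> {1..n}" "j \<in> {1..m i}"
    "composable {1..m i} (F i) j U (v i) w" "composable {1..n} E i U u u'"
  interpret Fi: bfly_stage "H i" U "F i" "{1..m i}" "K i" by (rule Fs[OF h(3)])
  show ?thesis using assms(2)
  proof (rule matchedE)
    fix v2 u2 w2 u2' assume k: "x' = (v2, u2)" "x'' = (v2(i := w2), u2')" "composable {1..m i} (F i) j U (v2 i) w2" "composable {1..n} E i U u2 u2'"
    have "v2 = v(i := w)" "u2 = u'" using h(2) k(1) by auto
    then show ?thesis using h k by (simp add: md_simp Fi.pl_assoc E.pl_assoc)
  qed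
qed

lemma md_act1_right:
  assumes "matched i j x x'" and h: "k \<in> H1 i"
  shows "md i j x (act1 i x' k) = act1 i (md i j x x') k" "matched i j x (act1 i x' k)"
proof -
  have "md i j x (act1 i x' k) = act1 i (md i j x x') k \<and> matched i j x (act1 i x' k)"
    using assms(1)
  proof (rule matchedE)
    fix v u w u' assume h': "x = (v, u)" "x' = (v(i := w), u')" "i \<in> {1..n}" "j \<in> {1..m i}" "v \<in> V" "w \<in> sec (tot (F i)) U" "u \<in> sec (tot E) U" "u' \<in> sec (tot E) U"
      "composable {1..m i} (F i) j U (v i) w" "composable {1..n} E i U u u'"
    interpret Fi: bfly_stage "H i" U "F i" "{1..m i}" "K i" by (rule Fs[OF h'(3)])
    have x: "x \<in> sec (tot P) U" "x' \<in> sec (tot P) U" using assms(1) by (auto simp: matched_def)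
    have c: "composable {1..m i} (F i) j U (v i) (ract (F i) U w k)" using h' h by (simp add: composable_def Fi.ra_in Fi.ra_proj)
    have "matched i j (v, u) (v(i := ract (F i) U w k), E.ac i u' k)"
      using act1_in[OF h'(3) x(2) h] x(1) h' by (intro matchedI c) (simp_all add: act1_simp)
    then show ?thesis using h h' by (simp add: md_simp act1_simp Fi.pl_ra E.ac_pl_right)
  qed
  then show "md i j x (act1 i x' k) = act1 i (md i j x x') k" "matched i j x (act1 i x' k)" by auto
qed

text \<open>The twist arises twice: in \<open>F\<^sub>i\<close> when a translation passes over the
  right factor, in \<open>E\<close> through \<open>E.ac_pl_left\<close>. The results coincide
  because the structural value of the component in \<open>F\<^sub>i\<close> is the coordinate of the
  last component in the base of \<open>E\<close>.\<close>

lemma md_act1_left: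
  assumes "matched i j x x'" and h: "k \<in> H1 i"
  shows "md i j (act1 i x k) x' = act1 i (md i j x x') (xact (H i) U k (str (F i) U (fst x' i)))" "matched i j (act1 i x k) x'"
    "xact (H i) U k (str (F i) U (fst x' i)) \<in> H1 i"
proof -
  have "md i j (act1 i x k) x' = act1 i (md i j x x') (xact (H i) U k (str (F i) U (fst x' i))) \<and> matched i j (act1 i x k) x'
      \<and> xact (H i) U k (str (F i) U (fst x' i)) \<in> H1 i"
    using assms(1)
  proof (rule matchedE)
    fix v u w u' assume h': "x = (v, u)" "x' = (v(i := w), u')" "i \<in> {1..n}" "j \<in> {1..m i}" "v \<in> V" "w \<in> sec (tot (F i)) U" "u \<in> sec (tot E) U" "u' \<in> sec (tot E) U"
      "composable {1..m i} (F i) j U (v i) w" "composable {1..n} E i U u u'" "proj E U u' = (ys v)(i := str (F i) U w)"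
    interpret Fi: bfly_stage "H i" U "F i" "{1..m i}" "K i" by (rule Fs[OF h'(3)])
    have x: "x \<in> sec (tot P) U" "x' \<in> sec (tot P) U" using assms(1) by (auto simp: matched_def)
    have v: "v i \<in> sec (tot (F i)) U" using V_at[OF h'(5,3)] .
    have c: "composable {1..m i} (F i) j U ((v(i := ract (F i) U (v i) k)) i) w" using h' h v by (simp add: composable_def Fi.ra_in Fi.ra_proj)
    have "matched i j (v(i := ract (F i) U (v i) k), E.ac i u k) (v(i := ract (F i) U (v i) k, i := w), u')"
      using act1_in[OF h'(3) x(1) h] x(2) h' c by (intro matchedI) (simp_all add: act1_simp)
    then show ?thesis using h h' by (simp add: md_simp act1_simp Fi.pl_ra_left E.ac_pl_left Fi.act_in Fi.str_in)
  qed
  then show "md i j (act1 i x k) x' = act1 i (md i j x x') (xact (H i) U k (str (F i) U (fst x' i)))" "matched i j (act1 i x k) x'"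
    "xact (H i) U k (str (F i) U (fst x' i)) \<in> H1 i" by auto
qed

text \<open>Both factors have to be moved, since a matched pair shares its component at
  \<open>l\<close>.\<close>

lemma md_act1_other:
  assumes "matched i j x x'" and l: "l \<in> {1..n}" "l \<noteq> i" and h: "k \<in> H1 l"
  shows "md i j (act1 l x k) (act1 l x' k) = act1 l (md i j x x') k" "matched i j (act1 l x k) (act1 l x' k)"
proof -
  have "md i j (act1 l x k) (act1 l x' k) = act1 l (md i j x x') k \<and> matched i j (act1 l x k) (act1 l x' k)"
    using assms(1)
  proof (rule matchedE)
    fix v u w u' assume h': "x = (v, u)" "x' = (v(i := w), u')" "i \<in> {1..n}" "j \<in> {1..m i}"
      "composable {1..m i} (F i) j U (v i) w" "composable {1..n} E i U u u'"
    have x: "x \<in> sec (tot P) U" "x' \<in> sec (tot P) U" using assms(1) by (auto simp: matched_def)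
    have "matched i j (act1 l x k) (act1 l x' k)"
      using assms(1) act1_in[OF l(1) x(1) h] act1_in[OF l(1) x(2) h] l(2) h'
      by (auto simp: matched_def act1_simp)
    then show ?thesis using l h h' E.ac_pl_other[OF h'(3) l h'(6) h]
      by (simp add: md_simp act1_simp fun_upd_twist)
  qed
  then show "md i j (act1 l x k) (act1 l x' k) = act1 l (md i j x x') k" "matched i j (act1 l x k) (act1 l x' k)" by auto
qed

lemma md_fa_other:
  assumes h: "\<forall>i\<in>{1..n}. h i \<in> H1 i" and mt: "matched i j x x'"
  shows "set xs \<subseteq> {1..n} - {i} \<Longrightarrow>
    md i j (fa xs x h) (fa xs x' h) = fa xs (md i j x x') h \<and> matched i j (fa xs x h) (fa xs x' h)"
proof (induction xs rule: rev_induct)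
  case (snoc l xs)
  then have l: "l \<in> {1..n}" "l \<noteq> i" and c: "matched i j (fa xs x h) (fa xs x' h)" by auto
  show ?case using md_act1_other[OF c l, of "h l"] snoc h l by simp
qed (simp add: mt)

text \<open>The calculation that makes the product well defined on orbits.\<close>

lemma md_orb:
  assumes mt: "matched i j x x'" and h: "h \<in> HH" "h' \<in> HH"
    and mt': "matched i j (comp_act n F E U x h) (comp_act n F E U x' h')"
  obtains k where "k \<in> HH" "md i j (comp_act n F E U x h) (comp_act n F E U x' h') = comp_act n F E U (md i j x x') k"
proof -
  have i: "i \<in> {1..n}" and x: "x \<in> sec (tot P) U" "x' \<in> sec (tot P) U" and e: "\<forall>l\<in>{1..n} - {i}. fst x l = fst x' l"
    and e': "\<forall>l\<in>{1..n} - {i}. fst (comp_act n F E U x h) l = fst (comp_act n F E U x' h') l"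
    using mt mt' by (auto simp: matched_def)
  \<comment> \<open>Outside \<open>i\<close> the two points have the same component before and after
    the action.\<close>
  have hh: "h' l = h l" if l: "l \<in> {1..n} - {i}" for l
  proof -
    obtain v u where v: "x = (v, u)" "v \<in> V" by (rule P_E[OF x(1)])
    have "ract (F l) U (v l) (h l) = ract (F l) U (v l) (h' l)"
      using bspec[OF e' l] bspec[OF e l] ca_fst[OF x(1) h(1)] ca_fst[OF x(2) h(2)] l v by (simp add: comp_base_act_def)
    then show ?thesis using V_ract_free[OF _ v(2), of l] HH_at h l by (metis DiffD1)
  qed
  define xs where "xs = remove1 i idx"
  have xs: "set xs = {1..n} - {i}" using idx i by (simp add: xs_def set_remove1_eq)
  note hA = HH_at[OF h(1)] and hB = HH_at[OF h(2)]
  have 1: "comp_act n F E U x h = act1 i (fa xs x h) (h i)"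
    unfolding comp_act_fa xs_def by (rule fa_remove[OF hA]) (use x i idx in auto)
  have "comp_act n F E U x' h' = act1 i (fa xs x' h') (h' i)"
    unfolding comp_act_fa xs_def by (rule fa_remove[OF hB]) (use x i idx in auto)
  also have "fa xs x' h' = fa xs x' h" using hh xs by (intro fa_cong) auto
  finally have 2: "comp_act n F E U x' h' = act1 i (fa xs x' h) (h' i)" .
  have 3: "md i j (fa xs x h) (fa xs x' h) = fa xs (md i j x x') h" "matched i j (fa xs x h) (fa xs x' h)"
    using md_fa_other[OF hA mt, of xs] xs by auto
  have hi: "h i \<in> H1 i" "h' i \<in> H1 i" using hA hB i by auto
  define t where "t = xact (H i) U (h i) (str (F i) U (fst (act1 i (fa xs x' h) (h' i)) i))"
  note L = md_act1_left[OF md_act1_right(2)[OF 3(2) hi(2)] hi(1), folded t_def]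
  \<comment> \<open>The element acting on the right factor comes out unchanged and is applied before
    the one acting on the left factor, which is twisted on its way out to \<open>t\<close>; hence
    the order of the product.\<close>
  define k where "k = h(i := h' i \<otimes>\<^bsub>grp (X1 (H i)) U\<^esub> t)"
  interpret Hi: xmod_stage "H i" U by (rule E.xH[OF i])
  have k: "k \<in> HH" unfolding k_def HH_eq using h(1) hi L(3) i by (intro PiE_upd) (simp_all add: HH_eq)
  have M: "md i j x x' \<in> sec (tot P) U" by (rule md_in[OF mt])
  have fM: "fa xs (md i j x x') h \<in> sec (tot P) U" using xs by (intro fa_in[OF hA] M) auto
  have "md i j (comp_act n F E U x h) (comp_act n F E U x' h') = act1 i (act1 i (fa xs (md i j x x') h) (h' i)) t"
    unfolding 1 2 L(1) md_act1_right(1)[OF 3(2) hi(2)] 3(1) ..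
  also have "\<dots> = act1 i (fa xs (md i j x x') h) (h' i \<otimes>\<^bsub>grp (X1 (H i)) U\<^esub> t)" by (rule act1_mult[OF i fM hi(2) L(3)])
  also have "fa xs (md i j x x') h = fa xs (md i j x x') k" using xs by (intro fa_cong) (auto simp: k_def)
  also have "act1 i \<dots> (h' i \<otimes>\<^bsub>grp (X1 (H i)) U\<^esub> t) = comp_act n F E U (md i j x x') k"
    unfolding comp_act_fa xs_def
    by (subst fa_remove[OF HH_at[OF k] _ M, of idx i]) (use i in \<open>simp_all add: k_def\<close>)
  finally show ?thesis using that k by blast
qed

end

section \<open>Interchange for products of points\<close>

context comp_stage
begin

lemma matched_ract:
  assumes "matched i j x x'" "g \<in> carrier (grp (X1 G) U)"
  shows "matched i j x (ract P U x' g)" "matched i j (ract P U x g) x'"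
proof -
  have f: "fst (ract P U y g) = fst y" for y by (cases y) (simp add: P_simps)
  show "matched i j x (ract P U x' g)" "matched i j (ract P U x g) x'"
    using assms P_ract_in unfolding matched_def f by auto
qed

lemma md_cmps:
  assumes "matched i j x x'"
  shows "composable {1..m i} (F i) j U (fst x i) (fst x' i)" "composable {1..n} E i U (snd x) (snd x')"
    "i \<in> {1..n}" "j \<in> {1..m i}" "x \<in> sec (tot P) U" "x' \<in> sec (tot P) U"
    "\<And>l. l \<in> {1..n} \<Longrightarrow> l \<noteq> i \<Longrightarrow> fst x' l = fst x l" "fst x' = (fst x)(i := fst x' i)"
proof -
  show "i \<in> {1..n}" "j \<in> {1..m i}" "x \<in> sec (tot P) U" "x' \<in> sec (tot P) U"
    "\<And>l. l \<in> {1..n} \<Longrightarrow> l \<noteq> i \<Longrightarrow> fst x' l = fst x l" using assms by (auto simp: matched_def)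
  show "composable {1..m i} (F i) j U (fst x i) (fst x' i)" using assms by (rule matchedE) simp
  show "composable {1..n} E i U (snd x) (snd x')" using assms by (rule matchedE) simp
  show "fst x' = (fst x)(i := fst x' i)" using assms by (rule matchedE) simp
qed

lemma snd_in: "x \<in> sec (tot P) U \<Longrightarrow> snd x \<in> sec (tot E) U"
  by (erule P_E) simp

lemma fst_in: "x \<in> sec (tot P) U \<Longrightarrow> fst x \<in> V"
  by (erule P_E) simp

lemma snd_proj: "x \<in> sec (tot P) U \<Longrightarrow> proj E U (snd x) = ys (fst x)"
  by (erule P_E) simp

lemma P_str: "str P U x = str E U (snd x)"
  by (cases x) (simp add: P_simps)

lemma P_ract: "ract P U x g = (fst x, ract E U (snd x) g)"
  by (cases x) (simp add: P_simps)

context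
  fixes i j i' j' a b c d
  assumes ab: "matched i j a b" and cd: "matched i j c d" and ac: "matched i' j' a c" and bd: "matched i' j' b d"
begin

lemma matched_md:
  assumes ne: "(i, j) \<noteq> (i', j')"
  shows "matched i' j' (md i j a b) (md i j c d)"
proof -
  note A = md_cmps[OF ab] and C = md_cmps[OF cd] and X = md_cmps[OF ac] and Y = md_cmps[OF bd]
  show ?thesis
  proof (cases "i = i'")
    case False
    have "fst c i = fst a i" "fst d i = fst b i" using X(7) Y(7) A(3) False by auto
    moreover have "fst d i' = fst c i'" "fst b i' = fst a i'" using C(7) A(7) X(3) False by auto
    ultimately show ?thesis unfolding matched_def
      using md_in[OF ab] md_in[OF cd] ac False by (auto simp: md_def matched_def)
  next
    case True
    interpret Fi: bfly_stage "H i" U "F i" "{1..m i}" "K i" by (rule Fs[OF A(3)])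
    have jj: "j \<noteq> j'" using ne True by simp
    have "\<forall>l\<in>{1..m i} - {j'}. proj (F i) U (fst a i) l = proj (F i) U (fst c i) l"
      "\<forall>l\<in>{1..m i} - {j'}. proj (F i) U (fst b i) l = proj (F i) U (fst d i) l"
      "\<forall>l\<in>{1..n} - {i}. fst a l = fst c l" "j' \<in> {1..m i}"
      using ac bd True by (auto simp: matched_def)
    then show ?thesis unfolding matched_def True[symmetric]
      using md_in[OF ab] md_in[OF cd] A(3,4) jj
      by (simp add: md_def Fi.pl_proj[OF A(4) A(1)] Fi.pl_proj[OF A(4) C(1)])
  qed
qed

text \<open>The two kinds of products change different components of the tuple, so only the
  interchange law of \<open>E\<close> is at stake.\<close>

lemma md_inter_ne:
  assumes ne: "i \<noteq> i'"
  shows "md i' j' (md i j a b) (md i j c d) = md i j (md i' j' a c)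
      (md i' j' (ract P U b (inv\<^bsub>grp (X1 G) U\<^esub> (brd G U (str P U b) (str P U c)))) d)"
proof -
  note A = md_cmps[OF ab] and C = md_cmps[OF cd] and X = md_cmps[OF ac] and Y = md_cmps[OF bd]
  have f: "fst c i = fst a i" "fst d i = fst b i" using X(7) Y(7) A(3) ne by auto
  have g: "fst d i' = fst c i'" "fst b i' = fst a i'" using C(7) A(7) X(3) ne by auto
  show ?thesis
    using E.inter[OF A(3) X(3) ne A(2) C(2) X(2) Y(2)] ne f g
    by (simp add: md_def P_ract P_str fun_upd_twist)
qed

text \<open>On a common outer axis the two sides lie in one orbit: the braiding of \<open>H\<^sub>i\<close>, coming from
  \<open>F\<^sub>i\<close>, is carried over to that of \<open>G\<close> because \<open>E\<close> is braided.\<close>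

lemma md_inter_eq:
  assumes e: "i' = i" and ne: "j \<noteq> j'"
  shows "\<exists>k\<in>H1 i. md i j (md i j' a c) (md i j' (ract P U b (inv\<^bsub>grp (X1 G) U\<^esub> (brd G U (str P U b) (str P U c)))) d)
     = act1 i (md i j' (md i j a b) (md i j c d)) k"
proof -
  note A = md_cmps[OF ab] and C = md_cmps[OF cd] and X = md_cmps[OF ac[unfolded e]] and Y = md_cmps[OF bd[unfolded e]]
  note i = A(3)
  interpret Fi: bfly_stage "H i" U "F i" "{1..m i}" "K i" by (rule Fs[OF i])
  define va vb vc vd where "va = fst a i" and "vb = fst b i" and "vc = fst c i" and "vd = fst d i"
  define ua ub uc ud where "ua = snd a" and "ub = snd b" and "uc = snd c" and "ud = snd d"
  note vs = va_def vb_def vc_def vd_def and us = ua_def ub_def uc_def ud_def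
  have um: "ua \<in> sec (tot E) U" "ub \<in> sec (tot E) U" "uc \<in> sec (tot E) U" "ud \<in> sec (tot E) U"
    unfolding us using snd_in A(5,6) C(5,6) by auto
  have vm: "va \<in> sec (tot (F i)) U" "vb \<in> sec (tot (F i)) U" "vc \<in> sec (tot (F i)) U" "vd \<in> sec (tot (F i)) U"
    unfolding vs using V_at[OF fst_in i] A(5,6) C(5,6) by auto
  note c1 = A(1)[folded vs] and c2 = C(1)[folded vs] and c3 = X(1)[folded vs] and c4 = Y(1)[folded vs]
  have cab: "E.cmps i ua ub" and ccd: "E.cmps i uc ud" and cac: "E.cmps i ua uc"
    using A(2) C(2) X(2) by (simp_all add: us)
  have cbc: "E.cmps i ub uc" using cab cac by (auto simp: E.cmps_iff)
  have yb: "proj E U ub i = str (F i) U vb" and yc: "proj E U uc i = str (F i) U vc" and yd: "proj E U ud i = str (F i) U vd"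
    unfolding us vs using snd_proj A(6) C(5,6) ys_at[OF i] by auto
  define \<beta> where "\<beta> = brd (H i) U (str (F i) U vb) (str (F i) U vc)"
  define \<gamma> where "\<gamma> = brd G U (str E U ub) (str E U uc)"
  have \<beta>: "\<beta> \<in> H1 i" unfolding \<beta>_def using vm by (simp add: Fi.brd_in Fi.str_in)
  have \<gamma>: "\<gamma> \<in> carrier (grp (X1 G) U)" unfolding \<gamma>_def using um by (simp add: E.brd_in E.str_in)
  \<comment> \<open>The braiding of \<open>H\<^sub>i\<close> in the form in which it emerges from
    interchange in \<open>F\<^sub>i\<close>. The point of the proof is to meet the same element in
    \<open>E\<close>.\<close>
  define k where "k = xact (H i) U \<beta> (str (F i) U vd)"
  have k: "k \<in> H1 i" unfolding k_def using \<beta> vm by (simp add: Fi.act_in Fi.str_in)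
  define XF where "XF = plaw (F i) j' U (plaw (F i) j U va vb) (plaw (F i) j U vc vd)"
  define YF where "YF = plaw (F i) j U (plaw (F i) j' U va vc) (plaw (F i) j' U vb vd)"
  have YFin: "YF \<in> sec (tot (F i)) U"
    unfolding YF_def by (rule Fi.pl_in[OF A(4) Fi.inter_cmps(2)[OF A(4) X(4) ne c1 c2 c3 c4]])
  have "XF = ract (F i) U YF (inv\<^bsub>grp (X1 (H i)) U\<^esub> k)"
    unfolding XF_def YF_def k_def \<beta>_def
    using Fi.inter_ra[OF A(4) X(4) ne c1 c2 c3 c4] vm by (simp add: Fi.act_inv Fi.brd_in Fi.str_in)
  then have F: "YF = ract (F i) U XF k"
    using k YFin by (simp add: Fi.ra_mult[symmetric] Fi.ra_one)
  define w where "w = plaw E i U ub uc"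
  have w: "w \<in> sec (tot E) U" unfolding w_def by (rule E.pl_in[OF i cbc])
  \<comment> \<open>Braidedness of \<open>E\<close> exchanges the factors. It involves the inverse
    of the reversed braiding of \<open>H\<^sub>i\<close>, which is \<open>\<beta>\<close> by the
    symmetry \<open>Fi.brd_sym\<close>.\<close>
  have braid: "plaw E i U uc ub = ract E U (E.ac i w \<beta>) \<gamma>"
  proof -
    have 1: "inv\<^bsub>grp (X1 (H i)) U\<^esub> (brd (H i) U (proj E U uc i) (proj E U ub i)) = \<beta>"
      unfolding yb yc \<beta>_def using Fi.brd_sym[OF A(4) X(4) ne c1 c2 c3 c4] by simp
    have 2: "(proj E U ub)(i := \<beta>) = (proj E U w)(i := \<beta>)"
      unfolding w_def using E.pl_proj[OF i cbc] by simp
    show ?thesis using bE[OF i cbc] unfolding 1 2 \<gamma>_def E.ac_def w_def .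
  qed
  have wac: "E.ac i w \<beta> \<in> sec (tot E) U" by (rule E.ac_in[OF i w \<beta>])
  have \<gamma>i: "inv\<^bsub>grp (X1 G) U\<^esub> \<gamma> \<in> carrier (grp (X1 G) U)" using \<gamma> by simp
  \<comment> \<open>The correction prescribed by the interchange law cancels the
    \<open>\<gamma>\<close> produced by exchanging the factors.\<close>
  define ub' where "ub' = ract E U ub (inv\<^bsub>grp (X1 G) U\<^esub> \<gamma>)"
  have ub': "ub' \<in> sec (tot E) U" "proj E U ub' = proj E U ub" unfolding ub'_def using um \<gamma>i by (simp_all add: E.ra_in E.ra_proj)
  have ccb: "E.cmps i uc ub" using cbc by (auto simp: E.cmps_iff)
  have ccb': "E.cmps i uc ub'" using ccb ub' by (simp add: E.cmps_iff)
  have cbd': "E.cmps i ub' ud" using ub' ccd ccb um by (auto simp: E.cmps_iff)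
  have br: "plaw E i U uc ub' = E.ac i w \<beta>"
    using E.pl_ra[OF i ccb \<gamma>i] braid wac \<gamma> by (simp add: ub'_def E.ra_mult[symmetric] E.ra_one)
  have caw: "E.cmps i ua w" "E.cmps i w ud" unfolding w_def
    using E.cmps_pl[OF i cbc] cab ccd by auto
  have cacb: "E.cmps i uc (plaw E i U ub' ud)" using E.cmps_pl(2)[OF i cbd'] ccb' by simp
  have cx: "E.cmps i ua (E.ac i w \<beta>)" "E.cmps i (E.ac i w \<beta>) ud"
    using caw wac E.ac_proj[OF i w \<beta>] by (auto simp: E.cmps_iff)
  have "plaw E i U (plaw E i U ua uc) (plaw E i U ub' ud) = plaw E i U ua (plaw E i U uc (plaw E i U ub' ud))"
    by (rule E.pl_assoc[OF i cac cacb])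
  also have "plaw E i U uc (plaw E i U ub' ud) = plaw E i U (E.ac i w \<beta>) ud"
    using E.pl_assoc[OF i ccb' cbd'] br by simp
  also have "plaw E i U ua (plaw E i U (E.ac i w \<beta>) ud) = plaw E i U (plaw E i U ua (E.ac i w \<beta>)) ud"
    by (rule E.pl_assoc[OF i cx, symmetric])
  also have "plaw E i U ua (E.ac i w \<beta>) = E.ac i (plaw E i U ua w) \<beta>"
    by (rule E.ac_pl_right[OF i caw(1) \<beta>])
  \<comment> \<open>Passing over the last factor twists \<open>\<beta>\<close> by the coordinate of
    \<open>ud\<close>, which is the structural value of \<open>vd\<close>: the result is
    \<open>k\<close>.\<close>
  also have "plaw E i U (E.ac i (plaw E i U ua w) \<beta>) ud = E.ac i (plaw E i U (plaw E i U ua w) ud) k"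
    unfolding k_def yd[symmetric] using E.cmps_pl[OF i caw(1)] caw cab ccd cac cbc
    by (intro E.ac_pl_left[OF i _ \<beta>]) (auto simp: E.cmps_iff)
  also have "plaw E i U (plaw E i U ua w) ud = plaw E i U (plaw E i U ua ub) (plaw E i U uc ud)"
  proof -
    have "E.cmps i ub (plaw E i U uc ud)" using E.cmps_pl(2)[OF i ccd] cbc by simp
    then show ?thesis
      using E.pl_assoc[OF i caw] E.pl_assoc[OF i cbc ccd] E.pl_assoc[OF i cab, of "plaw E i U uc ud"] by (simp add: w_def)
  qed
  finally have Ee: "plaw E i U (plaw E i U ua uc) (plaw E i U ub' ud) = E.ac i (plaw E i U (plaw E i U ua ub) (plaw E i U uc ud)) k" .
  show ?thesis
    using F Ee k
    by (intro bexI[of _ k]) (simp_all add: md_def act1_simp P_ract P_str vs[symmetric] us[symmetric] XF_def YF_def ub'_def \<gamma>_def)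
qed

end

text \<open>Representatives of the value of the section \<open>s\<^sub>i\<^sub>j\<close> of the composite; the component \<open>v i\<close> is not used.\<close>

definition tp where
  "tp i j v k = (v(i := triv (F i) j U k), E.tr i (ys v) \<one>\<^bsub>grp (X1 (H i)) U\<^esub>)"

abbreviation "KK i j \<equiv> \<Pi>\<^sub>E l\<in>{1..m i}. carrier (grp (xfam (K i) j l) U)"

section \<open>Points that represent the sections of the composite\<close>

lemma F_triv:
  assumes "i \<in> {1..n}" "j \<in> {1..m i}" "k \<in> KK i j"
  shows "triv (F i) j U k \<in> sec (tot (F i)) U"
    "proj (F i) U (triv (F i) j U k) = k(j := bd (K i j) U (k j))"
    "str (F i) U (triv (F i) j U k) = \<one>\<^bsub>grp (X0 (H i)) U\<^esub>"
    "\<And>l k'. l \<in> {1..m i} \<Longrightarrow> k' \<in> KK i j \<Longrightarrow> \<forall>t\<in>{1..m i} - {l}. k t = k' t \<Longrightarrow>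
       plaw (F i) l U (triv (F i) j U k) (triv (F i) j U k') = triv (F i) j U (axis_mult (xfam (K i) j) l U (k, k'))"
  using bfly_stage.trv[OF Fs[OF assms(1)] assms(2)] assms(3) unfolding triv_stage_def by blast+

lemma H_one: "i \<in> {1..n} \<Longrightarrow> \<one>\<^bsub>grp (X1 (H i)) U\<^esub> \<in> H1 i"
  using xmod_stage.grp1[OF E.xH] by (simp add: group.is_monoid monoid.one_closed)

lemma H_bd_one: "i \<in> {1..n} \<Longrightarrow> bd (H i) U \<one>\<^bsub>grp (X1 (H i)) U\<^esub> = \<one>\<^bsub>grp (X0 (H i)) U\<^esub>"
  by (rule xmod_stage.bd_one[OF E.xH])

text \<open>The section of \<open>F\<^sub>i\<close> has trivial structural value, and the
  \<open>i\<close>-th coordinate of \<open>s\<^sub>i\<close> at the unit is the boundary of the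
  unit; so the components fit together.\<close>

lemma tp_in:
  assumes "i \<in> {1..n}" "j \<in> {1..m i}" "k \<in> KK i j" "v \<in> V"
  shows "tp i j v k \<in> sec (tot P) U"
  using assms F_triv[OF assms(1-3)] H_one[OF assms(1)] H_bd_one[OF assms(1)] ys_in[OF assms(4)]
  by (simp add: tp_def P_mem V_upd E.tr_in E.tr_proj ys_upd)

lemma tp_str:
  assumes "i \<in> {1..n}" "v \<in> V"
  shows "str P U (tp i j v k) = \<one>\<^bsub>grp (X0 G) U\<^esub>"
  using assms H_one ys_in by (simp add: tp_def P_simps E.tr_str)

lemma tp_upd: "i \<in> {1..n} \<Longrightarrow> tp i j (v(i := w)) k = tp i j v k"
  by (simp add: tp_def ys_upd E.tr_upd)

lemma tp_fst: "fst (tp i j v k) = v(i := triv (F i) j U k)"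
  by (simp add: tp_def)

text \<open>\<open>E.ac_tr_one\<close> keeps the last component on the unit section, so that the
  action is absorbed by the auxiliary tuple.\<close>

lemma tp_act1:
  assumes i: "i \<in> {1..n}" and l: "l \<in> {1..n}" "l \<noteq> i" and h: "h \<in> H1 l" and v: "v \<in> V"
  shows "act1 l (tp i j v k) h = tp i j (v(l := ract (F l) U (v l) h)) k"
proof -
  interpret Fl: bfly_stage "H l" U "F l" "{1..m l}" "K l" by (rule Fs[OF l(1)])
  show ?thesis
    using E.ac_tr_one[OF i l ys_in[OF v] h] l h V_at[OF v l(1)]
    by (simp add: tp_def act1_simp fun_upd_twist ys_upd Fl.str_ra ys_at)
qed

lemma tp_fa:
  assumes i: "i \<in> {1..n}" and h: "\<forall>i\<in>{1..n}. h i \<in> H1 i" and v: "v \<in> V"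
  shows "set xs \<subseteq> {1..n} - {i} \<Longrightarrow> distinct xs \<Longrightarrow>
    fa xs (tp i j v k) h = tp i j (\<lambda>l. if l \<in> set xs then ract (F l) U (v l) (h l) else v l) k"
proof (induction xs rule: rev_induct)
  case (snoc l xs)
  define v' where "v' = (\<lambda>l. if l \<in> set xs then ract (F l) U (v l) (h l) else v l)"
  have l: "l \<in> {1..n}" "l \<noteq> i" "l \<notin> set xs" using snoc.prems by auto
  have v': "v' \<in> V"
  proof (rule PiE_I)
    fix t assume t: "t \<in> {1..n}"
    then show "v' t \<in> sec (tot (F t)) U"
      using tors_stage.ra_in[OF bfly_stage.axioms(1)[OF Fs[OF t]] V_at[OF v t], of "h t"] h V_at[OF v t] by (simp add: v'_def)
  next
    fix t assume "t \<notin> {1..n}"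
    then show "v' t = undefined" using PiE_arb[OF v] snoc.prems by (auto simp: v'_def)
  qed
  have "fa (xs @ [l]) (tp i j v k) h = act1 l (tp i j v' k) (h l)" using snoc v'_def by simp
  also have "\<dots> = tp i j (v'(l := ract (F l) U (v' l) (h l))) k" by (rule tp_act1[OF i l(1,2) _ v']) (use h l in auto)
  also have "v'(l := ract (F l) U (v' l) (h l)) = (\<lambda>t. if t \<in> set (xs @ [l]) then ract (F t) U (v t) (h t) else v t)"
    using l by (auto simp: v'_def)
  finally show ?case .
qed simp

text \<open>Changing the tuple within its fibres outside \<open>i\<close> amounts to the action of
  an element of the product group, so the class of \<open>tp\<close> does not see it.\<close>

lemma tp_orb:
  assumes i: "i \<in> {1..n}" "j \<in> {1..m i}" and k: "k \<in> KK i j" and v: "v \<in> V" "v' \<in> V"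
    and e: "\<And>l. l \<in> {1..n} \<Longrightarrow> l \<noteq> i \<Longrightarrow> proj (F l) U (v l) = proj (F l) U (v' l)"
  obtains h where "h \<in> HH" "tp i j v' k = comp_act n F E U (tp i j v k) h"
proof -
  \<comment> \<open>At \<open>i\<close> the unit is taken, because there the component is the
    section of \<open>F\<^sub>i\<close> on both sides.\<close>
  have "\<exists>g. g \<in> H1 l \<and> (if l = i then g = \<one>\<^bsub>grp (X1 (H i)) U\<^esub> else v' l = ract (F l) U (v l) g)" if l: "l \<in> {1..n}" for l
  proof (cases "l = i")
    case True
    then show ?thesis using H_one[OF i(1)] by auto
  next
    case False
    interpret Fl: bfly_stage "H l" U "F l" "{1..m l}" "K l" by (rule Fs[OF l])
    show ?thesis using Fl.ra_ex[OF V_at[OF v(1) l] V_at[OF v(2) l] e[OF l False]] False by metis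
  qed
  then obtain g where g: "\<And>l. l \<in> {1..n} \<Longrightarrow> g l \<in> H1 l \<and> (if l = i then g l = \<one>\<^bsub>grp (X1 (H i)) U\<^esub> else v' l = ract (F l) U (v l) (g l))"
    by metis
  define h where "h = restrict g {1..n}"
  have h: "h \<in> HH" unfolding HH_eq h_def using g by auto
  define xs where "xs = remove1 i idx"
  have xs: "set xs = {1..n} - {i}" "distinct xs" using i by (simp_all add: xs_def set_remove1_eq)
  have t: "tp i j v k \<in> sec (tot P) U" by (rule tp_in[OF i k v(1)])
  have "comp_act n F E U (tp i j v k) h = act1 i (fa xs (tp i j v k) h) (h i)"
    unfolding comp_act_fa xs_def by (rule fa_remove[OF HH_at[OF h]]) (use t i in auto)
  also have "\<dots> = fa xs (tp i j v k) h"
  proof -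
    have "fa xs (tp i j v k) h \<in> sec (tot P) U" using xs by (intro fa_in[OF HH_at[OF h] _ t]) auto
    moreover have "h i = \<one>\<^bsub>grp (X1 (H i)) U\<^esub>" using g[OF i(1)] i(1) by (simp add: h_def)
    ultimately show ?thesis using i(1) by (simp only: act1_one)
  qed
  also have "\<dots> = tp i j (\<lambda>l. if l \<in> set xs then ract (F l) U (v l) (h l) else v l) k"
    by (rule tp_fa[OF i(1) HH_at[OF h] v(1)]) (use xs in auto)
  also have "(\<lambda>l. if l \<in> set xs then ract (F l) U (v l) (h l) else v l) = v'(i := v i)"
  proof (rule ext)
    fix l show "(if l \<in> set xs then ract (F l) U (v l) (h l) else v l) = (v'(i := v i)) l"
    proof (cases "l \<in> {1..n} - {i}")
      case True
      then have "v' l = ract (F l) U (v l) (g l)" "h l = g l" using g[of l] by (auto simp: h_def)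
      then show ?thesis using True xs by simp
    next
      case False
      then have "l = i \<or> l \<notin> {1..n}" by auto
      then show ?thesis using False xs PiE_arb[OF v(1), of l] PiE_arb[OF v(2), of l] by auto
    qed
  qed
  also have "tp i j (v'(i := v i)) k = tp i j v' k" by (rule tp_upd[OF i(1)])
  finally show ?thesis using that[OF h] by simp
qed

lemma tp_mult_same:
  assumes i: "i \<in> {1..n}" "j \<in> {1..m i}" "l \<in> {1..m i}" and k: "k \<in> KK i j" "k' \<in> KK i j" and v: "v \<in> V"
    and e: "\<forall>t\<in>{1..m i} - {l}. k t = k' t"
  shows "md i l (tp i j v k) (tp i j v k') = tp i j v (axis_mult (xfam (K i) j) l U (k, k'))"
    "matched i l (tp i j v k) (tp i j v k')"
proof -
  note F = F_triv[OF i(1,2) k(1)] and F' = F_triv[OF i(1,2) k(2)]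
  interpret Hi: xmod_stage "H i" U by (rule E.xH[OF i(1)])
  show "md i l (tp i j v k) (tp i j v k') = tp i j v (axis_mult (xfam (K i) j) l U (k, k'))"
    using F(4)[OF i(3) k(2) e] E.tr_same[OF i(1) ys_in[OF v] Hi.G1.one_closed Hi.G1.one_closed]
    by (simp add: md_def tp_def)
  show "matched i l (tp i j v k) (tp i j v k')"
    using tp_in[OF i(1,2) k(1) v] tp_in[OF i(1,2) k(2) v] i e F(2) F'(2)
    by (auto simp: matched_def tp_fst)
qed

text \<open>The section of \<open>F\<^sub>i\<close> is common to both factors, while
  \<open>s\<^sub>i\<close> at the unit is multiplicative in the coordinate \<open>i'\<close>; the
  structural map carries the law of \<open>F\<close> at \<open>i'\<close> to the product in that
  coordinate.\<close>

lemma tp_mult_other: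
  assumes i: "i \<in> {1..n}" "j \<in> {1..m i}" and k: "k \<in> KK i j" and i': "i' \<in> {1..n}" "i' \<noteq> i" "j' \<in> {1..m i'}"
    and v: "v \<in> V" and w: "w \<in> sec (tot (F i')) U" and c: "composable {1..m i'} (F i') j' U (v i') w"
  shows "md i' j' (tp i j v k) (tp i j (v(i' := w)) k) = tp i j (v(i' := plaw (F i') j' U (v i') w)) k"
    "matched i' j' (tp i j v k) (tp i j (v(i' := w)) k)"
proof -
  interpret F': bfly_stage "H i'" U "F i'" "{1..m i'}" "K i'" by (rule Fs[OF i'(1)])
  have vw: "v(i' := w) \<in> V" by (rule V_upd[OF v i'(1) w])
  have "plaw E i' U (E.tr i (ys v) \<one>\<^bsub>grp (X1 (H i)) U\<^esub>) (E.tr i (ys (v(i' := w))) \<one>\<^bsub>grp (X1 (H i)) U\<^esub>)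
      = E.tr i ((ys v)(i' := ys v i' \<otimes>\<^bsub>grp (X0 (H i')) U\<^esub> ys (v(i' := w)) i')) \<one>\<^bsub>grp (X1 (H i)) U\<^esub>"
    using ys_upd[OF i'(1)] by (intro E.tr_other[OF i(1) i'(1,2) ys_in[OF v] ys_in[OF vw] H_one[OF i(1)]]) auto
  also have "(ys v)(i' := ys v i' \<otimes>\<^bsub>grp (X0 (H i')) U\<^esub> ys (v(i' := w)) i') = ys (v(i' := plaw (F i') j' U (v i') w))"
    using i' c by (simp add: ys_upd ys_at F'.pl_str)
  finally have Z: "plaw E i' U (E.tr i (ys v) \<one>\<^bsub>grp (X1 (H i)) U\<^esub>) (E.tr i (ys (v(i' := w))) \<one>\<^bsub>grp (X1 (H i)) U\<^esub>)
      = E.tr i (ys (v(i' := plaw (F i') j' U (v i') w))) \<one>\<^bsub>grp (X1 (H i)) U\<^esub>" .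
  show "md i' j' (tp i j v k) (tp i j (v(i' := w)) k) = tp i j (v(i' := plaw (F i') j' U (v i') w)) k"
    unfolding md_def tp_def fst_conv snd_conv Z using i'(2) by (simp add: fun_upd_twist)
  show "matched i' j' (tp i j v k) (tp i j (v(i' := w)) k)"
    using tp_in[OF i k v] tp_in[OF i k vw] i' c by (auto simp: matched_def tp_fst composable_def)
qed

lemma tp_compat_same:
  assumes i: "i \<in> {1..n}" "j \<in> {1..m i}" "j' \<in> {1..m i}" "j \<noteq> j'"
    and k: "k \<in> (\<Pi>\<^sub>E l\<in>{1..m i}. carrier (grp (((\<lambda>l. X0 (K i l))(j := X1 (K i j), j' := X1 (K i j'))) l) U))"
  shows "tp i j v (k(j' := bd (K i j') U (k j'))) = tp i j' v (k(j := bd (K i j) U (k j)))"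
proof -
  interpret Fi: bfly_stage "H i" U "F i" "{1..m i}" "K i" by (rule Fs[OF i(1)])
  show ?thesis using Fi.trv_compat[OF i(2-4) k] by (simp add: tp_def)
qed

text \<open>On both sides the components at \<open>i\<close> and at \<open>i'\<close> are sections.
  So the claim for the last component is compatibility of the two sections of \<open>E\<close> at a
  pair of units.\<close>

lemma tp_compat_other:
  assumes i: "i \<in> {1..n}" "j \<in> {1..m i}" and i': "i' \<in> {1..n}" "j' \<in> {1..m i'}" and ne: "i \<noteq> i'"
    and k: "k \<in> KK i j" and k': "k' \<in> KK i' j'" and v: "v \<in> V"
  shows "tp i j (v(i' := triv (F i') j' U k')) k = tp i' j' (v(i := triv (F i) j U k)) k'"
proof -
  have "E.tr i ((ys v)(i' := \<one>\<^bsub>grp (X0 (H i')) U\<^esub>)) \<one>\<^bsub>grp (X1 (H i)) U\<^esub> = E.tr i' ((ys v)(i := \<one>\<^bsub>grp (X0 (H i)) U\<^esub>)) \<one>\<^bsub>grp (X1 (H i')) U\<^esub>"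
    using E.tr_compat[OF i(1) i'(1) ne ys_in[OF v] H_one[OF i(1)] H_one[OF i'(1)]] H_bd_one[OF i(1)] H_bd_one[OF i'(1)] by simp
  then show ?thesis
    using F_triv[OF i k] F_triv[OF i' k'] i i' ne by (simp add: tp_def ys_upd fun_upd_twist)
qed

text \<open>In \<open>F\<^sub>i\<close> this is the commutation rule; in \<open>E\<close> both sides
  reduce to \<open>u\<close>, as the unit section is neutral on either side.\<close>

lemma tp_comm:
  assumes i: "i \<in> {1..n}" "j \<in> {1..m i}" and x: "x \<in> sec (tot P) U" and k: "k \<in> carrier (grp (X1 (K i j)) U)"
  defines "y \<equiv> proj (F i) U (fst x i)"
  shows "md i j (tp i j (fst x) (y(j := k))) x = md i j x (tp i j (fst x) (y(j := xact (K i j) U k (y j))))"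
    "matched i j (tp i j (fst x) (y(j := k))) x" "matched i j x (tp i j (fst x) (y(j := xact (K i j) U k (y j))))"
proof -
  interpret Fi: bfly_stage "H i" U "F i" "{1..m i}" "K i" by (rule Fs[OF i(1)])
  interpret Kij: xmod_stage "K i j" U by (rule Fi.xH[OF i(2)])
  obtain v u where e: "x = (v, u)" "v \<in> V" "u \<in> sec (tot E) U" "proj E U u = ys v" by (rule P_E[OF x])
  have vi: "v i \<in> sec (tot (F i)) U" by (rule V_at[OF e(2) i(1)])
  have y: "y \<in> Fi.base" unfolding y_def e fst_conv by (rule Fi.proj_in[OF vi])
  have yj: "y j \<in> carrier (grp (X0 (K i j)) U)" using y i by auto
  have k1: "xact (K i j) U k (y j) \<in> carrier (grp (X1 (K i j)) U)" using Kij.act_in[OF k yj] .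
  note K1 = Fi.xfam_upd[OF y i(2) k] and K2 = Fi.xfam_upd[OF y i(2) k1]
  show "md i j (tp i j (fst x) (y(j := k))) x = md i j x (tp i j (fst x) (y(j := xact (K i j) U k (y j))))"
    using Fi.trv_comm[OF i(2) vi k] E.tr_one_left[OF i(1) e(3)] E.ac_one[OF i(1) e(3)]
    unfolding y_def e by (simp add: md_def tp_def e(4)[symmetric] E.ac_tr)
  show "matched i j (tp i j (fst x) (y(j := k))) x" "matched i j x (tp i j (fst x) (y(j := xact (K i j) U k (y j))))"
    using tp_in[OF i K1 fst_in[OF x]] tp_in[OF i K2 fst_in[OF x]] F_triv(2)[OF i K1] F_triv(2)[OF i K2] x i
    by (auto simp: matched_def tp_fst y_def)
qed

end

section \<open>The quotient torsor\<close>

context site_loc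
begin

lemma pb_gtorsor:
  assumes cG: "crossed_module C G" and B': "sheaf C B'" and \<phi>: "sheaf_hom C B' B \<phi>" and gT: "gtorsor C G B T"
  shows "gtorsor C G B' (pb_tors B' \<phi> T)"
proof -
  let ?P = "pb_tors B' \<phi> T"
  note pT = sheaf_presheaf[OF gtorsorD(1)[OF gT]] and pB' = sheaf_presheaf[OF B']
  have shP: "sheaf C (tot ?P)" by (rule pb_sheaf[OF B' \<phi> gT])
  have hp: "sheaf_hom C (tot ?P) B' (proj ?P)"
    by (rule sheaf_homI) (auto simp: pb_simps)
  have hs: "sheaf_hom C (tot ?P) (ush (X0 G)) (str ?P)"
    by (rule sheaf_homI) (auto simp: pb_simps hom_in[OF gtorsorD(5)[OF gT]] hom_res[OF gtorsorD(5)[OF gT]])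
  have ts: "tors_stage G U T (sec B U)" if "U \<in> Ob C" for U by (rule tors_stageI[OF cG gT that])
  have ls: "locally_surj C (tot ?P) B' (proj ?P)"
  proof (rule locally_surjI[OF sheaf_presheaf[OF shP] pB' hp])
    fix U b assume U: "U \<in> Ob C" and b: "b \<in> sec B' U"
    show "lc U (\<lambda>f. \<exists>x\<in>sec (tot ?P) (src C f). proj ?P (src C f) x = res B' f b)"
    proof (rule lc_mono[OF locally_surjD[OF gtorsorD(4)[OF gT] U hom_in[OF \<phi> U b]] U])
      fix f assume f: "f \<in> arr_to C U" and "\<exists>x\<in>sec (tot T) (src C f). proj T (src C f) x = res B f (\<phi> U b)"
      then obtain u where "u \<in> sec (tot T) (src C f)" "proj T (src C f) u = res B f (\<phi> U b)" by auto
      then show "\<exists>x\<in>sec (tot ?P) (src C f). proj ?P (src C f) x = res B' f b"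
        using b f by (intro bexI[of _ "(res B' f b, u)"]) (auto simp: pb_simps res_in[OF pB'] hom_res[OF \<phi>])
    qed
  qed
  have ra: "right_action C (X1 G) (tot ?P) (ract ?P)"
    unfolding right_action_def
  proof (intro conjI ballI)
    fix U x g assume U: "U \<in> Ob C" and x: "x \<in> sec (tot ?P) U" and g: "g \<in> carrier (grp (X1 G) U)"
    interpret tors_stage G U T "sec B U" by (rule ts[OF U])
    show "ract ?P U x g \<in> sec (tot ?P) U" using x g by (auto simp: pb_simps ra_in ra_proj)
    fix h assume h: "h \<in> carrier (grp (X1 G) U)"
    show "ract ?P U x (g \<otimes>\<^bsub>grp (X1 G) U\<^esub> h) = ract ?P U (ract ?P U x g) h"
      using x g h by (auto simp: pb_simps ra_mult)
  next
    fix f x g assume f: "f \<in> Ar C" and x: "x \<in> sec (tot ?P) (tgt C f)" and g: "g \<in> carrier (grp (X1 G) (tgt C f))"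
    have "f \<in> arr_to C (tgt C f)" using f by (simp add: arr_to_def)
    then show "res (tot ?P) f (ract ?P (tgt C f) x g) = ract ?P (src C f) (res (tot ?P) f x) (gres (X1 G) f g)"
      using x g gtorsor_ract_res[OF gT] by (auto simp: pb_simps)
  next
    fix U x assume U: "U \<in> Ob C" and x: "x \<in> sec (tot ?P) U"
    interpret tors_stage G U T "sec B U" by (rule ts[OF U])
    show "ract ?P U x \<one>\<^bsub>grp (X1 G) U\<^esub> = x" using x by (auto simp: pb_simps ra_one)
  qed
  show ?thesis
    unfolding gtorsor_def torsor_def
  proof (intro conjI B' shP hp ls ra hs ballI impI)
    fix U x assume U: "U \<in> Ob C" and x: "x \<in> sec (tot ?P) U"
    interpret tors_stage G U T "sec B U" by (rule ts[OF U])
    obtain b u where e: "x = (b, u)" "b \<in> sec B' U" "u \<in> sec (tot T) U" "\<phi> U b = proj T U u"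
      using x by (auto simp: pb_simps)
    { fix g assume g: "g \<in> carrier (grp (X1 G) U)"
      show "proj ?P U (ract ?P U x g) = proj ?P U x"
        "str ?P U (ract ?P U x g) = str ?P U x \<otimes>\<^bsub>grp (X0 G) U\<^esub> bd G U g"
        using e g by (simp_all add: pb_simps str_ra) }
    fix y assume y: "y \<in> sec (tot ?P) U" and eq: "proj ?P U x = proj ?P U y"
    obtain u' where e': "y = (b, u')" "u' \<in> sec (tot T) U" "\<phi> U b = proj T U u'"
      using y eq e by (cases y) (simp add: pb_simps)
    show "\<exists>!g. g \<in> carrier (grp (X1 G) U) \<and> y = ract ?P U x g"
      using ra_ex1[OF e(3) e'(2)] e e' by (simp add: pb_simps)
  qed
qed

end

locale composite = site_loc C for C :: "('o, 'm) site_data" +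
  fixes G :: "('o, 'm, 'g) bxmod"
    and H :: "nat \<Rightarrow> ('o, 'm, 'h) bxmod"
    and K :: "nat \<Rightarrow> nat \<Rightarrow> ('o, 'm, 'k) xmod"
    and n :: nat and m :: "nat \<Rightarrow> nat"
    and E :: "('o, 'm, nat, 'h, 'g, 'e) bfly"
    and F :: "nat \<Rightarrow> ('o, 'm, nat, 'k, 'h, 'f) bfly"
  assumes bG: "braided_crossed_module C G"
    and bH: "\<And>i. i\<in>{1..n} \<Longrightarrow> braided_crossed_module C (H i)"
    and cK: "\<And>i j. i\<in>{1..n} \<Longrightarrow> j\<in>{1..m i} \<Longrightarrow> crossed_module C (K i j)"
    and bE: "braided_butterfly C {1..n} H G E"
    and bF: "\<And>i. i\<in>{1..n} \<Longrightarrow> butterfly C {1..m i} (K i) (H i) (F i)"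
begin

declare One_nat_def [simp del] atLeastAtMost_iff [simp del]

lemma cG: "crossed_module C G"
  using bG by (simp add: braided_crossed_module_def)

lemma cH: "i \<in> {1..n} \<Longrightarrow> crossed_module C (H i)"
  using bH by (simp add: braided_crossed_module_def)

lemma EB: "butterfly C {1..n} H G E"
  using bE by (simp add: braided_butterfly_def)

lemma gE: "gtorsor C G (mbase {1..n} (\<lambda>l. X0 (H l))) E"
  and stE: "U \<in> Ob C \<Longrightarrow> bfly_stage G U E {1..n} H"
  and lrE: "i \<in> {1..n} \<Longrightarrow> law_res C {1..n} E i"
  and trE: "i \<in> {1..n} \<Longrightarrow> triv_res C {1..n} H E i (triv E i)"
  using butterflyD[OF bG cH EB] by auto

lemma gF: "i \<in> {1..n} \<Longrightarrow> gtorsor C (H i) (mbase {1..m i} (\<lambda>l. X0 (K i l))) (F i)"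
  and stF: "i \<in> {1..n} \<Longrightarrow> U \<in> Ob C \<Longrightarrow> bfly_stage (H i) U (F i) {1..m i} (K i)"
  and lrF: "i \<in> {1..n} \<Longrightarrow> j \<in> {1..m i} \<Longrightarrow> law_res C {1..m i} (F i) j"
  and trF: "i \<in> {1..n} \<Longrightarrow> j \<in> {1..m i} \<Longrightarrow> triv_res C {1..m i} (K i) (F i) j (triv (F i) j)"
  using butterflyD[OF bH cK bF] by auto

lemma st: "U \<in> Ob C \<Longrightarrow> comp_stage G U n E H m F K"
proof (intro comp_stage.intro comp_stage_axioms.intro stE)
  fix i e e' assume "U \<in> Ob C" "i \<in> {1..n}" "composable {1..n} E i U e e'"
  then show "plaw E i U e' e = ract E U
           (plaw E i U (plaw E i U e e')
             (triv E i U ((proj E U e)(i := inv\<^bsub>grp (X1 (H i)) U\<^esub> (brd (H i) U (proj E U e' i) (proj E U e i))))))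
           (brd G U (str E U e) (str E U e'))"
    using bE unfolding braided_butterfly_def Let_def by blast
qed (use stF in auto)

abbreviation "P \<equiv> comp_tors n F E"
abbreviation "HG \<equiv> comp_group n H"
abbreviation "I \<equiv> comp_index n m"
abbreviation "K' \<equiv> \<lambda>(i, j). K i j"
abbreviation "B \<equiv> mbase I (\<lambda>l. X0 (K' l))"
abbreviation "\<pi> \<equiv> comp_proj n m F"
abbreviation "md U \<equiv> comp_stage.md U E F"
abbreviation "matched U \<equiv> comp_stage.matched U n E m F"
abbreviation "tp U \<equiv> comp_stage.tp U n E H F"

section \<open>The equivariant torsor as a sheaf with action\<close>

lemma pF: "i \<in> {1..n} \<Longrightarrow> presheaf C (tot (F i))" by (rule sheaf_presheaf[OF gtorsorD(1)[OF gF]])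

lemma CB_sheaf: "sheaf C (comp_base n F)"
  unfolding comp_base_def by (rule prod_sheaf[OF gtorsorD(1)[OF gF]])

lemma CB_simps: "sec (comp_base n F) U = (\<Pi>\<^sub>E i\<in>{1..n}. sec (tot (F i)) U)"
    "res (comp_base n F) f v = (\<lambda>i\<in>{1..n}. res (tot (F i)) f (v i))"
  by (simp_all add: comp_base_def prod_sh_def)

lemma ys_hom: "sheaf_hom C (comp_base n F) (mbase {1..n} (\<lambda>l. X0 (H l))) (\<lambda>U v. \<lambda>i\<in>{1..n}. str (F i) U (v i))"
proof (rule sheaf_homI)
  fix U v assume U: "U \<in> Ob C" and v: "v \<in> sec (comp_base n F) U"
  have m: "v i \<in> sec (tot (F i)) U" if "i \<in> {1..n}" for i using v that by (auto simp: CB_simps)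
  show "(\<lambda>i\<in>{1..n}. str (F i) U (v i)) \<in> sec (mbase {1..n} (\<lambda>l. X0 (H l))) U"
    unfolding mbase_sec using hom_in[OF gtorsorD(5)[OF gF] U m] by (auto simp: ush_def)
  fix f assume f: "f \<in> arr_to C U"
  show "(\<lambda>i\<in>{1..n}. str (F i) (src C f) (res (comp_base n F) f v i)) = res (mbase {1..n} (\<lambda>l. X0 (H l))) f (\<lambda>i\<in>{1..n}. str (F i) U (v i))"
    unfolding mbase_res using hom_res[OF gtorsorD(5)[OF gF] f m] by (auto simp: CB_simps ush_def fun_eq_iff)
qed

lemma gP: "gtorsor C G (comp_base n F) P"
  unfolding comp_tors_def by (rule pb_gtorsor[OF cG CB_sheaf ys_hom gE])

lemma P_res: "res (tot P) f (v, u) = (\<lambda>i\<in>{1..n}. res (tot (F i)) f (v i), res (tot E) f u)"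
  by (simp add: comp_tors_def pb_simps CB_simps)

lemma P_res_in: "f \<in> arr_to C U \<Longrightarrow> x \<in> sec (tot P) U \<Longrightarrow> res (tot P) f x \<in> sec (tot P) (src C f)"
  by (rule res_in[OF sheaf_presheaf[OF gtorsorD(1)[OF gP]]])

lemma tr_res:
  assumes i: "i \<in> {1..n}" and U: "U \<in> Ob C" and f: "f \<in> arr_to C U" and u: "u \<in> sec (tot E) U" and h: "h \<in> carrier (grp (X1 (H i)) U)"
  shows "res (tot E) f (triv E i U ((proj E U u)(i := h))) =
    triv E i (src C f) ((proj E (src C f) (res (tot E) f u))(i := gres (X1 (H i)) f h))"
proof -
  interpret E: bfly_stage G U E "{1..n}" H by (rule stE[OF U])
  have p: "proj E (src C f) (res (tot E) f u) = (\<lambda>l\<in>{1..n}. gres (X0 (H l)) f (proj E U u l))"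
    using hom_res[OF gtorsorD(3)[OF gE] f u] by (simp add: mbase_res)
  have e: "(\<lambda>l\<in>{1..n}. gres (xfam H i l) f (((proj E U u)(i := h)) l)) =
      (proj E (src C f) (res (tot E) f u))(i := gres (X1 (H i)) f h)"
    unfolding p using i by (auto simp: fun_eq_iff)
  show ?thesis
    using trE[OF i] U f E.xfam_upd[OF E.proj_in[OF u] i h] unfolding triv_res_def e[symmetric] by blast
qed

lemma act1_res:
  assumes i: "i \<in> {1..n}" and U: "U \<in> Ob C" and f: "f \<in> arr_to C U" and x: "x \<in> sec (tot P) U" and h: "h \<in> carrier (grp (X1 (H i)) U)"
  shows "res (tot P) f (comp_act1 F E i U x h) = comp_act1 F E i (src C f) (res (tot P) f x) (gres (X1 (H i)) f h)"
proof -
  interpret S: comp_stage G U n E H m F K by (rule st[OF U])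
  obtain v u where e: "x = (v, u)" "v \<in> S.V" "u \<in> sec (tot E) U" "proj E U u = S.ys v" by (rule S.P_E[OF x])
  have "res (tot E) f (plaw E i U u (triv E i U ((proj E U u)(i := h)))) =
      plaw E i (src C f) (res (tot E) f u) (res (tot E) f (triv E i U ((proj E U u)(i := h))))"
    using lrE[OF i] U f S.E.ac_cmps[OF i e(3) h] unfolding law_res_def S.E.tr_def by blast
  moreover have "(\<lambda>l\<in>{1..n}. res (tot (F l)) f ((v(i := ract (F i) U (v i) h)) l)) =
      (\<lambda>l\<in>{1..n}. res (tot (F l)) f (v l))(i := ract (F i) (src C f) (res (tot (F i)) f (v i)) (gres (X1 (H i)) f h))"
    using i gtorsor_ract_res[OF gF[OF i] f S.V_at[OF e(2) i] h] by (auto simp: fun_eq_iff)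
  ultimately show ?thesis
    using i tr_res[OF i U f e(3) h] by (simp add: e(1) comp_act1_def P_res)
qed

lemma comp_act_res:
  assumes U: "U \<in> Ob C" and f: "f \<in> arr_to C U" and x: "x \<in> sec (tot P) U" and h: "h \<in> carrier (grp HG U)"
  shows "res (tot P) f (comp_act n F E U x h) = comp_act n F E (src C f) (res (tot P) f x) (gres HG f h)"
proof -
  interpret S: comp_stage G U n E H m F K by (rule st[OF U])
  interpret S': comp_stage G "src C f" n E H m F K by (rule st[OF src_Ob[OF f]])
  have g: "gres HG f h i = gres (X1 (H i)) f (h i)" if "i \<in> {1..n}" for i using that by (simp add: comp_group_def prod_gsh_def)
  have "set xs \<subseteq> {1..n} \<Longrightarrow> res (tot P) f (S.fa xs x h) = S'.fa xs (res (tot P) f x) (gres HG f h)" for xs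
  proof (induction xs rule: rev_induct)
    case (snoc i xs)
    then show ?case
      using act1_res[OF _ U f S.fa_in[OF S.HH_at[OF h] _ x], of i xs "h i"] S.HH_at[OF h] g by simp
  qed simp
  then show ?thesis unfolding S.comp_act_fa S'.comp_act_fa by simp
qed

lemma HG_group_sheaf: "group_sheaf C HG"
  unfolding comp_group_def by (rule group_sheaf_prod) (rule xmod_sheaves(1)[OF cH])

lemma P_act: "right_action C HG (tot P) (comp_act n F E)"
  unfolding right_action_def
proof (intro conjI ballI)
  fix U x g assume U: "U \<in> Ob C" and x: "x \<in> sec (tot P) U" and g: "g \<in> carrier (grp HG U)"
  interpret S: comp_stage G U n E H m F K by (rule st[OF U])
  show "comp_act n F E U x g \<in> sec (tot P) U" by (rule S.ca_in[OF x g])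
  fix h assume h: "h \<in> carrier (grp HG U)"
  show "comp_act n F E U x (g \<otimes>\<^bsub>grp HG U\<^esub> h) = comp_act n F E U (comp_act n F E U x g) h" by (rule S.ca_mult[OF x g h])
next
  fix f x g assume f: "f \<in> Ar C" and x: "x \<in> sec (tot P) (tgt C f)" and g: "g \<in> carrier (grp HG (tgt C f))"
  have "f \<in> arr_to C (tgt C f)" "tgt C f \<in> Ob C" using f cat by (auto simp: arr_to_def category_def)
  then show "res (tot P) f (comp_act n F E (tgt C f) x g) = comp_act n F E (src C f) (res (tot P) f x) (gres HG f g)"
    using comp_act_res x g by blast
next
  fix U x assume U: "U \<in> Ob C" and x: "x \<in> sec (tot P) U"
  interpret S: comp_stage G U n E H m F K by (rule st[OF U])
  show "comp_act n F E U x \<one>\<^bsub>grp HG U\<^esub> = x" by (rule S.ca_one[OF x])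
qed

lemma CB_act: "right_action C HG (comp_base n F) (comp_base_act n F)"
proof -
  have ts: "tors_stage (H i) U (F i) (\<Pi>\<^sub>E l\<in>{1..m i}. carrier (grp (X0 (K i l)) U))" if "i \<in> {1..n}" "U \<in> Ob C" for i U
    using bfly_stage.axioms(1)[OF stF[OF that]] .
  show ?thesis
    unfolding right_action_def
  proof (intro conjI ballI)
    fix U x g assume U: "U \<in> Ob C" and x: "x \<in> sec (comp_base n F) U" and g: "g \<in> carrier (grp HG U)"
    have m: "x i \<in> sec (tot (F i)) U" "g i \<in> carrier (grp (X1 (H i)) U)" if "i \<in> {1..n}" for i
      using x g that by (auto simp: CB_simps comp_group_def prod_gsh_def)
    show "comp_base_act n F U x g \<in> sec (comp_base n F) U"
      using tors_stage.ra_in[OF ts[OF _ U] m] by (auto simp: comp_base_act_def CB_simps)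
    fix h assume h: "h \<in> carrier (grp HG U)"
    have m': "h i \<in> carrier (grp (X1 (H i)) U)" if "i \<in> {1..n}" for i
      using h that by (auto simp: comp_group_def prod_gsh_def)
    show "comp_base_act n F U x (g \<otimes>\<^bsub>grp HG U\<^esub> h) = comp_base_act n F U (comp_base_act n F U x g) h"
      using tors_stage.ra_mult[OF ts[OF _ U] m m']
      by (auto simp: comp_base_act_def comp_group_def prod_gsh_def fun_eq_iff)
  next
    fix f x g assume f: "f \<in> Ar C" and x: "x \<in> sec (comp_base n F) (tgt C f)" and g: "g \<in> carrier (grp HG (tgt C f))"
    have f': "f \<in> arr_to C (tgt C f)" using f by (auto simp: arr_to_def)
    have m: "x i \<in> sec (tot (F i)) (tgt C f)" "g i \<in> carrier (grp (X1 (H i)) (tgt C f))" if "i \<in> {1..n}" for i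
      using x g that by (auto simp: CB_simps comp_group_def prod_gsh_def)
    show "res (comp_base n F) f (comp_base_act n F (tgt C f) x g) = comp_base_act n F (src C f) (res (comp_base n F) f x) (gres HG f g)"
      using gtorsor_ract_res[OF gF f' m] by (auto simp: CB_simps comp_base_act_def comp_group_def prod_gsh_def fun_eq_iff)
  next
    fix U x assume U: "U \<in> Ob C" and x: "x \<in> sec (comp_base n F) U"
    have m: "x i \<in> sec (tot (F i)) U" if "i \<in> {1..n}" for i using x that by (auto simp: CB_simps)
    show "comp_base_act n F U x \<one>\<^bsub>grp HG U\<^esub> = x"
    proof (rule ext)
      fix i show "comp_base_act n F U x \<one>\<^bsub>grp HG U\<^esub> i = x i"
      proof (cases "i \<in> {1..n}")
        case True
        then show ?thesis using tors_stage.ra_one[OF ts[OF True U] m[OF True]]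
          by (simp add: comp_base_act_def comp_group_def prod_gsh_def)
      next
        case False
        then show ?thesis using x by (auto simp: comp_base_act_def CB_simps PiE_iff extensional_def)
      qed
    qed
  qed
qed

section \<open>The projection to the base of the composite and the quotient over it\<close>

lemma \<pi>_at: "i \<in> {1..n} \<Longrightarrow> j \<in> {1..m i} \<Longrightarrow> \<pi> U v (i, j) = proj (F i) U (v i) j"
  by (simp add: comp_proj_def comp_index_def)

lemma I_iff: "l \<in> I \<longleftrightarrow> fst l \<in> {1..n} \<and> snd l \<in> {1..m (fst l)}"
  by (cases l) (simp add: comp_index_def)

lemma F_proj:
  assumes "i \<in> {1..n}" "U \<in> Ob C" "w \<in> sec (tot (F i)) U"
  shows "proj (F i) U w \<in> (\<Pi>\<^sub>E l\<in>{1..m i}. carrier (grp (X0 (K i l)) U))"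
  using hom_in[OF gtorsorD(3)[OF gF[OF assms(1)]] assms(2,3)] by (simp add: mbase_sec)

lemma F_proj_res:
  assumes "i \<in> {1..n}" "f \<in> arr_to C U" "w \<in> sec (tot (F i)) U"
  shows "proj (F i) (src C f) (res (tot (F i)) f w) = (\<lambda>l\<in>{1..m i}. gres (X0 (K i l)) f (proj (F i) U w l))"
  using hom_res[OF gtorsorD(3)[OF gF[OF assms(1)]] assms(2,3)] by (simp add: mbase_res)

lemma \<pi>_hom: "sheaf_hom C (comp_base n F) B \<pi>"
proof (rule sheaf_homI)
  fix U v assume U: "U \<in> Ob C" and v: "v \<in> sec (comp_base n F) U"
  have m: "v i \<in> sec (tot (F i)) U" if "i \<in> {1..n}" for i using v that by (auto simp: CB_simps)
  show "\<pi> U v \<in> sec B U" unfolding mbase_sec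
  proof (rule PiE_I)
    fix l assume "l \<in> I"
    then obtain i j where l: "l = (i, j)" "i \<in> {1..n}" "j \<in> {1..m i}" using I_iff by (cases l) auto
    show "\<pi> U v l \<in> carrier (grp (X0 (K' l)) U)"
      using F_proj[OF l(2) U m[OF l(2)]] l by (auto simp: \<pi>_at)
  qed (simp add: comp_proj_def)
  fix f assume f: "f \<in> arr_to C U"
  show "\<pi> (src C f) (res (comp_base n F) f v) = res B f (\<pi> U v)"
    unfolding mbase_res
  proof (rule ext)
    fix l show "\<pi> (src C f) (res (comp_base n F) f v) l = (\<lambda>l\<in>I. gres (X0 (K' l)) f (\<pi> U v l)) l"
    proof (cases "l \<in> I")
      case True
      then obtain i j where l: "l = (i, j)" "i \<in> {1..n}" "j \<in> {1..m i}" using I_iff by (cases l) auto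
      show ?thesis using l True F_proj_res[OF l(2) f m[OF l(2)]] by (simp add: \<pi>_at CB_simps)
    next
      case False
      then show ?thesis by (simp add: comp_proj_def)
    qed
  qed
qed

lemma \<pi>_eqI:
  assumes "\<And>i. i \<in> {1..n} \<Longrightarrow> proj (F i) U (v i) = proj (F i) U (v' i)"
  shows "\<pi> U v = \<pi> U v'"
proof (rule ext)
  fix l show "\<pi> U v l = \<pi> U v' l"
    using assms[of "fst l"] by (cases "l \<in> I") (auto simp: comp_proj_def I_iff split_beta)
qed

lemma \<pi>_eqD:
  assumes U: "U \<in> Ob C" and i: "i \<in> {1..n}" and v: "v i \<in> sec (tot (F i)) U" "v' i \<in> sec (tot (F i)) U"
    and e: "\<And>j. j \<in> {1..m i} \<Longrightarrow> \<pi> U v (i, j) = \<pi> U v' (i, j)"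
  shows "proj (F i) U (v i) = proj (F i) U (v' i)"
  by (rule PiE_ext[OF F_proj[OF i U v(1)] F_proj[OF i U v(2)]]) (use e i in \<open>simp add: \<pi>_at\<close>)

lemma P_proj: "proj P U x = fst x"
  by (cases x) (simp add: comp_tors_def pb_simps)

lemma B_sheaf: "sheaf C B"
proof (rule mbase_sheaf)
  fix l assume "l \<in> I"
  then show "group_sheaf C (X0 (K' l))" using xmod_sheaves(2)[OF cK] I_iff by (cases l) auto
qed

text \<open>Freeness is inherited from the components in \<open>F\<close>, and \<open>\<pi>\<close>
  is invariant because each of these components moves within its fibre.\<close>

sublocale quotient_torsor C HG P "comp_act n F E" G B \<pi>
proof unfold_locales
  show "group_sheaf C HG" "sheaf C (tot P)" "crossed_module C G" "sheaf C B" "right_action C HG (tot P) (comp_act n F E)"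
    "right_action C (X1 G) (tot P) (ract P)" "sheaf_hom C (tot P) (ush (X0 G)) (str P)"
    using HG_group_sheaf gtorsorD[OF gP] cG B_sheaf P_act by auto
  show "sheaf_hom C (tot P) B (\<lambda>U u. \<pi> U (proj P U u))"
    by (rule sheaf_hom_comp[OF gtorsorD(3)[OF gP] \<pi>_hom])
next
  fix U x g assume U: "U \<in> Ob C" and x: "x \<in> sec (tot P) U" and g: "g \<in> carrier (grp HG U)"
  interpret S: comp_stage G U n E H m F K by (rule st[OF U])
  show "\<pi> U (proj P U (comp_act n F E U x g)) = \<pi> U (proj P U x)"
    unfolding P_proj S.ca_fst[OF x g]
  proof (rule \<pi>_eqI)
    fix i assume i: "i \<in> {1..n}"
    then show "proj (F i) U (comp_base_act n F U (fst x) g i) = proj (F i) U (fst x i)"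
      using tors_stage.ra_proj[OF bfly_stage.axioms(1)[OF stF[OF i U]] S.V_at[OF S.fst_in[OF x] i]] S.HH_at[OF g]
      by (simp add: comp_base_act_def)
  qed
  show "str P U (comp_act n F E U x g) = str P U x" by (rule S.ca_str[OF x g])
  { fix h assume h: "h \<in> carrier (grp HG U)" and "comp_act n F E U x g = comp_act n F E U x h"
    then show "g = h" using S.ca_free_fst[OF x g h] by simp }
  fix k assume k: "k \<in> carrier (grp (X1 G) U)"
  show "comp_act n F E U (ract P U x k) g = ract P U (comp_act n F E U x g) k" by (rule S.ca_ract[OF x g k])
next
  fix U x g assume U: "U \<in> Ob C" and x: "x \<in> sec (tot P) U" and g: "g \<in> carrier (grp (X1 G) U)"
  interpret T: tors_stage G U P "sec (comp_base n F) U" by (rule tors_stageI[OF cG gP U])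
  show "\<pi> U (proj P U (ract P U x g)) = \<pi> U (proj P U x)" using T.ra_proj[OF x g] by simp
  show "str P U (ract P U x g) = str P U x \<otimes>\<^bsub>grp (X0 G) U\<^esub> bd G U g" using T.str_ra[OF x g] .
qed

text \<open>Each \<open>F\<^sub>i\<close> has points over \<open>y i\<close> only locally; the
  finitely many covers have a common refinement.\<close>

lemma lift_tuple:
  assumes U: "U \<in> Ob C" and y: "\<And>i. i \<in> {1..n} \<Longrightarrow> y i \<in> (\<Pi>\<^sub>E l\<in>{1..m i}. carrier (grp (X0 (K i l)) U))"
  shows "lc U (\<lambda>f. \<exists>v\<in>sec (comp_base n F) (src C f). \<forall>i\<in>{1..n}. proj (F i) (src C f) (v i) = (\<lambda>l\<in>{1..m i}. gres (X0 (K i l)) f (y i l)))"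
proof -
  define R where "R i f \<longleftrightarrow> (\<exists>w\<in>sec (tot (F i)) (src C f). proj (F i) (src C f) w = (\<lambda>l\<in>{1..m i}. gres (X0 (K i l)) f (y i l)))" for i f
  have "lc U (\<lambda>f. \<forall>i\<in>{1..n}. R i f)"
  proof (rule lc_ball[OF U])
    show "lc U (R i)" if i: "i \<in> {1..n}" for i
      using locally_surjD[OF gtorsorD(4)[OF gF[OF i]] U, of "y i"] y[OF i] unfolding R_def mbase_res by (simp add: mbase_sec)
    fix i f g assume i: "i \<in> {1..n}" and f: "f \<in> arr_to C U" and g: "g \<in> arr_to C (src C f)" and R: "R i f"
    obtain w where w: "w \<in> sec (tot (F i)) (src C f)" "proj (F i) (src C f) w = (\<lambda>l\<in>{1..m i}. gres (X0 (K i l)) f (y i l))"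
      using R unfolding R_def by auto
    have "proj (F i) (src C g) (res (tot (F i)) g w) = (\<lambda>l\<in>{1..m i}. gres (X0 (K i l)) (cmp C f g) (y i l))"
      unfolding F_proj_res[OF i g w(1)] w(2)
    proof (rule restrict_ext)
      fix l assume l: "l \<in> {1..m i}"
      have "sheaf C (ush (X0 (K i l)))" using xmod_sheaves(2)[OF cK[OF i l]] by (simp add: group_sheaf_def)
      from res_cmp[OF sheaf_presheaf[OF this] f g, of "y i l"] show "gres (X0 (K i l)) g ((\<lambda>l\<in>{1..m i}. gres (X0 (K i l)) f (y i l)) l) = gres (X0 (K i l)) (cmp C f g) (y i l)"
        using l PiE_mem[OF y[OF i] l] by (simp add: ush_def)
    qed
    then show "R i (cmp C f g)" unfolding R_def using res_in[OF pF[OF i] g w(1)] f g by auto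
  qed simp
  then show ?thesis
  proof (rule lc_mono[OF _ U])
    fix f assume "\<forall>i\<in>{1..n}. R i f"
    then have "\<forall>i\<in>{1..n}. \<exists>w. w\<in>sec (tot (F i)) (src C f) \<and> proj (F i) (src C f) w = (\<lambda>l\<in>{1..m i}. gres (X0 (K i l)) f (y i l))"
      unfolding R_def by blast
    from bchoice[OF this] obtain v where v: "\<forall>i\<in>{1..n}. v i\<in>sec (tot (F i)) (src C f) \<and> proj (F i) (src C f) (v i) = (\<lambda>l\<in>{1..m i}. gres (X0 (K i l)) f (y i l))" ..
    show "\<exists>v\<in>sec (comp_base n F) (src C f). \<forall>i\<in>{1..n}. proj (F i) (src C f) (v i) = (\<lambda>l\<in>{1..m i}. gres (X0 (K i l)) f (y i l))"
      by (rule bexI[of _ "restrict v {1..n}"]) (use v in \<open>auto simp: CB_simps\<close>)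
  qed
qed

text \<open>Two local choices: a tuple of points of the \<open>F\<^sub>i\<close> over the given
  point, and a point of \<open>P\<close> over that tuple.\<close>

lemma \<pi>_surj: "locally_surj C (tot P) B (\<lambda>U u. \<pi> U (proj P U u))"
proof (rule locally_surjI[OF pX sheaf_presheaf[OF B_sheaf] prj])
  fix U y assume U: "U \<in> Ob C" and y: "y \<in> sec B U"
  define y' where "y' i = (\<lambda>j\<in>{1..m i}. y (i, j))" for i
  have y': "y' i \<in> (\<Pi>\<^sub>E l\<in>{1..m i}. carrier (grp (X0 (K i l)) U))" if "i \<in> {1..n}" for i
    unfolding y'_def
  proof (intro PiE_I)
    fix j assume j: "j \<in> {1..m i}"
    then have "(i, j) \<in> I" using that by (simp add: I_iff)
    from PiE_mem[OF y[unfolded mbase_sec] this] show "(\<lambda>j\<in>{1..m i}. y (i, j)) j \<in> carrier (grp (X0 (K i j)) U)"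
      using j by simp
  qed simp
  show "lc U (\<lambda>f. \<exists>x\<in>sec (tot P) (src C f). \<pi> (src C f) (proj P (src C f) x) = res B f y)"
  proof (rule lc_bind[OF U lift_tuple[OF U y']])
    fix f assume f: "f \<in> arr_to C U" and "\<exists>v\<in>sec (comp_base n F) (src C f). \<forall>i\<in>{1..n}. proj (F i) (src C f) (v i) = (\<lambda>l\<in>{1..m i}. gres (X0 (K i l)) f (y' i l))"
    then obtain v where v: "v \<in> sec (comp_base n F) (src C f)" "\<And>i. i\<in>{1..n} \<Longrightarrow> proj (F i) (src C f) (v i) = (\<lambda>l\<in>{1..m i}. gres (X0 (K i l)) f (y' i l))" by auto
    have \<pi>v: "\<pi> (src C f) v = res B f y"
    proof (rule ext)
      fix l show "\<pi> (src C f) v l = res B f y l"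
        using v(2)[of "fst l"] by (cases "l \<in> I") (auto simp: comp_proj_def I_iff split_beta mbase_res y'_def)
    qed
    show "lc (src C f) (\<lambda>g. \<exists>x\<in>sec (tot P) (src C (cmp C f g)). \<pi> (src C (cmp C f g)) (proj P (src C (cmp C f g)) x) = res B (cmp C f g) y)"
    proof (rule lc_mono[OF locally_surjD[OF gtorsorD(4)[OF gP] src_Ob[OF f] v(1)] src_Ob[OF f]])
      fix g assume g: "g \<in> arr_to C (src C f)" and "\<exists>x\<in>sec (tot P) (src C g). proj P (src C g) x = res (comp_base n F) g v"
      then obtain x where x: "x \<in> sec (tot P) (src C g)" "proj P (src C g) x = res (comp_base n F) g v" by auto
      have "\<pi> (src C g) (proj P (src C g) x) = res B (cmp C f g) y"
        using hom_res[OF \<pi>_hom g v(1)] x(2) \<pi>v res_cmp[OF sheaf_presheaf[OF B_sheaf] f g y] by simp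
      then show "\<exists>x\<in>sec (tot P) (src C (cmp C f g)). \<pi> (src C (cmp C f g)) (proj P (src C (cmp C f g)) x) = res B (cmp C f g) y"
        using x f g by (intro bexI[of _ x]) simp_all
    qed
  qed
qed

text \<open>Transitivity: the product group moves one point until its components in \<open>F\<close>
  are those of the other, which leaves an element of \<open>G\<^sub>1\<close>. Freeness: an element
  of the product group that relates two \<open>G\<^sub>1\<close>-translates of a point fixes all
  components in \<open>F\<close>, hence is trivial.\<close>

lemma gQ: "gtorsor C G B QT"
proof (rule gtorsor_QT[OF \<pi>_surj])
  fix U x y assume U: "U \<in> Ob C" and x: "x \<in> sec (tot P) U" and y: "y \<in> sec (tot P) U" and e: "\<pi> U (proj P U x) = \<pi> U (proj P U y)"
  interpret S: comp_stage G U n E H m F K by (rule st[OF U])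
  interpret T: tors_stage G U P "sec (comp_base n F) U" by (rule tors_stageI[OF cG gP U])
  obtain h where h: "h \<in> S.HH" "fst (comp_act n F E U x h) = fst y"
  proof (rule S.ca_move[OF x S.fst_in[OF y]])
    fix i assume i: "i \<in> {1..n}"
    show "proj (F i) U (fst x i) = proj (F i) U (fst y i)"
      using e unfolding P_proj by (intro \<pi>_eqD[where v = "fst x" and v' = "fst y", OF U i S.V_at[OF S.fst_in[OF x] i] S.V_at[OF S.fst_in[OF y] i]]) simp
  qed
  have xh: "comp_act n F E U x h \<in> sec (tot P) U" by (rule S.ca_in[OF x h(1)])
  have pe: "proj P U (comp_act n F E U x h) = proj P U y" using h(2) by (simp add: P_proj)
  obtain g where g: "g \<in> carrier (grp (X1 G) U)" "y = ract P U (comp_act n F E U x h) g"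
    using T.ra_ex[OF xh y pe] by auto
  show "\<exists>g\<in>carrier (grp (X1 G) U). orb U (ract P U x g) y"
    using g h(1) S.ca_ract[OF x h(1) g(1)] unfolding orb_def by (intro bexI[OF _ g(1)] bexI[of _ h]) simp_all
next
  fix U x g g' assume U: "U \<in> Ob C" and x: "x \<in> sec (tot P) U" and g: "g \<in> carrier (grp (X1 G) U)"
    and g': "g' \<in> carrier (grp (X1 G) U)" and o: "orb U (ract P U x g) (ract P U x g')"
  interpret S: comp_stage G U n E H m F K by (rule st[OF U])
  interpret T: tors_stage G U P "sec (comp_base n F) U" by (rule tors_stageI[OF cG gP U])
  obtain h where h: "h \<in> S.HH" "ract P U x g' = comp_act n F E U (ract P U x g) h" using o unfolding orb_def by auto
  have e: "ract P U x g' = ract P U (comp_act n F E U x h) g" using h S.ca_ract[OF x h(1) g] by simp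
  have one: "\<one>\<^bsub>grp HG U\<^esub> \<in> S.HH" using grpA[OF U] by (simp add: group.is_monoid monoid.one_closed)
  have "fst (comp_act n F E U x h) = fst (comp_act n F E U x \<one>\<^bsub>grp HG U\<^esub>)"
    using arg_cong[OF e, of fst] S.ca_one[OF x] by (simp add: S.P_ract)
  then have "h = \<one>\<^bsub>grp HG U\<^esub>" by (rule S.ca_free_fst[OF x h(1) one])
  then have "ract P U x g = ract P U x g'" using e S.ca_one[OF x] by simp
  then show "g = g'" by (rule T.ra_free[OF x g g'])
qed

lemma equivariant: "equivariant_gtorsor C G HG (comp_base n F) (comp_base_act n F) P (comp_act n F E)"
  unfolding equivariant_gtorsor_def
proof (intro conjI ballI gP CB_act P_act)
  fix U u h assume U: "U \<in> Ob C" and u: "u \<in> sec (tot P) U" and h: "h \<in> carrier (grp HG U)"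
  interpret S: comp_stage G U n E H m F K by (rule st[OF U])
  show "proj P U (comp_act n F E U u h) = comp_base_act n F U (proj P U u) h" using S.ca_fst[OF u h] by (simp add: P_proj)
  show "str P U (comp_act n F E U u h) = str P U u" by (rule str_inv[OF U u h])
  fix g assume g: "g \<in> carrier (grp (X1 G) U)"
  show "comp_act n F E U (ract P U u g) h = ract P U (comp_act n F E U u h) g" by (rule ra_comm[OF U u g h])
qed

lemma well_defined: "well_defined_quotient C G HG (comp_act n F E) B \<pi> P"
  unfolding well_defined_quotient_def Let_def
proof (intro conjI ballI gQ)
  show "sheaf_hom C (tot P) (tot QT) q" "locally_surj C (tot P) (tot QT) q" unfolding tot_QT by (rule q_hom q_surj)+
next
  fix U u v assume U: "U \<in> Ob C" and u: "u \<in> sec (tot P) U" and v: "v \<in> sec (tot P) U"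
  show "q U u = q U v \<longleftrightarrow> (\<exists>h\<in>carrier (grp HG U). v = comp_act n F E U u h)" using q_eq_iff[OF U u v] unfolding orb_def .
next
  fix U u assume U: "U \<in> Ob C" and u: "u \<in> sec (tot P) U"
  show "proj QT U (q U u) = \<pi> U (proj P U u)" "str QT U (q U u) = str P U u" by (rule proj_q[OF U u] str_q[OF U u])+
  fix g assume g: "g \<in> carrier (grp (X1 G) U)"
  show "ract QT U (q U u) g = q U (ract P U u g)" by (rule ract_q[OF U u g])
qed

end

section \<open>The partial composition laws of the quotient\<close>

context composite
begin

lemma CB_V: "sec (comp_base n F) U = (\<Pi>\<^sub>E i\<in>{1..n}. sec (tot (F i)) U)"
  by (rule CB_simps(1))

lemma fst_res: "fst (res (tot P) f x) = (\<lambda>i\<in>{1..n}. res (tot (F i)) f (fst x i))"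
  and snd_res: "snd (res (tot P) f x) = res (tot E) f (snd x)"
  by (cases x; simp add: P_res)+

lemma matched_res:
  assumes U: "U \<in> Ob C" and f: "f \<in> arr_to C U" and mt: "matched U i j x x'"
  shows "matched (src C f) i j (res (tot P) f x) (res (tot P) f x')"
proof -
  interpret S: comp_stage G U n E H m F K by (rule st[OF U])
  interpret S': comp_stage G "src C f" n E H m F K by (rule st[OF src_Ob[OF f]])
  have i: "i \<in> {1..n}" "j \<in> {1..m i}" and x: "x \<in> sec (tot P) U" "x' \<in> sec (tot P) U"
    and e: "\<And>l. l\<in>{1..n} - {i} \<Longrightarrow> fst x l = fst x' l" "\<And>l. l\<in>{1..m i} - {j} \<Longrightarrow> proj (F i) U (fst x i) l = proj (F i) U (fst x' i) l"
    using mt by (auto simp: S.matched_def)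
  have v: "fst x i \<in> sec (tot (F i)) U" "fst x' i \<in> sec (tot (F i)) U"
    using S.V_at[OF S.fst_in[OF x(1)] i(1)] S.V_at[OF S.fst_in[OF x(2)] i(1)] .
  show ?thesis unfolding S'.matched_def
    using i e P_res_in[OF f x(1)] P_res_in[OF f x(2)]
    by (simp add: fst_res F_proj_res[OF i(1) f v(1)] F_proj_res[OF i(1) f v(2)])
qed

lemma md_res:
  assumes U: "U \<in> Ob C" and f: "f \<in> arr_to C U" and mt: "matched U i j x x'"
  shows "res (tot P) f (md U i j x x') = md (src C f) i j (res (tot P) f x) (res (tot P) f x')"
proof -
  interpret S: comp_stage G U n E H m F K by (rule st[OF U])
  interpret S': comp_stage G "src C f" n E H m F K by (rule st[OF src_Ob[OF f]])
  note c = S.md_cmps[OF mt]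
  have 1: "res (tot (F i)) f (plaw (F i) j U (fst x i) (fst x' i)) = plaw (F i) j (src C f) (res (tot (F i)) f (fst x i)) (res (tot (F i)) f (fst x' i))"
    using lrF[OF c(3,4)] U f c(1) unfolding law_res_def by blast
  have 2: "res (tot E) f (plaw E i U (snd x) (snd x')) = plaw E i (src C f) (res (tot E) f (snd x)) (res (tot E) f (snd x'))"
    using lrE[OF c(3)] U f c(2) unfolding law_res_def by blast
  show ?thesis using 1 2 c(3) by (auto simp: S.md_def S'.md_def P_res fst_res snd_res fun_eq_iff)
qed

lemma q_move:
  assumes U: "U \<in> Ob C" and y: "y \<in> sec (tot P) U" and v: "v \<in> sec (comp_base n F) U"
    and e: "\<And>i. i \<in> {1..n} \<Longrightarrow> proj (F i) U (fst y i) = proj (F i) U (v i)"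
  obtains y' where "y' \<in> sec (tot P) U" "q U y' = q U y" "fst y' = v"
proof -
  interpret S: comp_stage G U n E H m F K by (rule st[OF U])
  obtain h where h: "h \<in> S.HH" "fst (comp_act n F E U y h) = v"
    by (rule S.ca_move[OF y v[unfolded CB_V] e])
  have "q U y = q U (comp_act n F E U y h)"
    using q_eq_iff[OF U y S.ca_in[OF y h(1)]] orb_act[OF h(1)] by simp
  then show ?thesis using that[OF S.ca_in[OF y h(1)] _ h(2)] by simp
qed

lemma \<pi>_eq_proj: "i \<in> {1..n} \<Longrightarrow> U \<in> Ob C \<Longrightarrow> x \<in> sec (tot P) U \<Longrightarrow> y \<in> sec (tot P) U \<Longrightarrow>
    (\<And>j. j \<in> {1..m i} \<Longrightarrow> \<pi> U (fst x) (i, j) = \<pi> U (fst y) (i, j)) \<Longrightarrow> proj (F i) U (fst x i) = proj (F i) U (fst y i)"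
  using \<pi>_eqD[where v = "fst x" and v' = "fst y"] comp_stage.V_at[OF st comp_stage.fst_in[OF st]] by blast

text \<open>A class composable with that of \<open>x\<close> is given a matched representative by
  replacing its components outside \<open>i\<close> with those of \<open>x\<close>. The explicit
  form of the new tuple is needed to complete a square of four classes.\<close>

lemma q_match:
  assumes U: "U \<in> Ob C" and x: "x \<in> sec (tot P) U" and y: "y \<in> sec (tot P) U" and ij: "(i, j) \<in> I"
    and e: "\<And>l. l \<in> I - {(i, j)} \<Longrightarrow> \<pi> U (fst x) l = \<pi> U (fst y) l"
  obtains y' where "matched U i j x y'" "q U y' = q U y" "fst y' = (fst x)(i := fst y i)"
proof -
  interpret S: comp_stage G U n E H m F K by (rule st[OF U])
  have i: "i \<in> {1..n}" "j \<in> {1..m i}" using ij by (auto simp: I_iff)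
  have v: "(fst x)(i := fst y i) \<in> sec (comp_base n F) U"
    unfolding CB_V by (rule S.V_upd[OF S.fst_in[OF x] i(1) S.V_at[OF S.fst_in[OF y] i(1)]])
  obtain y' where y': "y' \<in> sec (tot P) U" "q U y' = q U y" "fst y' = (fst x)(i := fst y i)"
  proof (rule q_move[OF U y v])
    fix l assume l: "l \<in> {1..n}"
    show "proj (F l) U (fst y l) = proj (F l) U (((fst x)(i := fst y i)) l)"
      using \<pi>_eq_proj[OF l U y x] e l by (auto simp: I_iff)
  qed
  have "matched U i j x y'" unfolding S.matched_def
  proof (intro conjI ballI)
    fix l assume "l \<in> {1..m i} - {j}"
    then show "proj (F i) U (fst x i) l = proj (F i) U (fst y' i) l"
      using e[of "(i, l)"] i by (simp add: I_iff \<pi>_at y'(3))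
  qed (use i x y' in auto)
  then show ?thesis using that y' by blast
qed

text \<open>Composability in the quotient, formulated without the record of the composite, which can
  only be formed once laws and sections exist.\<close>

definition cq where
  "cq p U W W' \<longleftrightarrow> W \<in> sec Q U \<and> W' \<in> sec Q U \<and> (\<forall>l\<in>I - {p}. proj QT U W l = proj QT U W' l)"

lemma proj_QT_q: "U \<in> Ob C \<Longrightarrow> x \<in> sec (tot P) U \<Longrightarrow> proj QT U (q U x) = \<pi> U (fst x)"
  by (simp add: proj_q P_proj)

lemma cq_q:
  assumes U: "U \<in> Ob C" and mt: "matched U i j x x'"
  shows "cq (i, j) U (q U x) (q U x')"
proof -
  interpret S: comp_stage G U n E H m F K by (rule st[OF U])
  note c = S.md_cmps[OF mt]
  have "\<pi> U (fst x) l = \<pi> U (fst x') l" if "l \<in> I - {(i, j)}" for l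
  proof -
    obtain a b where l: "l = (a, b)" by (cases l)
    then have ab: "a \<in> {1..n}" "b \<in> {1..m a}" using that by (auto simp: I_iff)
    show ?thesis using mt that ab by (cases "a = i") (auto simp: l \<pi>_at S.matched_def)
  qed
  then show ?thesis unfolding cq_def using U c by (simp add: q_in proj_QT_q)
qed

lemma proj_QT_in: "U \<in> Ob C \<Longrightarrow> W \<in> sec Q U \<Longrightarrow> proj QT U W \<in> sec B U"
  by (rule hom_in[OF proj_hom])

lemma proj_QT_res: "f \<in> arr_to C U \<Longrightarrow> W \<in> sec Q U \<Longrightarrow> proj QT (src C f) (res Q f W) = res B f (proj QT U W)"
  by (rule hom_res[OF proj_hom])

lemma cq_res:
  assumes U: "U \<in> Ob C" and f: "f \<in> arr_to C U" and c: "cq p U W W'"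
  shows "cq p (src C f) (res Q f W) (res Q f W')"
proof -
  have W: "W \<in> sec Q U" "W' \<in> sec Q U" and e: "\<And>l. l\<in>I - {p} \<Longrightarrow> proj QT U W l = proj QT U W' l" using c by (auto simp: cq_def)
  have "res B f (proj QT U W) l = res B f (proj QT U W') l" if "l \<in> I - {p}" for l
    using e[OF that] that by (simp add: mbase_res)
  then show ?thesis unfolding cq_def proj_QT_res[OF f W(1)] proj_QT_res[OF f W(2)] using Q_res_in[OF U f] W by blast
qed

text \<open>For identities in three or four classes, representatives have to be available over one
  and the same arrow.\<close>

lemma Qs_lift:
  assumes U: "U \<in> Ob C" and A: "finite A" "A \<subseteq> sec Q U"
  shows "lc U (\<lambda>f. \<forall>W\<in>A. \<exists>x\<in>sec (tot P) (src C f). q (src C f) x = res Q f W)"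
proof (rule lc_ball[OF U A(1)])
  show "lc U (\<lambda>f. \<exists>x\<in>sec (tot P) (src C f). q (src C f) x = res Q f W)" if "W \<in> A" for W
    using Q_lift[OF U] that A(2) by blast
  fix W f g assume W: "W \<in> A" and f: "f \<in> arr_to C U" and g: "g \<in> arr_to C (src C f)"
    and "\<exists>x\<in>sec (tot P) (src C f). q (src C f) x = res Q f W"
  then obtain x where x: "x\<in>sec (tot P) (src C f)" "q (src C f) x = res Q f W" by auto
  have "q (src C g) (res (tot P) g x) = res Q (cmp C f g) W"
    using q_res[OF g src_Ob[OF f] x(1)] x(2) res_cmp[OF Q_presheaf f g] W A(2) by auto
  then show "\<exists>x\<in>sec (tot P) (src C (cmp C f g)). q (src C (cmp C f g)) x = res Q (cmp C f g) W"
    using P_res_in[OF g x(1)] f g by auto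
qed

lemma cq_match:
  assumes U: "U \<in> Ob C" and x: "x \<in> sec (tot P) U" and y: "y \<in> sec (tot P) U" and ij: "(i, j) \<in> I"
    and c: "cq (i, j) U (q U x) (q U y)"
  obtains y' where "matched U i j x y'" "q U y' = q U y" "fst y' = (fst x)(i := fst y i)"
  by (rule q_match[OF U x y ij]) (use c U x y that in \<open>auto simp: cq_def proj_QT_q\<close>)

lemma lift2:
  assumes U: "U \<in> Ob C" and ij: "(i, j) \<in> I" and c: "cq (i, j) U W W'"
  shows "lc U (\<lambda>f. \<exists>x x'. matched (src C f) i j x x' \<and> res Q f W = q (src C f) x \<and> res Q f W' = q (src C f) x')"
proof -
  have W: "W \<in> sec Q U" "W' \<in> sec Q U" using c by (auto simp: cq_def)
  show ?thesis
  proof (rule lc_mono[OF Qs_lift[OF U, of "{W, W'}"] U])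
    fix f assume f: "f \<in> arr_to C U" and "\<forall>W\<in>{W, W'}. \<exists>x\<in>sec (tot P) (src C f). q (src C f) x = res Q f W"
    then obtain x y where x: "x \<in> sec (tot P) (src C f)" "q (src C f) x = res Q f W"
      and y: "y \<in> sec (tot P) (src C f)" "q (src C f) y = res Q f W'" by auto
    have c': "cq (i, j) (src C f) (q (src C f) x) (q (src C f) y)" using cq_res[OF U f c] x y by simp
    obtain y' where "matched (src C f) i j x y'" "q (src C f) y' = q (src C f) y" by (rule cq_match[OF src_Ob[OF f] x(1) y(1) ij c'])
    then show "\<exists>x x'. matched (src C f) i j x x' \<and> res Q f W = q (src C f) x \<and> res Q f W' = q (src C f) x'"
      using x y by metis
  qed (use W in auto)
qed

lemma md_q_cong:
  assumes U: "U \<in> Ob C" and mt: "matched U i j x x'" and mt': "matched U i j y y'"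
    and e: "q U x = q U y" "q U x' = q U y'"
  shows "q U (md U i j x x') = q U (md U i j y y')"
proof -
  interpret S: comp_stage G U n E H m F K by (rule st[OF U])
  have x: "x \<in> sec (tot P) U" "x' \<in> sec (tot P) U" "y \<in> sec (tot P) U" "y' \<in> sec (tot P) U"
    using mt mt' by (auto simp: S.matched_def)
  obtain h h' where h: "h \<in> S.HH" "y = comp_act n F E U x h" "h' \<in> S.HH" "y' = comp_act n F E U x' h'"
    using e q_eq_iff[OF U] x unfolding orb_def by metis
  obtain k where k: "k \<in> S.HH" "md U i j y y' = comp_act n F E U (md U i j x x') k"
    using S.md_orb[OF mt h(1,3)] mt' h by metis
  show ?thesis
    using q_eq_iff[OF U S.md_in[OF mt] S.md_in[OF mt']] orb_act[OF k(1)] k(2) by simp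
qed

text \<open>The law \<open>\<times>\<close> in direction \<open>p\<close>. All matched
  representatives over all arrows contribute, so nothing is chosen; the local values agree by
  \<open>md_q_cong\<close> and glue.\<close>

definition plq where
  "plq p U W W' = (THE Z. Z \<in> sec Q U \<and> (\<forall>f\<in>arr_to C U. \<forall>V.
     (\<exists>x x'. matched (src C f) (fst p) (snd p) x x' \<and> res Q f W = q (src C f) x \<and> res Q f W' = q (src C f) x' \<and>
       V = q (src C f) (md (src C f) (fst p) (snd p) x x')) \<longrightarrow> res Q f Z = V))"

lemma plq_props:
  assumes U: "U \<in> Ob C" and ij: "(i, j) \<in> I" and c: "cq (i, j) U W W'"
  shows "plq (i, j) U W W' \<in> sec Q U" (is ?a)
    and "\<And>f x x'. f \<in> arr_to C U \<Longrightarrow> matched (src C f) i j x x' \<Longrightarrow> res Q f W = q (src C f) x \<Longrightarrow>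
      res Q f W' = q (src C f) x' \<Longrightarrow> res Q f (plq (i, j) U W W') = q (src C f) (md (src C f) i j x x')"
proof -
  define \<Phi> where "\<Phi> f V \<longleftrightarrow> (\<exists>x x'. matched (src C f) i j x x' \<and> res Q f W = q (src C f) x \<and> res Q f W' = q (src C f) x' \<and>
       V = q (src C f) (md (src C f) i j x x'))" for f V
  have W: "W \<in> sec Q U" "W' \<in> sec Q U" using c by (auto simp: cq_def)
  have ex: "\<exists>!Z. Z \<in> sec Q U \<and> (\<forall>f\<in>arr_to C U. \<forall>V. \<Phi> f V \<longrightarrow> res Q f Z = V)"
  proof (rule glue[OF Q_sheaf U])
    fix f V assume f: "f \<in> arr_to C U" and V: "\<Phi> f V"
    interpret S: comp_stage G "src C f" n E H m F K by (rule st[OF src_Ob[OF f]])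
    obtain x x' where x: "matched (src C f) i j x x'" "res Q f W = q (src C f) x" "res Q f W' = q (src C f) x'"
      "V = q (src C f) (md (src C f) i j x x')" using V unfolding \<Phi>_def by blast
    have xm: "x \<in> sec (tot P) (src C f)" "x' \<in> sec (tot P) (src C f)" using x(1) by (auto simp: S.matched_def)
    show "V \<in> sec Q (src C f)" using x q_in[OF src_Ob[OF f] S.md_in[OF x(1)]] by simp
    { fix V' assume "\<Phi> f V'"
      then show "V = V'" unfolding \<Phi>_def using x md_q_cong[OF src_Ob[OF f] x(1)] by metis }
    fix g assume g: "g \<in> arr_to C (src C f)"
    have r: "res Q (cmp C f g) W = q (src C g) (res (tot P) g x)" "res Q (cmp C f g) W' = q (src C g) (res (tot P) g x')"
      using q_res[OF g src_Ob[OF f]] xm x W res_cmp[OF Q_presheaf f g] by simp_all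
    have "res Q g V = q (src C g) (md (src C g) i j (res (tot P) g x) (res (tot P) g x'))"
      using x(4) q_res[OF g src_Ob[OF f] S.md_in[OF x(1)]] md_res[OF src_Ob[OF f] g x(1)] by simp
    then show "\<Phi> (cmp C f g) (res Q g V)" unfolding \<Phi>_def
      using matched_res[OF src_Ob[OF f] g x(1)] r f g
      by (intro exI[of _ "res (tot P) g x"] exI[of _ "res (tot P) g x'"]) simp
  next
    show "lc U (\<lambda>f. \<exists>V. \<Phi> f V)"
      by (rule lc_mono[OF lift2[OF U ij c] U]) (auto simp: \<Phi>_def)
  qed
  have d: "plq (i, j) U W W' = (THE Z. Z \<in> sec Q U \<and> (\<forall>f\<in>arr_to C U. \<forall>V. \<Phi> f V \<longrightarrow> res Q f Z = V))"
    unfolding plq_def \<Phi>_def fst_conv snd_conv ..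
  note t = theI'[OF ex, folded d]
  show ?a using t by blast
  show "res Q f (plq (i, j) U W W') = q (src C f) (md (src C f) i j x x')"
    if "f \<in> arr_to C U" "matched (src C f) i j x x'" "res Q f W = q (src C f) x" "res Q f W' = q (src C f) x'" for f x x'
    using t that unfolding \<Phi>_def by blast
qed

lemma plq_q:
  assumes U: "U \<in> Ob C" and mt: "matched U i j x x'"
  shows "plq (i, j) U (q U x) (q U x') = q U (md U i j x x')"
proof -
  interpret S: comp_stage G U n E H m F K by (rule st[OF U])
  note c = S.md_cmps[OF mt]
  have ij: "(i, j) \<in> I" using c by (simp add: I_iff)
  note p = plq_props[OF U ij cq_q[OF U mt]]
  \<comment> \<open>With global representatives the defining property can be used at the identity
    arrow.\<close>
  have "res Q (idt C U) (plq (i, j) U (q U x) (q U x')) = q U (md U i j x x')"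
    using p(2)[OF idt_arr[OF U], of x x'] mt U c by (simp add: q_in res_idt[OF Q_presheaf])
  then show ?thesis using p(1) U by (simp add: res_idt[OF Q_presheaf])
qed

text \<open>The method of proof for identities in two composable classes: equality in a sheaf is
  local, and locally the classes have matched representatives.\<close>

lemma check2:
  assumes Y: "sheaf C Y" and U: "U \<in> Ob C" and ij: "(i, j) \<in> I" and c: "cq (i, j) U W W'"
    and s: "s \<in> sec Y U" "t \<in> sec Y U"
    and e: "\<And>f x x'. f \<in> arr_to C U \<Longrightarrow> src C f \<in> Ob C \<Longrightarrow> matched (src C f) i j x x' \<Longrightarrow> res Q f W = q (src C f) x \<Longrightarrow>
      res Q f W' = q (src C f) x' \<Longrightarrow> res Y f s = res Y f t"
  shows "s = t"
  by (rule sheaf_eqI[OF Y U s], rule lc_mono[OF lift2[OF U ij c] U]) (use e src_Ob in blast)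

lemma plq_res:
  assumes U: "U \<in> Ob C" and ij: "(i, j) \<in> I" and c: "cq (i, j) U W W'" and f: "f \<in> arr_to C U"
  shows "res Q f (plq (i, j) U W W') = plq (i, j) (src C f) (res Q f W) (res Q f W')"
proof -
  note V = src_Ob[OF f]
  note cf = cq_res[OF U f c]
  have W: "W \<in> sec Q U" "W' \<in> sec Q U" using c by (auto simp: cq_def)
  show ?thesis
  proof (rule check2[OF Q_sheaf V ij cf Q_res_in[OF U f plq_props(1)[OF U ij c]] plq_props(1)[OF V ij cf]])
    fix g x x' assume g: "g \<in> arr_to C (src C f)" and mt: "matched (src C g) i j x x'"
      and r: "res Q g (res Q f W) = q (src C g) x" "res Q g (res Q f W') = q (src C g) x'"
    have fg: "cmp C f g \<in> arr_to C U" "src C (cmp C f g) = src C g" using f g by simp_all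
    have r': "res Q (cmp C f g) W = q (src C g) x" "res Q (cmp C f g) W' = q (src C g) x'"
      using r W res_cmp[OF Q_presheaf f g] by simp_all
    have "res Q (cmp C f g) (plq (i, j) U W W') = q (src C g) (md (src C g) i j x x')"
      using plq_props(2)[OF U ij c fg(1)] mt r' fg(2) by simp
    then show "res Q g (res Q f (plq (i, j) U W W')) = res Q g (plq (i, j) (src C f) (res Q f W) (res Q f W'))"
      using plq_props(2)[OF V ij cf g mt r] res_cmp[OF Q_presheaf f g plq_props(1)[OF U ij c]] by simp
  qed
qed

lemma plq_proj:
  assumes U: "U \<in> Ob C" and ij: "(i, j) \<in> I" and c: "cq (i, j) U W W'"
  shows "proj QT U (plq (i, j) U W W') = axis_mult (\<lambda>l. X0 (K' l)) (i, j) U (proj QT U W, proj QT U W')"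
proof -
  \<comment> \<open>Provides naturality of the multiplication of base points along the axis; the
    record is provisional.\<close>
  interpret ax: mext_axis C I "\<lambda>l. X0 (K' l)" G "tors.extend QT (mext.fields plq)" "(i, j)"
  proof unfold_locales
    show "gtorsor C G B (tors.extend QT (mext.fields plq))"
      using gQ unfolding gtorsor_def torsor_def by (simp add: tors.defs mext.defs)
    fix l assume "l \<in> I"
    then show "group_sheaf C (X0 (K' l))" using xmod_sheaves(2)[OF cK] I_iff by (cases l) auto
  qed (rule cG ij)+
  have W: "W \<in> sec Q U" "W' \<in> sec Q U" using c by (auto simp: cq_def)
  have b: "(proj QT U W, proj QT U W') \<in> sec ax.B U"
    using c proj_QT_in[OF U] by (auto simp: cq_def ax.B_mem)
  show ?thesis
  proof (rule check2[OF B_sheaf U ij c proj_QT_in[OF U plq_props(1)[OF U ij c]] hom_in[OF ax.mult_hom U b]])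
    fix f x x' assume f: "f \<in> arr_to C U" and V: "src C f \<in> Ob C" and mt: "matched (src C f) i j x x'"
      and r: "res Q f W = q (src C f) x" "res Q f W' = q (src C f) x'"
    interpret S: comp_stage G "src C f" n E H m F K by (rule st[OF V])
    note cm = S.md_cmps[OF mt]
    have 1: "res B f (proj QT U (plq (i, j) U W W')) = \<pi> (src C f) (fst (md (src C f) i j x x'))"
      using proj_QT_res[OF f plq_props(1)[OF U ij c]] plq_props(2)[OF U ij c f mt r] proj_QT_q[OF V S.md_in[OF mt]] by simp
    have 2: "res B f (axis_mult (\<lambda>l. X0 (K' l)) (i, j) U (proj QT U W, proj QT U W')) =
        axis_mult (\<lambda>l. X0 (K' l)) (i, j) (src C f) (\<pi> (src C f) (fst x), \<pi> (src C f) (fst x'))"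
      using hom_res[OF ax.mult_hom f b] proj_QT_res[OF f W(1)] proj_QT_res[OF f W(2)] r proj_QT_q[OF V cm(5)] proj_QT_q[OF V cm(6)]
      by (simp add: ax.res_B)
    have "\<pi> (src C f) (fst (md (src C f) i j x x')) l = axis_mult (\<lambda>l. X0 (K' l)) (i, j) (src C f) (\<pi> (src C f) (fst x), \<pi> (src C f) (fst x')) l" for l
    proof (cases "l \<in> I")
      case True
      then obtain a b where l: "l = (a, b)" "a \<in> {1..n}" "b \<in> {1..m a}" by (cases l) (auto simp: I_iff)
      show ?thesis
        using S.md_proj[OF mt] cm(3,4) l by (cases "a = i") (auto simp: axis_mult_def \<pi>_at)
    next
      case False
      then have "l \<noteq> (i, j)" using ij by auto
      then show ?thesis using False by (simp add: axis_mult_def comp_proj_def)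
    qed
    then show "res B f (proj QT U (plq (i, j) U W W')) = res B f (axis_mult (\<lambda>l. X0 (K' l)) (i, j) U (proj QT U W, proj QT U W'))"
      unfolding 1 2 by (rule ext)
  qed
qed

lemma str_QT_in: "U \<in> Ob C \<Longrightarrow> W \<in> sec Q U \<Longrightarrow> str QT U W \<in> carrier (grp (X0 G) U)"
  using hom_in[OF str_hom] by (simp add: ush_def)

lemma str_QT_res: "f \<in> arr_to C U \<Longrightarrow> W \<in> sec Q U \<Longrightarrow> gres (X0 G) f (str QT U W) = str QT (src C f) (res Q f W)"
  using hom_res[OF str_hom] by (simp add: ush_def)

lemma plq_str:
  assumes U: "U \<in> Ob C" and ij: "(i, j) \<in> I" and c: "cq (i, j) U W W'"
  shows "str QT U (plq (i, j) U W W') = str QT U W \<otimes>\<^bsub>grp (X0 G) U\<^esub> str QT U W'"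
proof -
  have W: "W \<in> sec Q U" "W' \<in> sec Q U" using c by (auto simp: cq_def)
  interpret xmod_stage G U by (rule xmod_stageI[OF cG U])
  note s = str_QT_in[OF U W(1)] str_QT_in[OF U W(2)]
  show ?thesis
  proof (rule check2[OF shG0 U ij c hom_in[OF str_hom U plq_props(1)[OF U ij c]]])
    show "str QT U W \<otimes>\<^bsub>grp (X0 G) U\<^esub> str QT U W' \<in> sec (ush (X0 G)) U" using s by (simp add: ush_def)
    fix f x x' assume f: "f \<in> arr_to C U" and V: "src C f \<in> Ob C" and mt: "matched (src C f) i j x x'"
      and r: "res Q f W = q (src C f) x" "res Q f W' = q (src C f) x'"
    interpret S: comp_stage G "src C f" n E H m F K by (rule st[OF V])
    note cm = S.md_cmps[OF mt]
    have 1: "gres (X0 G) f (str QT U (plq (i, j) U W W')) = str P (src C f) x \<otimes>\<^bsub>grp (X0 G) (src C f)\<^esub> str P (src C f) x'"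
      using str_QT_res[OF f plq_props(1)[OF U ij c]] plq_props(2)[OF U ij c f mt r] str_q[OF V S.md_in[OF mt]] S.md_str[OF mt] by simp
    show "res (ush (X0 G)) f (str QT U (plq (i, j) U W W')) = res (ush (X0 G)) f (str QT U W \<otimes>\<^bsub>grp (X0 G) U\<^esub> str QT U W')"
      using 1 gsh_res_mult[OF xmod_sheaves(2)[OF cG] f s] str_QT_res[OF f W(1)] str_QT_res[OF f W(2)] r str_q[OF V cm(5)] str_q[OF V cm(6)]
      by (simp add: ush_def)
  qed
qed

lemma tsQ: "U \<in> Ob C \<Longrightarrow> tors_stage G U QT (sec B U)"
  by (rule tors_stageI[OF cG gQ])

lemma cq_ract:
  assumes U: "U \<in> Ob C" and c: "cq p U W W'" and g: "g \<in> carrier (grp (X1 G) U)"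
  shows "cq p U W (ract QT U W' g)" "cq p U (ract QT U W g) W'" "cq p U W (lact G QT U g W')"
proof -
  interpret T: tors_stage G U QT "sec B U" by (rule tsQ[OF U])
  show "cq p U W (ract QT U W' g)" "cq p U (ract QT U W g) W'" "cq p U W (lact G QT U g W')"
    using c g T.ra_in T.ra_proj T.lact_in T.lact_proj by (simp_all add: cq_def tot_QT)
qed

lemma lact_QT_res:
  "U \<in> Ob C \<Longrightarrow> f \<in> arr_to C U \<Longrightarrow> W \<in> sec Q U \<Longrightarrow> g \<in> carrier (grp (X1 G) U) \<Longrightarrow>
    res Q f (lact G QT U g W) = lact G QT (src C f) (gres (X1 G) f g) (res Q f W)"
  using lact_res[OF cG gQ] by (simp add: tot_QT)

lemma lact_q:
  assumes U: "U \<in> Ob C" and x: "x \<in> sec (tot P) U" and g: "g \<in> carrier (grp (X1 G) U)"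
  shows "lact G QT U g (q U x) = q U (lact G P U g x)"
proof -
  interpret T: tors_stage G U P "sec (comp_base n F) U" by (rule tors_stageI[OF cG gP U])
  show ?thesis using ract_q[OF U x T.act_in[OF g T.str_in[OF x]]] str_q[OF U x] by (simp add: lact_def)
qed

lemma plq_ract:
  assumes U: "U \<in> Ob C" and ij: "(i, j) \<in> I" and c: "cq (i, j) U W W'" and g: "g \<in> carrier (grp (X1 G) U)"
  shows "plq (i, j) U W (ract QT U W' g) = ract QT U (plq (i, j) U W W') g"
    and "plq (i, j) U (ract QT U W g) W' = plq (i, j) U W (lact G QT U g W')"
proof -
  have W: "W \<in> sec Q U" "W' \<in> sec Q U" using c by (auto simp: cq_def)
  note cg = cq_ract[OF U c g]
  note pin = plq_props(1)[OF U ij]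
  show "plq (i, j) U W (ract QT U W' g) = ract QT U (plq (i, j) U W W') g"
  proof (rule check2[OF Q_sheaf U ij c pin[OF cg(1)] ract_QT_in[OF U pin[OF c] g]])
    fix f x x' assume f: "f \<in> arr_to C U" and V: "src C f \<in> Ob C" and mt: "matched (src C f) i j x x'"
      and r: "res Q f W = q (src C f) x" "res Q f W' = q (src C f) x'"
    interpret S: comp_stage G "src C f" n E H m F K by (rule st[OF V])
    note cm = S.md_cmps[OF mt]
    note gf = gresG_in[OF f g]
    show "res Q f (plq (i, j) U W (ract QT U W' g)) = res Q f (ract QT U (plq (i, j) U W W') g)"
      using plq_res[OF U ij cg(1) f] res_ract_QT[OF U W(2) g f] res_ract_QT[OF U pin[OF c] g f] plq_res[OF U ij c f] r
        ract_q[OF V cm(6) gf] plq_q[OF V S.matched_ract(1)[OF mt gf]] plq_q[OF V mt] ract_q[OF V S.md_in[OF mt] gf] S.md_ract(1)[OF mt gf]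
      by simp
  qed
  show "plq (i, j) U (ract QT U W g) W' = plq (i, j) U W (lact G QT U g W')"
  proof (rule check2[OF Q_sheaf U ij c pin[OF cg(2)] pin[OF cg(3)]])
    fix f x x' assume f: "f \<in> arr_to C U" and V: "src C f \<in> Ob C" and mt: "matched (src C f) i j x x'"
      and r: "res Q f W = q (src C f) x" "res Q f W' = q (src C f) x'"
    interpret S: comp_stage G "src C f" n E H m F K by (rule st[OF V])
    interpret T: tors_stage G "src C f" P "sec (comp_base n F) (src C f)" by (rule tors_stageI[OF cG gP V])
    note cm = S.md_cmps[OF mt]
    note gf = gresG_in[OF f g]
    have ml: "matched (src C f) i j x (lact G P (src C f) (gres (X1 G) f g) x')"
      unfolding lact_def by (rule S.matched_ract(1)[OF mt S.E.act_in[OF gf T.str_in[OF cm(6)]]])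
    show "res Q f (plq (i, j) U (ract QT U W g) W') = res Q f (plq (i, j) U W (lact G QT U g W'))"
      using plq_res[OF U ij cg(2) f] plq_res[OF U ij cg(3) f] res_ract_QT[OF U W(1) g f] lact_QT_res[OF U f W(2) g] r
        ract_q[OF V cm(5) gf] lact_q[OF V cm(6) gf] plq_q[OF V S.matched_ract(2)[OF mt gf]] plq_q[OF V ml] S.md_ract(2)[OF mt gf]
      by simp
  qed
qed

lemma cq_plq:
  assumes U: "U \<in> Ob C" and ij: "(i, j) \<in> I" and c: "cq (i, j) U W W'"
  shows "cq (i, j) U W' W'' \<Longrightarrow> cq (i, j) U (plq (i, j) U W W') W''"
    and "cq (i, j) U V W \<Longrightarrow> cq (i, j) U V (plq (i, j) U W W')"
  using plq_props(1)[OF U ij c] plq_proj[OF U ij c] c by (auto simp: cq_def axis_mult_def)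

lemma plq_assoc:
  assumes U: "U \<in> Ob C" and ij: "(i, j) \<in> I" and c: "cq (i, j) U W1 W2" and c': "cq (i, j) U W2 W3"
  shows "plq (i, j) U (plq (i, j) U W1 W2) W3 = plq (i, j) U W1 (plq (i, j) U W2 W3)"
proof -
  have W: "W1 \<in> sec Q U" "W2 \<in> sec Q U" "W3 \<in> sec Q U" using c c' by (auto simp: cq_def)
  note c1 = cq_plq(1)[OF U ij c c'] and c2 = cq_plq(2)[OF U ij c' c]
  note pin = plq_props(1)[OF U ij]
  show ?thesis
  proof (rule Q_sep[OF U pin[OF c1] pin[OF c2]], rule lc_mono[OF Qs_lift[OF U, of "{W1, W2, W3}"] U])
    fix f assume f: "f \<in> arr_to C U" and "\<forall>W\<in>{W1, W2, W3}. \<exists>x\<in>sec (tot P) (src C f). q (src C f) x = res Q f W"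
    then obtain x y z where x: "x \<in> sec (tot P) (src C f)" "q (src C f) x = res Q f W1"
      and y: "y \<in> sec (tot P) (src C f)" "q (src C f) y = res Q f W2"
      and z: "z \<in> sec (tot P) (src C f)" "q (src C f) z = res Q f W3" by auto
    note V = src_Ob[OF f]
    interpret S: comp_stage G "src C f" n E H m F K by (rule st[OF V])
    have k: "cq (i, j) (src C f) (q (src C f) x) (q (src C f) y)" "cq (i, j) (src C f) (q (src C f) y) (q (src C f) z)"
      using cq_res[OF U f c] cq_res[OF U f c'] x y z by simp_all
    obtain y' where y': "matched (src C f) i j x y'" "q (src C f) y' = q (src C f) y" by (rule cq_match[OF V x(1) y(1) ij k(1)])
    have k2: "cq (i, j) (src C f) (q (src C f) y') (q (src C f) z)" using k(2) y'(2) by simp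
    \<comment> \<open>Matching proceeds from one factor to the next: \<open>z'\<close> is matched
      with the representative \<open>y'\<close> already adapted to \<open>x\<close>.\<close>
    obtain z' where z': "matched (src C f) i j y' z'" "q (src C f) z' = q (src C f) z" by (rule cq_match[OF V S.md_cmps(6)[OF y'(1)] z(1) ij k2])
    have m1: "matched (src C f) i j (md (src C f) i j x y') z'" "matched (src C f) i j x (md (src C f) i j y' z')"
      using S.md_in[OF y'(1)] S.md_in[OF z'(1)] S.md_proj[OF y'(1)] S.md_proj[OF z'(1)] y'(1) z'(1)
      by (auto simp: S.matched_def)
    show "res Q f (plq (i, j) U (plq (i, j) U W1 W2) W3) = res Q f (plq (i, j) U W1 (plq (i, j) U W2 W3))"
      using plq_res[OF U ij c1 f] plq_res[OF U ij c2 f] plq_res[OF U ij c f] plq_res[OF U ij c' f] x(2) y(2) z(2) y'(2) z'(2)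
        plq_q[OF V y'(1)] plq_q[OF V z'(1)] plq_q[OF V m1(1)] plq_q[OF V m1(2)] S.md_assoc[OF y'(1) z'(1)]
      by simp
  qed (use W in auto)
qed

text \<open>Interchange involves four classes, and the calculation with points needs representatives
  that are matched along all four sides of the square at once.\<close>

lemma rep4:
  assumes U: "U \<in> Ob C" and ij: "(i, j) \<in> I" and ij': "(i', j') \<in> I" and ne: "(i, j) \<noteq> (i', j')"
    and x: "x \<in> sec (tot P) U" and y: "y \<in> sec (tot P) U" and z: "z \<in> sec (tot P) U" and t: "t \<in> sec (tot P) U"
    and c: "cq (i, j) U (q U x) (q U y)" "cq (i, j) U (q U z) (q U t)"
      "cq (i', j') U (q U x) (q U z)" "cq (i', j') U (q U y) (q U t)"
  obtains b c d where "matched U i j x b" "matched U i j c d" "matched U i' j' x c" "matched U i' j' b d"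
    "q U b = q U y" "q U c = q U z" "q U d = q U t"
proof -
  interpret S: comp_stage G U n E H m F K by (rule st[OF U])
  have i: "i \<in> {1..n}" "j \<in> {1..m i}" "i' \<in> {1..n}" "j' \<in> {1..m i'}" using ij ij' by (auto simp: I_iff)
  have e: "\<And>l. l \<in> I - {(i, j)} \<Longrightarrow> \<pi> U (fst x) l = \<pi> U (fst y) l" "\<And>l. l \<in> I - {(i, j)} \<Longrightarrow> \<pi> U (fst z) l = \<pi> U (fst t) l"
    "\<And>l. l \<in> I - {(i', j')} \<Longrightarrow> \<pi> U (fst x) l = \<pi> U (fst z) l" "\<And>l. l \<in> I - {(i', j')} \<Longrightarrow> \<pi> U (fst y) l = \<pi> U (fst t) l"
    using c x y z t U by (auto simp: cq_def proj_QT_q)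
  obtain b where b: "matched U i j x b" "q U b = q U y" "fst b = (fst x)(i := fst y i)" by (rule cq_match[OF U x y ij c(1)])
  obtain c where cc: "matched U i' j' x c" "q U c = q U z" "fst c = (fst x)(i' := fst z i')" by (rule cq_match[OF U x z ij' c(3)])
  have yi: "fst y i \<in> sec (tot (F i)) U" and zi: "fst z i' \<in> sec (tot (F i')) U" and ti: "fst t i \<in> sec (tot (F i)) U"
    using S.V_at[OF S.fst_in] y z t i by auto
  \<comment> \<open>The components of the fourth corner. For distinct outer indices \<open>b\<close>
    and \<open>c\<close> dictate them; for a common one the component of \<open>t\<close> at
    \<open>i\<close> is kept.\<close>
  define v where "v = (if i = i' then (fst x)(i := fst t i) else (fst x)(i := fst y i, i' := fst z i'))"
  have v: "v \<in> sec (comp_base n F) U" unfolding v_def CB_V using i yi zi ti S.fst_in[OF x] by (auto intro!: S.V_upd)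
  obtain d where d: "d \<in> sec (tot P) U" "q U d = q U t" "fst d = v"
  proof (rule q_move[OF U t v])
    fix l assume l: "l \<in> {1..n}"
    show "proj (F l) U (fst t l) = proj (F l) U (v l)"
    proof (cases "l = i \<or> l = i'")
      case False
      have "proj (F l) U (fst t l) = proj (F l) U (fst z l)"
        by (rule \<pi>_eq_proj[OF l U t z]) (use e(2) l False in \<open>auto simp: I_iff\<close>)
      also have "\<dots> = proj (F l) U (fst x l)"
        by (rule \<pi>_eq_proj[OF l U z x]) (use e(3) l False in \<open>auto simp: I_iff\<close>)
      finally show ?thesis using False by (simp add: v_def)
    next
      case True
      show ?thesis
      proof (cases "i = i'")
        case False
        have "proj (F i) U (fst t i) = proj (F i) U (fst y i)"
          by (rule \<pi>_eq_proj[OF i(1) U t y]) (use e(4) i False in \<open>auto simp: I_iff\<close>)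
        moreover have "proj (F i') U (fst t i') = proj (F i') U (fst z i')"
          by (rule \<pi>_eq_proj[OF i(3) U t z]) (use e(2) i False in \<open>auto simp: I_iff\<close>)
        ultimately show ?thesis using True False by (auto simp: v_def)
      qed (use True in \<open>simp add: v_def\<close>)
    qed
  qed
  have bP: "b \<in> sec (tot P) U" and cP: "c \<in> sec (tot P) U" using b(1) cc(1) by (auto simp: S.matched_def)
  have e2: "proj (F i) U (fst z i) l = proj (F i) U (fst t i) l" if "l \<in> {1..m i} - {j}" for l
    using e(2)[of "(i, l)"] that i by (simp add: I_iff \<pi>_at)
  have e4: "proj (F i') U (fst y i') l = proj (F i') U (fst t i') l" if "l \<in> {1..m i'} - {j'}" for l
    using e(4)[of "(i', l)"] that i by (simp add: I_iff \<pi>_at)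
  have e1: "proj (F i) U (fst x i) l = proj (F i) U (fst y i) l" if "l \<in> {1..m i} - {j}" for l
    using e(1)[of "(i, l)"] that i by (simp add: I_iff \<pi>_at)
  have e3: "proj (F i') U (fst x i') l = proj (F i') U (fst z i') l" if "l \<in> {1..m i'} - {j'}" for l
    using e(3)[of "(i', l)"] that i by (simp add: I_iff \<pi>_at)
  have "matched U i j c d" unfolding S.matched_def
    using cP d i e1 e2 by (cases "i = i'") (auto simp: v_def cc(3))
  moreover have "matched U i' j' b d" unfolding S.matched_def
    using bP d i e3 e4 by (cases "i = i'") (auto simp: v_def b(3))
  ultimately show ?thesis using that b cc d by blast
qed

lemma brd_res: "f \<in> arr_to C U \<Longrightarrow> x \<in> carrier (grp (X0 G) U) \<Longrightarrow> y \<in> carrier (grp (X0 G) U) \<Longrightarrow>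
    gres (X1 G) f (brd G U x y) = brd G (src C f) (gres (X0 G) f x) (gres (X0 G) f y)"
  using bG by (auto simp: braided_crossed_module_def arr_to_def)

text \<open>For distinct outer indices the two sides are equal as points of \<open>P\<close>. For a
  common one they differ by an element of \<open>H\<^sub>i\<^sub>,\<^sub>1\<close>, so the law holds
  only after passing to the quotient.\<close>

lemma plq_inter_q:
  assumes U: "U \<in> Ob C" and ne: "(i, j) \<noteq> (i', j')"
    and ab: "matched U i j a b" and cd: "matched U i j c d" and ac: "matched U i' j' a c" and bd: "matched U i' j' b d"
  shows "plq (i', j') U (plq (i, j) U (q U a) (q U b)) (plq (i, j) U (q U c) (q U d)) =
    plq (i, j) U (plq (i', j') U (q U a) (q U c))
      (plq (i', j') U (ract QT U (q U b) (inv\<^bsub>grp (X1 G) U\<^esub> (brd G U (str QT U (q U b)) (str QT U (q U c))))) (q U d))"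
proof -
  interpret S: comp_stage G U n E H m F K by (rule st[OF U])
  interpret T: tors_stage G U P "sec (comp_base n F) U" by (rule tors_stageI[OF cG gP U])
  have x: "b \<in> sec (tot P) U" "c \<in> sec (tot P) U" using ab ac by (auto simp: S.matched_def)
  define g where "g = inv\<^bsub>grp (X1 G) U\<^esub> (brd G U (str P U b) (str P U c))"
  have g: "g \<in> carrier (grp (X1 G) U)" unfolding g_def using T.str_in x by (simp add: S.E.brd_in)
  define b' where "b' = ract P U b g"
  have ab': "matched U i j a b'" unfolding b'_def by (rule S.matched_ract(1)[OF ab g])
  have bd': "matched U i' j' b' d" unfolding b'_def by (rule S.matched_ract(2)[OF bd g])
  have M: "matched U i' j' (md U i j a b) (md U i j c d)" by (rule S.matched_md[OF ab cd ac bd ne])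
  have M': "matched U i j (md U i' j' a c) (md U i' j' b' d)" by (rule S.matched_md[OF ac bd' ab' cd ne[symmetric]])
  have "q U (md U i' j' (md U i j a b) (md U i j c d)) = q U (md U i j (md U i' j' a c) (md U i' j' b' d))"
  proof (cases "i = i'")
    case False
    show ?thesis using S.md_inter_ne[OF ab cd ac bd False] unfolding b'_def g_def by simp
  next
    case True
    obtain k where k: "k \<in> carrier (grp (X1 (H i)) U)"
      "md U i j (md U i j' a c) (md U i j' b' d) = comp_act1 F E i U (md U i j' (md U i j a b) (md U i j c d)) k"
      using S.md_inter_eq[OF ab cd ac bd True[symmetric]] ne True unfolding b'_def g_def by auto
    have i: "i \<in> {1..n}" using ab by (simp add: S.matched_def)
    note Mi = S.md_in[OF M] and Mi' = S.md_in[OF M']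
    obtain h where h: "h \<in> S.HH" "comp_act1 F E i U (md U i' j' (md U i j a b) (md U i j c d)) k = comp_act n F E U (md U i' j' (md U i j a b) (md U i j c d)) h"
      by (rule S.act1_ca[OF i Mi k(1)])
    have "orb U (md U i' j' (md U i j a b) (md U i j c d)) (md U i j (md U i' j' a c) (md U i' j' b' d))"
      using orb_act[OF h(1)] h(2) k(2) True by metis
    then show ?thesis using q_eq_iff[OF U Mi Mi'] by simp
  qed
  moreover have "ract QT U (q U b) (inv\<^bsub>grp (X1 G) U\<^esub> (brd G U (str QT U (q U b)) (str QT U (q U c)))) = q U b'"
    unfolding b'_def str_q[OF U x(1)] str_q[OF U x(2)] g_def[symmetric] by (rule ract_q[OF U x(1) g])
  ultimately show ?thesis
    by (simp add: plq_q[OF U ab] plq_q[OF U cd] plq_q[OF U ac] plq_q[OF U bd'] plq_q[OF U M] plq_q[OF U M'])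
qed

lemma plq_inter:
  assumes U: "U \<in> Ob C" and ij: "(i, j) \<in> I" and ij': "(i', j') \<in> I" and ne: "(i, j) \<noteq> (i', j')"
    and c: "cq (i, j) U W1 W2" "cq (i, j) U W3 W4" "cq (i', j') U W1 W3" "cq (i', j') U W2 W4"
  shows "plq (i', j') U (plq (i, j) U W1 W2) (plq (i, j) U W3 W4) =
    plq (i, j) U (plq (i', j') U W1 W3)
      (plq (i', j') U (ract QT U W2 (inv\<^bsub>grp (X1 G) U\<^esub> (brd G U (str QT U W2) (str QT U W3)))) W4)"
proof -
  interpret S: comp_stage G U n E H m F K by (rule st[OF U])
  have W: "W1 \<in> sec Q U" "W2 \<in> sec Q U" "W3 \<in> sec Q U" "W4 \<in> sec Q U" using c by (auto simp: cq_def)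
  note s2 = str_QT_in[OF U W(2)] and s3 = str_QT_in[OF U W(3)]
  define g where "g = inv\<^bsub>grp (X1 G) U\<^esub> (brd G U (str QT U W2) (str QT U W3))"
  have g: "g \<in> carrier (grp (X1 G) U)" unfolding g_def using s2 s3 by (simp add: S.E.brd_in)
  note c4 = cq_ract(2)[OF U c(4) g] and c1 = cq_ract(1)[OF U c(1) g]
  \<comment> \<open>A law along one axis changes only its own coordinate, so the outer products on
    both sides are defined.\<close>
  have L: "cq (i', j') U (plq (i, j) U W1 W2) (plq (i, j) U W3 W4)"
    using c ne plq_props(1)[OF U ij] plq_proj[OF U ij c(1)] plq_proj[OF U ij c(2)] by (auto simp: cq_def axis_mult_def)
  have R: "cq (i, j) U (plq (i', j') U W1 W3) (plq (i', j') U (ract QT U W2 g) W4)"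
    using c c1 c4 ne plq_props(1)[OF U ij'] plq_proj[OF U ij' c(3)] plq_proj[OF U ij' c4] by (auto simp: cq_def axis_mult_def)
  show ?thesis unfolding g_def[symmetric]
  proof (rule Q_sep[OF U plq_props(1)[OF U ij' L] plq_props(1)[OF U ij R]], rule lc_mono[OF Qs_lift[OF U, of "{W1, W2, W3, W4}"] U])
    fix f assume f: "f \<in> arr_to C U" and "\<forall>W\<in>{W1, W2, W3, W4}. \<exists>x\<in>sec (tot P) (src C f). q (src C f) x = res Q f W"
    then obtain x y z t where x: "x \<in> sec (tot P) (src C f)" "res Q f W1 = q (src C f) x"
      and y: "y \<in> sec (tot P) (src C f)" "res Q f W2 = q (src C f) y"
      and z: "z \<in> sec (tot P) (src C f)" "res Q f W3 = q (src C f) z"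
      and t: "t \<in> sec (tot P) (src C f)" "res Q f W4 = q (src C f) t" by (auto simp: eq_commute)
    note V = src_Ob[OF f]
    obtain b c' d where *: "matched (src C f) i j x b" "matched (src C f) i j c' d" "matched (src C f) i' j' x c'" "matched (src C f) i' j' b d"
      "q (src C f) b = q (src C f) y" "q (src C f) c' = q (src C f) z" "q (src C f) d = q (src C f) t"
      by (rule rep4[OF V ij ij' ne x(1) y(1) z(1) t(1)])
        (use cq_res[OF U f c(1)] cq_res[OF U f c(2)] cq_res[OF U f c(3)] cq_res[OF U f c(4)] x y z t in auto)
    have gf: "gres (X1 G) f g = inv\<^bsub>grp (X1 G) (src C f)\<^esub> (brd G (src C f) (str QT (src C f) (res Q f W2)) (str QT (src C f) (res Q f W3)))"
      unfolding g_def using gsh_res_inv[OF xmod_sheaves(1)[OF cG] f U S.E.brd_in[OF s2 s3]] brd_res[OF f s2 s3]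
        str_QT_res[OF f W(2)] str_QT_res[OF f W(3)] by simp
    have l: "res Q f (plq (i', j') U (plq (i, j) U W1 W2) (plq (i, j) U W3 W4)) =
        plq (i', j') (src C f) (plq (i, j) (src C f) (q (src C f) x) (q (src C f) b)) (plq (i, j) (src C f) (q (src C f) c') (q (src C f) d))"
      using plq_res[OF U ij' L f] plq_res[OF U ij c(1) f] plq_res[OF U ij c(2) f] x(2) y(2) z(2) t(2) *(5-7) by simp
    have r: "res Q f (plq (i, j) U (plq (i', j') U W1 W3) (plq (i', j') U (ract QT U W2 g) W4)) =
        plq (i, j) (src C f) (plq (i', j') (src C f) (q (src C f) x) (q (src C f) c'))
          (plq (i', j') (src C f) (ract QT (src C f) (q (src C f) b) (inv\<^bsub>grp (X1 G) (src C f)\<^esub> (brd G (src C f) (str QT (src C f) (q (src C f) b)) (str QT (src C f) (q (src C f) c'))))) (q (src C f) d))"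
      using plq_res[OF U ij R f] plq_res[OF U ij' c(3) f] plq_res[OF U ij' c4 f] res_ract_QT[OF U W(2) g f] gf x(2) y(2) z(2) t(2) *(5-7) by simp
    show "res Q f (plq (i', j') U (plq (i, j) U W1 W2) (plq (i, j) U W3 W4)) = res Q f (plq (i, j) U (plq (i', j') U W1 W3) (plq (i', j') U (ract QT U W2 g) W4))"
      unfolding l r by (rule plq_inter_q[OF V ne *(1-4)])
  qed (use W in auto)
qed

end

section \<open>The trivializations of the quotient\<close>

context composite
begin

abbreviation "KQ p U \<equiv> \<Pi>\<^sub>E l\<in>I. carrier (grp (xfam K' p l) U)"
definition kr where "kr p f k = (\<lambda>l\<in>I. gres (xfam K' p l) f (k l))"

lemma kr_at: "l \<in> I \<Longrightarrow> kr p f k l = gres (xfam K' p l) f (k l)"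
  by (simp add: kr_def)

text \<open>The block of \<open>k\<close> at the outer index \<open>i\<close>, that is, the part of
  the argument that concerns \<open>F\<^sub>i\<close>.\<close>

definition slc where "slc i k = (\<lambda>j\<in>{1..m i}. k (i, j))"

lemma slc_at: "j \<in> {1..m i} \<Longrightarrow> slc i k j = k (i, j)"
  by (simp add: slc_def)

lemma slc_upd: "j \<in> {1..m i} \<Longrightarrow> slc i (k((i, j) := z)) = (slc i k)(j := z)"
  and slc_upd_other: "fst p \<noteq> i \<Longrightarrow> slc i (k(p := z)) = slc i k"
  by (auto simp: slc_def fun_eq_iff)

lemma slc_cong: "(\<And>j. j \<in> {1..m i} \<Longrightarrow> k (i, j) = k' (i, j)) \<Longrightarrow> slc i k = slc i k'"
  by (auto simp: slc_def fun_eq_iff)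

lemma slc_kr_own: "i \<in> {1..n} \<Longrightarrow> slc i (kr (i, j) f k) = (\<lambda>l\<in>{1..m i}. gres (xfam (K i) j l) f (slc i k l))"
  by (auto simp: slc_def kr_def fun_eq_iff I_iff)

lemma slc_kr_other: "l \<in> {1..n} \<Longrightarrow> l \<noteq> fst p \<Longrightarrow> slc l (kr p f k) = (\<lambda>j\<in>{1..m l}. gres (X0 (K l j)) f (slc l k j))"
  by (auto simp: slc_def kr_def fun_eq_iff I_iff)

lemma slc_in_own: "i \<in> {1..n} \<Longrightarrow> k \<in> KQ (i, j) U \<Longrightarrow> slc i k \<in> (\<Pi>\<^sub>E l\<in>{1..m i}. carrier (grp (xfam (K i) j l) U))"
proof (rule PiE_I)
  fix l assume i: "i \<in> {1..n}" and k: "k \<in> KQ (i, j) U" and l: "l \<in> {1..m i}"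
  then have "k (i, l) \<in> carrier (grp (xfam K' (i, j) (i, l)) U)" by (intro PiE_mem[OF k]) (simp add: I_iff)
  then show "slc i k l \<in> carrier (grp (xfam (K i) j l) U)" using l by (cases "l = j") (simp_all add: slc_at)
qed (simp add: slc_def)

lemma slc_in_other: "l \<in> {1..n} \<Longrightarrow> l \<noteq> fst p \<Longrightarrow> k \<in> KQ p U \<Longrightarrow> slc l k \<in> (\<Pi>\<^sub>E j\<in>{1..m l}. carrier (grp (X0 (K l j)) U))"
proof (rule PiE_I)
  fix j assume l: "l \<in> {1..n}" "l \<noteq> fst p" and k: "k \<in> KQ p U" and j: "j \<in> {1..m l}"
  then have "k (l, j) \<in> carrier (grp (xfam K' p (l, j)) U)" by (intro PiE_mem[OF k]) (simp add: I_iff)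
  moreover have "p \<noteq> (l, j)" using l by auto
  ultimately show "slc l k j \<in> carrier (grp (X0 (K l j)) U)" using j by (simp add: slc_at)
qed (simp add: slc_def)

lemma KQ_sheaf: "sheaf C (mbase I (xfam K' p))"
proof (rule mbase_sheaf)
  fix l assume "l \<in> I"
  then have "crossed_module C (K' l)" using cK by (cases l) (auto simp: I_iff)
  then show "group_sheaf C (xfam K' p l)" using xmod_sheaves[of "K' l"] by (cases "l = p") simp_all
qed

lemma kr_in: "f \<in> arr_to C U \<Longrightarrow> k \<in> KQ p U \<Longrightarrow> kr p f k \<in> KQ p (src C f)"
  using res_in[OF sheaf_presheaf[OF KQ_sheaf[of p]], of f U k] unfolding mbase_sec mbase_res kr_def .

lemma kr_cmp: "f \<in> arr_to C U \<Longrightarrow> g \<in> arr_to C (src C f) \<Longrightarrow> k \<in> KQ p U \<Longrightarrow> kr p (cmp C f g) k = kr p g (kr p f k)"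
  using res_cmp[OF sheaf_presheaf[OF KQ_sheaf[of p]], of f U g k] unfolding mbase_sec mbase_res kr_def .

lemma kr_idt: "U \<in> Ob C \<Longrightarrow> k \<in> KQ p U \<Longrightarrow> kr p (idt C U) k = k"
  using res_idt[OF sheaf_presheaf[OF KQ_sheaf[of p]], of U k] unfolding mbase_sec mbase_res kr_def .

text \<open>The tuples from which the section at \<open>k\<close> can be represented. Nothing is
  asked at the outer index of \<open>p\<close>, where the section of \<open>F\<close> supplies the
  component.\<close>

definition over where
  "over p U k v \<longleftrightarrow> v \<in> sec (comp_base n F) U \<and> (\<forall>l\<in>{1..n}. l \<noteq> fst p \<longrightarrow> proj (F l) U (v l) = slc l k)"

lemma over_res:
  assumes f: "f \<in> arr_to C U" and o: "over p U k v"
  shows "over p (src C f) (kr p f k) (res (comp_base n F) f v)"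
  unfolding over_def
proof (intro conjI ballI impI)
  have v: "v \<in> sec (comp_base n F) U" using o by (simp add: over_def)
  then show "res (comp_base n F) f v \<in> sec (comp_base n F) (src C f)" by (rule res_in[OF sheaf_presheaf[OF CB_sheaf] f])
  fix l assume l: "l \<in> {1..n}" "l \<noteq> fst p"
  have vl: "v l \<in> sec (tot (F l)) U" using PiE_mem[OF v[unfolded CB_V] l(1)] .
  show "proj (F l) (src C f) (res (comp_base n F) f v l) = slc l (kr p f k)"
    unfolding slc_kr_other[OF l] using F_proj_res[OF l(1) f vl] o l by (simp add: CB_simps(2) over_def)
qed

lemma tp_res:
  assumes U: "U \<in> Ob C" and f: "f \<in> arr_to C U" and i: "i \<in> {1..n}" "j \<in> {1..m i}" and v: "v \<in> sec (comp_base n F) U"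
    and k: "k \<in> (\<Pi>\<^sub>E l\<in>{1..m i}. carrier (grp (xfam (K i) j l) U))"
  shows "res (tot P) f (tp U i j v k) = tp (src C f) i j (res (comp_base n F) f v) (\<lambda>l\<in>{1..m i}. gres (xfam (K i) j l) f (k l))"
proof -
  interpret S: comp_stage G U n E H m F K by (rule st[OF U])
  interpret S': comp_stage G "src C f" n E H m F K by (rule st[OF src_Ob[OF f]])
  have 1: "res (tot (F i)) f (triv (F i) j U k) = triv (F i) j (src C f) (\<lambda>l\<in>{1..m i}. gres (xfam (K i) j l) f (k l))"
    using trF[OF i] U f k unfolding triv_res_def by blast
  have y: "S.ys v \<in> S.E.base" by (rule S.ys_in[OF v[unfolded CB_V]])
  have yr: "S'.ys (res (comp_base n F) f v) = (\<lambda>l\<in>{1..n}. gres (X0 (H l)) f (S.ys v l))"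
    using hom_res[OF ys_hom f v] unfolding mbase_res S.ys_def S'.ys_def .
  have e: "(\<lambda>l\<in>{1..n}. gres (xfam H i l) f (((S.ys v)(i := \<one>\<^bsub>grp (X1 (H i)) U\<^esub>)) l)) =
      (S'.ys (res (comp_base n F) f v))(i := \<one>\<^bsub>grp (X1 (H i)) (src C f)\<^esub>)"
    unfolding yr using i gsh_res_one[OF xmod_sheaves(1)[OF cH[OF i(1)]] f U] by (auto simp: fun_eq_iff)
  have "res (tot E) f (triv E i U ((S.ys v)(i := \<one>\<^bsub>grp (X1 (H i)) U\<^esub>))) =
      triv E i (src C f) ((S'.ys (res (comp_base n F) f v))(i := \<one>\<^bsub>grp (X1 (H i)) (src C f)\<^esub>))"
    using trE[OF i(1)] U f S.E.xfam_upd[OF y i(1) S.H_one[OF i(1)]] unfolding triv_res_def e[symmetric] by blast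
  then show ?thesis
    using 1 i by (auto simp: S.tp_def S'.tp_def S.E.tr_def S'.E.tr_def P_res CB_simps(2) fun_eq_iff)
qed

lemma over_lift:
  assumes U: "U \<in> Ob C" and ij: "(i, j) \<in> I" and k: "k \<in> KQ (i, j) U"
  shows "lc U (\<lambda>f. \<exists>v. over (i, j) (src C f) (kr (i, j) f k) v)"
proof -
  interpret S: comp_stage G U n E H m F K by (rule st[OF U])
  have i: "i \<in> {1..n}" "j \<in> {1..m i}" using ij by (auto simp: I_iff)
  \<comment> \<open>\<open>over\<close> leaves the component at \<open>i\<close> free; the
    projection of the section of \<open>F\<^sub>i\<close> is taken as a value in the right
    group.\<close>
  define y where "y l = (if l = i then proj (F i) U (triv (F i) j U (slc i k)) else slc l k)" for l
  have y: "y l \<in> (\<Pi>\<^sub>E j\<in>{1..m l}. carrier (grp (X0 (K l j)) U))" if "l \<in> {1..n}" for l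
    unfolding y_def using slc_in_other[OF that _ k] F_proj[OF i(1) U S.F_triv(1)[OF i slc_in_own[OF i(1) k]]] by simp
  show ?thesis
  proof (rule lc_mono[OF lift_tuple[OF U y] U])
    fix f assume "\<exists>v\<in>sec (comp_base n F) (src C f). \<forall>l\<in>{1..n}. proj (F l) (src C f) (v l) = (\<lambda>j\<in>{1..m l}. gres (X0 (K l j)) f (y l j))"
    then obtain v where v: "v\<in>sec (comp_base n F) (src C f)" "\<And>l. l\<in>{1..n} \<Longrightarrow> proj (F l) (src C f) (v l) = (\<lambda>j\<in>{1..m l}. gres (X0 (K l j)) f (y l j))" by auto
    have "over (i, j) (src C f) (kr (i, j) f k) v" unfolding over_def
    proof (intro conjI ballI impI v(1))
      fix l assume l: "l \<in> {1..n}" "l \<noteq> fst (i, j)"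
      then show "proj (F l) (src C f) (v l) = slc l (kr (i, j) f k)"
        unfolding slc_kr_other[OF l] v(2)[OF l(1)] y_def by simp
    qed
    then show "\<exists>v. over (i, j) (src C f) (kr (i, j) f k) v" by blast
  qed
qed

lemma tp_q_cong:
  assumes U: "U \<in> Ob C" and ij: "(i, j) \<in> I" and k: "k \<in> KQ (i, j) U" and v: "over (i, j) U k v" "over (i, j) U k v'"
  shows "q U (tp U i j v (slc i k)) = q U (tp U i j v' (slc i k))"
proof -
  interpret S: comp_stage G U n E H m F K by (rule st[OF U])
  have i: "i \<in> {1..n}" "j \<in> {1..m i}" using ij by (auto simp: I_iff)
  have V: "v \<in> S.V" "v' \<in> S.V" using v by (auto simp: over_def CB_V)
  note s = slc_in_own[OF i(1) k]
  have e: "proj (F l) U (v l) = proj (F l) U (v' l)" if "l \<in> {1..n}" "l \<noteq> i" for l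
    using v that by (simp add: over_def)
  obtain h where h: "h \<in> S.HH" "S.tp i j v' (slc i k) = comp_act n F E U (S.tp i j v (slc i k)) h"
    by (rule S.tp_orb[OF i s V e])
  show ?thesis
    using q_eq_iff[OF U S.tp_in[OF i s V(1)] S.tp_in[OF i s V(2)]] orb_act[OF h(1)] h(2) by simp
qed

text \<open>The section of the composite in direction \<open>p\<close>, glued from the classes of
  \<open>tp\<close> for all admissible tuples over all arrows; \<open>tp_q_cong\<close> makes the
  tuple irrelevant.\<close>

definition tq where
  "tq p U k = (THE Z. Z \<in> sec Q U \<and> (\<forall>f\<in>arr_to C U. \<forall>V.
     (\<exists>v. over p (src C f) (kr p f k) v \<and> V = q (src C f) (tp (src C f) (fst p) (snd p) v (slc (fst p) (kr p f k)))) \<longrightarrow>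
     res Q f Z = V))"

lemma tq_props:
  assumes U: "U \<in> Ob C" and ij: "(i, j) \<in> I" and k: "k \<in> KQ (i, j) U"
  shows "tq (i, j) U k \<in> sec Q U" (is ?a)
    and "\<And>f v. f \<in> arr_to C U \<Longrightarrow> over (i, j) (src C f) (kr (i, j) f k) v \<Longrightarrow>
      res Q f (tq (i, j) U k) = q (src C f) (tp (src C f) i j v (slc i (kr (i, j) f k)))"
proof -
  define \<Phi> where "\<Phi> f V \<longleftrightarrow> (\<exists>v. over (i, j) (src C f) (kr (i, j) f k) v \<and>
      V = q (src C f) (tp (src C f) i j v (slc i (kr (i, j) f k))))" for f V
  have i: "i \<in> {1..n}" "j \<in> {1..m i}" using ij by (auto simp: I_iff)
  have ex: "\<exists>!Z. Z \<in> sec Q U \<and> (\<forall>f\<in>arr_to C U. \<forall>V. \<Phi> f V \<longrightarrow> res Q f Z = V)"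
  proof (rule glue[OF Q_sheaf U])
    fix f V assume f: "f \<in> arr_to C U" and V: "\<Phi> f V"
    note W = src_Ob[OF f]
    interpret S: comp_stage G "src C f" n E H m F K by (rule st[OF W])
    note kf = kr_in[OF f k]
    note s = slc_in_own[OF i(1) kf]
    obtain v where v: "over (i, j) (src C f) (kr (i, j) f k) v" "V = q (src C f) (tp (src C f) i j v (slc i (kr (i, j) f k)))"
      using V unfolding \<Phi>_def by blast
    have vV: "v \<in> sec (comp_base n F) (src C f)" using v(1) by (simp add: over_def)
    note t = S.tp_in[OF i s vV[unfolded CB_V]]
    show "V \<in> sec Q (src C f)" using v(2) q_in[OF W t] by simp
    { fix V' assume "\<Phi> f V'"
      then show "V = V'" unfolding \<Phi>_def v(2) using tp_q_cong[OF W ij kf v(1)] by metis }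
    fix g assume g: "g \<in> arr_to C (src C f)"
    have e: "kr (i, j) (cmp C f g) k = kr (i, j) g (kr (i, j) f k)" by (rule kr_cmp[OF f g k])
    have "res Q g V = q (src C g) (res (tot P) g (tp (src C f) i j v (slc i (kr (i, j) f k))))"
      using v(2) q_res[OF g W t] by simp
    also have "\<dots> = q (src C g) (tp (src C g) i j (res (comp_base n F) g v) (slc i (kr (i, j) g (kr (i, j) f k))))"
      unfolding tp_res[OF W g i vV s] slc_kr_own[OF i(1), of j g "kr (i, j) f k"] ..
    finally show "\<Phi> (cmp C f g) (res Q g V)" unfolding \<Phi>_def e using over_res[OF g v(1)] f g by auto
  next
    show "lc U (\<lambda>f. \<exists>V. \<Phi> f V)" by (rule lc_mono[OF over_lift[OF U ij k] U]) (auto simp: \<Phi>_def)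
  qed
  have d: "tq (i, j) U k = (THE Z. Z \<in> sec Q U \<and> (\<forall>f\<in>arr_to C U. \<forall>V. \<Phi> f V \<longrightarrow> res Q f Z = V))"
    unfolding tq_def \<Phi>_def fst_conv snd_conv ..
  note t = theI'[OF ex, folded d]
  show ?a using t by blast
  show "res Q f (tq (i, j) U k) = q (src C f) (tp (src C f) i j v (slc i (kr (i, j) f k)))"
    if "f \<in> arr_to C U" "over (i, j) (src C f) (kr (i, j) f k) v" for f v
    using t that unfolding \<Phi>_def by blast
qed

lemma tq_q:
  assumes U: "U \<in> Ob C" and ij: "(i, j) \<in> I" and k: "k \<in> KQ (i, j) U" and v: "over (i, j) U k v"
  shows "tq (i, j) U k = q U (tp U i j v (slc i k))"
  using tq_props(2)[OF U ij k idt_arr[OF U], of v] v tq_props(1)[OF U ij k] U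
  unfolding kr_idt[OF U k] by (simp add: res_idt[OF Q_presheaf] kr_idt[OF U k])

lemma tq_res:
  assumes U: "U \<in> Ob C" and ij: "(i, j) \<in> I" and k: "k \<in> KQ (i, j) U" and f: "f \<in> arr_to C U"
  shows "res Q f (tq (i, j) U k) = tq (i, j) (src C f) (kr (i, j) f k)"
proof -
  note V = src_Ob[OF f] and kf = kr_in[OF f k]
  show ?thesis
  proof (rule Q_sep[OF V Q_res_in[OF U f tq_props(1)[OF U ij k]] tq_props(1)[OF V ij kf]], rule lc_mono[OF over_lift[OF V ij kf] V])
    fix g assume g: "g \<in> arr_to C (src C f)" and "\<exists>v. over (i, j) (src C g) (kr (i, j) g (kr (i, j) f k)) v"
    then obtain v where v: "over (i, j) (src C g) (kr (i, j) g (kr (i, j) f k)) v" by blast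
    have fg: "cmp C f g \<in> arr_to C U" "src C (cmp C f g) = src C g" using f g by simp_all
    note e = kr_cmp[OF f g k]
    have "res Q (cmp C f g) (tq (i, j) U k) = q (src C g) (tp (src C g) i j v (slc i (kr (i, j) g (kr (i, j) f k))))"
      using tq_props(2)[OF U ij k fg(1), unfolded fg(2) e, OF v] .
    then show "res Q g (res Q f (tq (i, j) U k)) = res Q g (tq (i, j) (src C f) (kr (i, j) f k))"
      using tq_props(2)[OF V ij kf g v] res_cmp[OF Q_presheaf f g tq_props(1)[OF U ij k]] by simp
  qed
qed

section \<open>Projection, structural map and multiplicativity of the sections\<close>

lemma K'_xmod: "l \<in> I \<Longrightarrow> crossed_module C (K' l)"
  using cK by (cases l) (auto simp: I_iff)

lemma KQ_bd:
  assumes U: "U \<in> Ob C" and p: "p \<in> I" and k: "k \<in> KQ p U"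
  shows "k(p := bd (K' p) U (k p)) \<in> sec B U"
proof -
  interpret xmod_stage "K' p" U by (rule xmod_stageI[OF K'_xmod[OF p] U])
  have "k p \<in> carrier (grp (X1 (K' p)) U)" using PiE_mem[OF k p] by simp
  then have b: "bd (K' p) U (k p) \<in> carrier (grp (X0 (K' p)) U)" by (rule bd_in)
  show ?thesis unfolding mbase_sec
  proof (rule PiE_I)
    fix l assume l: "l \<in> I"
    show "(k(p := bd (K' p) U (k p))) l \<in> carrier (grp (X0 (K' l)) U)"
      using b PiE_mem[OF k l] by (cases "l = p") simp_all
  qed (use PiE_arb[OF k] p in auto)
qed

lemma tq_proj:
  assumes U: "U \<in> Ob C" and ij: "(i, j) \<in> I" and k: "k \<in> KQ (i, j) U"
  shows "proj QT U (tq (i, j) U k) = k((i, j) := bd (K i j) U (k (i, j)))"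
proof -
  have i: "i \<in> {1..n}" "j \<in> {1..m i}" using ij by (auto simp: I_iff)
  have b: "k((i, j) := bd (K i j) U (k (i, j))) \<in> sec B U" using KQ_bd[OF U ij k] by simp
  show ?thesis
  proof (rule sheaf_eqI[OF B_sheaf U proj_QT_in[OF U tq_props(1)[OF U ij k]] b], rule lc_mono[OF over_lift[OF U ij k] U])
    fix f assume f: "f \<in> arr_to C U" and "\<exists>v. over (i, j) (src C f) (kr (i, j) f k) v"
    then obtain v where v: "over (i, j) (src C f) (kr (i, j) f k) v" by blast
    note V = src_Ob[OF f] and kf = kr_in[OF f k]
    interpret S: comp_stage G "src C f" n E H m F K by (rule st[OF V])
    have vV: "v \<in> S.V" using v by (simp add: over_def CB_V)
    note s = slc_in_own[OF i(1) kf]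
    have 1: "res B f (proj QT U (tq (i, j) U k)) = \<pi> (src C f) (v(i := triv (F i) j (src C f) (slc i (kr (i, j) f k))))"
      using proj_QT_res[OF f tq_props(1)[OF U ij k]] tq_props(2)[OF U ij k f v] proj_QT_q[OF V S.tp_in[OF i s vV]] S.tp_fst by simp
    have "\<pi> (src C f) (v(i := triv (F i) j (src C f) (slc i (kr (i, j) f k)))) l = res B f (k((i, j) := bd (K i j) U (k (i, j)))) l" for l
    proof (cases "l \<in> I")
      case True
      then obtain a c where l: "l = (a, c)" "a \<in> {1..n}" "c \<in> {1..m a}" by (cases l) (auto simp: I_iff)
      show ?thesis
      proof (cases "a = i")
        case False
        then show ?thesis using v l True
          by (simp add: \<pi>_at over_def slc_at mbase_res kr_at)
      next
        case True
        note t = S.F_triv(2)[OF i s]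
        have kij: "k (i, j) \<in> carrier (grp (X1 (K i j)) U)" using PiE_mem[OF k ij] by simp
        show ?thesis
          using t l True ij \<open>l \<in> I\<close> i bd_res[OF cK[OF i] f kij] by (cases "c = j") (simp_all add: \<pi>_at slc_at mbase_res kr_at)
      qed
    qed (simp add: comp_proj_def mbase_res)
    then show "res B f (proj QT U (tq (i, j) U k)) = res B f (k((i, j) := bd (K i j) U (k (i, j))))" unfolding 1 by (rule ext)
  qed
qed

lemma tq_str:
  assumes U: "U \<in> Ob C" and ij: "(i, j) \<in> I" and k: "k \<in> KQ (i, j) U"
  shows "str QT U (tq (i, j) U k) = \<one>\<^bsub>grp (X0 G) U\<^esub>"
proof (rule sheaf_eqI[OF shG0 U hom_in[OF str_hom U tq_props(1)[OF U ij k]]])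
  have i: "i \<in> {1..n}" "j \<in> {1..m i}" using ij by (auto simp: I_iff)
  interpret xmod_stage G U by (rule xmod_stageI[OF cG U])
  show "\<one>\<^bsub>grp (X0 G) U\<^esub> \<in> sec (ush (X0 G)) U" by (simp add: ush_def)
  show "lc U (\<lambda>f. res (ush (X0 G)) f (str QT U (tq (i, j) U k)) = res (ush (X0 G)) f \<one>\<^bsub>grp (X0 G) U\<^esub>)"
  proof (rule lc_mono[OF over_lift[OF U ij k] U])
    fix f assume f: "f \<in> arr_to C U" and "\<exists>v. over (i, j) (src C f) (kr (i, j) f k) v"
    then obtain v where v: "over (i, j) (src C f) (kr (i, j) f k) v" by blast
    note V = src_Ob[OF f] and kf = kr_in[OF f k]
    interpret S: comp_stage G "src C f" n E H m F K by (rule st[OF V])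
    have vV: "v \<in> S.V" using v by (simp add: over_def CB_V)
    show "res (ush (X0 G)) f (str QT U (tq (i, j) U k)) = res (ush (X0 G)) f \<one>\<^bsub>grp (X0 G) U\<^esub>"
      using str_QT_res[OF f tq_props(1)[OF U ij k]] tq_props(2)[OF U ij k f v] str_q[OF V S.tp_in[OF i slc_in_own[OF i(1) kf] vV]]
        S.tp_str[OF i(1) vV] gsh_res_one[OF xmod_sheaves(2)[OF cG] f U] by (simp add: ush_def)
  qed
qed

lemma KQ_mult:
  assumes U: "U \<in> Ob C" and l: "l \<in> I" and k: "k \<in> KQ p U" "k' \<in> KQ p U"
  shows "axis_mult (xfam K' p) l U (k, k') \<in> KQ p U"
proof -
  have "group_sheaf C (xfam K' p l)" using xmod_sheaves[OF K'_xmod[OF l]] by (cases "l = p") simp_all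
  then interpret group "grp (xfam K' p l) U" by (rule gsh_group[OF _ U])
  have "k l \<otimes>\<^bsub>grp (xfam K' p l) U\<^esub> k' l \<in> carrier (grp (xfam K' p l) U)"
    by (rule m_closed[OF PiE_mem[OF k(1) l] PiE_mem[OF k(2) l]])
  from PiE_upd[OF k(1) l this] show ?thesis by (simp only: axis_mult_def prod.case)
qed

lemma kr_mult:
  assumes f: "f \<in> arr_to C U" and l: "l \<in> I" and k: "k \<in> KQ p U" "k' \<in> KQ p U"
  shows "kr p f (axis_mult (xfam K' p) l U (k, k')) = axis_mult (xfam K' p) l (src C f) (kr p f k, kr p f k')"
proof -
  have g: "group_sheaf C (xfam K' p l)" using xmod_sheaves[OF K'_xmod[OF l]] by (cases "l = p") simp_all
  note e = gsh_res_mult[OF g f PiE_mem[OF k(1) l] PiE_mem[OF k(2) l]]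
  show ?thesis
  proof (rule ext)
    fix t show "kr p f (axis_mult (xfam K' p) l U (k, k')) t = axis_mult (xfam K' p) l (src C f) (kr p f k, kr p f k') t"
      using e l by (cases "t = l") (simp_all add: axis_mult_def kr_def del: fun_upd_apply, simp_all add: fun_upd_other restrict_def)
  qed
qed

text \<open>When the axis has the outer index of the section, one tuple serves for both factors and
  for the product. Otherwise the tuple of the second factor is taken to be \<open>v\<close> with its
  component at \<open>i'\<close> exchanged for that of \<open>v'\<close>, which makes the two points
  matched.\<close>

lemma tq_mult_q:
  assumes U: "U \<in> Ob C" and ij: "(i, j) \<in> I" and l: "(i', j') \<in> I" and k: "k \<in> KQ (i, j) U" "k' \<in> KQ (i, j) U"
    and e: "\<And>t. t \<in> I - {(i', j')} \<Longrightarrow> k t = k' t" and v: "over (i, j) U k v" "over (i, j) U k' v'"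
  shows "plq (i', j') U (tq (i, j) U k) (tq (i, j) U k') = tq (i, j) U (axis_mult (xfam K' (i, j)) (i', j') U (k, k'))"
proof -
  interpret S: comp_stage G U n E H m F K by (rule st[OF U])
  have i: "i \<in> {1..n}" "j \<in> {1..m i}" "i' \<in> {1..n}" "j' \<in> {1..m i'}" using ij l by (auto simp: I_iff)
  have V: "v \<in> S.V" "v' \<in> S.V" using v by (auto simp: over_def CB_V)
  note s = slc_in_own[OF i(1) k(1)] and s' = slc_in_own[OF i(1) k(2)]
  note km = KQ_mult[OF U l k]
  have se: "slc t k = slc t k'" if "t \<in> {1..n}" "t \<noteq> i'" for t
    by (rule slc_cong) (use e that in \<open>auto simp: I_iff\<close>)
  have sm: "slc t (axis_mult (xfam K' (i, j)) (i', j') U (k, k')) = slc t k" if "t \<noteq> i'" for t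
    unfolding axis_mult_def prod.case using that by (intro slc_upd_other) simp
  have sm': "slc i' (axis_mult (xfam K' (i, j)) (i', j') U (k, k')) =
      (slc i' k)(j' := slc i' k j' \<otimes>\<^bsub>grp (xfam K' (i, j) (i', j')) U\<^esub> slc i' k' j')"
    unfolding axis_mult_def prod.case using i by (simp add: slc_upd slc_at del: fun_upd_apply)
  show ?thesis
  proof (cases "i' = i")
    case True
    have o': "over (i, j) U k' v" using v(1) se True by (simp add: over_def)
    have om: "over (i, j) U (axis_mult (xfam K' (i, j)) (i', j') U (k, k')) v" using v(1) sm True by (simp add: over_def)
    have ag: "\<forall>t\<in>{1..m i} - {j'}. slc i k t = slc i k' t" using e i True by (auto simp: slc_at I_iff)
    have x: "xfam K' (i, j) (i, j') = xfam (K i) j j'" by simp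
    have am: "axis_mult (xfam (K i) j) j' U (slc i k, slc i k') = slc i (axis_mult (xfam K' (i, j)) (i', j') U (k, k'))"
      using sm'[unfolded True x] True by (simp only: axis_mult_def prod.case)
    note T = S.tp_mult_same[OF i(1,2) i(4)[unfolded True] s s' V(1) ag]
    have "plq (i, j') U (q U (tp U i j v (slc i k))) (q U (tp U i j v (slc i k'))) =
        q U (tp U i j v (slc i (axis_mult (xfam K' (i, j)) (i', j') U (k, k'))))"
      unfolding plq_q[OF U T(2)] T(1) am ..
    then show ?thesis
      unfolding tq_q[OF U ij k(1) v(1)] tq_q[OF U ij k(2) o'] tq_q[OF U ij km om] using True by (simp only:)
  next
    case False
    have ss: "slc i k' = slc i k" using se[OF i(1)] False by simp
    define w where "w = v' i'"
    have w: "w \<in> sec (tot (F i')) U" "proj (F i') U w = slc i' k'"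
      using S.V_at[OF V(2) i(3)] v(2) i(3) False by (simp_all add: w_def over_def)
    have pv: "proj (F i') U (v i') = slc i' k" using v(1) i(3) False by (simp add: over_def)
    interpret F': bfly_stage "H i'" U "F i'" "{1..m i'}" "K i'" by (rule stF[OF i(3) U])
    have c: "composable {1..m i'} (F i') j' U (v i') w"
      using S.V_at[OF V(1) i(3)] w pv e i by (auto simp: composable_def slc_at I_iff)
    have o': "over (i, j) U k' (v(i' := w))" unfolding over_def CB_V
      using S.V_upd[OF V(1) i(3) w(1)] v(1) se w(2) by (auto simp: over_def)
    have x: "xfam K' (i, j) (i', j') = X0 (K i' j')" using False by simp
    have om: "over (i, j) U (axis_mult (xfam K' (i, j)) (i', j') U (k, k')) (v(i' := plaw (F i') j' U (v i') w))"
      unfolding over_def CB_V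
    proof (intro conjI ballI impI S.V_upd[OF V(1) i(3) F'.pl_in[OF i(4) c]])
      fix t assume t: "t \<in> {1..n}" "t \<noteq> fst (i, j)"
      show "proj (F t) U ((v(i' := plaw (F i') j' U (v i') w)) t) = slc t (axis_mult (xfam K' (i, j)) (i', j') U (k, k'))"
      proof (cases "t = i'")
        case True
        then show ?thesis using sm'[unfolded x] F'.pl_proj[OF i(4) c] pv w(2) by simp
      next
        case False
        then show ?thesis using sm[of t] v(1) t by (simp add: over_def)
      qed
    qed
    note T = S.tp_mult_other[OF i(1,2) s i(3) False i(4) V(1) w(1) c]
    show ?thesis
      unfolding tq_q[OF U ij k(1) v(1)] tq_q[OF U ij k(2) o'] tq_q[OF U ij km om] ss sm[OF False[symmetric]]
        plq_q[OF U T(2)] T(1) ..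
  qed
qed

lemma cq_tq:
  assumes U: "U \<in> Ob C" and ij: "(i, j) \<in> I" and k: "k \<in> KQ (i, j) U" "k' \<in> KQ (i, j) U"
    and e: "\<And>t. t \<in> I - {l} \<Longrightarrow> k t = k' t"
  shows "cq l U (tq (i, j) U k) (tq (i, j) U k')"
  unfolding cq_def using tq_props(1)[OF U ij k(1)] tq_props(1)[OF U ij k(2)] e
  by (auto simp: tq_proj[OF U ij k(1)] tq_proj[OF U ij k(2)])

lemma tq_mult:
  assumes U: "U \<in> Ob C" and ij: "(i, j) \<in> I" and l: "(i', j') \<in> I" and k: "k \<in> KQ (i, j) U" "k' \<in> KQ (i, j) U"
    and e: "\<And>t. t \<in> I - {(i', j')} \<Longrightarrow> k t = k' t"
  shows "plq (i', j') U (tq (i, j) U k) (tq (i, j) U k') = tq (i, j) U (axis_mult (xfam K' (i, j)) (i', j') U (k, k'))"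
proof -
  have c: "cq (i', j') U (tq (i, j) U k) (tq (i, j) U k')" by (rule cq_tq[OF U ij k]) (rule e)
  note km = KQ_mult[OF U l k]
  show ?thesis
  proof (rule Q_sep[OF U plq_props(1)[OF U l c] tq_props(1)[OF U ij km]])
   show "lc U (\<lambda>f. res Q f (plq (i', j') U (tq (i, j) U k) (tq (i, j) U k')) =
        res Q f (tq (i, j) U (axis_mult (xfam K' (i, j)) (i', j') U (k, k'))))"
   \<comment> \<open>Tuples for \<open>k\<close> and for \<open>k'\<close> exist over different
     covers, hence the second refinement.\<close>
   proof (rule lc_bind[OF U over_lift[OF U ij k(1)]])
    fix f assume f: "f \<in> arr_to C U" and "\<exists>v. over (i, j) (src C f) (kr (i, j) f k) v"
    then obtain v where v: "over (i, j) (src C f) (kr (i, j) f k) v" by blast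
    show "lc (src C f) (\<lambda>g. res Q (cmp C f g) (plq (i', j') U (tq (i, j) U k) (tq (i, j) U k')) =
        res Q (cmp C f g) (tq (i, j) U (axis_mult (xfam K' (i, j)) (i', j') U (k, k'))))"
    proof (rule lc_mono[OF lc_pull[OF f over_lift[OF U ij k(2)]] src_Ob[OF f]])
      fix g assume g: "g \<in> arr_to C (src C f)" and "\<exists>v. over (i, j) (src C (cmp C f g)) (kr (i, j) (cmp C f g) k') v"
      then obtain v' where v': "over (i, j) (src C (cmp C f g)) (kr (i, j) (cmp C f g) k') v'" by blast
      define h where "h = cmp C f g"
      have h: "h \<in> arr_to C U" and sh: "src C h = src C g" using f g by (simp_all add: h_def)
      note V = src_Ob[OF h]
      have vv: "over (i, j) (src C h) (kr (i, j) h k) (res (comp_base n F) g v)"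
        using over_res[OF g v] unfolding kr_cmp[OF f g k(1), symmetric] h_def[symmetric] sh .
      have ee: "kr (i, j) h k t = kr (i, j) h k' t" if "t \<in> I - {(i', j')}" for t using e[OF that] that by (simp add: kr_at)
      show "res Q (cmp C f g) (plq (i', j') U (tq (i, j) U k) (tq (i, j) U k')) =
        res Q (cmp C f g) (tq (i, j) U (axis_mult (xfam K' (i, j)) (i', j') U (k, k')))"
        unfolding h_def[symmetric] plq_res[OF U l c h] tq_res[OF U ij k(1) h] tq_res[OF U ij k(2) h] tq_res[OF U ij km h] kr_mult[OF h l k]
        by (rule tq_mult_q[OF V ij l kr_in[OF h k(1)] kr_in[OF h k(2)] ee vv v'[folded h_def]])
    qed
   qed
  qed
qed

section \<open>Compatibility of the sections with one another and the commutation rule\<close>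

abbreviation "dbl p p' \<equiv> (\<lambda>l. X0 (K' l))(p := X1 (K' p), p' := X1 (K' p'))"

lemma dbl_in:
  assumes U: "U \<in> Ob C" and p: "p \<in> I" "p' \<in> I" "p \<noteq> p'" and k: "k \<in> (\<Pi>\<^sub>E l\<in>I. carrier (grp (dbl p p' l) U))"
  shows "k(p' := bd (K' p') U (k p')) \<in> KQ p U" "k(p := bd (K' p) U (k p)) \<in> KQ p' U"
    "k p \<in> carrier (grp (X1 (K' p)) U)" "k p' \<in> carrier (grp (X1 (K' p')) U)"
proof -
  show kp: "k p \<in> carrier (grp (X1 (K' p)) U)" "k p' \<in> carrier (grp (X1 (K' p')) U)"
    using PiE_mem[OF k p(1)] PiE_mem[OF k p(2)] p(3) by simp_all
  note b = xmod_stage.bd_in[OF xmod_stageI[OF K'_xmod[OF p(1)] U] kp(1)] xmod_stage.bd_in[OF xmod_stageI[OF K'_xmod[OF p(2)] U] kp(2)]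
  show "k(p' := bd (K' p') U (k p')) \<in> KQ p U"
  proof (rule PiE_I)
    fix l assume l: "l \<in> I"
    show "(k(p' := bd (K' p') U (k p'))) l \<in> carrier (grp (xfam K' p l) U)"
      using b PiE_mem[OF k l] p(3) by (cases "l = p'"; cases "l = p") simp_all
  qed (use PiE_arb[OF k] p in auto)
  show "k(p := bd (K' p) U (k p)) \<in> KQ p' U"
  proof (rule PiE_I)
    fix l assume l: "l \<in> I"
    show "(k(p := bd (K' p) U (k p))) l \<in> carrier (grp (xfam K' p' l) U)"
      using b PiE_mem[OF k l] p(3) by (cases "l = p'"; cases "l = p") simp_all
  qed (use PiE_arb[OF k] p in auto)
qed

text \<open>For a common outer index a single tuple represents both sides. For distinct ones the
  argument of each side has a boundary in the block of the other, and the section of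
  \<open>F\<close> at that block is the component lying over it; this is the configuration of
  \<open>tp_compat_other\<close>.\<close>

lemma tq_compat_q:
  assumes U: "U \<in> Ob C" and p: "(i, j) \<in> I" "(i', j') \<in> I" "(i, j) \<noteq> (i', j')"
    and k: "k \<in> (\<Pi>\<^sub>E l\<in>I. carrier (grp (dbl (i, j) (i', j') l) U))"
    and v: "over (i, j) U (k((i', j') := bd (K i' j') U (k (i', j')))) v"
  shows "tq (i, j) U (k((i', j') := bd (K i' j') U (k (i', j')))) = tq (i', j') U (k((i, j) := bd (K i j) U (k (i, j))))"
proof -
  interpret S: comp_stage G U n E H m F K by (rule st[OF U])
  have i: "i \<in> {1..n}" "j \<in> {1..m i}" "i' \<in> {1..n}" "j' \<in> {1..m i'}" using p by (auto simp: I_iff)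
  define k1 where "k1 = k((i', j') := bd (K i' j') U (k (i', j')))"
  define k2 where "k2 = k((i, j) := bd (K i j) U (k (i, j)))"
  have k12: "k1 \<in> KQ (i, j) U" "k2 \<in> KQ (i', j') U" using dbl_in(1,2)[OF U p k] by (simp_all add: k1_def k2_def)
  have V: "v \<in> S.V" using v by (auto simp: over_def CB_V)
  note v = v[folded k1_def]
  have s1: "slc i' k1 = (slc i' k)(j' := bd (K i' j') U (slc i' k j'))" using i by (simp add: k1_def slc_upd slc_at)
  have s2: "slc i k2 = (slc i k)(j := bd (K i j) U (slc i k j))" using i by (simp add: k2_def slc_upd slc_at)
  have o1: "slc l k1 = slc l k" if "l \<noteq> i'" for l unfolding k1_def using that by (intro slc_upd_other) simp
  have o2: "slc l k2 = slc l k" if "l \<noteq> i" for l unfolding k2_def using that by (intro slc_upd_other) simp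
  have "tq (i, j) U k1 = tq (i', j') U k2"
  proof (cases "i = i'")
    case True
    have jj: "j \<noteq> j'" using p True by simp
    have v2: "over (i', j') U k2 v" using v o1 o2 True by (simp add: over_def)
    have "slc i k \<in> (\<Pi>\<^sub>E l\<in>{1..m i}. carrier (grp (((\<lambda>l. X0 (K i l))(j := X1 (K i j), j' := X1 (K i j'))) l) U))"
    proof (rule PiE_I)
      fix l assume l: "l \<in> {1..m i}"
      then have "(i, l) \<in> I" using i by (simp add: I_iff)
      from PiE_mem[OF k this] show "slc i k l \<in> carrier (grp (((\<lambda>l. X0 (K i l))(j := X1 (K i j), j' := X1 (K i j'))) l) U)"
        using l True jj by (cases "l = j"; cases "l = j'") (simp_all add: slc_at)
    qed (simp add: slc_def)
    from S.tp_compat_same[OF i(1,2) i(4)[folded True] jj this, of v]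
    have "tp U i j v (slc i k1) = tp U i' j' v (slc i' k2)" using s1 s2 True by simp
    then show ?thesis unfolding tq_q[OF U p(1) k12(1) v] tq_q[OF U p(2) k12(2) v2] by simp
  next
    case False
    have sk: "slc i k \<in> (\<Pi>\<^sub>E l\<in>{1..m i}. carrier (grp (xfam (K i) j l) U))"
      using slc_in_own[OF i(1) k12(1)] o1 False by simp
    have sk': "slc i' k \<in> (\<Pi>\<^sub>E l\<in>{1..m i'}. carrier (grp (xfam (K i') j' l) U))"
      using slc_in_own[OF i(3) k12(2)] o2 False by simp
    note t = S.F_triv[OF i(1,2) sk] and t' = S.F_triv[OF i(3,4) sk']
    define v1 where "v1 = v(i' := triv (F i') j' U (slc i' k))"
    define v2 where "v2 = v(i := triv (F i) j U (slc i k))"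
    have w1: "over (i, j) U k1 v1" unfolding over_def CB_V v1_def
      using S.V_upd[OF V i(3) t'(1)] v t'(2) s1 by (auto simp: over_def)
    have w2: "over (i', j') U k2 v2" unfolding over_def CB_V
    proof (intro conjI ballI impI)
      show "v2 \<in> S.V" unfolding v2_def by (rule S.V_upd[OF V i(1) t(1)])
      fix l assume l: "l \<in> {1..n}" "l \<noteq> fst (i', j')"
      show "proj (F l) U (v2 l) = slc l k2"
        using t(2) s2 v l o1[of l] o2[of l] by (cases "l = i") (simp_all add: v2_def over_def)
    qed
    have "tp U i j v1 (slc i k) = tp U i' j' v2 (slc i' k)"
      unfolding v1_def v2_def by (rule S.tp_compat_other[OF i False sk sk' V])
    then show ?thesis unfolding tq_q[OF U p(1) k12(1) w1] tq_q[OF U p(2) k12(2) w2] using o1[of i] o2[of i'] False by simp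
  qed
  then show ?thesis by (simp add: k1_def k2_def)
qed

lemma tq_compat:
  assumes U: "U \<in> Ob C" and p: "(i, j) \<in> I" "(i', j') \<in> I" "(i, j) \<noteq> (i', j')"
    and k: "k \<in> (\<Pi>\<^sub>E l\<in>I. carrier (grp (dbl (i, j) (i', j') l) U))"
  shows "tq (i, j) U (k((i', j') := bd (K i' j') U (k (i', j')))) = tq (i', j') U (k((i, j) := bd (K i j) U (k (i, j))))"
proof -
  define k1 where "k1 = k((i', j') := bd (K i' j') U (k (i', j')))"
  define k2 where "k2 = k((i, j) := bd (K i j) U (k (i, j)))"
  have i: "i \<in> {1..n}" "j \<in> {1..m i}" "i' \<in> {1..n}" "j' \<in> {1..m i'}" using p by (auto simp: I_iff)
  have k12: "k1 \<in> KQ (i, j) U" "k2 \<in> KQ (i', j') U" using dbl_in(1,2)[OF U p k] by (simp_all add: k1_def k2_def)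
  have kp: "k (i, j) \<in> carrier (grp (X1 (K i j)) U)" "k (i', j') \<in> carrier (grp (X1 (K i' j')) U)"
    using dbl_in(3,4)[OF U p k] by simp_all
  have "tq (i, j) U k1 = tq (i', j') U k2"
  proof (rule Q_sep[OF U tq_props(1)[OF U p(1) k12(1)] tq_props(1)[OF U p(2) k12(2)]], rule lc_mono[OF over_lift[OF U p(1) k12(1)] U])
    fix f assume f: "f \<in> arr_to C U" and "\<exists>v. over (i, j) (src C f) (kr (i, j) f k1) v"
    then obtain v where v: "over (i, j) (src C f) (kr (i, j) f k1) v" by blast
    note V = src_Ob[OF f]
    \<comment> \<open>The restriction of \<open>k\<close> as an argument in two directions, through
      which the restricted arguments of both sides are expressed.\<close>
    define kf where "kf = (\<lambda>l\<in>I. gres (dbl (i, j) (i', j') l) f (k l))"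
    have kf: "kf \<in> (\<Pi>\<^sub>E l\<in>I. carrier (grp (dbl (i, j) (i', j') l) (src C f)))"
    proof (rule PiE_I)
      fix l assume l: "l \<in> I"
      have "group_sheaf C (dbl (i, j) (i', j') l)" using xmod_sheaves[OF K'_xmod[OF l]] p(3) by (cases "l = (i, j)"; cases "l = (i', j')") auto
      from gsh_res_in[OF this f PiE_mem[OF k l]] show "kf l \<in> carrier (grp (dbl (i, j) (i', j') l) (src C f))" using l by (simp add: kf_def del: fun_upd_apply)
    qed (simp add: kf_def)
    have kfp: "kf (i, j) = gres (X1 (K i j)) f (k (i, j))" "kf (i', j') = gres (X1 (K i' j')) f (k (i', j'))"
      using p by (simp_all add: kf_def)
    have "kr (i, j) f k1 l = (kf((i', j') := bd (K i' j') (src C f) (kf (i', j')))) l" for l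
      using p bd_res[OF cK[OF i(3,4)] f kp(2)] kfp
      by (cases "l = (i', j')"; cases "l = (i, j)") (auto simp: k1_def kf_def kr_def restrict_def)
    then have e1: "kr (i, j) f k1 = kf((i', j') := bd (K i' j') (src C f) (kf (i', j')))" by (rule ext)
    have "kr (i', j') f k2 l = (kf((i, j) := bd (K i j) (src C f) (kf (i, j)))) l" for l
      using p bd_res[OF cK[OF i(1,2)] f kp(1)] kfp
      by (cases "l = (i', j')"; cases "l = (i, j)") (auto simp: k2_def kf_def kr_def restrict_def)
    then have e2: "kr (i', j') f k2 = kf((i, j) := bd (K i j) (src C f) (kf (i, j)))" by (rule ext)
    show "res Q f (tq (i, j) U k1) = res Q f (tq (i', j') U k2)"
      unfolding tq_res[OF U p(1) k12(1) f] tq_res[OF U p(2) k12(2) f] e1 e2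
      by (rule tq_compat_q[OF V p kf v[unfolded e1]])
  qed
  then show ?thesis by (simp add: k1_def k2_def)
qed

lemma KQ_upd:
  assumes "p \<in> I" "y \<in> sec B U" "\<kappa> \<in> carrier (grp (X1 (K' p)) U)"
  shows "y(p := \<kappa>) \<in> KQ p U"
proof (rule PiE_I)
  note y = assms(2)[unfolded mbase_sec]
  fix l assume "l \<in> I"
  from PiE_mem[OF y this] show "(y(p := \<kappa>)) l \<in> carrier (grp (xfam K' p l) U)" using assms(3) by (cases "l = p") simp_all
next
  note y = assms(2)[unfolded mbase_sec]
  fix l assume "l \<notin> I"
  then show "(y(p := \<kappa>)) l = undefined" using PiE_arb[OF y] assms(1) by auto
qed

lemma kr_upd: "p \<in> I \<Longrightarrow> kr p f (y(p := \<kappa>)) = (res B f y)(p := gres (X1 (K' p)) f \<kappa>)"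
  by (auto simp: kr_def mbase_res fun_eq_iff)

text \<open>A local representative of \<open>W\<close> brings along a tuple over the arguments in
  question, so the claim becomes \<open>tp_comm\<close> at that point.\<close>

lemma tq_comm:
  assumes U: "U \<in> Ob C" and ij: "(i, j) \<in> I" and W: "W \<in> sec Q U" and \<kappa>: "\<kappa> \<in> carrier (grp (X1 (K i j)) U)"
  defines "y \<equiv> proj QT U W"
  shows "plq (i, j) U (tq (i, j) U (y((i, j) := \<kappa>))) W = plq (i, j) U W (tq (i, j) U (y((i, j) := xact (K i j) U \<kappa> (y (i, j)))))"
proof -
  have i: "i \<in> {1..n}" "j \<in> {1..m i}" using ij by (auto simp: I_iff)
  interpret Kij: xmod_stage "K i j" U by (rule xmod_stageI[OF cK[OF i] U])
  have y: "y \<in> sec B U" unfolding y_def by (rule proj_QT_in[OF U W])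
  have yj: "y (i, j) \<in> carrier (grp (X0 (K i j)) U)" using PiE_mem[OF y[unfolded mbase_sec] ij] by simp
  define \<kappa>' where "\<kappa>' = xact (K i j) U \<kappa> (y (i, j))"
  have \<kappa>': "\<kappa>' \<in> carrier (grp (X1 (K i j)) U)" unfolding \<kappa>'_def by (rule Kij.act_in[OF \<kappa> yj])
  have k1: "y((i, j) := \<kappa>) \<in> KQ (i, j) U" and k2: "y((i, j) := \<kappa>') \<in> KQ (i, j) U"
    using KQ_upd[OF ij y, of \<kappa>] KQ_upd[OF ij y, of \<kappa>'] \<kappa> \<kappa>' by simp_all
  have c1: "cq (i, j) U (tq (i, j) U (y((i, j) := \<kappa>))) W" and c2: "cq (i, j) U W (tq (i, j) U (y((i, j) := \<kappa>')))"
    unfolding cq_def tq_proj[OF U ij k1] tq_proj[OF U ij k2]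
    using W tq_props(1)[OF U ij k1] tq_props(1)[OF U ij k2] by (auto simp: y_def)
  show ?thesis unfolding \<kappa>'_def[symmetric]
  proof (rule Q_eq_lift[OF U W plq_props(1)[OF U ij c1] plq_props(1)[OF U ij c2]])
    fix f x assume f: "f \<in> arr_to C U" and x: "x \<in> sec (tot P) (src C f)" and r: "res Q f W = q (src C f) x"
    note V = src_Ob[OF f]
    interpret S: comp_stage G "src C f" n E H m F K by (rule st[OF V])
    have yf: "res B f y = \<pi> (src C f) (fst x)" unfolding y_def using proj_QT_res[OF f W] r proj_QT_q[OF V x] by simp
    define z where "z = proj (F i) (src C f) (fst x i)"
    define \<mu>1 where "\<mu>1 = gres (X1 (K i j)) f \<kappa>"
    have \<mu>1: "\<mu>1 \<in> carrier (grp (X1 (K i j)) (src C f))" unfolding \<mu>1_def by (rule gsh_res_in[OF xmod_sheaves(1)[OF cK[OF i]] f \<kappa>])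
    have zj: "res B f y (i, j) = z j" unfolding yf \<pi>_at[OF i] z_def ..
    have "res B f y (i, j) = gres (X0 (K i j)) f (y (i, j))" using ij by (simp add: mbase_res)
    note zj = zj zj[unfolded this]
    have \<mu>2: "gres (X1 (K i j)) f \<kappa>' = xact (K i j) (src C f) \<mu>1 (z j)"
      unfolding \<kappa>'_def \<mu>1_def using xact_res[OF cK[OF i] f \<kappa> yj] zj by simp
    have e1: "kr (i, j) f (y((i, j) := \<kappa>)) = (res B f y)((i, j) := \<mu>1)"
      and e2: "kr (i, j) f (y((i, j) := \<kappa>')) = (res B f y)((i, j) := xact (K i j) (src C f) \<mu>1 (z j))"
      using kr_upd[OF ij, of f y \<kappa>] kr_upd[OF ij, of f y \<kappa>'] \<mu>2 by (simp_all add: \<mu>1_def)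
    have so: "slc l (res B f y) = proj (F l) (src C f) (fst x l)" if l: "l \<in> {1..n}" for l
    proof (rule ext)
      fix a show "slc l (res B f y) a = proj (F l) (src C f) (fst x l) a"
        using PiE_arb[OF F_proj[OF l V S.V_at[OF S.fst_in[OF x] l]], of a] l unfolding yf by (cases "a \<in> {1..m l}") (simp_all add: slc_def \<pi>_at)
    qed
    have ov: "over (i, j) (src C f) ((res B f y)((i, j) := \<mu>)) (fst x)" for \<mu>
      unfolding over_def CB_V using S.fst_in[OF x] so by (simp add: slc_upd_other)
    have sl: "slc i ((res B f y)((i, j) := \<mu>)) = z(j := \<mu>)" for \<mu> using so[OF i(1)] i by (simp add: slc_upd z_def)
    note T = S.tp_comm[OF i x \<mu>1, folded z_def]
    have a1: "res Q f (tq (i, j) U (y((i, j) := \<kappa>))) = q (src C f) (tp (src C f) i j (fst x) (z(j := \<mu>1)))"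
      using tq_props(2)[OF U ij k1 f, of "fst x"] ov[of \<mu>1] unfolding e1 sl by blast
    have a2: "res Q f (tq (i, j) U (y((i, j) := \<kappa>'))) = q (src C f) (tp (src C f) i j (fst x) (z(j := xact (K i j) (src C f) \<mu>1 (z j))))"
      using tq_props(2)[OF U ij k2 f, of "fst x"] ov[of "xact (K i j) (src C f) \<mu>1 (z j)"] unfolding e2 sl by blast
    show "res Q f (plq (i, j) U (tq (i, j) U (y((i, j) := \<kappa>))) W) = res Q f (plq (i, j) U W (tq (i, j) U (y((i, j) := \<kappa>'))))"
      unfolding plq_res[OF U ij c1 f] plq_res[OF U ij c2 f] a1 a2 r plq_q[OF V T(2)] plq_q[OF V T(3)] T(1) ..
  qed
qed

section \<open>The composite butterfly\<close>

text \<open>The torsor fields are those of the quotient itself, so that truncation returns the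
  quotient and not merely an isomorphic torsor.\<close>

definition QB where
  "QB = \<lparr> tot = tot QT, proj = proj QT, ract = ract QT, str = str QT, plaw = plq, triv = tq \<rparr>"

lemma QB_simps [simp]: "tot QB = Q" "proj QB = proj QT" "ract QB = ract QT" "str QB = str QT" "plaw QB = plq" "triv QB = tq"
  by (simp_all add: QB_def tot_QT)

lemma gQB: "gtorsor C G B QB"
  using gQ unfolding gtorsor_def torsor_def by (simp add: tot_QT)

lemma QB_composable: "composable I QB p U W W' \<longleftrightarrow> cq p U W W'"
  by (simp add: composable_def cq_def)

lemma QB_stage:
  assumes U: "U \<in> Ob C"
  shows "bfly_stage G U QB I K'"
proof (intro bfly_stage.intro bfly_stage_axioms.intro)
  show "tors_stage G U QB (\<Pi>\<^sub>E l\<in>I. carrier (grp (X0 (K' l)) U))"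
    using tors_stageI[OF cG gQB U] unfolding mbase_sec .
  show "bxmod_stage G U" by (rule bxmod_stageI[OF bG U])
  show "xmod_stage (K' l) U" if "l \<in> I" for l by (rule xmod_stageI[OF K'_xmod[OF that] U])
next
  fix p assume p: "p \<in> I"
  obtain i j where ij: "p = (i, j)" by (cases p)
  note p' = p[unfolded ij]
  have lq: "lact G QB = lact G QT" by (intro ext) (simp add: lact_def)
  show "law_stage I (\<lambda>l. X0 (K' l)) G QB p U"
    unfolding law_stage_def QB_composable QB_simps lq ij
    using plq_props(1)[OF U p'] plq_proj[OF U p'] plq_str[OF U p'] plq_ract[OF U p'] plq_assoc[OF U p'] by blast
  show "triv_stage I K' G QB p (triv QB p) U"
    unfolding triv_stage_def QB_simps ij
  proof (intro ballI conjI impI)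
    fix k assume k: "k \<in> KQ (i, j) U"
    show "tq (i, j) U k \<in> sec Q U" by (rule tq_props(1)[OF U p' k])
    show "proj QT U (tq (i, j) U k) = k((i, j) := bd (K' (i, j)) U (k (i, j)))" using tq_proj[OF U p' k] by simp
    show "str QT U (tq (i, j) U k) = \<one>\<^bsub>grp (X0 G) U\<^esub>" by (rule tq_str[OF U p' k])
    fix l k' assume l: "l \<in> I" and k': "k' \<in> KQ (i, j) U" and e: "\<forall>t\<in>I - {l}. k t = k' t"
    obtain a b where ab: "l = (a, b)" by (cases l)
    show "plq l U (tq (i, j) U k) (tq (i, j) U k') = tq (i, j) U (axis_mult (xfam K' (i, j)) l U (k, k'))"
      unfolding ab by (rule tq_mult[OF U p' l[unfolded ab] k k']) (use e ab in blast)
  qed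
  { fix W \<kappa> assume W: "W \<in> sec (tot QB) U" and \<kappa>: "\<kappa> \<in> carrier (grp (X1 (K' p)) U)"
    show "plaw QB p U (triv QB p U ((proj QB U W)(p := \<kappa>))) W =
        plaw QB p U W (triv QB p U ((proj QB U W)(p := xact (K' p) U \<kappa> (proj QB U W p))))"
      using tq_comm[OF U p', of W \<kappa>] W \<kappa> by (simp add: ij) }
next
  fix p p' a b c d assume p: "p \<in> I" "p' \<in> I" "p \<noteq> p'"
    and k: "composable I QB p U a b" "composable I QB p U c d" "composable I QB p' U a c" "composable I QB p' U b d"
  obtain i j i' j' where ij: "p = (i, j)" "p' = (i', j')" by (cases p, cases p')
  show "plaw QB p' U (plaw QB p U a b) (plaw QB p U c d) =
       plaw QB p U (plaw QB p' U a c)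
         (plaw QB p' U (ract QB U b (inv\<^bsub>grp (X1 G) U\<^esub> (brd G U (str QB U b) (str QB U c)))) d)"
    using plq_inter[OF U p[unfolded ij] k[unfolded QB_composable ij]] by (simp add: ij)
next
  fix p p' k assume p: "p \<in> I" "p' \<in> I" "p \<noteq> p'" and k: "k \<in> (\<Pi>\<^sub>E l\<in>I. carrier (grp (dbl p p' l) U))"
  obtain i j i' j' where ij: "p = (i, j)" "p' = (i', j')" by (cases p, cases p')
  show "triv QB p U (k(p' := bd (K' p') U (k p'))) = triv QB p' U (k(p := bd (K' p) U (k p)))"
    using tq_compat[OF U p[unfolded ij] k[unfolded ij]] by (simp add: ij)
qed

lemma finite_I: "finite I"
  by (simp add: comp_index_def)

lemma QB_butterfly: "butterfly C I K' G QB"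
proof (rule butterflyI[OF bG K'_xmod gQB finite_I QB_stage])
  fix p assume p: "p \<in> I"
  obtain i j where ij: "p = (i, j)" by (cases p)
  note p' = p[unfolded ij]
  show "law_res C I QB p"
    unfolding law_res_def QB_composable QB_simps ij using plq_res[OF _ p'] by blast
  show "triv_res C I K' QB p (triv QB p)"
    unfolding triv_res_def QB_simps ij kr_def[symmetric] using tq_res[OF _ p'] by blast
qed

lemma QB_truncate: "tors.truncate QB = QT"
  by (simp add: QB_def tors.defs)

end

theorem theorem10p1:
  fixes C :: "('o, 'm) site_data"
    and G :: "('o, 'm, 'g) bxmod"
    and H :: "nat \<Rightarrow> ('o, 'm, 'h) bxmod"
    and K :: "nat \<Rightarrow> nat \<Rightarrow> ('o, 'm, 'k) xmod"
    and n :: nat and m :: "nat \<Rightarrow> nat"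
    and E :: "('o, 'm, nat, 'h, 'g, 'e) bfly"
    and F :: "nat \<Rightarrow> ('o, 'm, nat, 'k, 'h, 'f) bfly"
  assumes "site C"
    and "braided_crossed_module C G"
    and "\<forall>i\<in>{1..n}. braided_crossed_module C (H i)"
    and "\<forall>i\<in>{1..n}. \<forall>j\<in>{1..m i}. crossed_module C (K i j)"
    and "braided_butterfly C {1..n} H G E"
    and "\<forall>i\<in>{1..n}. butterfly C {1..m i} (K i) (H i) (F i)"
  shows
    "let P = comp_tors n F E;
         H1 = comp_group n H;
         a = comp_act n F E;
         I = comp_index n m;
         K' = (\<lambda>(i, j). K i j);
         B = mbase I (\<lambda>l. X0 (K' l));
         \<pi> = comp_proj n m F
     in
       equivariant_gtorsor C G H1 (comp_base n F) (comp_base_act n F) P a \<and>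
       (\<forall>i\<in>{1..n}. \<forall>U\<in>Ob C. \<forall>(v, u)\<in>sec (tot P) U. \<forall>h\<in>carrier (grp (X1 (H i)) U).
          comp_left_act1 H F E i U h (v, u) =
          comp_act1 F E i U (v, u) (xact (H i) U h (proj E U u i))) \<and>
       well_defined_quotient C G H1 a B \<pi> P \<and>
       (\<exists>Q. tors.truncate Q = quot_tors C G H1 a B \<pi> P \<and> butterfly C I K' G Q)"
proof -
  interpret composite C G H K n m E F
    by unfold_locales (use assms in auto)
  show ?thesis
    unfolding Let_def
  proof (intro conjI equivariant well_defined exI[of _ QB] QB_truncate QB_butterfly ballI)
    fix i U x h assume i: "i \<in> {1..n}" and U: "U \<in> Ob C" and x: "x \<in> sec (tot P) U"
    interpret S: comp_stage G U n E H m F K by (rule st[OF U])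
    obtain v u where e: "x = (v, u)" by (cases x)
    show "case x of (v, u) \<Rightarrow> \<forall>h\<in>carrier (grp (X1 (H i)) U). comp_left_act1 H F E i U h (v, u) =
          comp_act1 F E i U (v, u) (xact (H i) U h (proj E U u i))"
      unfolding e prod.case using S.left_act1[OF i x[unfolded e]] by blast
  qed
qed

end
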